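(* For every sufficiently small $\eta>0$ there is $\mathcal{A}=\mathcal{A}(\eta)$, sufficiently large, and a choice of the parameters $X,Y,Z$ (functions of $N$ with $XYZ=N$) such that, with $\Pi$ and $\Pi_{AP}$ constructed as described below, $$\#\Pi_{AP}>N^{2\delta_{\mathcal{A}}-\eta}\quad\text{as }N\to\infty.$$
   Context: For an integer $\mathcal{A}\ge1$, $\Gamma_{\mathcal{A}}$ is the semigroup of all products of even length of the matrices $\begin{pmatrix}a&1\\1&0\end{pmatrix}$, $1\le a\le \mathcal{A}$; $\delta_{\mathcal{A}}$ is the Hausdorff dimension of the set of real numbers $[0;a_1,a_2,\dots]$ whose continued fraction partial quotients all satisfy $a_j\le\mathcal{A}$. For $g\in\mathrm{SL}_2(\mathbb{R})$, $\|g\|=\sqrt{\mathrm{tr}(g\,{}^{t}g)}$ and $B_X=\{g:\|g\|<X\}$; ${}^t$ is transpose. Construction: fix absolute constants $C,\Theta>0$ such that for every $Y\ge1$ there is a nonempty set $\aleph\subset\{\gamma\in\Gamma_2:\|\gamma\|<Y\}$ with $\#\{\mathfrak a\in\aleph:\mathfrak a\equiv\mathfrak a_0 \bmod q\}=|\aleph|/|\mathrm{SL}_2(\mathbb{Z}/q)|+O(|\aleph|q^{C}Y^{-\Theta})$ for all $q\ge1$ and $\mathfrak a_0\in\mathrm{SL}_2(\mathbb{Z}/q)$, with absolute implied constant (such sets and constants exist by known spectral gap results); take such an $\aleph$ for the parameter $Y$. Let $\Omega_X\subset\Gamma_{\mathcal{A}}\cap B_X$ be a subset all of whose elements have the same word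 length in the generators, with $\#\Omega_X\gg X^{2\delta_{\mathcal{A}}}/\log X$, and similarly $\Omega_Z\subset\Gamma_{\mathcal{A}}\cap B_Z$. Set $\Pi=\Omega_X\cdot\aleph\cdot\Omega_Z\subset\Gamma_{\mathcal{A}}$ (each element $\xi\mathfrak a\omega$ is uniquely represented), and $$\Pi_{AP}=\{\varphi\in\Pi:\ p\text{ prime},\ p\mid \mathrm{tr}(\varphi\,{}^t\varphi)^2-4\ \Longrightarrow\ p>N^{1/350}\}.$$ *)

theory Defs
  imports "HOL-Analysis.Analysis" "HOL-Number_Theory.Number_Theory"
begin

definition cf_matrix :: "nat \<Rightarrow> int^2^2" where
  "cf_matrix a = vector [vector [int a, 1], vector [1, 0]]"

definition word_matrix :: "nat list \<Rightarrow> int^2^2" where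
  "word_matrix w = foldr (\<lambda>a M. cf_matrix a ** M) w (mat 1)"

text \<open>A semigroup rather than a monoid: the empty word is excluded.\<close>

definition Gamma_semigroup :: "nat \<Rightarrow> (int^2^2) set" where
  "Gamma_semigroup A =
     {word_matrix w |w. w \<noteq> [] \<and> even (length w) \<and> set w \<subseteq> {1..A}}"

definition same_word_length :: "nat \<Rightarrow> (int^2^2) set \<Rightarrow> bool" where
  "same_word_length A S \<longleftrightarrow>
     (\<exists>l. \<forall>g\<in>S. \<exists>w. length w = l \<and> set w \<subseteq> {1..A} \<and> g = word_matrix w)"

definition matrix_norm :: "int^2^2 \<Rightarrow> real" where
  "matrix_norm g = sqrt (real_of_int (trace (g ** transpose g)))"

text \<open>Each \<open>U i\<close> is required to be bounded because \<^const>\<open>diameter\<close> is unspecified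
  on unbounded sets.\<close>

definition hausdorff_premeasure :: "real \<Rightarrow> real \<Rightarrow> 'a::metric_space set \<Rightarrow> ennreal" where
  "hausdorff_premeasure s d S =
     (INF U \<in> {U :: nat \<Rightarrow> 'a set. S \<subseteq> (\<Union>i. U i) \<and> (\<forall>i. bounded (U i) \<and> diameter (U i) \<le> d)}.
        \<Sum>i. ennreal (diameter (U i) powr s))"

definition hausdorff_measure :: "real \<Rightarrow> 'a::metric_space set \<Rightarrow> ennreal" where
  "hausdorff_measure s S = (SUP d \<in> {0<..}. hausdorff_premeasure s d S)"

text \<open>Only exponents \<open>s > 0\<close> occur, which does not change the infimum and keeps clear of
  \<open>0 powr 0 = 0\<close>.\<close>

definition hausdorff_dimension :: "'a::metric_space set \<Rightarrow> ennreal" where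
  "hausdorff_dimension S = Inf {ennreal s |s. 0 < s \<and> hausdorff_measure s S = 0}"

fun finite_cf :: "nat list \<Rightarrow> real" where
  "finite_cf [] = 0"
| "finite_cf (a # as) = 1 / (real a + finite_cf as)"

definition bounded_cf_set :: "nat \<Rightarrow> real set" where
  "bounded_cf_set A =
     {x. \<exists>a :: nat \<Rightarrow> nat. (\<forall>j. 1 \<le> a j \<and> a j \<le> A) \<and>
           (\<lambda>n. finite_cf (map a [0..<n])) \<longlonglongrightarrow> x}"

definition cf_dim :: "nat \<Rightarrow> real" where
  "cf_dim A = enn2real (hausdorff_dimension (bounded_cf_set A))"

text \<open>\<open>SL\<^sub>2(\<int>/q)\<close>, each residue being represented in \<open>{0..<q}\<close>.\<close>

definition SL2_mod :: "nat \<Rightarrow> (int^2^2) set" where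
  "SL2_mod q = {g. (\<forall>i j. g $ i $ j \<in> {0..<int q}) \<and> [det g = 1] (mod int q)}"

definition matrix_cong :: "nat \<Rightarrow> int^2^2 \<Rightarrow> int^2^2 \<Rightarrow> bool" where
  "matrix_cong q g h \<longleftrightarrow> (\<forall>i j. [g $ i $ j = h $ i $ j] (mod int q))"

text \<open>\<open>K\<close> is the implied constant of the error term.\<close>

definition equidistributed_set :: "real \<Rightarrow> real \<Rightarrow> real \<Rightarrow> real \<Rightarrow> (int^2^2) set \<Rightarrow> bool" where
  "equidistributed_set C \<Theta> K Y S \<longleftrightarrow>
     S \<noteq> {} \<and> S \<subseteq> {g \<in> Gamma_semigroup 2. matrix_norm g < Y} \<and>
     (\<forall>q\<ge>1. \<forall>g0\<in>SL2_mod q.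
        \<bar>real (card {g \<in> S. matrix_cong q g g0}) - real (card S) / real (card (SL2_mod q))\<bar>
          \<le> K * (real (card S) * real q powr C * Y powr (- \<Theta>)))"

text \<open>\<open>c\<close> is the implied constant of the lower bound for the cardinality.\<close>

definition Omega_set :: "nat \<Rightarrow> real \<Rightarrow> real \<Rightarrow> (int^2^2) set \<Rightarrow> bool" where
  "Omega_set A c X S \<longleftrightarrow>
     S \<subseteq> {g \<in> Gamma_semigroup A. matrix_norm g < X} \<and>
     same_word_length A S \<and>
     real (card S) \<ge> c * (X powr (2 * cf_dim A) / ln X)"

definition Pi_set :: "(int^2^2) set \<Rightarrow> (int^2^2) set \<Rightarrow> (int^2^2) set \<Rightarrow> (int^2^2) set" where
  "Pi_set \<Omega>X S \<Omega>Z = {\<xi> ** a ** \<omega> |\<xi> a \<omega>. \<xi> \<in> \<Omega>X \<and> a \<in> S \<and> \<omega> \<in> \<Omega>Z}"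

definition almost_primes :: "real \<Rightarrow> (int^2^2) set \<Rightarrow> (int^2^2) set" where
  "almost_primes N P =
     {\<phi> \<in> P. \<forall>p::int. prime p \<longrightarrow> p dvd (trace (\<phi> ** transpose \<phi>))^2 - 4 \<longrightarrow>
                real_of_int p > N powr (1 / 350)}"

end

theory Submission
  imports Defs "HOL-Real_Asymp.Real_Asymp"
begin

text \<open>Write \<open>f(g) = tr(g g\<^sup>t)\<^sup>2 - 4\<close>, let \<open>\<chi>\<^sub>p(g)\<close> be the indicator of \<open>p | f(g)\<close>, \<open>\<rho>\<^sub>p\<close> its mean over
  \<open>SL\<^sub>2(\<int>/p)\<close>, \<open>F\<^sub>p = \<chi>\<^sub>p - \<rho>\<^sub>p\<close> and \<open>F\<^sub>D = \<Prod>p\<in>D. F\<^sub>p\<close>. The sieve is Selberg's lower bound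
  \<open>L = G\<^sup>2 (1 - \<Sum>\<^sub>p \<chi>\<^sub>p)\<close> over the primes \<open>p \<le> z = N^(1/350)\<close>, with \<open>G\<close> a combination of the \<open>F\<^sub>I\<close>: \<open>L\<close> is positive
  only on almost primes, and in its expansion \<open>\<Sum> c\<^sub>D F\<^sub>D\<close>, of level \<open>N^(1/14)\<close>, the coefficient of the empty set
  is at least \<open>1/10\<close>. The terms with \<open>\<Prod>D \<le> N^\<kappa>\<close> cancel by equidistribution of \<open>\<aleph>\<close>. The others are treated by
  Cauchy--Schwarz in \<open>\<xi> \<in> \<Omega>\<^sub>X\<close>, enlarging \<open>\<Omega>\<^sub>X\<close> to products of blocks of comparable size;
  sums over blocks mix modulo square-free \<open>r\<close> with a power saving, because functions of mean
  zero have large multiplicity and few pairs of block products agree modulo \<open>r\<close>. The extension loses only a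
  power \<open>N^O(1 - \<delta>\<^sub>A)\<close>, and \<open>\<delta>\<^sub>A \<rightarrow> 1\<close> as \<open>A\<close> grows.\<close>

section \<open>Integer two-by-two matrices modulo q\<close>

text \<open>The equidistribution of the middle factor is useful only for moduli up to a tiny power
  N^\<kappa>, while sieving by all primes up to N^(1/350) needs moduli up to N^(25/350) = N^(1/14).
  The outer factors bridge this gap. Opening a square over \<Omega>_Z pairs two sets of primes, so
  moduli up to N^(1/7) occur; blocks mix modulo r once their product exceeds about r^(16/3), and
  16/21 < 1, so the factor of size X, close to N, is long enough. Two distinct elements of
  \<Omega>_Z correlate only at the primes dividing \<open>disc\<close> of their quotient, a nonzero
  integer with few prime factors. The saving r^(-4/3) has an exponent beyond 1, which keeps the
  Euler products over all sieving primes harmless. In the end the dispersion saves N^(-\<kappa>/4),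
  and this must beat the loss caused by 1 - \<delta>_A. Hence the order of choice: \<eta> fixes the
  exponent of Y and Z, this fixes \<kappa>, then the auxiliary exponents and A, and N comes
  last.\<close>

definition mk :: "int => int => int => int => int^2^2" where
 "mk a b c d = vector [vector [a, b], vector [c, d]]"

lemma mk_nth [simp]:
 "mk a b c d $ 1 $ 1 = a" "mk a b c d $ 1 $ 2 = b" "mk a b c d $ 2 $ 1 = c" "mk a b c d $ 2 $ 2 = d"
 by (simp_all add: mk_def)

lemma mat2_eq_iff:
 "(g::'a^2^2) = h \<longleftrightarrow> g$1$1 = h$1$1 & g$1$2 = h$1$2 & g$2$1 = h$2$1 & g$2$2 = h$2$2"
 by (auto simp: vec_eq_iff forall_2)

lemma mult_nth: "((A::int^2^2) ** B) $ i $ j = A$i$1 * B$1$j + A$i$2 * B$2$j"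
 by (simp add: matrix_matrix_mult_def sum_2)

lemma mat_1_nth [simp]:
 "(mat 1 :: int^2^2) $ 1 $ 1 = 1" "(mat 1 :: int^2^2) $ 1 $ 2 = 0"
 "(mat 1 :: int^2^2) $ 2 $ 1 = 0" "(mat 1 :: int^2^2) $ 2 $ 2 = 1"
 by (simp_all add: mat_def)

lemma mk_mult: "mk a b c d ** mk a' b' c' d' = mk (a*a'+b*c') (a*b'+b*d') (c*a'+d*c') (c*b'+d*d')"
 by (simp add: mat2_eq_iff mult_nth)

lemma mk_det [simp]: "det (mk a b c d) = a * d - b * c"
 by (simp add: det_2)

lemma mat_1_mk: "mat 1 = mk 1 0 0 1"
 by (simp add: mat2_eq_iff)

text \<open>The adjugate serves as inverse: many matrices here have determinant one only modulo q,
  where an integer inverse need not exist.\<close>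

definition adjm :: "int^2^2 => int^2^2" where
 "adjm g = mk (g$2$2) (- g$1$2) (- g$2$1) (g$1$1)"

lemma det_adjm [simp]: "det (adjm g) = det g"
 by (simp add: adjm_def det_2 algebra_simps)

lemma mult_adjm: "g ** adjm g = mk (det g) 0 0 (det g)" "adjm g ** g = mk (det g) 0 0 (det g)"
 by (simp_all add: mat2_eq_iff mult_nth adjm_def det_2 algebra_simps)

lemma matrix_cong_iff:
 "matrix_cong q g h \<longleftrightarrow> [g$1$1 = h$1$1] (mod int q) & [g$1$2 = h$1$2] (mod int q) &
   [g$2$1 = h$2$1] (mod int q) & [g$2$2 = h$2$2] (mod int q)"
 by (auto simp: matrix_cong_def forall_2)

lemma matrix_cong_refl [simp]: "matrix_cong q g g"
 by (simp add: matrix_cong_iff)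

lemma matrix_cong_sym: "matrix_cong q g h ==> matrix_cong q h g"
 by (simp add: matrix_cong_iff cong_sym_eq)

lemma matrix_cong_trans: "matrix_cong q g h ==> matrix_cong q h k ==> matrix_cong q g k"
 unfolding matrix_cong_iff by (meson cong_trans)

lemma matrix_cong_mult:
 "matrix_cong q g h ==> matrix_cong q g' h' ==> matrix_cong q (g ** g') (h ** h')"
 unfolding matrix_cong_iff mult_nth by (auto intro!: cong_add cong_mult)

lemma matrix_cong_det: "matrix_cong q g h ==> [det g = det h] (mod int q)"
 unfolding matrix_cong_iff det_2 by (auto intro!: cong_diff cong_mult)

lemma matrix_cong_dvd: "matrix_cong q g h ==> p dvd q ==> matrix_cong p g h"
 unfolding matrix_cong_iff by (meson cong_dvd_modulus int_dvd_int_iff)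

definition rmod :: "nat => int^2^2 => int^2^2" where
 "rmod q g = mk (g$1$1 mod int q) (g$1$2 mod int q) (g$2$1 mod int q) (g$2$2 mod int q)"

lemma rmod_cong: "matrix_cong q (rmod q g) g" "matrix_cong q g (rmod q g)"
 by (simp_all add: matrix_cong_iff rmod_def cong_def)

lemma rmod_eqI: "matrix_cong q g h ==> rmod q g = rmod q h"
 by (simp add: matrix_cong_iff rmod_def cong_def)

lemma SL2_mod_iff:
 "g \<in> SL2_mod q \<longleftrightarrow> g$1$1 \<in> {0..<int q} & g$1$2 \<in> {0..<int q} & g$2$1 \<in> {0..<int q} &
   g$2$2 \<in> {0..<int q} & [det g = 1] (mod int q)"
 by (auto simp: SL2_mod_def forall_2)

lemma rmod_SL2: "q > 0 ==> [det g = 1] (mod int q) ==> rmod q g \<in> SL2_mod q"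
 using matrix_cong_det[OF rmod_cong(1)[of q g]]
 by (auto simp: SL2_mod_iff rmod_def intro: cong_trans)

lemma rmod_SL2_id: "g \<in> SL2_mod q ==> rmod q g = g"
 by (simp add: SL2_mod_iff rmod_def mat2_eq_iff)

lemma SL2_mod_eqI: "g \<in> SL2_mod q ==> h \<in> SL2_mod q ==> matrix_cong q g h ==> g = h"
 by (metis rmod_SL2_id rmod_eqI)

lemma SL2_mod_det: "g \<in> SL2_mod q ==> [det g = 1] (mod int q)"
 by (simp add: SL2_mod_def)

lemma finite_SL2_mod [simp]: "finite (SL2_mod q)"
proof -
 let ?I = "{0..<int q}"
 have "SL2_mod q \<subseteq> (%(a,b,c,d). mk a b c d) ` (?I \<times> ?I \<times> ?I \<times> ?I)"
 proof
  fix g assume g: "g \<in> SL2_mod q"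
  have "g = (%(a,b,c,d). mk a b c d) (g$1$1, g$1$2, g$2$1, g$2$2)"
   by (simp add: mat2_eq_iff)
  then show "g \<in> (%(a,b,c,d). mk a b c d) ` (?I \<times> ?I \<times> ?I \<times> ?I)"
   using g unfolding SL2_mod_iff by blast
 qed
 then show ?thesis by (rule finite_subset) auto
qed

lemma SL2_mod_nonempty: "q > 0 ==> SL2_mod q ~= {}"
 using rmod_SL2[of q "mat 1"] by (auto simp: det_2)

lemma card_SL2_mod_pos: "q > 0 ==> card (SL2_mod q) > 0"
 using SL2_mod_nonempty by (simp add: card_gt_0_iff)

text \<open>Functions on SL_2(Z/q) are kept as functions on all integer matrices that factor through
  reduction, so that translates and products need no representatives; sums still run over
  \<open>SL2_mod q\<close>.\<close>

definition qperiodic :: "nat => (int^2^2 => 'b) => bool" where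
 "qperiodic q \<Phi> \<longleftrightarrow> (\<forall>g h. matrix_cong q g h --> \<Phi> g = \<Phi> h)"

lemma qperiodicD: "qperiodic q \<Phi> ==> matrix_cong q g h ==> \<Phi> g = \<Phi> h"
 by (auto simp: qperiodic_def)

lemma cong_mult_one: "[a = 1] (mod m) ==> [b = 1] (mod m) ==> [a * b = (1::int)] (mod m)"
 using cong_mult[of a 1 m b 1] by simp

lemma det_mult_cong_one:
 "[det g = 1] (mod int q) ==> [det h = 1] (mod int q) ==> [det (g ** h) = 1] (mod int q)"
 by (simp add: det_mul cong_mult_one)

lemma mult_adjm_cong:
 assumes "[det u = 1] (mod int q)"
 shows "matrix_cong q (h ** u ** adjm u) h" "matrix_cong q (adjm u ** (u ** h)) h"
proof -
 have "matrix_cong q (u ** adjm u) (mat 1)" "matrix_cong q (adjm u ** u) (mat 1)"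
  using assms by (simp_all add: mult_adjm matrix_cong_iff)
 then have "matrix_cong q (h ** (u ** adjm u)) (h ** mat 1)" "matrix_cong q ((adjm u ** u) ** h) (mat 1 ** h)"
  by (auto intro!: matrix_cong_mult simp del: matrix_mul_rid matrix_mul_lid)
 then show "matrix_cong q (h ** u ** adjm u) h" "matrix_cong q (adjm u ** (u ** h)) h"
  by (simp_all add: matrix_mul_assoc)
qed

lemma sum_right_shift:
 fixes \<Phi> :: "int^2^2 => 'b::comm_monoid_add"
 assumes "qperiodic q \<Phi>" "q > 0" "[det u = 1] (mod int q)"
 shows "(SUM h:SL2_mod q. \<Phi> (h ** u)) = (SUM h:SL2_mod q. \<Phi> h)"
proof -
 let ?f = "%h. rmod q (h ** u)"
 have into: "?f ` SL2_mod q \<subseteq> SL2_mod q"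
  by (auto intro!: rmod_SL2 det_mult_cong_one assms dest: SL2_mod_det)
 have inj: "inj_on ?f (SL2_mod q)"
 proof
  fix h h' assume h: "h \<in> SL2_mod q" "h' \<in> SL2_mod q" "?f h = ?f h'"
  have "matrix_cong q (h ** u) (h' ** u)"
   by (metis h(3) rmod_cong matrix_cong_trans)
  then have "matrix_cong q (h ** u ** adjm u) (h' ** u ** adjm u)"
   by (simp add: matrix_cong_mult)
  then show "h = h'" using h mult_adjm_cong[OF assms(3)]
   by (meson SL2_mod_eqI matrix_cong_sym matrix_cong_trans)
 qed
 have surj: "?f ` SL2_mod q = SL2_mod q"
  by (simp add: endo_inj_surj inj into)
 have "(SUM h:SL2_mod q. \<Phi> h) = (SUM h:SL2_mod q. \<Phi> (?f h))"
  using sum.reindex[OF inj, of \<Phi>] surj by simp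
 also have "... = (SUM h:SL2_mod q. \<Phi> (h ** u))"
  by (intro sum.cong refl qperiodicD[OF assms(1)] rmod_cong)
 finally show ?thesis by simp
qed

lemma sum_left_shift:
 fixes \<Phi> :: "int^2^2 => 'b::comm_monoid_add"
 assumes "qperiodic q \<Phi>" "q > 0" "[det u = 1] (mod int q)"
 shows "(SUM h:SL2_mod q. \<Phi> (u ** h)) = (SUM h:SL2_mod q. \<Phi> h)"
proof -
 let ?f = "%h. rmod q (u ** h)"
 have into: "?f ` SL2_mod q \<subseteq> SL2_mod q"
  by (auto intro!: rmod_SL2 det_mult_cong_one assms dest: SL2_mod_det)
 have inj: "inj_on ?f (SL2_mod q)"
 proof
  fix h h' assume h: "h \<in> SL2_mod q" "h' \<in> SL2_mod q" "?f h = ?f h'"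
  have "matrix_cong q (u ** h) (u ** h')"
   by (metis h(3) rmod_cong matrix_cong_trans)
  then have "matrix_cong q (adjm u ** (u ** h)) (adjm u ** (u ** h'))"
   by (simp add: matrix_cong_mult)
  then show "h = h'" using h mult_adjm_cong[OF assms(3)]
   by (meson SL2_mod_eqI matrix_cong_sym matrix_cong_trans)
 qed
 have surj: "?f ` SL2_mod q = SL2_mod q"
  by (simp add: endo_inj_surj inj into)
 have "(SUM h:SL2_mod q. \<Phi> h) = (SUM h:SL2_mod q. \<Phi> (?f h))"
  using sum.reindex[OF inj, of \<Phi>] surj by simp
 also have "... = (SUM h:SL2_mod q. \<Phi> (u ** h))"
  by (intro sum.cong refl qperiodicD[OF assms(1)] rmod_cong)
 finally show ?thesis by simp
qed

lemma qperiodic_right: "qperiodic q \<Phi> ==> qperiodic q (%h. \<Phi> (h ** u))"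
 unfolding qperiodic_def using matrix_cong_mult matrix_cong_refl by blast

lemma qperiodic_left: "qperiodic q \<Phi> ==> qperiodic q (%h. \<Phi> (u ** h))"
 unfolding qperiodic_def using matrix_cong_mult matrix_cong_refl by blast

text \<open>There are at most q^2 first rows. Two second rows completing the same first row differ
  by a multiple of it, and the determinant of a second row against that of a fixed reference matrix
  \<open>c0\<close> recovers this multiple.\<close>

lemma card_SL2_mod_le: "card (SL2_mod q) <= q ^ 3"
proof (cases "q = 0")
 case True then show ?thesis by (simp add: SL2_mod_iff SL2_mod_def)
next
 case False
 let ?I = "{0..<int q}"
 have "card (SL2_mod q) <= card (?I \<times> ?I \<times> ?I)"
 proof -
  define c0 where "c0 = (%(a,b). SOME g. g \<in> SL2_mod q & g$1$1 = a & g$1$2 = b)"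
  define \<phi> where "\<phi> g = (g$1$1, g$1$2, (g$2$1 * c0 (g$1$1,g$1$2) $2$2 - g$2$2 * c0 (g$1$1,g$1$2) $2$1) mod int q)" for g :: "int^2^2"
  have "inj_on \<phi> (SL2_mod q)"
  proof
   fix g h assume gh: "g \<in> SL2_mod q" "h \<in> SL2_mod q" "\<phi> g = \<phi> h"
   define a b where "a = g$1$1" and "b = g$1$2"
   define k where "k = c0 (a,b)"
   have "k \<in> SL2_mod q & k$1$1 = a & k$1$2 = b"
    unfolding k_def c0_def split by (rule someI[of _ g]) (use gh in \<open>auto simp: a_def b_def\<close>)
   then have k: "[a * k$2$2 - b * k$2$1 = 1] (mod int q)" by (metis SL2_mod_det det_2)
   have hh: "h$1$1 = a" "h$1$2 = b" using gh(3) by (auto simp: \<phi>_def a_def b_def)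
   have g1: "[a * g$2$2 - b * g$2$1 = 1] (mod int q)" "[a * h$2$2 - b * h$2$1 = 1] (mod int q)"
    using SL2_mod_det[OF gh(1)] SL2_mod_det[OF gh(2)] hh by (simp_all add: det_2 a_def b_def)
   have e: "[g$2$1 * k$2$2 - g$2$2 * k$2$1 = h$2$1 * k$2$2 - h$2$2 * k$2$1] (mod int q)"
    using gh(3) hh by (auto simp: \<phi>_def cong_def k_def a_def b_def)
   define x y where "x = g$2$1 - h$2$1" and "y = g$2$2 - h$2$2"
   have "[a * g$2$2 - b * g$2$1 = a * h$2$2 - b * h$2$1] (mod int q)"
    using g1 by (meson cong_trans cong_sym)
   then have d1: "int q dvd a * y - b * x"
    unfolding x_def y_def cong_iff_dvd_diff by (simp add: algebra_simps)
   from e have d2: "int q dvd x * k$2$2 - y * k$2$1"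
    unfolding x_def y_def cong_iff_dvd_diff by (simp add: algebra_simps)
   from k have d3: "int q dvd a * k$2$2 - b * k$2$1 - 1" by (simp add: cong_iff_dvd_diff)
   have "x = a * (x * k$2$2 - y * k$2$1) + k$2$1 * (a * y - b * x) - x * (a * k$2$2 - b * k$2$1 - 1)"
    by (simp add: algebra_simps)
   then have dx: "int q dvd x" using d1 d2 d3 by (metis dvd_add dvd_diff dvd_mult)
   have "y = b * (x * k$2$2 - y * k$2$1) + k$2$2 * (a * y - b * x) - y * (a * k$2$2 - b * k$2$1 - 1)"
    by (simp add: algebra_simps)
   then have dy: "int q dvd y" using d1 d2 d3 by (metis dvd_add dvd_diff dvd_mult)
   have "matrix_cong q g h" using dx dy hh
    by (simp add: matrix_cong_iff cong_iff_dvd_diff x_def y_def a_def b_def)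
   then show "g = h" using gh by (simp add: SL2_mod_eqI)
  qed
  moreover have "\<phi> ` SL2_mod q \<subseteq> ?I \<times> ?I \<times> ?I"
   using False by (auto simp: \<phi>_def SL2_mod_iff)
  ultimately show ?thesis by (intro card_inj_on_le) auto
 qed
 also have "... = q ^ 3" by (simp add: card_cartesian_product power3_eq_cube)
 finally show ?thesis .
qed

section \<open>Square norms of functions modulo r\<close>

lemma Cauchy_Schwarz_cmod_sum:
 "(cmod (SUM x:X. f x * g x))^2 <= (SUM x:X. (cmod (f x))^2) * (SUM x:X. (cmod (g x))^2)"
proof -
 have "cmod (SUM x:X. f x * g x) <= (SUM x:X. cmod (f x) * cmod (g x))"
  by (rule order_trans[OF norm_sum]) (simp add: norm_mult)
 then have "(cmod (SUM x:X. f x * g x))^2 <= (SUM x:X. cmod (f x) * cmod (g x))^2"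
  by (intro power_mono) auto
 also have "... <= (SUM x:X. (cmod (f x))^2) * (SUM x:X. (cmod (g x))^2)"
  by (rule Cauchy_Schwarz_ineq_sum)
 finally show ?thesis .
qed

lemma sum_square_orthogonal:
 fixes \<Phi> :: "'i => 'a => complex"
 assumes "finite I" "finite X"
  and orth: "!!i j. i \<in> I ==> j \<in> I ==> i ~= j ==> (SUM x:X. \<Phi> i x * cnj (\<Phi> j x)) = 0"
 shows "(SUM x:X. (cmod (SUM i:I. a i * \<Phi> i x))^2) = (SUM i:I. (cmod (a i))^2 * (SUM x:X. (cmod (\<Phi> i x))^2))"
proof -
 have "complex_of_real (SUM x:X. (cmod (SUM i:I. a i * \<Phi> i x))^2)
   = (SUM x:X. (SUM i:I. a i * \<Phi> i x) * (SUM j:I. cnj (a j) * cnj (\<Phi> j x)))"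
  by (simp only: of_real_sum complex_norm_square cnj_sum complex_cnj_mult)
 also have "... = (SUM x:X. SUM i:I. SUM j:I. a i * cnj (a j) * (\<Phi> i x * cnj (\<Phi> j x)))"
  by (simp add: sum_product mult_ac)
 also have "... = (SUM i:I. SUM j:I. a i * cnj (a j) * (SUM x:X. \<Phi> i x * cnj (\<Phi> j x)))"
  by (subst sum.swap, intro sum.cong refl, subst sum.swap) (simp add: sum_distrib_left)
 also have "... = (SUM i:I. SUM j:I. if j = i then a i * cnj (a i) * (SUM x:X. \<Phi> i x * cnj (\<Phi> i x)) else 0)"
  by (intro sum.cong refl) (auto simp: orth)
 also have "... = (SUM i:I. a i * cnj (a i) * (SUM x:X. \<Phi> i x * cnj (\<Phi> i x)))"
  using assms(1) by (simp add: sum.delta)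
 also have "... = complex_of_real (SUM i:I. (cmod (a i))^2 * (SUM x:X. (cmod (\<Phi> i x))^2))"
  by (simp only: of_real_sum of_real_mult complex_norm_square)
 finally show ?thesis using of_real_eq_iff by blast
qed

text \<open>Duality: pairing \<open>k\<close> with the combination of the \<open>\<Phi> i\<close>
  with coefficients \<open>cnj (a i)\<close> returns the sum of squares S, and Cauchy--Schwarz with
  orthogonality gives S^2 <= S * \<nu> * |k|^2. An upper bound \<nu> for the norms replaces
  normalization.\<close>

lemma bessel:
 fixes k :: "'a => complex"
 assumes "finite I" "finite X"
  and orth: "!!i j. i \<in> I ==> j \<in> I ==> i ~= j ==> (SUM x:X. \<Phi> i x * cnj (\<Phi> j x)) = 0"
  and nrm: "!!i. i \<in> I ==> (SUM x:X. (cmod (\<Phi> i x))^2) <= \<nu>"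
  and \<nu>: "\<nu> >= 0"
 shows "(SUM i:I. (cmod (SUM x:X. k x * \<Phi> i x))^2) <= \<nu> * (SUM x:X. (cmod (k x))^2)"
proof -
 define a where "a i = (SUM x:X. k x * \<Phi> i x)" for i
 define S where "S = (SUM i:I. (cmod (a i))^2)"
 define b where "b x = (SUM i:I. cnj (a i) * \<Phi> i x)" for x
 have "(SUM x:X. k x * b x) = (SUM i:I. cnj (a i) * a i)"
  unfolding b_def a_def sum_distrib_left by (subst sum.swap) (simp add: mult_ac sum_distrib_left)
 also have "... = complex_of_real S"
  unfolding S_def by (simp only: of_real_sum complex_norm_square mult.commute)
 finally have "S^2 = (cmod (SUM x:X. k x * b x))^2" by simp
 also have "... <= (SUM x:X. (cmod (k x))^2) * (SUM x:X. (cmod (b x))^2)"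
  by (rule Cauchy_Schwarz_cmod_sum)
 also have "(SUM x:X. (cmod (b x))^2) = (SUM i:I. (cmod (cnj (a i)))^2 * (SUM x:X. (cmod (\<Phi> i x))^2))"
  unfolding b_def by (rule sum_square_orthogonal[OF assms(1,2) orth])
 also have "... <= (SUM i:I. (cmod (a i))^2 * \<nu>)"
  by (intro sum_mono) (simp add: mult_left_mono nrm)
 also have "... = S * \<nu>" by (simp add: S_def sum_distrib_right)
 finally have "S^2 <= (SUM x:X. (cmod (k x))^2) * (S * \<nu>)"
  by (simp add: mult_left_mono sum_nonneg)
 then have "S * S <= S * (\<nu> * (SUM x:X. (cmod (k x))^2))" by (simp add: power2_eq_square mult_ac)
 moreover have "S >= 0" by (simp add: S_def sum_nonneg)
 moreover have "\<nu> * (SUM x:X. (cmod (k x))^2) >= 0" using \<nu> by (simp add: sum_nonneg)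
 ultimately have "S <= \<nu> * (SUM x:X. (cmod (k x))^2)"
  by (cases "S = 0") auto
 then show ?thesis by (simp add: S_def a_def)
qed

lemma sum_card_fibre_square:
 assumes "finite S" "finite T" "f ` S \<subseteq> T"
 shows "(SUM g:T. (card {s\<in>S. f s = g})^2) = card {(s,s'). s \<in> S & s' \<in> S & f s = f s'}"
proof -
 have "{(s,s'). s \<in> S & s' \<in> S & f s = f s'} = (SIGMA s:S. {s'\<in>S. f s' = f s})" by auto
 then have "card {(s,s'). s \<in> S & s' \<in> S & f s = f s'} = (SUM s:S. card {s'\<in>S. f s' = f s})"
  using assms(1) by simp
 also have "... = (SUM g:T. SUM s:{s\<in>S. f s = g}. card {s'\<in>S. f s' = f s})"
  by (rule sum.group[OF assms, symmetric])
 also have "... = (SUM g:T. (card {s\<in>S. f s = g})^2)"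
  by (intro sum.cong refl) (simp add: power2_eq_square)
 finally show ?thesis by simp
qed

section \<open>Convolution operators modulo q and their Hilbert--Schmidt norm\<close>

definition nrm2 :: "nat => (int^2^2 => complex) => real" where
 "nrm2 q \<Phi> = (SUM h:SL2_mod q. (cmod (\<Phi> h))^2)"

text \<open>Sums over left translates commute with right translations, the property on which the
  multiplicity argument rests.\<close>

definition convS :: "(int^2^2) set => (int^2^2 => complex) => int^2^2 => complex" where
 "convS S \<Phi> h = (SUM s:S. \<Phi> (s ** h))"

text \<open>The squared L^2 norm of the push-forward of the counting measure of S to the matrices
  modulo r.\<close>

definition cpairs :: "nat => (int^2^2) set => nat" where
 "cpairs r S = card {(s,s'). s \<in> S & s' \<in> S & matrix_cong r s s'}"

lemma nrm2_nonneg [simp]: "nrm2 q \<Phi> >= 0"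
 by (simp add: nrm2_def sum_nonneg)

lemma nrm2_right_shift:
 assumes "qperiodic q \<Phi>" "q > 0" "[det u = 1] (mod int q)"
 shows "nrm2 q (%h. \<Phi> (h ** u)) = nrm2 q \<Phi>"
proof -
 have "qperiodic q (%h. (cmod (\<Phi> h))^2)" using assms(1) by (auto simp: qperiodic_def)
 from sum_right_shift[OF this assms(2,3)] show ?thesis by (simp add: nrm2_def)
qed

lemma qperiodic_convS: "qperiodic q \<Phi> ==> qperiodic q (convS S \<Phi>)"
proof -
 assume per: "qperiodic q \<Phi>"
 have "\<Phi> (s ** g) = \<Phi> (s ** h)" if "matrix_cong q g h" for s g h
  by (rule qperiodicD[OF per matrix_cong_mult[OF matrix_cong_refl that]])
 then show ?thesis unfolding qperiodic_def convS_def by simp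
qed

lemma rmod_eq_iff: "rmod q g = rmod q h \<longleftrightarrow> matrix_cong q g h"
 by (metis rmod_eqI rmod_cong matrix_cong_trans matrix_cong_sym)

lemma rmod_mult_cancel_right:
 assumes "[det h = 1] (mod int q)"
 shows "rmod q (s ** h) = rmod q (s' ** h) \<longleftrightarrow> matrix_cong q s s'"
proof
 assume "rmod q (s ** h) = rmod q (s' ** h)"
 then have "matrix_cong q (s ** h ** adjm h) (s' ** h ** adjm h)"
  by (simp add: rmod_eq_iff matrix_cong_mult)
 then show "matrix_cong q s s'" using mult_adjm_cong(1)[OF assms]
  by (meson matrix_cong_sym matrix_cong_trans)
next
 assume "matrix_cong q s s'"
 then show "rmod q (s ** h) = rmod q (s' ** h)" by (simp add: rmod_eq_iff matrix_cong_mult)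
qed

text \<open>The operator norm of \<^const>\<open>convS\<close> on an orthogonal family is controlled by its
 Hilbert--Schmidt norm, which counts coincidences modulo \<open>q\<close>.\<close>

lemma fibre_square_sum:
 assumes "finite S" "!!s. s \<in> S ==> det s = 1" "q > 0" "[det h = 1] (mod int q)"
 shows "(SUM g:SL2_mod q. (cmod (of_nat (card {s\<in>S. rmod q (s ** h) = g})))^2) = cpairs q S"
proof -
 have "(%s. rmod q (s ** h)) ` S \<subseteq> SL2_mod q"
  using assms by (auto intro!: rmod_SL2 simp: det_mul)
 from sum_card_fibre_square[OF assms(1) finite_SL2_mod this]
 have "(SUM g:SL2_mod q. (card {s\<in>S. rmod q (s ** h) = g})^2) = cpairs q S"
  by (simp add: cpairs_def rmod_mult_cancel_right[OF assms(4)])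
 then have "real (SUM g:SL2_mod q. (card {s\<in>S. rmod q (s ** h) = g})^2) = cpairs q S" by simp
 then show ?thesis by simp
qed

lemma convS_fibre:
 assumes "qperiodic q \<Phi>" "finite S" "!!s. s \<in> S ==> det s = 1" "q > 0" "[det h = 1] (mod int q)"
 shows "convS S \<Phi> h = (SUM g:SL2_mod q. of_nat (card {s\<in>S. rmod q (s ** h) = g}) * \<Phi> g)"
proof -
 have into: "(%s. rmod q (s ** h)) ` S \<subseteq> SL2_mod q"
  using assms by (auto intro!: rmod_SL2 simp: det_mul)
 have "convS S \<Phi> h = (SUM s:S. \<Phi> (rmod q (s ** h)))"
  unfolding convS_def by (intro sum.cong refl qperiodicD[OF assms(1)] rmod_cong)
 also have "... = (SUM g:SL2_mod q. SUM s:{s\<in>S. rmod q (s ** h) = g}. \<Phi> (rmod q (s ** h)))"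
  by (rule sum.group[OF assms(2) finite_SL2_mod into, symmetric])
 also have "... = (SUM g:SL2_mod q. of_nat (card {s\<in>S. rmod q (s ** h) = g}) * \<Phi> g)"
  by (intro sum.cong refl) simp
 finally show ?thesis .
qed

text \<open>At each h the values \<open>convS S (\<Phi> i) h\<close> are the coefficients of one
  vector, the fibre counts of the products s ** h, whose squared norm is \<open>cpairs q S\<close>.
  Bessel bounds their square sum over the family, and summing over h gives the factor
  \<open>card (SL2_mod q)\<close>. The bound does not grow with the family, which is what
  multiplicity exploits.\<close>

lemma convS_family:
 assumes S: "finite S" "!!s. s \<in> S ==> det s = 1" and q: "q > 0" and I: "finite I"
  and per: "!!i. i \<in> I ==> qperiodic q (\<Phi> i)"
  and orth: "!!i j. i \<in> I ==> j \<in> I ==> i ~= j ==> (SUM x:SL2_mod q. \<Phi> i x * cnj (\<Phi> j x)) = 0"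
  and nrm: "!!i. i \<in> I ==> nrm2 q (\<Phi> i) <= \<nu>"
  and \<nu>: "\<nu> >= 0"
 shows "(SUM i:I. nrm2 q (convS S (\<Phi> i))) <= \<nu> * card (SL2_mod q) * cpairs q S"
proof -
 have "(SUM i:I. nrm2 q (convS S (\<Phi> i))) = (SUM h:SL2_mod q. SUM i:I. (cmod (convS S (\<Phi> i) h))^2)"
  unfolding nrm2_def by (rule sum.swap)
 also have "... <= (SUM h:SL2_mod q. \<nu> * cpairs q S)"
 proof (intro sum_mono)
  fix h assume h: "h \<in> SL2_mod q"
  have d: "[det h = 1] (mod int q)" by (rule SL2_mod_det[OF h])
  have "(SUM i:I. (cmod (convS S (\<Phi> i) h))^2)
    = (SUM i:I. (cmod (SUM g:SL2_mod q. of_nat (card {s\<in>S. rmod q (s ** h) = g}) * \<Phi> i g))^2)"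
   by (intro sum.cong refl) (simp add: convS_fibre[OF per S q d])
  also have "... <= \<nu> * (SUM g:SL2_mod q. (cmod (of_nat (card {s\<in>S. rmod q (s ** h) = g})))^2)"
   by (rule bessel[OF I finite_SL2_mod orth]) (use nrm \<nu> in \<open>auto simp: nrm2_def\<close>)
  also have "... = \<nu> * cpairs q S" by (simp only: fibre_square_sum[OF S q d])
  finally show "(SUM i:I. (cmod (convS S (\<Phi> i) h))^2) <= \<nu> * cpairs q S" .
 qed
 finally show ?thesis by (simp add: mult_ac)
qed

text \<open>Turns an L^2 bound back into a bound for a single value, at the end of an
  iteration.\<close>

lemma sum_fibre_bound:
 assumes "qperiodic q \<Phi>" "finite S" "!!s. s \<in> S ==> det s = 1" "q > 0" "[det h = 1] (mod int q)"
 shows "(cmod (convS S \<Phi> h))^2 <= cpairs q S * nrm2 q \<Phi>"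
 using Cauchy_Schwarz_cmod_sum[of "%g. of_nat (card {s\<in>S. rmod q (s ** h) = g})" \<Phi> "SL2_mod q"]
 by (simp only: convS_fibre[OF assms] nrm2_def fibre_square_sum[OF assms(2-5)])

section \<open>Unipotent types\<close>

text \<open>The additive character e(j/p).\<close>

definition zt :: "nat => nat => complex" where
 "zt p j = exp (2 * of_real pi * \<i> * of_nat j / of_nat p)"

lemma zt_add: "zt p (i + j) = zt p i * zt p j"
 by (simp add: zt_def exp_add[symmetric] add_divide_distrib distrib_left)

lemma zt_0 [simp]: "zt p 0 = 1"
 by (simp add: zt_def)

lemma zt_eq_iff: "p > 0 ==> zt p j = zt p k \<longleftrightarrow> j mod p = k mod p"
 unfolding zt_def by (rule complex_root_unity_eq) simp

lemma zt_mult_period [simp]: "p > 0 ==> zt p (j * p) = 1" "p > 0 ==> zt p (p * j) = 1"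
 using zt_eq_iff[of p "j * p" 0] by (simp_all add: mult.commute)

lemma cmod_zt [simp]: "cmod (zt p j) = 1"
proof -
 have "zt p j = exp (\<i> * complex_of_real (2 * pi * j / p))" by (simp add: zt_def mult_ac)
 then show ?thesis by (simp only: norm_exp_i_times)
qed

lemma zt_cnj [simp]: "zt p j * cnj (zt p j) = 1" "cnj (zt p j) * zt p j = 1"
 by (simp_all add: complex_norm_square[symmetric] mult.commute)

lemma zt_power: "zt p j ^ n = zt p (j * n)"
 by (induction n) (simp_all add: zt_add)

lemma sum_cnj_zt:
 assumes "p > 0" "x < p"
 shows "(\<Sum>j<p. cnj (zt p (j * x))) = (if x = 0 then of_nat p else 0)"
proof (cases "x = 0")
 case False
 let ?c = "cnj (zt p x)"
 have ne: "?c ~= 1" using zt_eq_iff[of p x 0] assms False by auto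
 have e: "cnj (zt p (j * x)) = ?c ^ j" for j
  by (simp add: zt_power mult.commute flip: complex_cnj_power)
 have "(\<Sum>j<p. ?c ^ j) = (?c ^ p - 1) / (?c - 1)" using ne by (rule geometric_sum)
 also have "?c ^ p = 1" using assms by (simp add: zt_power flip: complex_cnj_power)
 finally show ?thesis using False by (simp add: e)
qed simp

text \<open>Eigenfunctions of right translation by u; j is the frequency of the eigenvalue, a p-th
  root of unity.\<close>

definition typed :: "nat => int^2^2 => nat => (int^2^2 => complex) => bool" where
 "typed p u j \<Phi> \<longleftrightarrow> (\<forall>h. \<Phi> (h ** u) = zt p j * \<Phi> h)"

text \<open>The flag selects the upper or the lower unipotent subgroup, so that both are treated by
  the same lemmas.\<close>

definition un :: "bool => int => int^2^2" where
 "un b x = (if b then mk 1 x 0 1 else mk 1 0 x 1)"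

lemma un_add: "un b x ** un b y = un b (x + y)"
 by (simp add: un_def mk_mult add.commute)

lemma det_un [simp]: "det (un b x) = 1"
 by (simp add: un_def)

lemma un_0 [simp]: "un b 0 = mat 1"
 by (simp add: un_def mat_1_mk)

lemma un_cong: "[x = y] (mod int q) ==> matrix_cong q (un b x) (un b y)"
 by (simp add: un_def matrix_cong_iff)

lemma typed_un_mult:
 assumes "typed p (un b e) j \<Phi>"
 shows "\<Phi> (h ** un b (e * int n)) = zt p (j * n) * \<Phi> h"
proof (induction n)
 case (Suc n)
 have "un b (e * int (Suc n)) = un b (e * int n) ** un b e"
  by (simp add: un_add algebra_simps)
 then have "\<Phi> (h ** un b (e * int (Suc n))) = \<Phi> (h ** un b (e * int n) ** un b e)"
  by (simp add: matrix_mul_assoc)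
 also have "... = zt p j * (zt p (j * n) * \<Phi> h)"
  using assms Suc by (simp add: typed_def)
 finally show ?case by (simp add: zt_add)
qed simp

text \<open>The Fourier component of frequency j along the subgroup x ->
  \<open>un b (e * x)\<close>. With e the idempotent of p this subgroup has period p modulo r and
  moves only the coordinate at p.\<close>

definition ucomp :: "nat => bool => int => nat => (int^2^2 => complex) => int^2^2 => complex" where
 "ucomp p b e j \<Phi> h = (\<Sum>x<p. cnj (zt p (j * x)) * \<Phi> (h ** un b (e * int x))) / of_nat p"

lemma ucomp_typed:
 assumes per: "qperiodic r \<Phi>" and dvd: "int r dvd e * int p" and p: "p > 0"
 shows "typed p (un b e) j (ucomp p b e j \<Phi>)"
 unfolding typed_def
proof
 fix h
 define f where "f x = cnj (zt p (j * x)) * \<Phi> (h ** un b (e * int x))" for x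
 have "matrix_cong r (un b (e * int p)) (un b 0)"
  by (rule un_cong) (use dvd in \<open>simp add: cong_iff_dvd_diff\<close>)
 then have "matrix_cong r (h ** un b (e * int p)) (h ** mat 1)"
  using matrix_cong_mult matrix_cong_refl un_0 by metis
 then have fp: "f p = f 0" using qperiodicD[OF per] p by (simp add: f_def)
 have "(\<Sum>x<p. f (Suc x)) = (\<Sum>x<p. f x)"
  using sum.lessThan_Suc_shift[of f p] sum.lessThan_Suc[of f p] fp by simp
 moreover have "cnj (zt p (j * x)) * \<Phi> (h ** un b e ** un b (e * int x)) = zt p j * f (Suc x)" for x
 proof -
  have "h ** un b e ** un b (e * int x) = h ** un b (e * int (Suc x))"
   by (simp add: matrix_mul_assoc[symmetric] un_add algebra_simps)
  moreover have "cnj (zt p (j * x)) = zt p j * cnj (zt p (j * Suc x))"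
   by (simp add: zt_add mult.assoc[symmetric])
  ultimately show ?thesis by (simp add: f_def)
 qed
 ultimately show "ucomp p b e j \<Phi> (h ** un b e) = zt p j * ucomp p b e j \<Phi> h"
  by (simp add: ucomp_def sum_distrib_left[symmetric] f_def[symmetric])
qed

lemma ucomp_sum:
 assumes "p > 0"
 shows "(\<Sum>j<p. ucomp p b e j \<Phi> h) = \<Phi> h"
proof -
 have "(\<Sum>j<p. ucomp p b e j \<Phi> h) = (\<Sum>x<p. \<Sum>j<p. cnj (zt p (j * x)) * \<Phi> (h ** un b (e * int x))) / of_nat p"
  unfolding ucomp_def by (subst sum.swap) (simp add: sum_divide_distrib)
 also have "(\<Sum>x<p. \<Sum>j<p. cnj (zt p (j * x)) * \<Phi> (h ** un b (e * int x))) =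
   (\<Sum>x<p. if x = 0 then of_nat p * \<Phi> h else 0)"
  by (intro sum.cong refl) (simp add: sum_distrib_right[symmetric] sum_cnj_zt assms)
 finally show ?thesis using assms by (simp add: sum.delta)
qed

lemma qperiodic_ucomp: "qperiodic r \<Phi> ==> qperiodic r (ucomp p b e j \<Phi>)"
proof -
 assume per: "qperiodic r \<Phi>"
 show ?thesis unfolding qperiodic_def ucomp_def
 proof (intro allI impI)
  fix g h assume "matrix_cong r g h"
  then have "\<Phi> (g ** u) = \<Phi> (h ** u)" for u
   using qperiodicD[OF per] matrix_cong_mult matrix_cong_refl by blast
  then show "(\<Sum>x<p. cnj (zt p (j * x)) * \<Phi> (g ** un b (e * int x))) / of_nat p =
   (\<Sum>x<p. cnj (zt p (j * x)) * \<Phi> (h ** un b (e * int x))) / of_nat p" by simp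
 qed
qed

lemma convS_ucomp: "convS S (ucomp p b e j \<Phi>) = ucomp p b e j (convS S \<Phi>)"
proof
 fix h
 have "convS S (ucomp p b e j \<Phi>) h =
   (SUM s:S. \<Sum>x<p. cnj (zt p (j * x)) * \<Phi> (s ** h ** un b (e * int x))) / of_nat p"
  by (simp add: convS_def ucomp_def sum_divide_distrib matrix_mul_assoc)
 also have "... = (\<Sum>x<p. SUM s:S. cnj (zt p (j * x)) * \<Phi> (s ** h ** un b (e * int x))) / of_nat p"
  by (subst sum.swap) (rule refl)
 also have "... = ucomp p b e j (convS S \<Phi>) h"
  by (simp add: convS_def ucomp_def sum_distrib_left matrix_mul_assoc)
 finally show "convS S (ucomp p b e j \<Phi>) h = ucomp p b e j (convS S \<Phi>) h" .
qed

lemma eq_mult_self_zero: "(S::complex) = c * S ==> c ~= 1 ==> S = 0"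
 by (metis mult_cancel_right1)

text \<open>Translation by u preserves the inner product, but multiplies it by a root of unity
  different from 1.\<close>

lemma typed_orthogonal:
 assumes "qperiodic r \<Phi>" "qperiodic r \<Psi>" "r > 0" "[det u = 1] (mod int r)"
  and "typed p u j \<Phi>" "typed p u k \<Psi>" "j mod p ~= k mod p" "p > 0"
 shows "(SUM h:SL2_mod r. \<Phi> h * cnj (\<Psi> h)) = 0"
proof -
 let ?S = "SUM h:SL2_mod r. \<Phi> h * cnj (\<Psi> h)"
 have "qperiodic r (%h. \<Phi> h * cnj (\<Psi> h))"
  using assms(1,2) by (auto simp: qperiodic_def)
 from sum_right_shift[OF this assms(3,4)]
 have "?S = (SUM h:SL2_mod r. \<Phi> (h ** u) * cnj (\<Psi> (h ** u)))" by simp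
 also have "... = (SUM h:SL2_mod r. zt p j * cnj (zt p k) * (\<Phi> h * cnj (\<Psi> h)))"
  using assms(5,6) by (intro sum.cong refl) (simp add: typed_def mult_ac)
 finally have "?S = (SUM h:SL2_mod r. zt p j * cnj (zt p k) * (\<Phi> h * cnj (\<Psi> h)))" .
 then have e: "?S = zt p j * cnj (zt p k) * ?S" by (simp only: sum_distrib_left[symmetric])
 have "zt p j * cnj (zt p k) ~= 1"
 proof
  assume "zt p j * cnj (zt p k) = 1"
  then have "zt p j * cnj (zt p k) * zt p k = zt p k" by simp
  then have "zt p j = zt p k" by (simp only: mult.assoc zt_cnj) simp
  then show False using assms zt_eq_iff by blast
 qed
 then show ?thesis using eq_mult_self_zero[OF e] by blast
qed

lemma ucomp_parseval:
 assumes per: "qperiodic r \<Phi>" and dvd: "int r dvd e * int p" and p: "p > 0" and r: "r > 0"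
 shows "nrm2 r \<Phi> = (\<Sum>j<p. nrm2 r (ucomp p b e j \<Phi>))"
proof -
 have "(SUM x:SL2_mod r. (cmod (\<Sum>j<p. 1 * ucomp p b e j \<Phi> x))^2)
   = (\<Sum>j<p. (cmod 1)^2 * (SUM x:SL2_mod r. (cmod (ucomp p b e j \<Phi> x))^2))"
  by (rule sum_square_orthogonal)
    (auto intro!: typed_orthogonal[OF _ _ r _ ucomp_typed[OF per dvd p, of b] ucomp_typed[OF per dvd p, of b]]
       simp: p qperiodic_ucomp per)
 then show ?thesis by (simp add: nrm2_def ucomp_sum[OF p])
qed

section \<open>Square-free moduli\<close>

text \<open>\<open>E p\<close> is the idempotent of \<open>\<int>/r\<close> belonging to the prime \<open>p\<close>.\<close>

locale prime_set =
 fixes Pr :: "nat set" and E :: "nat => nat"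
 assumes fin: "finite Pr" and pr: "!!p. p \<in> Pr ==> prime p"
  and E1: "!!p. p \<in> Pr ==> [E p = 1] (mod p)"
  and E0: "!!p q. p \<in> Pr ==> q \<in> Pr ==> p ~= q ==> [E p = 0] (mod q)"
begin

definition r :: nat where "r = \<Prod>Pr"

lemma r_pos: "r > 0"
 unfolding r_def using fin pr by (auto intro!: prod_pos prime_gt_0_nat)

lemma dvd_r: "p \<in> Pr ==> p dvd r"
 unfolding r_def using fin by (rule dvd_prodI)

lemma cong_r_int: "[x = y] (mod int r) \<longleftrightarrow> (\<forall>p\<in>Pr. [x = y] (mod int p))"
proof
 assume "[x = y] (mod int r)" then show "\<forall>p\<in>Pr. [x = y] (mod int p)"
  using dvd_r by (meson cong_dvd_modulus int_dvd_int_iff)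
next
 assume *: "\<forall>p\<in>Pr. [x = y] (mod int p)"
 have "[x = y] (mod (PROD p:P. int p))" if "P \<subseteq> Pr" for P
  using finite_subset[OF that fin] that
 proof (induction P rule: finite_induct)
  case (insert p P)
  have "coprime (int p) (PROD q:P. int q)"
   using insert pr by (intro prod_coprime_right) (auto intro!: primes_coprime simp: coprime_int_iff)
  then show ?case using insert * by (simp add: coprime_cong_mult)
 qed simp
 from this[of Pr] have "[x = y] (mod (PROD p:Pr. int p))" by simp
 then show "[x = y] (mod int r)" by (simp add: r_def)
qed

lemma cong_r: "matrix_cong r g h \<longleftrightarrow> (\<forall>p\<in>Pr. matrix_cong p g h)"
 unfolding matrix_cong_iff cong_r_int by blast

lemma E1i: "p \<in> Pr ==> [int (E p) = 1] (mod int p)"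
 using E1[of p] cong_int_iff[of "E p" 1 p] by simp

lemma E0i: "p \<in> Pr ==> q \<in> Pr ==> p ~= q ==> [int (E p) = 0] (mod int q)"
 using E0[of p q] cong_int_iff[of "E p" 0 q] by simp

lemma E_dvd: "p \<in> Pr ==> int r dvd int (E p) * int p"
proof -
 assume p: "p \<in> Pr"
 have "[int (E p) * int p = 0] (mod int q)" if "q \<in> Pr" for q
  using E0i[OF p that] by (cases "p = q") (auto simp: cong_0_iff)
 then have "[int (E p) * int p = 0] (mod int r)" by (simp add: cong_r_int)
 then show ?thesis by (simp add: cong_0_iff)
qed

text \<open>The matrix 1 + E p (g - 1): congruent to g modulo p and to the identity modulo the other
  primes, thus the embedding of the factor at p given by the Chinese remainder theorem.\<close>

definition lift :: "nat => int^2^2 => int^2^2" where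
 "lift p g = mk (1 + int (E p) * (g$1$1 - 1)) (int (E p) * g$1$2) (int (E p) * g$2$1) (1 + int (E p) * (g$2$2 - 1))"

lemma lift_same: "p \<in> Pr ==> matrix_cong p (lift p g) g"
proof -
 assume "p \<in> Pr"
 then have e: "int p dvd int (E p) - 1" using E1i by (simp add: cong_iff_dvd_diff)
 have "1 + int (E p) * (x - 1) - x = (int (E p) - 1) * (x - 1)" "int (E p) * x - x = (int (E p) - 1) * x" for x :: int
  by (simp_all add: algebra_simps)
 then show ?thesis using e by (simp add: matrix_cong_iff lift_def cong_iff_dvd_diff)
qed

lemma lift_other: "p \<in> Pr ==> q \<in> Pr ==> p ~= q ==> matrix_cong q (lift p g) (mat 1)"
 using E0i[of p q] by (simp add: matrix_cong_iff lift_def cong_iff_dvd_diff)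

lemma lift_cong: "p \<in> Pr ==> matrix_cong p g h ==> matrix_cong r (lift p g) (lift p h)"
 unfolding cong_r by (metis lift_same lift_other matrix_cong_sym matrix_cong_trans)

lemma lift_mult: "p \<in> Pr ==> matrix_cong r (lift p g ** lift p h) (lift p (g ** h))"
 unfolding cong_r
proof
 fix q assume p: "p \<in> Pr" and q: "q \<in> Pr"
 show "matrix_cong q (lift p g ** lift p h) (lift p (g ** h))"
 proof (cases "p = q")
  case True
  then show ?thesis using lift_same[OF p] by (meson matrix_cong_mult matrix_cong_sym matrix_cong_trans)
 next
  case False
  have "matrix_cong q (lift p g ** lift p h) (mat 1 ** mat 1)"
   by (intro matrix_cong_mult lift_other p q False)
  then show ?thesis using lift_other[OF p q False, of "g ** h"]
   by (metis matrix_cong_sym matrix_cong_trans matrix_mul_lid)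
 qed
qed

lemma lift_commute: "p \<in> Pr ==> q \<in> Pr ==> p ~= q ==> matrix_cong r (lift p g ** lift q h) (lift q h ** lift p g)"
 unfolding cong_r
proof
 fix s assume p: "p \<in> Pr" and q: "q \<in> Pr" and pq: "p ~= q" and s: "s \<in> Pr"
 show "matrix_cong s (lift p g ** lift q h) (lift q h ** lift p g)"
 proof (cases "s = p")
  case True
  then have "matrix_cong s (lift q h) (mat 1)" using lift_other[OF q s] pq by blast
  then have "matrix_cong s (lift p g ** lift q h) (lift p g ** mat 1)"
       "matrix_cong s (lift q h ** lift p g) (mat 1 ** lift p g)"
   by (intro matrix_cong_mult matrix_cong_refl; assumption)+
  from matrix_cong_trans[OF this(1)[unfolded matrix_mul_lid matrix_mul_rid]
    matrix_cong_sym[OF this(2)[unfolded matrix_mul_lid matrix_mul_rid]]]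
  show ?thesis .
 next
  case False
  then have "matrix_cong s (lift p g) (mat 1)" using lift_other[OF p s] by blast
  then have "matrix_cong s (lift p g ** lift q h) (mat 1 ** lift q h)"
       "matrix_cong s (lift q h ** lift p g) (lift q h ** mat 1)"
   by (intro matrix_cong_mult matrix_cong_refl; assumption)+
  from matrix_cong_trans[OF this(1)[unfolded matrix_mul_lid matrix_mul_rid]
    matrix_cong_sym[OF this(2)[unfolded matrix_mul_lid matrix_mul_rid]]]
  show ?thesis .
 qed
qed

lemma det_lift: "p \<in> Pr ==> [det g = 1] (mod int p) ==> [det (lift p g) = 1] (mod int r)"
 unfolding cong_r_int
proof
 fix q assume p: "p \<in> Pr" and g: "[det g = 1] (mod int p)" and q: "q \<in> Pr"
 show "[det (lift p g) = 1] (mod int q)"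
 proof (cases "p = q")
  case True then show ?thesis using matrix_cong_det[OF lift_same[OF p]] g cong_trans by blast
 next
  case False then show ?thesis using matrix_cong_det[OF lift_other[OF p q False]] by (simp add: det_2)
 qed
qed

lemma un_lift: "un b (int (E p) * x) = lift p (un b x)"
 by (simp add: un_def lift_def mat2_eq_iff)

text \<open>The mean vanishes over each coset of the factor at p, not merely over the whole group;
  base points h of every determinant are included.\<close>

definition mzero :: "nat => (int^2^2 => complex) => bool" where
 "mzero p \<Phi> \<longleftrightarrow> (\<forall>h. (SUM g:SL2_mod p. \<Phi> (h ** lift p g)) = 0)"

lemma qperiodic_lift:
 assumes "p \<in> Pr" "qperiodic r \<Phi>"
 shows "qperiodic p (%g. \<Phi> (h ** lift p g))"
 unfolding qperiodic_def
 using assms(2) lift_cong[OF assms(1)] matrix_cong_mult matrix_cong_refl by (meson qperiodicD)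

end

context prime_set begin

subsection \<open>Torus translates\<close>

text \<open>Conjugation by the torus multiplies a unipotent parameter by a square, x'^2 for the
  upper and x^2 for the lower subgroup, where x' is an inverse of x modulo r.\<close>

lemma torus_un:
 assumes "[int x * int x' = 1] (mod int r)"
 shows "matrix_cong r (un b e ** mk (int x) 0 0 (int x'))
   (mk (int x) 0 0 (int x') ** un b (e * int (if b then x'\<^sup>2 else x\<^sup>2)))"
proof -
 have d: "int r dvd int x * int x' - 1" using assms by (simp add: cong_iff_dvd_diff)
 have "int x * (e * (int x')^2) - e * int x' = e * int x' * (int x * int x' - 1)"
    "int x' * (e * (int x)^2) - e * int x = e * int x * (int x * int x' - 1)"
  by (simp_all add: power2_eq_square algebra_simps)
 then have "int r dvd int x * (e * (int x')^2) - e * int x'" "int r dvd int x' * (e * (int x)^2) - e * int x"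
  using d by simp_all
 then show ?thesis
  by (simp add: un_def mk_mult matrix_cong_iff cong_iff_dvd_diff)
    (simp add: dvd_diff_commute mult_ac)
qed

lemma typed_torus:
 assumes "qperiodic r \<Phi>" "typed p (un b e) j \<Phi>" "[int x * int x' = 1] (mod int r)"
 shows "typed p (un b e) (j * (if b then x'\<^sup>2 else x\<^sup>2)) (%h. \<Phi> (h ** mk (int x) 0 0 (int x')))"
 unfolding typed_def
proof
 fix h
 let ?t = "mk (int x) 0 0 (int x')" and ?n = "if b then x'\<^sup>2 else x\<^sup>2"
 have "matrix_cong r (h ** (un b e ** ?t)) (h ** (?t ** un b (e * int ?n)))"
  using torus_un[OF assms(3)] matrix_cong_mult matrix_cong_refl by blast
 then have "\<Phi> (h ** un b e ** ?t) = \<Phi> (h ** ?t ** un b (e * int ?n))"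
  using qperiodicD[OF assms(1)] by (simp add: matrix_mul_assoc)
 also have "... = zt p (j * ?n) * \<Phi> (h ** ?t)" by (rule typed_un_mult[OF assms(2)])
 finally show "\<Phi> (h ** un b e ** ?t) = zt p (j * ?n) * \<Phi> (h ** ?t)" .
qed

end

text \<open>The numbers 1, ..., (p - 1)/2 have distinct squares modulo p, so this counts the
  frequencies into which the torus carries a nonzero one. The maximum covers p = 2.\<close>

definition wgt :: "nat => nat" where "wgt p = max 1 ((p - 1) div 2)"

lemma squares_distinct:
 assumes "prime p" "a \<in> {1..wgt p}" "a' \<in> {1..wgt p}" "a ~= a'"
 shows "\<not> [a\<^sup>2 = a'^2] (mod p)"
proof
 assume c: "[a\<^sup>2 = a'^2] (mod p)"
 have w: "wgt p > 1" using assms(2-4) by auto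
 then have lt: "2 * wgt p < p" by (auto simp: wgt_def max_def split: if_splits)
 have "[int (a^2) = int (a'^2)] (mod int p)" using c by (simp add: cong_int_iff del: of_nat_power)
 then have "int p dvd (int a - int a') * (int a + int a')"
  by (simp add: cong_iff_dvd_diff power2_eq_square algebra_simps)
 then have "int p dvd (int a - int a') \<or> int p dvd (int a + int a')"
  using assms(1) by (simp add: prime_dvd_mult_iff)
 moreover have "0 < \<bar>int a - int a'\<bar>" "\<bar>int a - int a'\<bar> < int p" "0 < int a + int a'" "int a + int a' < int p"
  using assms lt by auto
 ultimately show False using zdvd_not_zless[of "\<bar>int a - int a'\<bar>" "int p"] zdvd_not_zless[of "int a + int a'" "int p"]
  by auto
qed

context prime_set begin

text \<open>A torus element with entry a p modulo p multiplies the frequency at p by (a p)^2 or its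
  inverse. Independent choices of the a p at the primes of k give \<open>PROD p:k. wgt p\<close>
  pairwise orthogonal translates with the same norm before and after convolution, to which
  \<open>convS_family\<close> applies.\<close>

lemma convS_full_typed:
 assumes S: "finite S" "!!s. s \<in> S ==> det s = 1" and per: "qperiodic r \<Phi>" and k: "k \<subseteq> Pr"
  and ty: "!!p. p \<in> k ==> typed p (un (b p) (int (E p))) (j p) \<Phi>"
  and j: "!!p. p \<in> k ==> \<not> p dvd j p"
 shows "real (PROD p:k. wgt p) * nrm2 r (convS S \<Phi>) <= nrm2 r \<Phi> * card (SL2_mod r) * cpairs r S"
proof -
 have fk: "finite k" using k fin finite_subset by blast
 define I where "I = PiE k (%p. {1..wgt p})"
 have fI: "finite I" unfolding I_def using fk by (intro finite_PiE) auto
 have cI: "card I = (PROD p:k. wgt p)" unfolding I_def using fk by (simp add: card_PiE)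
 \<comment> \<open>Chinese remainder: \<open>x a\<close> is congruent to a p modulo each p in k and
   to 1 modulo the other primes. All a p are at least 1, so the natural subtraction is
   exact.\<close>
 define x where "x a = 1 + (SUM p:k. E p * (a p - 1))" for a :: "nat => nat"
 have xk: "[x a = a p] (mod p)" if "a \<in> I" "p \<in> k" for a p
 proof -
  have "[(SUM q:k. E q * (a q - 1)) = (SUM q:k. if q = p then a p - 1 else 0)] (mod p)"
  proof (rule cong_sum)
   fix q assume q: "q \<in> k"
   show "[E q * (a q - 1) = (if q = p then a p - 1 else 0)] (mod p)"
   proof (cases "q = p")
    case True
    have "[E p * (a p - 1) = 1 * (a p - 1)] (mod p)"
     by (rule cong_scalar_right) (use E1[of p] k that(2) in blast)
    then show ?thesis using True by simp
   next
    case False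
    then have "[E q = 0] (mod p)" using E0[of q p] k q that(2) by blast
    then show ?thesis using False by (simp add: cong_0_iff)
   qed
  qed
  then have "[x a = 1 + (a p - 1)] (mod p)"
   unfolding x_def using fk that(2) by (intro cong_add) (simp_all add: sum.delta)
  moreover have "a p >= 1" using that by (auto simp: I_def PiE_def Pi_def)
  ultimately show ?thesis by simp
 qed
 have xo: "[x a = 1] (mod p)" if "p \<in> Pr" "p \<notin> k" for a p
 proof -
  have "[(SUM q:k. E q * (a q - 1)) = (SUM q:k. 0)] (mod p)"
  proof (rule cong_sum)
   fix q assume q: "q \<in> k"
   then have "[E q = 0] (mod p)" using E0[of q p] k that by blast
   then show "[E q * (a q - 1) = 0] (mod p)" by (simp add: cong_0_iff)
  qed
  then show ?thesis unfolding x_def using cong_add[of 1 1 p _ "SUM q:k. 0"] by simp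
 qed
 have cop: "coprime (x a) r" if "a \<in> I" for a
  unfolding r_def
 proof (rule prod_coprime_right)
  fix p assume p: "p \<in> Pr"
  have "\<not> p dvd x a"
  proof (cases "p \<in> k")
   case True
   have "1 <= a p" "a p <= wgt p" using that True by (auto simp: I_def PiE_def Pi_def)
   moreover have "wgt p < p" using prime_gt_1_nat[OF pr[OF p]] by (auto simp: wgt_def)
   ultimately have "\<not> p dvd a p" by (meson nat_dvd_not_less le_less_trans less_le_trans zero_less_one)
   then show ?thesis using xk[OF that True] cong_dvd_iff by blast
  next
   case False
   then show ?thesis using xo[OF p False, of a] cong_dvd_iff prime_gt_1_nat[OF pr[OF p]]
    by (metis nat_dvd_1_iff_1 less_irrefl)
  qed
  then have "coprime p (x a)" using prime_imp_coprime[OF pr[OF p]] by blast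
  then show "coprime (x a) p" by (subst coprime_commute)
 qed
 have "\<exists>y. [x a * y = 1] (mod r)" if "a \<in> I" for a
  using cong_solve_coprime_nat[OF cop[OF that]] by simp
 then obtain y where y: "!!a. a \<in> I ==> [x a * y a = 1] (mod r)" by metis
 have yi: "[int (x a) * int (y a) = 1] (mod int r)" if "a \<in> I" for a
  using y[OF that] by (metis cong_int_iff of_nat_1 of_nat_mult)
 define t where "t a = mk (int (x a)) 0 0 (int (y a))" for a
 define \<Psi> where "\<Psi> a = (%h. \<Phi> (h ** t a))" for a
 have dt: "[det (t a) = 1] (mod int r)" if "a \<in> I" for a
  using yi[OF that] by (simp add: t_def)
 have perP: "qperiodic r (\<Psi> a)" for a unfolding \<Psi>_def by (rule qperiodic_right[OF per])
 have orth: "(SUM h:SL2_mod r. \<Psi> a h * cnj (\<Psi> a' h)) = 0" if a: "a \<in> I" "a' \<in> I" "a ~= a'" for a a'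
 proof -
  obtain p where p: "p \<in> k" "a p ~= a' p" using a unfolding I_def by (metis PiE_ext)
  then have pP: "p \<in> Pr" "prime p" using k pr by auto
  define n where "n a = (if b p then (y a)\<^sup>2 else (x a)\<^sup>2)" for a
  have ap: "a p \<in> {1..wgt p}" "a' p \<in> {1..wgt p}" using a p by (auto simp: I_def PiE_def Pi_def)
  have x2: "[(x a)\<^sup>2 = (a p)^2] (mod p)" "[(x a')\<^sup>2 = (a' p)^2] (mod p)"
   using xk a p by (auto intro: cong_pow)
  have ns: "\<not> [(x a)\<^sup>2 = (x a')^2] (mod p)"
   using squares_distinct[OF pP(2) ap p(2)] x2 by (meson cong_sym cong_trans)
  have yp: "[(x c)\<^sup>2 * (y c)^2 = 1] (mod p)" if "c \<in> I" for c
   using cong_pow[OF cong_dvd_modulus_nat[OF y[OF that] dvd_r[OF pP(1)]], of 2]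
   by (simp add: power_mult_distrib)
  have nn: "\<not> [n a = n a'] (mod p)"
  proof (cases "b p")
   case True
   show ?thesis
   proof
    assume "[n a = n a'] (mod p)"
    then have e: "[(y a)\<^sup>2 = (y a')^2] (mod p)" using True by (simp add: n_def)
    have "[(x a)\<^sup>2 = (x a)^2 * ((x a')^2 * (y a')^2)] (mod p)"
     using cong_scalar_left[OF yp[OF a(2)], of "(x a)^2"] by (simp add: cong_sym)
    also have "[(x a)\<^sup>2 * ((x a')^2 * (y a')^2) = (x a)^2 * ((x a')^2 * (y a)^2)] (mod p)"
     using e by (intro cong_mult cong_refl) (rule cong_sym)
    also have "(x a)^2 * ((x a')^2 * (y a)^2) = (x a')^2 * ((x a)^2 * (y a)^2)" by simp
    also have "[(x a')\<^sup>2 * ((x a)^2 * (y a)^2) = (x a')^2 * 1] (mod p)"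
     by (rule cong_scalar_left[OF yp[OF a(1)]])
    finally show False using ns by simp
   qed
  qed (use ns in \<open>simp add: n_def\<close>)
  \<comment> \<open>Since the frequency j p is invertible modulo p, distinct multipliers produce
    distinct frequencies.\<close>
  have "coprime (j p) p" using j[OF p(1)] pP(2) prime_imp_coprime coprime_commute by blast
  then have jn: "j p * n a mod p ~= j p * n a' mod p"
   using nn by (metis cong_def cong_mult_lcancel_nat)
  have "typed p (un (b p) (int (E p))) (j p * n c) (\<Psi> c)" if "c \<in> I" for c
   unfolding n_def \<Psi>_def t_def by (rule typed_torus[OF per ty[OF p(1)] yi[OF that]])
  from typed_orthogonal[OF perP perP r_pos _ this[OF a(1)] this[OF a(2)] jn]
  show ?thesis using prime_gt_0_nat[OF pP(2)] by simp
 qed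
 have nP: "nrm2 r (\<Psi> a) = nrm2 r \<Phi>" if "a \<in> I" for a
  unfolding \<Psi>_def by (rule nrm2_right_shift[OF per r_pos dt[OF that]])
 have cP: "nrm2 r (convS S (\<Psi> a)) = nrm2 r (convS S \<Phi>)" if "a \<in> I" for a
 proof -
  have "convS S (\<Psi> a) = (%h. convS S \<Phi> (h ** t a))"
   by (simp add: convS_def \<Psi>_def matrix_mul_assoc fun_eq_iff)
  then show ?thesis using nrm2_right_shift[OF qperiodic_convS[OF per] r_pos dt[OF that]] by simp
 qed
 have "(SUM a:I. nrm2 r (convS S (\<Psi> a))) <= nrm2 r \<Phi> * card (SL2_mod r) * cpairs r S"
  by (rule convS_family[OF S r_pos fI perP orth]) (auto simp: nP)
 then show ?thesis using cP cI by (simp add: mult_ac del: of_nat_prod)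
qed

end

section \<open>The Bruhat decomposition modulo a prime\<close>

lemma prime_coprime_less:
 assumes "prime p" "1 <= x" "x < p"
 shows "coprime (int x) (int p)"
proof -
 have "\<not> p dvd x" using assms nat_dvd_not_less[of x p] by auto
 then have "coprime p x" using assms(1) prime_imp_coprime by blast
 then show ?thesis by (simp add: coprime_commute)
qed

text \<open>In the coordinates upper, lower, upper unipotent, the lower left entry of the product is
  x itself; the diagonal entries 1 + y x and 1 + x z then give y and z because x is invertible, and
  the determinant forces the remaining entry.\<close>

lemma bruhat_bij:
 assumes p: "prime p"
 shows "bij_betw (%(x,y,z). rmod p (un True (int y) ** un False (int x) ** un True (int z)))
   ({1..<p} \<times> {..<p} \<times> {..<p}) {g \<in> SL2_mod p. g$2$1 ~= 0}"
proof -
 define f where "f = (%(x::nat,y::nat,z::nat). rmod p (un True (int y) ** un False (int x) ** un True (int z)))"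
 have p0: "p > 0" using p prime_gt_0_nat by blast
 have e: "un True y ** un False x ** un True z = mk (1 + y*x) ((1 + y*x)*z + y) x (x*z+1)" for x y z
  by (simp add: un_def mk_mult)
 have fe: "f (x,y,z) = rmod p (mk (1 + int y*int x) ((1 + int y*int x)*int z + int y) (int x) (int x*int z+1))" for x y z
  by (simp add: f_def e)
 have inj: "inj_on f ({1..<p} \<times> {..<p} \<times> {..<p})"
 proof
  fix u v assume u: "u \<in> {1..<p} \<times> {..<p} \<times> {..<p}" "v \<in> {1..<p} \<times> {..<p} \<times> {..<p}" "f u = f v"
  obtain x y z x' y' z' where uv: "u = (x,y,z)" "v = (x',y',z')" by (metis prod_cases3)
  from u(3) have c: "[int x = int x'] (mod int p)" "[1 + int y*int x = 1 + int y'*int x'] (mod int p)"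
    "[int x*int z+1 = int x'*int z'+1] (mod int p)"
   unfolding uv fe rmod_eq_iff by (simp_all add: matrix_cong_iff)
  have xx: "x = x'" using c(1) u uv by (auto simp: cong_int_iff cong_def)
  have cop: "coprime (int x) (int p)" by (rule prime_coprime_less[OF p]) (use u uv in auto)
  have "[int x * int y = int x * int y'] (mod int p)" "[int x * int z = int x * int z'] (mod int p)"
   using c(2,3) xx by (simp_all add: cong_add_lcancel cong_add_rcancel mult.commute)
  then have "[int y = int y'] (mod int p)" "[int z = int z'] (mod int p)"
   using cop by (simp_all add: cong_mult_lcancel)
  then have "y = y'" "z = z'" using u uv by (auto simp: cong_int_iff cong_def)
  then show "u = v" using xx uv by simp
 qed
 have im: "f ` ({1..<p} \<times> {..<p} \<times> {..<p}) = {g \<in> SL2_mod p. g$2$1 ~= 0}"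
 proof (intro equalityI subsetI)
  fix g assume "g \<in> f ` ({1..<p} \<times> {..<p} \<times> {..<p})"
  then obtain x y z where x: "1 <= x" "x < p" and g: "g = f (x,y,z)" by auto
  have "g \<in> SL2_mod p" unfolding g fe by (rule rmod_SL2[OF p0]) (simp add: algebra_simps)
  moreover have "g$2$1 = int x" unfolding g fe using x by (simp add: rmod_def)
  ultimately show "g \<in> {g \<in> SL2_mod p. g$2$1 ~= 0}" using x by simp
 next
  fix g assume "g \<in> {g \<in> SL2_mod p. g$2$1 ~= 0}"
  then have g: "g \<in> SL2_mod p" "g$2$1 ~= 0" by auto
  define x where "x = nat (g$2$1)"
  have x: "int x = g$2$1" "1 <= x" "x < p" using g by (auto simp: x_def SL2_mod_iff)
  have cop: "coprime (int x) (int p)" by (rule prime_coprime_less[OF p]) (use x in auto)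
  then obtain w where w: "[int x * w = 1] (mod int p)" using cong_solve_coprime_int by blast
  define y where "y = nat (((g$1$1 - 1) * w) mod int p)"
  define z where "z = nat (((g$2$2 - 1) * w) mod int p)"
  have yz: "int y = ((g$1$1 - 1) * w) mod int p" "int z = ((g$2$2 - 1) * w) mod int p" "y < p" "z < p"
   using p0 by (auto simp: y_def z_def nat_less_iff)
  have ym: "[int y * int x = g$1$1 - 1] (mod int p)"
  proof -
   have "[int y * int x = ((g$1$1 - 1) * w) * int x] (mod int p)"
    unfolding yz by (rule cong_scalar_right) (simp add: cong_def)
   also have "((g$1$1 - 1) * w) * int x = (g$1$1 - 1) * (int x * w)" by simp
   also have "[(g$1$1 - 1) * (int x * w) = (g$1$1 - 1) * 1] (mod int p)" by (rule cong_scalar_left[OF w])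
   finally show ?thesis by simp
  qed
  have zm: "[int x * int z = g$2$2 - 1] (mod int p)"
  proof -
   have "[int x * int z = int x * ((g$2$2 - 1) * w)] (mod int p)"
    unfolding yz by (rule cong_scalar_left) (simp add: cong_def)
   also have "int x * ((g$2$2 - 1) * w) = (g$2$2 - 1) * (int x * w)" by simp
   also have "[(g$2$2 - 1) * (int x * w) = (g$2$2 - 1) * 1] (mod int p)" by (rule cong_scalar_left[OF w])
   finally show ?thesis by simp
  qed
  have d: "[g$1$1 * g$2$2 - g$1$2 * g$2$1 = 1] (mod int p)" using SL2_mod_det[OF g(1)] by (simp add: det_2)
  define A where "A = 1 + int y * int x"
  define D where "D = int x * int z + 1"
  have AD: "[A = g$1$1] (mod int p)" "[D = g$2$2] (mod int p)"
   using cong_add[OF cong_refl[of 1] ym] cong_add[OF zm cong_refl[of 1]] by (simp_all add: A_def D_def)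
  have "int x * (A * int z + int y) = A * D - 1" by (simp add: A_def D_def algebra_simps)
  moreover have "[A * D - 1 = g$1$1 * g$2$2 - 1] (mod int p)" using AD by (intro cong_diff cong_mult) auto
  moreover have "[g$1$1 * g$2$2 - 1 = int x * g$1$2] (mod int p)"
   using d unfolding cong_iff_dvd_diff x(1) by (simp add: algebra_simps)
  ultimately have "[int x * (A * int z + int y) = int x * g$1$2] (mod int p)" by (metis cong_trans)
  then have B: "[A * int z + int y = g$1$2] (mod int p)" using cop by (simp add: cong_mult_lcancel)
  have "matrix_cong p (mk A (A * int z + int y) (int x) D) g"
   using AD B x by (simp add: matrix_cong_iff)
  then have "f (x,y,z) = g" unfolding fe A_def[symmetric] D_def[symmetric]
   by (metis rmod_eqI rmod_SL2_id g(1))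
  moreover have "(x,y,z) \<in> {1..<p} \<times> {..<p} \<times> {..<p}" using x yz by auto
  ultimately show "g \<in> f ` ({1..<p} \<times> {..<p} \<times> {..<p})" by blast
 qed
 show ?thesis using inj im by (simp add: bij_betw_def f_def)
qed

lemma borel_shift_bij:
 assumes p: "p > 0" and b: "b \<in> SL2_mod p" "b$2$1 = 0"
 shows "bij_betw (%g. rmod p (adjm b ** g)) {g \<in> SL2_mod p. g$2$1 = 0} {g \<in> SL2_mod p. g$2$1 = 0}"
proof -
 let ?D = "{g \<in> SL2_mod p. g$2$1 = 0}" and ?f = "%g. rmod p (adjm b ** g)"
 have db: "[det b = 1] (mod int p)" by (rule SL2_mod_det[OF b(1)])
 have into: "?f ` ?D \<subseteq> ?D"
 proof
  fix g assume "g \<in> ?f ` ?D"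
  then obtain h where h: "h \<in> SL2_mod p" "h$2$1 = 0" "g = ?f h" by auto
  have "g \<in> SL2_mod p" unfolding h(3)
   by (rule rmod_SL2[OF p det_mult_cong_one]) (use db SL2_mod_det[OF h(1)] in simp_all)
  moreover have "g$2$1 = 0" using h b by (simp add: rmod_def mult_nth adjm_def)
  ultimately show "g \<in> ?D" by simp
 qed
 have inj: "inj_on ?f ?D"
 proof
  fix h h' assume h: "h \<in> ?D" "h' \<in> ?D" "?f h = ?f h'"
  have d: "[det (adjm b) = 1] (mod int p)" using db by simp
  have "matrix_cong p (adjm b ** h) (adjm b ** h')" using h(3) by (simp add: rmod_eq_iff)
  then have "matrix_cong p (adjm (adjm b) ** (adjm b ** h)) (adjm (adjm b) ** (adjm b ** h'))"
   by (simp add: matrix_cong_mult)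
  then have "matrix_cong p h h'" using mult_adjm_cong(2)[OF d] matrix_cong_trans matrix_cong_sym by meson
  then show "h = h'" using h SL2_mod_eqI by blast
 qed
 have "?f ` ?D = ?D" by (intro endo_inj_surj inj into) simp
 then show ?thesis using inj by (simp add: bij_betw_def)
qed

context prime_set begin

lemma lift_one: "matrix_cong r (lift p (mat 1)) (mat 1)"
 by (simp add: lift_def matrix_cong_iff)

text \<open>A function invariant under the upper unipotents that has mean zero over \<open>SL\<^sub>2(\<int>/p)\<close> is nearly
 orthogonal to its translates by lower unipotents: by the Bruhat decomposition those
 correlations add up to minus the contribution of the Borel subgroup, which is positive definite.\<close>

lemma ucomp_lower_of_upper_invariant:
 assumes p: "p \<in> Pr" and per: "qperiodic r \<Phi>" and ty: "typed p (un True (int (E p))) 0 \<Phi>"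
  and mz: "mzero p \<Phi>"
 shows "nrm2 r (ucomp p False (int (E p)) 0 \<Phi>) <= nrm2 r \<Phi> / p"
proof -
 let ?G = "SL2_mod r" and ?e = "int (E p)"
 have pp: "prime p" and p0: "p > 0" using pr[OF p] prime_gt_0_nat by auto
 \<comment> \<open>The autocorrelation of \<Phi> along the factor at p. Invariance of \<Phi> under
   upper unipotents makes it bi-invariant, so that on the big cell it depends only on the lower left
   entry.\<close>
 define c where "c g = (SUM h:?G. \<Phi> (h ** lift p g) * cnj (\<Phi> h))" for g
 have pc: "qperiodic p c"
  unfolding qperiodic_def c_def
 proof (intro allI impI)
  fix g g' assume "matrix_cong p g g'"
  then have "\<Phi> (h ** lift p g) = \<Phi> (h ** lift p g')" for h
   using qperiodicD[OF qperiodic_lift[OF p per]] by blast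
  then show "(SUM h:?G. \<Phi> (h ** lift p g) * cnj (\<Phi> h)) = (SUM h:?G. \<Phi> (h ** lift p g') * cnj (\<Phi> h))" by simp
 qed
 have Uinv: "\<Phi> (h ** lift p (un True (int y))) = \<Phi> h" for h y
  using typed_un_mult[OF ty, of h y] by (simp add: un_lift)
 have liftm: "\<Phi> (h ** lift p (g ** g')) = \<Phi> (h ** lift p g ** lift p g')" for h g g'
  using qperiodicD[OF per matrix_cong_mult[OF matrix_cong_refl lift_mult[OF p]], of h g g']
  by (simp add: matrix_mul_assoc)
 have shift: "(SUM h:?G. f (h ** lift p u)) = (SUM h:?G. f h)" if "qperiodic r f" "[det u = 1] (mod int p)" for f :: "int^2^2 => complex" and u
  by (rule sum_right_shift[OF that(1) r_pos det_lift[OF p that(2)]])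
 have per2: "qperiodic r (%h. \<Phi> (h ** a) * cnj (\<Phi> (h ** b)))" for a b
  using qperiodic_right[OF per] by (auto simp: qperiodic_def)
 have per3: "qperiodic r (%h. \<Phi> (h ** a) * cnj (\<Phi> h))" for a
  using per2[of a "mat 1"] by simp
 have cr: "c (g ** un True (int z)) = c g" for g z
  unfolding c_def liftm Uinv by simp
 have cl: "c (un True (int y) ** g) = c g" for g y
 proof -
  have "c (un True (int y) ** g) = (SUM h:?G. \<Phi> (h ** lift p (un True (int y)) ** lift p g) * cnj (\<Phi> (h ** lift p (un True (int y)))))"
   unfolding c_def liftm Uinv by simp
  also have "... = c g" unfolding c_def
   by (rule shift[of "%h. \<Phi> (h ** lift p g) * cnj (\<Phi> h)"]) (simp_all add: per3)
  finally show ?thesis .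
 qed
 have c0: "(SUM g:SL2_mod p. c g) = 0"
 proof -
  have "(SUM g:SL2_mod p. c g) = (SUM h:?G. (SUM g:SL2_mod p. \<Phi> (h ** lift p g)) * cnj (\<Phi> h))"
   unfolding c_def by (subst sum.swap) (simp add: sum_distrib_right)
  then show ?thesis using mz by (simp add: mzero_def)
 qed
 define V where "V = (SUM x:{1..<p}. c (un False (int x)))"
 define D where "D = {g \<in> SL2_mod p. g$2$1 = 0}"
 have big: "(SUM g:{g \<in> SL2_mod p. g$2$1 ~= 0}. c g) = (of_nat p)^2 * V"
 proof -
  have "(SUM g:{g \<in> SL2_mod p. g$2$1 ~= 0}. c g) =
    (SUM (x,y,z):{1..<p} \<times> {..<p} \<times> {..<p}. c (rmod p (un True (int y) ** un False (int x) ** un True (int z))))"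
   using sum.reindex_bij_betw[OF bruhat_bij[OF pp], of c] by (simp add: case_prod_unfold)
  also have "... = (SUM (x,y,z):{1..<p} \<times> {..<p} \<times> {..<p}. c (un False (int x)))"
   by (intro sum.cong refl) (auto simp: cr cl matrix_mul_assoc[symmetric] qperiodicD[OF pc rmod_cong(1)]
      simp flip: matrix_mul_assoc)
  also have "... = (of_nat p)^2 * V"
   by (simp add: sum.cartesian_product[symmetric] V_def sum_distrib_left power2_eq_square mult_ac)
  finally show ?thesis .
 qed
 have "finite D" by (simp add: D_def)
 \<comment> \<open>Positive definiteness: \<open>card D\<close> times the sum of \<open>c\<close>
   over the Borel subgroup is the square norm of the sum of the translates of \<Phi> by that
   subgroup.\<close>
 have Dpos: "\<exists>\<delta>\<ge>0. (SUM g:D. c g) = complex_of_real \<delta>"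
 proof -
  have one: "rmod p (mat 1) \<in> D" unfolding D_def using rmod_SL2[OF p0, of "mat 1"] by (simp add: det_2 rmod_def)
  then have cD: "card D > 0" using \<open>finite D\<close> card_gt_0_iff by blast
  define \<Psi> where "\<Psi> h = (SUM g:D. \<Phi> (h ** lift p g))" for h
  have "complex_of_real (nrm2 r \<Psi>) = (SUM h:?G. \<Psi> h * cnj (\<Psi> h))"
   unfolding nrm2_def by (simp only: of_real_sum complex_norm_square)
  also have "... = (SUM h:?G. SUM b:D. SUM g:D. \<Phi> (h ** lift p g) * cnj (\<Phi> (h ** lift p b)))"
   unfolding \<Psi>_def by (simp add: sum_product) (subst sum.swap, rule refl)
  also have "... = (SUM b:D. SUM g:D. SUM h:?G. \<Phi> (h ** lift p g) * cnj (\<Phi> (h ** lift p b)))"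
   by (subst sum.swap, rule sum.cong[OF refl], rule sum.swap)
  also have "... = (SUM b:D. SUM g:D. c (adjm b ** g))"
  proof (intro sum.cong refl)
   fix b g assume b: "b \<in> D" and g: "g \<in> D"
   have db: "[det b = 1] (mod int p)" using b SL2_mod_det by (auto simp: D_def)
   then have db': "[det (adjm b) = 1] (mod int p)" by simp
   have "(SUM h:?G. \<Phi> (h ** lift p g) * cnj (\<Phi> (h ** lift p b)))
     = (SUM h:?G. \<Phi> (h ** lift p (adjm b) ** lift p g) * cnj (\<Phi> (h ** lift p (adjm b) ** lift p b)))"
    by (rule shift[OF per2 db', symmetric])
   also have "... = c (adjm b ** g)"
    unfolding c_def
   proof (intro sum.cong refl)
    fix h
    have "matrix_cong p (adjm b ** b) (mat 1)" using db by (simp add: mult_adjm matrix_cong_iff)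
    then have "matrix_cong r (lift p (adjm b ** b)) (mat 1)"
     using lift_cong[OF p] lift_one matrix_cong_trans by blast
    then have "matrix_cong r (h ** lift p (adjm b ** b)) (h ** mat 1)"
     using matrix_cong_mult matrix_cong_refl by blast
    then have "\<Phi> (h ** lift p (adjm b) ** lift p b) = \<Phi> h"
     using qperiodicD[OF per] by (simp add: liftm[symmetric])
    then show "\<Phi> (h ** lift p (adjm b) ** lift p g) * cnj (\<Phi> (h ** lift p (adjm b) ** lift p b))
      = \<Phi> (h ** lift p (adjm b ** g)) * cnj (\<Phi> h)" by (simp add: liftm)
   qed
   finally show "(SUM h:?G. \<Phi> (h ** lift p g) * cnj (\<Phi> (h ** lift p b))) = c (adjm b ** g)" .
  qed
  also have "... = (SUM b:D. SUM g:D. c g)"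
  proof (rule sum.cong[OF refl])
   fix b assume b: "b \<in> D"
   have "(SUM g:D. c (adjm b ** g)) = (SUM g:D. c (rmod p (adjm b ** g)))"
    by (intro sum.cong refl qperiodicD[OF pc] rmod_cong)
   also have "... = (SUM g:D. c g)"
    using sum.reindex_bij_betw[OF borel_shift_bij[OF p0, of b], of c] b by (simp add: D_def)
   finally show "(SUM g:D. c (adjm b ** g)) = (SUM g:D. c g)" .
  qed
  also have "... = of_nat (card D) * (SUM g:D. c g)" by simp
  finally have "(SUM g:D. c g) = complex_of_real (nrm2 r \<Psi> / card D)"
   using cD by (simp add: field_simps)
  moreover have "nrm2 r \<Psi> / card D >= 0" by simp
  ultimately show ?thesis by blast
 qed
 then obtain \<delta> where \<delta>: "\<delta> >= 0" "(SUM g:D. c g) = complex_of_real \<delta>" by blast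
 have un: "SL2_mod p = {g \<in> SL2_mod p. g$2$1 ~= 0} \<union> D" by (auto simp: D_def)
 have "(SUM g:{g \<in> SL2_mod p. g$2$1 ~= 0} \<union> D. c g) = (SUM g:{g \<in> SL2_mod p. g$2$1 ~= 0}. c g) + (SUM g:D. c g)"
  by (rule sum.union_disjoint) (auto simp: D_def)
 then have "(SUM g:SL2_mod p. c g) = (SUM g:{g \<in> SL2_mod p. g$2$1 ~= 0}. c g) + (SUM g:D. c g)"
  by (subst un)
 then have Veq: "(of_nat p)^2 * V = - complex_of_real \<delta>"
  using c0 big \<delta>(2) by (simp add: eq_neg_iff_add_eq_0)
 let ?P = "ucomp p False ?e 0 \<Phi>"
 have dv: "int r dvd ?e * int p" by (rule E_dvd[OF p])
 \<comment> \<open>Components of different frequency are orthogonal, so pairing \<open>?P\<close>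
   with \<Phi> gives the square norm of \<open>?P\<close>. Expanding \<open>?P\<close> instead gives
   (c 1 + V)/p, where V = -\<delta>/p^2 is not positive.\<close>
 have "(SUM h:?G. ?P h * cnj (\<Phi> h)) = (\<Sum>j<p. SUM h:?G. ?P h * cnj (ucomp p False ?e j \<Phi> h))"
  by (subst sum.swap) (simp add: sum_distrib_left[symmetric] cnj_sum[symmetric] ucomp_sum[OF p0] del: cnj_sum)
 also have "... = (\<Sum>j<p. if j = 0 then SUM h:?G. ?P h * cnj (?P h) else 0)"
 proof (intro sum.cong refl)
  fix j assume j: "j \<in> {..<p}"
  show "(SUM h:?G. ?P h * cnj (ucomp p False ?e j \<Phi> h)) = (if j = 0 then SUM h:?G. ?P h * cnj (?P h) else 0)"
  proof (cases "j = 0")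
   case False
   then have "(SUM h:?G. ?P h * cnj (ucomp p False ?e j \<Phi> h)) = 0"
    using j p0 by (intro typed_orthogonal[OF qperiodic_ucomp[OF per] qperiodic_ucomp[OF per] r_pos _
      ucomp_typed[OF per dv p0] ucomp_typed[OF per dv p0]]) auto
   then show ?thesis using False by simp
  qed simp
 qed
 also have "... = complex_of_real (nrm2 r ?P)"
  using p0 by (simp only: nrm2_def of_real_sum complex_norm_square sum.delta finite_lessThan) simp
 finally have e1: "complex_of_real (nrm2 r ?P) = (SUM h:?G. ?P h * cnj (\<Phi> h))" by simp
 also have "... = (\<Sum>x<p. c (un False (int x))) / of_nat p"
  unfolding ucomp_def c_def un_lift[symmetric]
  by (subst sum.swap) (simp add: sum_distrib_right sum_divide_distrib)
 also have "(\<Sum>x<p. c (un False (int x))) = c (mat 1) + V"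
  unfolding V_def using p0 by (subst lessThan_atLeast0, subst sum.atLeast_Suc_lessThan) auto
 also have "c (mat 1) = complex_of_real (nrm2 r \<Phi>)"
 proof -
  have "\<Phi> (h ** lift p (mat 1)) = \<Phi> h" for h
   using qperiodicD[OF per matrix_cong_mult[OF matrix_cong_refl lift_one]] by simp
  then show ?thesis by (simp only: c_def nrm2_def of_real_sum complex_norm_square)
 qed
 also have "V = - complex_of_real (\<delta> / (real p)^2)"
  using Veq p0 by (simp add: field_simps)
 finally have "complex_of_real (nrm2 r ?P) = complex_of_real ((nrm2 r \<Phi> - \<delta> / (real p)^2) / real p)" by simp
 then have "nrm2 r ?P = (nrm2 r \<Phi> - \<delta> / (real p)^2) / real p" using of_real_eq_iff by blast
 then show ?thesis using \<delta>(1) by (simp add: divide_right_mono)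
qed

end

text \<open>The two losses of an induction step of \<open>convS_mean_zero_typed\<close>: 1/wgt p for
  nonzero frequencies, 1/p for the lower-invariant component of the upper-invariant part.\<close>

lemma wgt_ge: "prime p ==> 1 / real (wgt p) + 1 / real p <= 4 / real p"
proof -
 assume "prime p"
 then have p: "p >= 2" by (rule prime_ge_2_nat)
 \<comment> \<open>From 2 on, 4 is the only value at which \<open>p <= 3 * wgt p\<close>
   fails.\<close>
 have "p ~= 2 * 2" using \<open>prime p\<close> prime_product[of 2 "2::nat"] by auto
 then have "p <= 3 * wgt p" by (cases "p <= 3") (auto simp: wgt_def)
 then have "real p <= 3 * real (wgt p)" by linarith
 moreover have "real (wgt p) > 0" by (simp add: wgt_def)
 ultimately show ?thesis using p by (simp add: field_simps)
qed

context prime_set begin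

lemma lift_commute_apply:
 assumes "qperiodic r \<Phi>" "p \<in> Pr" "q \<in> Pr" "p ~= q"
 shows "\<Phi> (h ** lift p g ** lift q g') = \<Phi> (h ** lift q g' ** lift p g)"
 using qperiodicD[OF assms(1) matrix_cong_mult[OF matrix_cong_refl lift_commute[OF assms(2-4)]], of h g g']
 by (simp add: matrix_mul_assoc)

lemma lift_mult_apply:
 assumes "qperiodic r \<Phi>" "p \<in> Pr"
 shows "\<Phi> (h ** lift p g ** lift p g') = \<Phi> (h ** lift p (g ** g'))"
 using qperiodicD[OF assms(1) matrix_cong_mult[OF matrix_cong_refl lift_mult[OF assms(2)]], of h g g']
 by (simp add: matrix_mul_assoc)

lemma ucomp_keeps_typed:
 assumes "qperiodic r \<Phi>" "p \<in> Pr" "q \<in> Pr" "p ~= q" "typed q (un b (int (E q))) j \<Phi>"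
 shows "typed q (un b (int (E q))) j (ucomp p \<beta> (int (E p)) i \<Phi>)"
proof -
 have l: "un b (int (E q)) = lift q (un b 1)" using un_lift[of b q 1] by simp
 have "\<Phi> (h ** lift q (un b 1) ** lift p (un \<beta> (int x))) = zt q j * \<Phi> (h ** lift p (un \<beta> (int x)))" for h x
  using assms(5) lift_commute_apply[OF assms(1,3,2)] assms(4) by (simp add: typed_def l)
 then show ?thesis
  unfolding typed_def ucomp_def l un_lift by (simp add: sum_distrib_left mult.left_commute)
qed

lemma ucomp_keeps_mzero:
 assumes "qperiodic r \<Phi>" "p \<in> Pr" "q \<in> Pr" "mzero q \<Phi>"
 shows "mzero q (ucomp p \<beta> (int (E p)) i \<Phi>)"
 unfolding mzero_def
proof
 fix h
 have z: "(SUM g:SL2_mod q. \<Phi> (h ** lift q g ** lift p (un \<beta> (int x)))) = 0" for x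
 proof (cases "p = q")
  case True
  have "(SUM g:SL2_mod q. \<Phi> (h ** lift q (g ** un \<beta> (int x)))) = (SUM g:SL2_mod q. \<Phi> (h ** lift q g))"
   by (rule sum_right_shift[OF qperiodic_lift[OF assms(3,1)]]) (use pr[OF assms(3)] prime_gt_0_nat in auto)
  then show ?thesis using True assms(4) by (simp add: lift_mult_apply[OF assms(1,3)] mzero_def)
 next
  case False
  then show ?thesis using assms(4) lift_commute_apply[OF assms(1,3,2)] by (simp add: mzero_def)
 qed
 have "(SUM g:SL2_mod q. ucomp p \<beta> (int (E p)) i \<Phi> (h ** lift q g)) =
   (\<Sum>x<p. cnj (zt p (i * x)) * (SUM g:SL2_mod q. \<Phi> (h ** lift q g ** lift p (un \<beta> (int x))))) / of_nat p"
  unfolding ucomp_def un_lift sum_distrib_left by (subst sum.swap) (simp add: sum_divide_distrib)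
 then show "(SUM g:SL2_mod q. ucomp p \<beta> (int (E p)) i \<Phi> (h ** lift q g)) = 0"
  by (simp only: z) simp
qed

text \<open>Induction over the primes not yet typed. At a new p, \<Phi> is split along the upper
  subgroup, and its frequency-zero part along the lower one; all components of nonzero frequency
  move p into k, where they gain a factor \<open>wgt p\<close>. What remains has squared norm at
  most 1/p of that of \<Phi> by the Bruhat argument, so for it the bound without p suffices.\<close>

lemma convS_mean_zero_typed:
 assumes S: "finite S" "!!s. s \<in> S ==> det s = 1"
  and "finite m" "m \<subseteq> Pr" "k \<subseteq> Pr" "m \<inter> k = {}" "qperiodic r \<Phi>"
  and "!!p. p \<in> k ==> typed p (un (b p) (int (E p))) (j p) \<Phi>"
  and "!!p. p \<in> k ==> \<not> p dvd j p"
  and "!!p. p \<in> m ==> mzero p \<Phi>"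
 shows "real (PROD p:k. wgt p) * nrm2 r (convS S \<Phi>)
   <= (PROD p:m. 4 / real p) * (nrm2 r \<Phi> * (real (card (SL2_mod r)) * real (cpairs r S)))"
 using assms(3-)
proof (induction m arbitrary: k b j \<Phi> rule: finite_induct)
 case empty
 then show ?case using convS_full_typed[OF S empty(4,2,5,6)] by (simp add: mult.assoc)
next
 case (insert p m)
 define X where "X = real (card (SL2_mod r)) * real (cpairs r S)"
 define M where "M = (PROD p:m. 4 / real p)"
 define W where "W = real (PROD p:k. wgt p)"
 define w where "w = real (wgt p)"
 have p: "p \<in> Pr" "p \<notin> k" "p \<notin> m" using insert by auto
 have pp: "prime p" and p0: "p > 0" using pr[OF p(1)] prime_gt_0_nat by auto
 have w: "w > 0" by (simp add: w_def wgt_def)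
 have nn: "M >= 0" "X >= 0" by (auto simp: M_def X_def intro!: prod_nonneg)
 have fk: "finite k" using insert.prems(2) fin finite_subset by blast
 note per = insert.prems(4)
 let ?c = "%\<beta> i. ucomp p \<beta> (int (E p)) i"
 have perc: "qperiodic r (?c \<beta> i \<Psi>)" if "qperiodic r \<Psi>" for \<beta> i \<Psi> by (rule qperiodic_ucomp[OF that])
 define good where "good \<Psi> \<longleftrightarrow> qperiodic r \<Psi> & (\<forall>q\<in>k. typed q (un (b q) (int (E q))) (j q) \<Psi>)
   & (\<forall>q\<in>m. mzero q \<Psi>) & mzero p \<Psi>" for \<Psi>
 have g\<Phi>: "good \<Phi>" using insert.prems by (auto simp: good_def)
 have goodc: "good (?c \<beta> i \<Psi>)" if "good \<Psi>" for \<beta> i \<Psi>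
  using that p insert.prems unfolding good_def
  by (auto intro!: perc ucomp_keeps_mzero ucomp_keeps_typed)
 have I1: "W * nrm2 r (convS S \<Psi>) <= M * (nrm2 r \<Psi> * X)" if "good \<Psi>" for \<Psi>
  unfolding W_def M_def X_def
  by (rule insert.IH) (use insert.prems that in \<open>auto simp: good_def\<close>)
 have I2: "W * w * nrm2 r (convS S (?c \<beta> i \<Psi>)) <= M * (nrm2 r (?c \<beta> i \<Psi>) * X)"
  if "good \<Psi>" "i \<in> {1..<p}" for \<beta> i \<Psi>
 proof -
  have ni: "\<not> p dvd i" using that(2) by (auto dest: nat_dvd_not_less)
  have per': "qperiodic r \<Psi>" using that by (simp add: good_def)
  have ty: "typed p (un \<beta> (int (E p))) i (?c \<beta> i \<Psi>)"
   by (rule ucomp_typed[OF per' E_dvd[OF p(1)] p0])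
  have gc: "good (?c \<beta> i \<Psi>)" by (rule goodc[OF that(1)])
  have "real (PROD q:insert p k. wgt q) * nrm2 r (convS S (?c \<beta> i \<Psi>))
    <= (PROD p:m. 4 / real p) * (nrm2 r (?c \<beta> i \<Psi>) * (real (card (SL2_mod r)) * real (cpairs r S)))"
   by (rule insert.IH[of "insert p k" _ "b(p := \<beta>)" "j(p := i)"])
     (use insert.prems insert.hyps p gc ty ni in \<open>auto simp: good_def\<close>)
  then show ?thesis using p fk by (simp add: W_def w_def M_def X_def mult_ac)
 qed
 \<comment> \<open>Convolution commutes with \<open>ucomp\<close>, so both square norms decompose
   over the frequencies; the nonzero ones are covered by \<open>I2\<close>.\<close>
 have split: "W * nrm2 r (convS S \<Psi>) <= W * nrm2 r (convS S (?c \<beta> 0 \<Psi>)) + M * X / w * (nrm2 r \<Psi> - nrm2 r (?c \<beta> 0 \<Psi>))"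
  if g: "good \<Psi>" for \<beta> \<Psi>
 proof -
  have per': "qperiodic r \<Psi>" using g by (simp add: good_def)
  have sp: "(\<Sum>i<p. f i) = f 0 + (SUM i:{1..<p}. f i)" for f :: "nat => real"
   using p0 by (simp add: lessThan_atLeast0 sum.atLeast_Suc_lessThan)
  have "nrm2 r (convS S \<Psi>) = (\<Sum>i<p. nrm2 r (convS S (?c \<beta> i \<Psi>)))"
   unfolding convS_ucomp by (rule ucomp_parseval[OF qperiodic_convS[OF per'] E_dvd[OF p(1)] p0 r_pos])
  then have 1: "nrm2 r (convS S \<Psi>) = nrm2 r (convS S (?c \<beta> 0 \<Psi>)) + (SUM i:{1..<p}. nrm2 r (convS S (?c \<beta> i \<Psi>)))"
   by (simp only: sp)
  have 2: "nrm2 r \<Psi> - nrm2 r (?c \<beta> 0 \<Psi>) = (SUM i:{1..<p}. nrm2 r (?c \<beta> i \<Psi>))"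
   using ucomp_parseval[OF per' E_dvd[OF p(1)] p0 r_pos, of \<beta>] sp by simp
  have "W * (SUM i:{1..<p}. nrm2 r (convS S (?c \<beta> i \<Psi>))) <= (SUM i:{1..<p}. M * X / w * nrm2 r (?c \<beta> i \<Psi>))"
   unfolding sum_distrib_left
  proof (rule sum_mono)
   fix i assume "i \<in> {1..<p}"
   from I2[OF g this, of \<beta>] show "W * nrm2 r (convS S (?c \<beta> i \<Psi>)) <= M * X / w * nrm2 r (?c \<beta> i \<Psi>)"
    using w by (simp add: field_simps)
  qed
  then show ?thesis unfolding 1 2 distrib_left by (simp only: sum_distrib_left[symmetric] add_left_mono)
 qed
 let ?\<Phi>0 = "?c True 0 \<Phi>"
 have g0: "good ?\<Phi>0" by (rule goodc[OF g\<Phi>])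
 have t0: "typed p (un True (int (E p))) 0 ?\<Phi>0" by (rule ucomp_typed[OF per E_dvd[OF p(1)] p0])
 have n00: "nrm2 r (?c False 0 ?\<Phi>0) <= nrm2 r ?\<Phi>0 / p"
  by (rule ucomp_lower_of_upper_invariant[OF p(1) _ t0]) (use g0 in \<open>auto simp: good_def\<close>)
 have n0: "nrm2 r ?\<Phi>0 <= nrm2 r \<Phi>"
  using ucomp_parseval[OF per E_dvd[OF p(1)] p0 r_pos, of True] p0
   member_le_sum[of 0 "{..<p}" "%i. nrm2 r (?c True i \<Phi>)"] by simp
 have "W * nrm2 r (convS S \<Phi>) <= W * nrm2 r (convS S ?\<Phi>0) + M * X / w * (nrm2 r \<Phi> - nrm2 r ?\<Phi>0)"
  by (rule split[OF g\<Phi>])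
 also have "W * nrm2 r (convS S ?\<Phi>0) <= W * nrm2 r (convS S (?c False 0 ?\<Phi>0)) + M * X / w * (nrm2 r ?\<Phi>0 - nrm2 r (?c False 0 ?\<Phi>0))"
  by (rule split[OF g0])
 also have "W * nrm2 r (convS S (?c False 0 ?\<Phi>0)) <= M * (nrm2 r (?c False 0 ?\<Phi>0) * X)"
  by (rule I1[OF goodc[OF g0]])
 also have "... <= M * (nrm2 r \<Phi> / p * X)"
  using nn n00 n0 by (intro mult_left_mono mult_right_mono order_trans[OF n00] divide_right_mono) auto
 finally have "W * nrm2 r (convS S \<Phi>) <= M * (nrm2 r \<Phi> / p * X) + M * X / w * (nrm2 r \<Phi> - nrm2 r (?c False 0 ?\<Phi>0))"
  by (simp add: algebra_simps)
 also have "... <= M * (nrm2 r \<Phi> / p * X) + M * X / w * nrm2 r \<Phi>"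
  using nn w by (intro add_left_mono mult_left_mono) auto
 also have "... = (1 / w + 1 / p) * (M * nrm2 r \<Phi> * X)" by (simp add: algebra_simps)
 also have "... <= (4 / p) * (M * nrm2 r \<Phi> * X)"
  unfolding w_def by (rule mult_right_mono[OF wgt_ge[OF pp]]) (use nn in auto)
 finally show ?case using insert.hyps by (simp add: W_def M_def X_def mult_ac)
qed

text \<open>The spectral gap. Left convolution commutes with right translations, and conjugation by the
 diagonal torus modulo \<open>p\<close> carries a function of one unipotent type into about \<open>p/2\<close> mutually orthogonal
 functions of the same norm; the Hilbert--Schmidt norm bounds the sum over all of them.\<close>

theorem convS_mean_zero:
 assumes "finite S" "!!s. s \<in> S ==> det s = 1" "qperiodic r \<Phi>" "!!p. p \<in> Pr ==> mzero p \<Phi>"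
 shows "nrm2 r (convS S \<Phi>) <= 4 ^ card Pr / r * (nrm2 r \<Phi> * (real (card (SL2_mod r)) * real (cpairs r S)))"
proof -
 have "(PROD p:Pr. 4 / real p) = 4 ^ card Pr / r" by (simp add: prod_dividef r_def)
 then show ?thesis
  using convS_mean_zero_typed[OF assms(1,2) fin _ _ _ assms(3), of "{}"] assms(4) by simp
qed

lemma mzero_convS: "mzero p \<Phi> ==> mzero p (convS S \<Phi>)"
proof -
 assume "mzero p \<Phi>"
 then have z: "(SUM g:SL2_mod p. \<Phi> (s ** h ** lift p g)) = 0" for s h by (simp add: mzero_def)
 show ?thesis unfolding mzero_def
 proof
  fix h
  have "(SUM g:SL2_mod p. convS S \<Phi> (h ** lift p g)) = (SUM s:S. SUM g:SL2_mod p. \<Phi> (s ** h ** lift p g))"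
   unfolding convS_def matrix_mul_assoc by (rule sum.swap)
  then show "(SUM g:SL2_mod p. convS S \<Phi> (h ** lift p g)) = 0" by (simp only: z) simp
 qed
qed

end

section \<open>Products of local functions and iterated convolution\<close>

definition pmean :: "nat => (int^2^2 => real) => real" where
 "pmean p f = (SUM g:SL2_mod p. f g) / card (SL2_mod p)"

context prime_set begin

lemma mult_lift_same: "p \<in> Pr ==> qperiodic p f ==> f (h ** lift p g) = f (h ** g)"
 by (rule qperiodicD, assumption, rule matrix_cong_mult[OF matrix_cong_refl lift_same])

lemma mult_lift_other:
 assumes "p \<in> Pr" "q \<in> Pr" "p ~= q" "qperiodic q f" shows "f (h ** lift p g) = f h"
 using qperiodicD[OF assms(4) matrix_cong_mult[OF matrix_cong_refl lift_other[OF assms(1-3)]], of h g] by simp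

text \<open>Independence of the primes, without an explicit bijection onto the product group:
  translation by \<open>lift p g\<close> leaves the factors at other primes alone, and averaging it
  over g replaces f p by its mean.\<close>

lemma sum_prod_independent:
 fixes f :: "nat => int^2^2 => real"
 assumes "I \<subseteq> Pr" "!!p. p \<in> I ==> qperiodic p (f p)"
 shows "(SUM h:SL2_mod r. PROD p:I. f p h) = card (SL2_mod r) * (PROD p:I. pmean p (f p))"
 using finite_subset[OF assms(1) fin] assms
proof (induction I rule: finite_induct)
 case (insert p I)
 have p: "p \<in> Pr" "p > 0" using insert pr prime_gt_0_nat by auto
 let ?P = "%h. PROD q:I. f q h" and ?G = "SL2_mod r"
 have perp: "qperiodic p (f p)" using insert by simp
 have perP: "qperiodic r (%h. f p h * ?P h)"
  unfolding qperiodic_def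
 proof (intro allI impI)
  fix g h assume gh: "matrix_cong r g h"
  have "f q g = f q h" if "q \<in> insert p I" for q
   using qperiodicD[OF insert.prems(2)[OF that] matrix_cong_dvd[OF gh dvd_r]] that insert.prems by blast
  then show "f p g * ?P g = f p h * ?P h" by simp
 qed
 have PP: "?P (h ** lift p g) = ?P h" for h g
 proof (rule prod.cong[OF refl])
  fix q assume "q \<in> I"
  then show "f q (h ** lift p g) = f q h" using insert by (intro mult_lift_other[of p q, OF p(1)]) auto
 qed
 have "card (SL2_mod p) * (SUM h:?G. f p h * ?P h) = (SUM g:SL2_mod p. SUM h:?G. f p (h ** g) * ?P h)"
 proof -
  have "(SUM h:?G. f p (h ** g) * ?P h) = (SUM h:?G. f p h * ?P h)" if "g \<in> SL2_mod p" for g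
   using sum_right_shift[OF perP r_pos det_lift[OF p(1) SL2_mod_det[OF that]]]
   by (simp add: PP mult_lift_same[OF p(1) perp])
  then show ?thesis by simp
 qed
 also have "... = (SUM h:?G. ?P h * (SUM g:SL2_mod p. f p (h ** g)))"
  by (subst sum.swap) (simp add: sum_distrib_left mult.commute)
 also have "... = (SUM h:?G. ?P h * (SUM g:SL2_mod p. f p g))"
 proof (intro sum.cong refl)
  fix h assume "h \<in> ?G"
  then have "[det h = 1] (mod int p)" using SL2_mod_det dvd_r[OF p(1)]
   by (meson cong_dvd_modulus int_dvd_int_iff)
  from sum_left_shift[OF perp p(2) this]
  show "?P h * (SUM g:SL2_mod p. f p (h ** g)) = ?P h * (SUM g:SL2_mod p. f p g)" by simp
 qed
 also have "... = (card ?G * (PROD q:I. pmean q (f q))) * (SUM g:SL2_mod p. f p g)"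
  using insert by (simp add: sum_distrib_right[symmetric])
 finally have "(SUM h:?G. f p h * ?P h) = card ?G * (PROD q:I. pmean q (f q)) * pmean p (f p)"
  using SL2_mod_nonempty[OF p(2)] by (subst pmean_def[of p]) (simp add: eq_divide_eq mult_ac)
 then show ?case using insert.hyps by (simp add: mult_ac)
qed simp

text \<open>With R = r and P = \<open>cpairs r S\<close>, a convolution of mean-zero functions
  multiplies the square norm by at most 4^(card Pr) R^2 P, since |SL_2(Z/r)| <= R^3. Three
  convolutions are estimated in L^2 and the outermost one pointwise; the square root of the result
  is the bound.\<close>

theorem four_fold_sum_bound:
 fixes \<psi> :: "nat => int^2^2 => real"
 assumes S: "finite S" "!!s. s \<in> S ==> det s = 1" and t: "det t = 1"
  and per: "!!p. p \<in> Pr ==> qperiodic p (\<psi> p)"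
  and mean: "!!p. p \<in> Pr ==> pmean p (\<psi> p) = 0"
  and var: "!!p. p \<in> Pr ==> pmean p (%h. (\<psi> p h)^2) <= 4 / p"
 shows "\<bar>SUM s4:S. SUM s3:S. SUM s2:S. SUM s1:S. PROD p:Pr. \<psi> p (s1 ** (s2 ** (s3 ** (s4 ** t))))\<bar>
   <= 16 ^ card Pr * (real (cpairs r S))^2 * real r ^ 4"
proof -
 define F where "F h = (PROD p:Pr. \<psi> p h)" for h
 \<comment> \<open>Cut off to determinant one modulo r: the means of the \<psi> p vanish over
   SL_2(Z/p), whereas \<open>mzero\<close> quantifies over all base points.\<close>
 define \<Psi> where "\<Psi> h = (if [det h = 1] (mod int r) then complex_of_real (F h) else 0)" for h
 have perF: "F g = F h" if "matrix_cong r g h" for g h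
  unfolding F_def by (intro prod.cong refl qperiodicD[OF per] matrix_cong_dvd[OF that] dvd_r)
 have per\<Psi>: "qperiodic r \<Psi>"
  unfolding qperiodic_def \<Psi>_def using perF matrix_cong_det cong_trans cong_sym by metis
 have mz: "mzero p \<Psi>" if p: "p \<in> Pr" for p
  unfolding mzero_def
 proof
  fix h
  have dl: "[det (h ** lift p g) = 1] (mod int r) \<longleftrightarrow> [det h = 1] (mod int r)" if "g \<in> SL2_mod p" for g
  proof -
   have "[det h * det (lift p g) = det h * 1] (mod int r)"
    by (rule cong_scalar_left[OF det_lift[OF p SL2_mod_det[OF that]]])
   then show ?thesis by (simp add: det_mul cong_def)
  qed
  show "(SUM g:SL2_mod p. \<Psi> (h ** lift p g)) = 0"
  proof (cases "[det h = 1] (mod int r)")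
   case True
   have p0: "p > 0" using pr[OF p] prime_gt_0_nat by blast
   have "(SUM g:SL2_mod p. \<Psi> (h ** lift p g)) = complex_of_real (SUM g:SL2_mod p. F (h ** lift p g))"
    using True dl by (simp add: \<Psi>_def)
   also have "(SUM g:SL2_mod p. F (h ** lift p g)) = (SUM g:SL2_mod p. \<psi> p (h ** g) * (PROD q:Pr - {p}. \<psi> q h))"
   proof (intro sum.cong refl)
    fix g
    have "F (h ** lift p g) = \<psi> p (h ** lift p g) * (PROD q:Pr - {p}. \<psi> q (h ** lift p g))"
     unfolding F_def by (rule prod.remove[OF fin p])
    also have "(PROD q:Pr - {p}. \<psi> q (h ** lift p g)) = (PROD q:Pr - {p}. \<psi> q h)"
    proof (rule prod.cong[OF refl])
     fix q assume "q \<in> Pr - {p}"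
     then show "\<psi> q (h ** lift p g) = \<psi> q h" using per p by (intro mult_lift_other[of p q]) auto
    qed
    finally show "F (h ** lift p g) = \<psi> p (h ** g) * (PROD q:Pr - {p}. \<psi> q h)"
     by (simp add: mult_lift_same[OF p per[OF p]])
   qed
   also have "... = (SUM g:SL2_mod p. \<psi> p (h ** g)) * (PROD q:Pr - {p}. \<psi> q h)"
    by (simp add: sum_distrib_right)
   also have "(SUM g:SL2_mod p. \<psi> p (h ** g)) = (SUM g:SL2_mod p. \<psi> p g)"
    by (rule sum_left_shift[OF per[OF p] p0]) (use True dvd_r[OF p] in \<open>meson cong_dvd_modulus int_dvd_int_iff\<close>)
   also have "... = 0" using mean[OF p] SL2_mod_nonempty[OF p0] by (simp add: pmean_def)
   finally show ?thesis by simp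
  next
   case False
   then show ?thesis using dl by (simp add: \<Psi>_def)
  qed
 qed
 define G where "G = real (card (SL2_mod r))"
 define P where "P = real (cpairs r S)"
 define R where "R = real r"
 define w where "w = (4::real) ^ card Pr"
 have R: "R > 0" using r_pos by (simp add: R_def)
 have G: "G <= R ^ 3" "G >= 0" using card_SL2_mod_le[of r] by (simp_all add: G_def R_def flip: of_nat_power)
 have P: "P >= 0" "w > 0" by (simp_all add: P_def w_def)
 have n0: "nrm2 r \<Psi> <= G * (w / R)"
 proof -
  have "nrm2 r \<Psi> = (SUM h:SL2_mod r. PROD p:Pr. (\<psi> p h)^2)"
   unfolding nrm2_def
  proof (intro sum.cong refl)
   fix h assume "h \<in> SL2_mod r"
   then have "[det h = 1] (mod int r)" by (rule SL2_mod_det)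
   then show "(cmod (\<Psi> h))^2 = (PROD p:Pr. (\<psi> p h)^2)"
    by (simp add: \<Psi>_def F_def norm_of_real prod_power_distrib del: of_real_prod)
  qed
  also have "... = card (SL2_mod r) * (PROD p:Pr. pmean p (%h. (\<psi> p h)^2))"
   by (rule sum_prod_independent) (use per in \<open>auto simp: qperiodic_def\<close>)
  also have "... <= card (SL2_mod r) * (PROD p:Pr. 4 / real p)"
   by (intro mult_left_mono prod_mono conjI var) (auto simp: pmean_def intro!: divide_nonneg_nonneg sum_nonneg)
  also have "... = G * (w / R)" by (simp add: prod_dividef G_def w_def R_def r_def)
  finally show ?thesis .
 qed
 have step: "nrm2 r (convS S \<Phi>) <= (w * R^2 * P) * nrm2 r \<Phi>" if "qperiodic r \<Phi>" "!!p. p \<in> Pr ==> mzero p \<Phi>" for \<Phi>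
 proof -
  have "nrm2 r (convS S \<Phi>) <= w / R * (nrm2 r \<Phi> * (G * P))"
   using convS_mean_zero[OF S that] by (simp add: w_def R_def G_def P_def)
  also have "... <= w / R * (nrm2 r \<Phi> * (R ^ 3 * P))"
   using G P R by (intro mult_left_mono mult_right_mono) auto
  also have "... = (w * R^2 * P) * nrm2 r \<Phi>" using R by (simp add: power3_eq_cube power2_eq_square)
  finally show ?thesis .
 qed
 let ?c = "convS S"
 define A where "A = w * R^2 * P"
 have A: "A >= 0" using P R by (simp add: A_def)
 have "nrm2 r (?c (?c (?c \<Psi>))) <= A * nrm2 r (?c (?c \<Psi>))"
  unfolding A_def by (intro step qperiodic_convS mzero_convS per\<Psi> mz)
 also have "... <= A * (A * nrm2 r (?c \<Psi>))"
  by (rule mult_left_mono[OF _ A], unfold A_def, intro step qperiodic_convS mzero_convS per\<Psi> mz)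
 also have "... <= A * (A * (A * nrm2 r \<Psi>))"
  by (rule mult_left_mono[OF _ A], rule mult_left_mono[OF _ A], unfold A_def, intro step per\<Psi> mz)
 also have "... <= A * (A * (A * (w * R^2)))"
 proof -
  have "G * (w / R) <= R ^ 3 * (w / R)" using G P R by (intro mult_right_mono) auto
  also have "... = w * R^2" using R by (simp add: power3_eq_cube power2_eq_square)
  finally show ?thesis using n0 A by (intro mult_left_mono) auto
 qed
 finally have n3: "nrm2 r (?c (?c (?c \<Psi>))) <= A * (A * (A * (w * R^2)))" .
 have "(cmod (?c (?c (?c (?c \<Psi>))) t))^2 <= P * nrm2 r (?c (?c (?c \<Psi>)))"
  unfolding P_def by (rule sum_fibre_bound[OF _ S r_pos]) (auto intro!: qperiodic_convS per\<Psi> simp: t)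
 also have "... <= P * (A * (A * (A * (w * R^2))))" by (rule mult_left_mono[OF n3 P(1)])
 also have "... = (w^2 * P^2 * R ^ 4)^2" by (simp add: A_def power2_eq_square power4_eq_xxxx)
 finally have sq: "(cmod (?c (?c (?c (?c \<Psi>))) t))^2 <= (w^2 * P^2 * R ^ 4)^2" .
 have "0 <= w^2 * P^2 * R ^ 4" using R by simp
 from power2_le_imp_le[OF sq this] have "cmod (?c (?c (?c (?c \<Psi>))) t) <= w^2 * P^2 * R ^ 4" .
 moreover have "w^2 = 16 ^ card Pr" by (simp add: w_def power2_eq_square flip: power_mult_distrib)
 moreover have "?c (?c (?c (?c \<Psi>))) t = complex_of_real (SUM s4:S. SUM s3:S. SUM s2:S. SUM s1:S. F (s1 ** (s2 ** (s3 ** (s4 ** t)))))"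
  unfolding convS_def of_real_sum
  by (intro sum.cong refl) (simp add: \<Psi>_def det_mul S t)
 ultimately show ?thesis by (simp only: norm_of_real F_def P_def R_def)
qed

end

lemma prime_idempotents:
 assumes "finite Pr" "!!p. p \<in> Pr ==> prime p"
 shows "\<exists>E. prime_set Pr E"
proof -
 have "\<exists>e. [e = 1] (mod p) & (\<forall>q\<in>Pr. p ~= q --> [e = 0] (mod q))" if p: "p \<in> Pr" for p
 proof -
  have "coprime (\<Prod>(Pr - {p})) p"
   by (rule prod_coprime_left) (use assms p in \<open>auto intro: primes_coprime\<close>)
  then obtain x where x: "[\<Prod>(Pr - {p}) * x = 1] (mod p)" using cong_solve_coprime_nat by auto
  moreover have "[\<Prod>(Pr - {p}) * x = 0] (mod q)" if "q \<in> Pr" "p ~= q" for q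
   using that assms(1) by (auto simp: cong_0_iff intro!: dvd_mult2 dvd_prodI[where f = "%x. x"])
  ultimately show ?thesis by blast
 qed
 then obtain E where "!!p. p \<in> Pr ==> [E p = 1] (mod p) & (\<forall>q\<in>Pr. p ~= q --> [E p = 0] (mod q))" by metis
 then have "prime_set Pr E" using assms by unfold_locales auto
 then show ?thesis by blast
qed

section \<open>The divisor bound\<close>

definition dcount :: "nat => nat" where "dcount n = card {d. d dvd n}"

lemma dcount_mult_le:
 assumes "a > 0" "b > 0" shows "dcount (a * b) <= dcount a * dcount b"
proof -
 have "{d. d dvd a * b} \<subseteq> (%(x,y). x * y) ` ({d. d dvd a} \<times> {d. d dvd b})"
 proof
  fix d assume "d \<in> {d. d dvd a * b}"
  then obtain x y where "d = x * y" "x dvd a" "y dvd b" using division_decomp by blast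
  then show "d \<in> (%(x,y). x * y) ` ({d. d dvd a} \<times> {d. d dvd b})" by force
 qed
 then have "dcount (a * b) <= card ({d. d dvd a} \<times> {d. d dvd b})"
  unfolding dcount_def using assms by (intro surj_card_le) auto
 then show ?thesis by (simp add: dcount_def card_cartesian_product)
qed

lemma dcount_prime_power_le: "prime p ==> dcount (p ^ k) <= k + 1"
proof -
 assume p: "prime p"
 have "{d. d dvd p ^ k} \<subseteq> (%i. p ^ i) ` {..k}"
  using divides_primepow_nat[OF p] by auto
 then have "dcount (p ^ k) <= card {..k}" unfolding dcount_def by (intro surj_card_le) auto
 then show ?thesis by simp
qed

text \<open>Primes with p^\<epsilon> >= 2 satisfy k + 1 <= 2^k <= p^(k \<epsilon>); the finitely
  many smaller ones cost a bounded factor \<open>C1\<close> each.\<close>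

theorem dcount_bound:
 assumes "\<epsilon> > 0"
 shows "\<exists>C\<ge>1. \<forall>n>0. real (dcount n) <= C * real n powr \<epsilon>"
proof -
 define B where "B = nat \<lceil>2 powr (1/\<epsilon>)\<rceil>"
 define C1 where "C1 = max 1 (1 / (\<epsilon> * ln 2))"
 have C1: "C1 >= 1" by (simp add: C1_def)
 have big: "real p powr \<epsilon> >= 2" if "p >= B" for p
 proof -
  have "2 powr (1/\<epsilon>) <= real p" using that unfolding B_def by linarith
  then have "(2 powr (1/\<epsilon>)) powr \<epsilon> <= real p powr \<epsilon>" using assms by (intro powr_mono2) auto
  then show ?thesis using assms by (simp add: powr_powr)
 qed
 have small: "real k + 1 <= C1 * real p powr (k * \<epsilon>)" if "p >= 2" for p k
 proof -
  have "1 + k * \<epsilon> * ln 2 <= exp (k * \<epsilon> * ln 2)" by (rule exp_ge_add_one_self)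
  also have "... = 2 powr (k * \<epsilon>)" by (simp add: powr_def)
  also have "... <= real p powr (k * \<epsilon>)" using that assms by (intro powr_mono2) auto
  finally have e: "1 + k * \<epsilon> * ln 2 <= real p powr (k * \<epsilon>)" .
  have "real k * 1 <= real k * (C1 * (\<epsilon> * ln 2))"
  proof (rule mult_left_mono)
   have "1 / (\<epsilon> * ln 2) * (\<epsilon> * ln 2) <= C1 * (\<epsilon> * ln 2)"
    unfolding C1_def using assms by (intro mult_right_mono) auto
   then show "1 <= C1 * (\<epsilon> * ln 2)" using assms by simp
  qed simp
  then have "real k + 1 <= C1 * (1 + k * \<epsilon> * ln 2)" using C1 by (simp add: algebra_simps)
  also have "... <= C1 * real p powr (k * \<epsilon>)" using e C1 by (intro mult_left_mono) auto
  finally show ?thesis .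
 qed
 let ?s = "%n. {p. prime p & p < B & p dvd n}"
 \<comment> \<open>Strong induction that removes the full power of one prime; a prime below
   \<open>B\<close> uses up one factor \<open>C1\<close>, any other prime none.\<close>
 have claim: "real (dcount n) <= C1 ^ card (?s n) * real n powr \<epsilon>" if "n > 0" for n
  using that
 proof (induction n rule: less_induct)
  case (less n)
  show ?case
  proof (cases "n = 1")
   case True
   then show ?thesis using C1 by (simp add: dcount_def)
  next
   case False
   then obtain p where p: "prime p" "p dvd n" using prime_factor_nat by blast
   have p2: "p >= 2" using p(1) by (rule prime_ge_2_nat)
   define k where "k = multiplicity p n"
   have "\<not> is_unit p" "n ~= 0" using p2 less.prems by auto
   then obtain m where m: "n = p ^ k * m" "\<not> p dvd m"
    unfolding k_def using multiplicity_decompose'[of n p] by metis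
   have k1: "k >= 1" using p m by (cases k) auto
   have m0: "m > 0" using m less.prems by (cases m) auto
   have "p ^ k > 1" using p2 k1 by (intro one_less_power) auto
   then have mn: "m < n" using m m0 by simp
   have fin: "finite (?s n)" by simp
   have sub: "?s m \<subseteq> ?s n" using m by auto
   have "real (dcount n) <= real (dcount (p ^ k) * dcount m)"
    unfolding m(1) of_nat_le_iff by (rule dcount_mult_le) (use p2 m0 in auto)
   also have "... <= (real k + 1) * real (dcount m)"
    using dcount_prime_power_le[OF p(1), of k] by (simp add: mult_right_mono)
   also have "... <= (real k + 1) * (C1 ^ card (?s m) * real m powr \<epsilon>)"
    by (intro mult_left_mono less.IH mn m0) auto
   finally have d: "real (dcount n) <= (real k + 1) * (C1 ^ card (?s m) * real m powr \<epsilon>)" .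
   have np: "real n powr \<epsilon> = real p powr (k * \<epsilon>) * real m powr \<epsilon>"
   proof -
    have "(real p ^ k) powr \<epsilon> = real p powr (k * \<epsilon>)"
     by (subst powr_realpow[symmetric]) (use p2 in \<open>auto simp: powr_powr\<close>)
    then show ?thesis using p2 m0 by (simp add: m(1) powr_mult)
   qed
   show ?thesis
   proof (cases "p < B")
    case True
    have "insert p (?s m) \<subseteq> ?s n" using sub p True by auto
    moreover have "p \<notin> ?s m" using m(2) by simp
    ultimately have "Suc (card (?s m)) <= card (?s n)"
     using card_mono[OF fin, of "insert p (?s m)"] by simp
    then have "C1 ^ Suc (card (?s m)) <= C1 ^ card (?s n)" using C1 by (intro power_increasing) auto
    have "(real k + 1) * (C1 ^ card (?s m) * real m powr \<epsilon>) <= (C1 * real p powr (k * \<epsilon>)) * (C1 ^ card (?s m) * real m powr \<epsilon>)"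
     using small[OF p2] C1 by (intro mult_right_mono) auto
    also have "... = C1 ^ Suc (card (?s m)) * real n powr \<epsilon>" by (simp add: np)
    also have "... <= C1 ^ card (?s n) * real n powr \<epsilon>"
     using \<open>C1 ^ Suc (card (?s m)) <= C1 ^ card (?s n)\<close> by (intro mult_right_mono) auto
    finally show ?thesis using d by linarith
   next
    case False
    have "k + 1 <= 2 ^ k" by (induction k) auto
    then have "real (k + 1) <= real (2 ^ k)" by (simp only: of_nat_le_iff)
    then have "real k + 1 <= 2 ^ k" by simp
    also have "... <= (real p powr \<epsilon>) ^ k" using big[of p] False by (intro power_mono) auto
    also have "... = real p powr (k * \<epsilon>)" using p2 by (simp add: powr_power mult.commute)
    finally have "(real k + 1) * (C1 ^ card (?s m) * real m powr \<epsilon>) <= real p powr (k * \<epsilon>) * (C1 ^ card (?s m) * real m powr \<epsilon>)"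
     using C1 by (intro mult_right_mono) auto
    also have "... = C1 ^ card (?s m) * real n powr \<epsilon>" by (simp add: np)
    also have "... <= C1 ^ card (?s n) * real n powr \<epsilon>"
     using card_mono[OF fin sub] C1 by (intro mult_right_mono power_increasing) auto
    finally show ?thesis using d by linarith
   qed
  qed
 qed
 have "real (dcount n) <= C1 ^ B * real n powr \<epsilon>" if "n > 0" for n
 proof -
  have "card (?s n) <= card {..<B}" by (intro card_mono) auto
  then have "C1 ^ card (?s n) * real n powr \<epsilon> <= C1 ^ B * real n powr \<epsilon>"
   using C1 by (intro mult_right_mono power_increasing) auto
  then show ?thesis using claim[OF that] by linarith
 qed
 moreover have "C1 ^ B >= 1" using C1 by simp
 ultimately show ?thesis by blast
qed

lemma int_divisors_card:
 assumes "N ~= (0::int)"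
 shows "finite {d. d dvd N}" "card {d. d dvd N} <= 2 * dcount (nat \<bar>N\<bar>)"
proof -
 have sub: "{d. d dvd N} \<subseteq> (%d. int d) ` {d. d dvd nat \<bar>N\<bar>} \<union> (%d. - int d) ` {d. d dvd nat \<bar>N\<bar>}" (is "_ \<subseteq> ?A \<union> ?B")
 proof
  fix d assume "d \<in> {d. d dvd N}"
  then have "nat \<bar>d\<bar> dvd nat \<bar>N\<bar>" by (simp add: nat_dvd_iff)
  then show "d \<in> ?A \<union> ?B"
   by (cases "d >= 0") (auto simp: image_iff intro: exI[of _ "nat \<bar>d\<bar>"])
 qed
 have f: "finite {d. d dvd nat \<bar>N\<bar>}" using assms finite_divisors_nat[of "nat \<bar>N\<bar>"] by simp
 then show "finite {d. d dvd N}" using sub finite_subset by blast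
 have "card {d. d dvd N} <= card (?A \<union> ?B)" using f sub by (intro card_mono) auto
 also have "... <= card ?A + card ?B" by (rule card_Un_le)
 also have "... <= dcount (nat \<bar>N\<bar>) + dcount (nat \<bar>N\<bar>)"
  unfolding dcount_def by (intro add_mono card_image_le f)
 finally show "card {d. d dvd N} <= 2 * dcount (nat \<bar>N\<bar>)" by simp
qed

section \<open>Coincidences modulo r in a box\<close>

lemma quadratic_roots_int:
 assumes "C ~= (0::int)"
 shows "card {a. A * a^2 + B * a + C = 0} <= 2" "finite {a. A * a^2 + B * a + C = 0}"
proof -
 let ?p = "[:C, B, A:]"
 have e: "{a. A * a^2 + B * a + C = 0} = {a. poly ?p a = 0}"
  by (auto simp: power2_eq_square algebra_simps)
 have ne: "?p ~= 0" using assms by simp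
 have "card {a. poly ?p a = 0} <= degree ?p" by (rule card_poly_roots_bound[OF ne])
 also have "... <= 2" by (simp add: degree_pCons_eq_if)
 finally show "card {a. A * a^2 + B * a + C = 0} <= 2" by (simp add: e)
 show "finite {a. A * a^2 + B * a + C = 0}" using poly_roots_finite[OF ne] by (simp add: e)
qed

text \<open>Eliminating d turns the two equations into (\<delta> b + a \<gamma>)(\<delta> c + a
  \<beta>) = M(a) with M quadratic. For fixed a with M(a) nonzero, (b, c) is determined by a divisor
  of M(a). The constant term of M is nonzero, so at most two a give M(a) = 0; for these one linear
  factor vanishes and at most twice \<open>card {0..T}\<close> pairs remain.\<close>

lemma sl2_hyperplane_count:
 fixes \<alpha> \<beta> \<gamma> \<delta> m \<sigma> T :: int
 assumes \<delta>: "\<delta> ~= 0" and \<sigma>: "\<sigma> ~= 0"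
  and Dv: "!!a. a \<in> {0..T} ==> (\<beta>*\<gamma> - \<alpha>*\<delta>) * a^2 + \<delta>*m*a - \<sigma>*\<delta>\<^sup>2 ~= 0 ==>
    card {d. d dvd (\<beta>*\<gamma> - \<alpha>*\<delta>) * a^2 + \<delta>*m*a - \<sigma>*\<delta>\<^sup>2} <= Dv"
 shows "card {(a,b,c,d). a \<in> {0..T} & b \<in> {0..T} & c \<in> {0..T} & d \<in> {0..T} &
   a*d - b*c = \<sigma> & \<alpha>*a + \<beta>*b + \<gamma>*c + \<delta>*d = m} <= card {0..T} * (Dv + 4)"
proof -
 let ?I = "{0..T}"
 define X where "X = {(a,b,c,d). a \<in> ?I & b \<in> ?I & c \<in> ?I & d \<in> ?I &
   a*d - b*c = \<sigma> & \<alpha>*a + \<beta>*b + \<gamma>*c + \<delta>*d = m}"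
 define M where "M a = (\<beta>*\<gamma> - \<alpha>*\<delta>) * a^2 + \<delta>*m*a - \<sigma>*\<delta>\<^sup>2" for a
 have "X \<subseteq> ?I \<times> ?I \<times> ?I \<times> ?I" by (auto simp: X_def)
 then have finX: "finite X" by (rule finite_subset) auto
 define Xa where "Xa a = {(b,c). \<exists>d. (a,b,c,d) \<in> X}" for a
 have Xa_sub: "Xa a \<subseteq> ?I \<times> ?I" for a by (auto simp: Xa_def X_def)
 have finXa: "finite (Xa a)" for a using Xa_sub by (rule finite_subset) auto
 have fact: "(\<delta>*b + a*\<gamma>) * (\<delta>*c + a*\<beta>) = M a" if "(b,c) \<in> Xa a" for a b c
 proof -
  from that obtain d where "(a,b,c,d) \<in> X" by (auto simp: Xa_def)
  then have d: "a*d - b*c = \<sigma>" "\<delta>*d = m - \<alpha>*a - \<beta>*b - \<gamma>*c" by (auto simp: X_def)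
  have "\<delta> * (b * c) = a * (\<delta> * d) - \<delta> * \<sigma>" by (simp add: d(1)[symmetric] algebra_simps)
  then have "\<delta> * (b * c) = a * (m - \<alpha>*a - \<beta>*b - \<gamma>*c) - \<delta> * \<sigma>" by (simp add: d(2))
  then have e: "\<delta> * (\<delta> * (b * c)) = \<delta> * (a * (m - \<alpha>*a - \<beta>*b - \<gamma>*c) - \<delta> * \<sigma>)" by simp
  have "(\<delta>*b + a*\<gamma>) * (\<delta>*c + a*\<beta>) = \<delta> * (\<delta> * (b * c)) + \<delta>*a*(b*\<beta> + c*\<gamma>) + a^2*\<beta>*\<gamma>"
   by (simp add: algebra_simps power2_eq_square)
  also have "... = M a" unfolding e M_def by (simp add: algebra_simps power2_eq_square)
  finally show ?thesis .
 qed
 have inj: "inj_on (%(a,b,c,d). (a,b,c)) X"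
  using \<delta> by (auto simp: inj_on_def X_def)
 have "card X = card ((%(a,b,c,d). (a,b,c)) ` X)" by (simp add: card_image inj)
 also have "... <= card (SIGMA a:?I. Xa a)"
  by (intro card_mono finite_SigmaI finXa) (auto simp: Xa_def X_def)
 also have "... = (SUM a:?I. card (Xa a))" by (simp add: finXa)
 also have "... <= (SUM a:?I. Dv + (if M a = 0 then 2 * card ?I else 0))"
 proof (intro sum_mono)
  fix a assume a: "a \<in> ?I"
  show "card (Xa a) <= Dv + (if M a = 0 then 2 * card ?I else 0)"
  proof (cases "M a = 0")
   case True
   have "Xa a \<subseteq> (%c. (- a*\<gamma> div \<delta>, c)) ` ?I \<union> (%b. (b, - a*\<beta> div \<delta>)) ` ?I"
   proof
    fix x assume x: "x \<in> Xa a"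
    obtain b c where bc: "x = (b,c)" by (cases x)
    have I: "b \<in> ?I" "c \<in> ?I" using subsetD[OF Xa_sub x] bc by auto
    have "\<delta>*b + a*\<gamma> = 0 \<or> \<delta>*c + a*\<beta> = 0" using fact[of b c a] x bc True by simp
    then show "x \<in> (%c. (- a*\<gamma> div \<delta>, c)) ` ?I \<union> (%b. (b, - a*\<beta> div \<delta>)) ` ?I"
    proof
     assume "\<delta>*b + a*\<gamma> = 0"
     then have "- a*\<gamma> = \<delta> * b" by simp
     then have "- a*\<gamma> div \<delta> = b" using \<delta> by simp
     then show ?thesis using I bc by auto
    next
     assume "\<delta>*c + a*\<beta> = 0"
     then have "- a*\<beta> = \<delta> * c" by simp
     then have "- a*\<beta> div \<delta> = c" using \<delta> by simp
     then show ?thesis using I bc by auto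
    qed
   qed
   then have "card (Xa a) <= card ((%c. (- a*\<gamma> div \<delta>, c)) ` ?I \<union> (%b. (b, - a*\<beta> div \<delta>)) ` ?I)"
    by (intro card_mono) auto
   also have "... <= card ((%c. (- a*\<gamma> div \<delta>, c)) ` ?I) + card ((%b. (b, - a*\<beta> div \<delta>)) ` ?I)" by (rule card_Un_le)
   also have "... <= card ?I + card ?I" by (intro add_mono card_image_le) auto
   finally show ?thesis using True by simp
  next
   case False
   have "card (Xa a) <= card {d. d dvd M a}"
   proof (rule card_inj_on_le[of "%(b,c). \<delta>*b + a*\<gamma>"])
    show "inj_on (%(b,c). \<delta>*b + a*\<gamma>) (Xa a)"
    proof
     fix x y assume xy: "x \<in> Xa a" "y \<in> Xa a" "(case x of (b,c) => \<delta>*b + a*\<gamma>) = (case y of (b,c) => \<delta>*b + a*\<gamma>)"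
     obtain b c b' c' where s: "x = (b,c)" "y = (b',c')" by (cases x, cases y)
     have b: "b = b'" using xy(3) s \<delta> by simp
     have "\<delta>*b + a*\<gamma> ~= 0" using fact[of b c a] xy(1) s False by auto
     moreover have "(\<delta>*b + a*\<gamma>) * (\<delta>*c + a*\<beta>) = (\<delta>*b + a*\<gamma>) * (\<delta>*c' + a*\<beta>)"
      using fact[of b c a] fact[of b' c' a] xy s b by simp
     ultimately have "c = c'" using \<delta> by simp
     then show "x = y" using s b by simp
    qed
    show "(%(b,c). \<delta>*b + a*\<gamma>) ` Xa a \<subseteq> {d. d dvd M a}"
    proof clarsimp
     fix b c assume "(b, c) \<in> Xa a"
     from fact[OF this] show "\<delta>*b + a*\<gamma> dvd M a" by (metis dvd_triv_left)
    qed
    show "finite {d. d dvd M a}" by (rule int_divisors_card(1)[OF False])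
   qed
   also have "... <= Dv" using Dv[OF a] False by (simp add: M_def)
   finally show ?thesis using False by simp
  qed
 qed
 also have "... = card ?I * Dv + card {a\<in>?I. M a = 0} * (2 * card ?I)"
  by (simp add: sum.distrib sum.If_cases Int_def)
 also have "card {a\<in>?I. M a = 0} <= 2"
 proof -
  have ne: "- \<sigma>*\<delta>\<^sup>2 ~= 0" using \<delta> \<sigma> by simp
  have "card {a\<in>?I. M a = 0} <= card {a. (\<beta>*\<gamma> - \<alpha>*\<delta>) * a^2 + \<delta>*m*a + (- \<sigma>*\<delta>\<^sup>2) = 0}"
   by (intro card_mono quadratic_roots_int(2)[OF ne]) (auto simp: M_def)
  then show ?thesis using quadratic_roots_int(1)[OF ne, of "\<beta>*\<gamma> - \<alpha>*\<delta>" "\<delta>*m"] by linarith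
 qed
 finally show ?thesis by (simp add: X_def algebra_simps)
qed

lemma hyperplane_value_bound:
 fixes \<alpha> \<beta> \<gamma> \<delta> m a T H m0 \<sigma> :: int
 assumes "\<bar>\<alpha>\<bar> <= H" "\<bar>\<beta>\<bar> <= H" "\<bar>\<gamma>\<bar> <= H" "\<bar>\<delta>\<bar> <= H" "\<bar>m\<bar> <= m0" "a \<in> {0..T}" "\<bar>\<sigma>\<bar> = 1"
 shows "\<bar>(\<beta>*\<gamma> - \<alpha>*\<delta>) * a^2 + \<delta>*m*a - \<sigma>*\<delta>\<^sup>2\<bar> <= 2*H^2*T^2 + H*m0*T + H^2"
proof -
 have H: "H >= 0" "T >= 0" "m0 >= 0" using assms by auto
 have "\<bar>\<beta>*\<gamma>\<bar> <= H * H" "\<bar>\<alpha>*\<delta>\<bar> <= H * H"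
  unfolding abs_mult by (intro mult_mono assms H; simp)+
 then have 1: "\<bar>\<beta>*\<gamma> - \<alpha>*\<delta>\<bar> <= 2 * H^2" by (simp add: power2_eq_square)
 have "\<bar>a\<^sup>2\<bar> <= T^2" using assms(6) by (simp add: power_mono)
 then have a: "\<bar>(\<beta>*\<gamma> - \<alpha>*\<delta>) * a^2\<bar> <= 2*H^2 * T^2"
  unfolding abs_mult[of "\<beta>*\<gamma> - \<alpha>*\<delta>"] using 1 by (intro mult_mono) auto
 have "\<bar>\<delta>\<bar> * \<bar>m\<bar> <= H * m0" by (rule mult_mono[OF assms(4,5) H(1)]) simp
 then have "\<bar>\<delta>\<bar> * \<bar>m\<bar> * \<bar>a\<bar> <= H * m0 * T"
  by (rule mult_mono) (use assms(6) H in auto)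
 then have "\<bar>\<delta>*m*a\<bar> <= H*m0*T" by (simp only: abs_mult)
 moreover have "\<bar>\<delta>\<bar>\<^sup>2 <= H^2" by (rule power_mono[OF assms(4)]) simp
 then have "\<bar>\<sigma>*\<delta>\<^sup>2\<bar> <= H^2" by (simp add: abs_mult assms(7))
 ultimately show ?thesis using a by linarith
qed

text \<open>Some coefficient is nonzero, and permuting the entries makes it the coefficient of d.
  Moving an off-diagonal entry there reverses the sign of the determinant, the reason for \<sigma> =
  -1 in the count above.\<close>

lemma sl2_hyperplane_count_matrices:
 fixes \<alpha> \<beta> \<gamma> \<delta> m T H m0 :: int and S :: "(int^2^2) set"
 assumes S: "!!s. s \<in> S ==> det s = 1 & (\<forall>i j. s$i$j \<in> {0..T})"
  and ne: "\<alpha> ~= 0 \<or> \<beta> ~= 0 \<or> \<gamma> ~= 0 \<or> \<delta> ~= 0"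
  and bd: "\<bar>\<alpha>\<bar> <= H" "\<bar>\<beta>\<bar> <= H" "\<bar>\<gamma>\<bar> <= H" "\<bar>\<delta>\<bar> <= H" "\<bar>m\<bar> <= m0"
  and Dv: "!!N. N ~= 0 ==> \<bar>N\<bar> <= 2*H^2*T^2 + H*m0*T + H^2 ==> card {d::int. d dvd N} <= Dv"
 shows "card {s\<in>S. \<alpha> * s$1$1 + \<beta> * s$1$2 + \<gamma> * s$2$1 + \<delta> * s$2$2 = m} <= card {0..T} * (Dv + 4)"
proof -
 let ?S = "{s\<in>S. \<alpha> * s$1$1 + \<beta> * s$1$2 + \<gamma> * s$2$1 + \<delta> * s$2$2 = m}"
 define X where "X \<alpha> \<beta> \<gamma> \<delta> \<sigma> = {(a,b,c,d). a \<in> {0..T} & b \<in> {0..T} & c \<in> {0..T} & d \<in> {0..T} &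
   a*d - b*c = \<sigma> & \<alpha>*a + \<beta>*b + \<gamma>*c + \<delta>*d = m}" for \<alpha> \<beta> \<gamma> \<delta> \<sigma> :: int
 have finX: "finite (X \<alpha> \<beta> \<gamma> \<delta> \<sigma>)" for \<alpha> \<beta> \<gamma> \<delta> \<sigma>
  by (rule finite_subset[of _ "{0..T} \<times> {0..T} \<times> {0..T} \<times> {0..T}"]) (auto simp: X_def)
 have cX: "card (X \<alpha> \<beta> \<gamma> \<delta> \<sigma>) <= card {0..T} * (Dv + 4)"
  if "\<delta> ~= 0" "\<bar>\<sigma>\<bar> = 1" "\<bar>\<alpha>\<bar> <= H" "\<bar>\<beta>\<bar> <= H" "\<bar>\<gamma>\<bar> <= H" "\<bar>\<delta>\<bar> <= H" for \<alpha> \<beta> \<gamma> \<delta> \<sigma>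
  unfolding X_def using that bd(5)
  by (intro sl2_hyperplane_count Dv hyperplane_value_bound) auto
 have e: "s$1$1 \<in> {0..T} & s$1$2 \<in> {0..T} & s$2$1 \<in> {0..T} & s$2$2 \<in> {0..T} & s$1$1 * s$2$2 - s$1$2 * s$2$1 = 1
   & \<alpha> * s$1$1 + \<beta> * s$1$2 + \<gamma> * s$2$1 + \<delta> * s$2$2 = m" if "s \<in> ?S" for s
  using S[of s] that by (auto simp: det_2)
 have inj: "inj_on (%s::int^2^2. (s$1$1, s$1$2, s$2$1, s$2$2)) ?S" "inj_on (%s::int^2^2. (s$2$2, s$1$2, s$2$1, s$1$1)) ?S"
  "inj_on (%s::int^2^2. (s$2$1, s$1$1, s$2$2, s$1$2)) ?S" "inj_on (%s::int^2^2. (s$1$2, s$1$1, s$2$2, s$2$1)) ?S"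
  by (auto simp: inj_on_def mat2_eq_iff)
 consider "\<delta> ~= 0" | "\<alpha> ~= 0" | "\<beta> ~= 0" | "\<gamma> ~= 0" using ne by blast
 then show ?thesis
 proof cases
  case 1
  have "card ?S <= card (X \<alpha> \<beta> \<gamma> \<delta> 1)"
   by (rule card_inj_on_le[OF inj(1) _ finX]) (use e in \<open>auto simp: X_def\<close>)
  also have "... <= card {0..T} * (Dv + 4)" by (rule cX) (use 1 bd in auto)
  finally show ?thesis .
 next
  case 2
  have "card ?S <= card (X \<delta> \<beta> \<gamma> \<alpha> 1)"
   by (rule card_inj_on_le[OF inj(2) _ finX]) (use e in \<open>auto simp: X_def algebra_simps\<close>)
  also have "... <= card {0..T} * (Dv + 4)" by (rule cX) (use 2 bd in auto)
  finally show ?thesis .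
 next
  case 3
  have "card ?S <= card (X \<gamma> \<alpha> \<delta> \<beta> (-1))"
   by (rule card_inj_on_le[OF inj(3) _ finX]) (use e in \<open>auto simp: X_def algebra_simps\<close>)
  also have "... <= card {0..T} * (Dv + 4)" by (rule cX) (use 3 bd in auto)
  finally show ?thesis .
 next
  case 4
  have "card ?S <= card (X \<beta> \<alpha> \<delta> \<gamma> (-1))"
   by (rule card_inj_on_le[OF inj(4) _ finX]) (use e in \<open>auto simp: X_def algebra_simps\<close>)
  also have "... <= card {0..T} * (Dv + 4)" by (rule cX) (use 4 bd in auto)
  finally show ?thesis .
 qed
qed

text \<open>Congruent matrices are s and s + r e with e in a box of side about T/r. For e = 0 these
  are the pairs on the diagonal; for e nonzero the two determinant conditions confine s to a
  hyperplane.\<close>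

lemma cpairs_bound_nat:
 fixes T r :: nat and S :: "(int^2^2) set"
 assumes S: "finite S" "!!s. s \<in> S ==> det s = 1 & (\<forall>i j. s$i$j \<in> {0..int T})"
  and r: "r > 0" "r <= T"
  and Dv: "!!N. N ~= 0 ==> \<bar>N\<bar> <= 7 * int T ^ 4 ==> card {d::int. d dvd N} <= Dv"
 shows "cpairs r S <= card S + (2 * (T div r) + 1) ^ 4 * ((T + 1) * (Dv + 4))"
proof -
 define H where "H = int (T div r)"
 let ?B = "{-H..H}"
 define Box where "Box = ?B \<times> ?B \<times> ?B \<times> ?B"
 define mt where "mt = (%(x,y,z,w). mk x y z w)"
 define A where "A e = {s\<in>S. (\<exists>s'\<in>S. \<forall>i j. s'$i$j = s$i$j + int r * (mt e)$i$j)}" for e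
 have H0: "H >= 0" by (simp add: H_def)
 have HT: "H * int r <= int T" unfolding H_def by (metis div_times_less_eq_dividend of_nat_le_iff of_nat_mult)
 have HT': "H <= int T" unfolding H_def by simp
 have cB: "card ?B = 2 * (T div r) + 1" by (simp add: H_def)
 have cBox: "card Box = (2 * (T div r) + 1) ^ 4"
  unfolding Box_def card_cartesian_product cB by (simp add: power4_eq_xxxx)
 have finB: "finite Box" by (simp add: Box_def)
 let ?P = "{(s,s'). s \<in> S & s' \<in> S & matrix_cong r s s'}"
 define f where "f = (%(s::int^2^2,s'::int^2^2). (((s'$1$1 - s$1$1) div int r, (s'$1$2 - s$1$2) div int r, (s'$2$1 - s$2$1) div int r, (s'$2$2 - s$2$2) div int r), s))"
 have fE: "\<exists>e. f (s,s') = (e,s) & e \<in> Box & s \<in> A e & (\<forall>i j. s'$i$j = s$i$j + int r * (mt e)$i$j)"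
  if ss: "s \<in> S" "s' \<in> S" "matrix_cong r s s'" for s s'
 proof -
  have q: "s'$i$j = s$i$j + int r * ((s'$i$j - s$i$j) div int r) & (s'$i$j - s$i$j) div int r \<in> ?B" for i j
  proof -
   have "[s$i$j = s'$i$j] (mod int r)" using ss(3) by (simp add: matrix_cong_def)
   then have d: "int r dvd s'$i$j - s$i$j" by (simp add: cong_iff_dvd_diff dvd_diff_commute)
   then obtain x where x: "s'$i$j - s$i$j = int r * x" by (elim dvdE)
   have xq: "(s'$i$j - s$i$j) div int r = x" using x r by simp
   have "s$i$j \<in> {0..int T}" "s'$i$j \<in> {0..int T}" using S(2) ss by blast+
   then have "\<bar>int r * x\<bar> <= int T" using x by auto
   then have "\<bar>x\<bar> * int r <= int T" by (simp add: abs_mult mult.commute)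
   then have "\<bar>x\<bar> * int r div int r <= int T div int r" by (rule zdiv_mono1) (use r in simp)
   then have "\<bar>x\<bar> <= int T div int r" using r by simp
   then have "\<bar>x\<bar> <= H" by (simp add: H_def zdiv_int)
   then show ?thesis using x xq by auto
  qed
  let ?e = "((s'$1$1 - s$1$1) div int r, (s'$1$2 - s$1$2) div int r, (s'$2$1 - s$2$1) div int r, (s'$2$2 - s$2$2) div int r)"
  have eq: "\<forall>i j. s'$i$j = s$i$j + int r * (mt ?e)$i$j"
   using q by (simp add: forall_2 mt_def)
  moreover have "?e \<in> Box" using q by (simp add: Box_def)
  moreover have "s \<in> A ?e" unfolding A_def using ss eq by blast
  moreover have "f (s,s') = (?e, s)" by (simp add: f_def)
  ultimately show ?thesis by blast
 qed
 have "cpairs r S = card ?P" by (simp add: cpairs_def)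
 also have "... <= card (SIGMA e:Box. A e)"
 proof (rule card_inj_on_le[of f])
  show "inj_on f ?P"
  proof
   fix x y assume xy: "x \<in> ?P" "y \<in> ?P" "f x = f y"
   obtain s s' t t' where d: "x = (s,s')" "y = (t,t')" by (cases x, cases y)
   obtain e where e: "f (s,s') = (e,s)" "\<forall>i j. s'$i$j = s$i$j + int r * (mt e)$i$j" using fE[of s s'] xy d by auto
   obtain e' where e': "f (t,t') = (e',t)" "\<forall>i j. t'$i$j = t$i$j + int r * (mt e')$i$j" using fE[of t t'] xy d by auto
   have "e = e'" "s = t" using xy(3) d e(1) e'(1) by auto
   then show "x = y" using d e(2) e'(2) by (simp add: vec_eq_iff)
  qed
  show "f ` ?P \<subseteq> (SIGMA e:Box. A e)"
  proof
   fix y assume "y \<in> f ` ?P"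
   then obtain s s' where s: "s \<in> S" "s' \<in> S" "matrix_cong r s s'" "y = f (s,s')" by auto
   from fE[OF s(1-3)] obtain e where "f (s,s') = (e,s)" "e \<in> Box" "s \<in> A e" by blast
   then show "y \<in> (SIGMA e:Box. A e)" using s(4) by simp
  qed
  show "finite (SIGMA e:Box. A e)" using finB S(1) by (auto simp: A_def)
 qed
 also have "... = (SUM e:Box. card (A e))" using finB S(1) by (simp add: A_def)
 also have "... <= (SUM e:Box. (if e = (0,0,0,0) then card S else 0) + (T + 1) * (Dv + 4))"
 proof (intro sum_mono)
  fix e assume e: "e \<in> Box"
  obtain x y z w where ew: "e = (x,y,z,w)" by (metis prod_cases4)
  have b: "\<bar>x\<bar> <= H" "\<bar>y\<bar> <= H" "\<bar>z\<bar> <= H" "\<bar>w\<bar> <= H" using e ew by (auto simp: Box_def)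
  show "card (A e) <= (if e = (0,0,0,0) then card S else 0) + (T + 1) * (Dv + 4)"
  proof (cases "e = (0,0,0,0)")
   case True
   have "card (A e) <= card S" by (intro card_mono S(1)) (auto simp: A_def)
   then show ?thesis using True by simp
  next
   case False
   \<comment> \<open>Subtracting det s = 1 from det (s + r e) = 1 and dividing by r leaves an
     equation linear in s, because the quadratic part r det e does not depend on s.\<close>
   define m where "m = - int r * (x*w - y*z)"
   have sub: "A e \<subseteq> {s\<in>S. w * s$1$1 + (-z) * s$1$2 + (-y) * s$2$1 + x * s$2$2 = m}"
   proof
    fix s assume "s \<in> A e"
    then obtain s' where s: "s \<in> S" "s' \<in> S" "\<forall>i j. s'$i$j = s$i$j + int r * (mt e)$i$j" by (auto simp: A_def)
    have d: "s$1$1 * s$2$2 - s$1$2 * s$2$1 = 1" using S(2)[OF s(1)] by (simp add: det_2)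
    have "s'$1$1 * s'$2$2 - s'$1$2 * s'$2$1 = 1" using S(2)[OF s(2)] by (simp add: det_2)
    then have "(s$1$1 + int r*x) * (s$2$2 + int r*w) - (s$1$2 + int r*y) * (s$2$1 + int r*z) = 1"
     using s(3) ew by (simp add: mt_def)
    then have "int r * (w * s$1$1 + (-z) * s$1$2 + (-y) * s$2$1 + x * s$2$2 - m) = 0"
     using d by (simp add: m_def algebra_simps)
    then have "w * s$1$1 + (-z) * s$1$2 + (-y) * s$2$1 + x * s$2$2 = m" using r by simp
    then show "s \<in> {s\<in>S. w * s$1$1 + (-z) * s$1$2 + (-y) * s$2$1 + x * s$2$2 = m}" using s by simp
   qed
   have "\<bar>x*w - y*z\<bar> <= 2 * H^2"
   proof -
    have "\<bar>x*w\<bar> <= H*H" "\<bar>y*z\<bar> <= H*H" unfolding abs_mult using b H0 by (auto intro!: mult_mono)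
    then show ?thesis by (simp add: power2_eq_square)
   qed
   then have mb: "\<bar>m\<bar> <= int r * (2 * H^2)" unfolding m_def abs_mult by (simp add: mult_left_mono)
   have le: "2*H^2*(int T)^2 + H*(int r * (2 * H^2))*int T + H^2 <= 7 * int T ^ 4"
   proof -
    have T1: "int T >= 1" using r by simp
    have h2: "H^2 <= (int T)^2" using HT' H0 by (intro power_mono)
    have "H^2*(int T)^2 <= (int T)^2*(int T)^2" using h2 by (intro mult_right_mono) auto
    then have "2*H^2*(int T)^2 <= 2*((int T)^2*(int T)^2)" by simp
    moreover have "H*(int r * (2 * H^2))*int T = 2 * ((H * int r) * H^2 * int T)" by simp
    moreover have "(H * int r) * H^2 * int T <= int T * (int T)^2 * int T"
     using HT h2 H0 by (intro mult_right_mono mult_mono) auto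
    moreover have "int T ^ 4 >= 0" by simp
    moreover have "(int T)^2 <= (int T) ^ 4" using T1 by (intro power_increasing) auto
    moreover have "(int T)^2*(int T)^2 = int T ^ 4" "int T * (int T)^2 * int T = int T ^ 4" by (simp_all add: power2_eq_square power4_eq_xxxx)
    ultimately show ?thesis using h2 by linarith
   qed
   have "card {s\<in>S. w * s$1$1 + (-z) * s$1$2 + (-y) * s$2$1 + x * s$2$2 = m} <= card {0..int T} * (Dv + 4)"
   proof (rule sl2_hyperplane_count_matrices[of S "int T" w "-z" "-y" x H m "int r * (2 * H^2)" Dv])
    show "w ~= 0 \<or> - z ~= 0 \<or> - y ~= 0 \<or> x ~= 0" using False ew by auto
    show "card {d. d dvd N} <= Dv" if "N ~= 0" "\<bar>N\<bar> <= 2 * H^2 * (int T)^2 + H * (int r * (2 * H^2)) * int T + H^2" for N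
     by (rule Dv[OF that(1)]) (use that(2) le in linarith)
   qed (use S(2) b mb in auto)
   moreover have "card (A e) <= card {s\<in>S. w * s$1$1 + (-z) * s$1$2 + (-y) * s$2$1 + x * s$2$2 = m}"
    by (intro card_mono sub) (use S(1) in auto)
   ultimately show ?thesis by (simp add: nat_add_distrib)
  qed
 qed
 also have "... = card S + card Box * ((T + 1) * (Dv + 4))"
 proof -
  have "(0,0,0,0) \<in> Box" using H0 by (simp add: Box_def)
  then show ?thesis using finB by (simp add: sum.distrib sum.delta)
 qed
 finally show ?thesis by (simp add: cBox)
qed

section \<open>The local densities\<close>

definition ptr :: "int^2^2 => int" where "ptr g = trace (g ** transpose g)"

definition disc :: "int^2^2 => int" where "disc g = (ptr g)^2 - 4"

lemma ptr_eq: "ptr g = (g$1$1)^2 + (g$1$2)^2 + (g$2$1)^2 + (g$2$2)^2"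
 by (simp add: ptr_def trace_def mult_nth transpose_def sum_2 power2_eq_square)

lemma disc_factor: "disc g = (ptr g - 2) * (ptr g + 2)"
 by (simp add: disc_def algebra_simps power2_eq_square)

lemma ptr_cong: "matrix_cong q g h ==> [ptr g = ptr h] (mod int q)"
 unfolding ptr_eq matrix_cong_iff by (auto intro!: cong_add cong_pow)

lemma disc_cong: "matrix_cong q g h ==> [disc g = disc h] (mod int q)"
 unfolding disc_def by (intro cong_diff cong_pow ptr_cong) auto

definition chi :: "nat => int^2^2 => real" where
 "chi p g = (if int p dvd disc g then 1 else 0)"

definition rho :: "nat => real" where "rho p = pmean p (chi p)"

lemma qperiodic_chi: "qperiodic p (chi p)"
 unfolding qperiodic_def
proof (intro allI impI)
 fix g h assume "matrix_cong p g h"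
 then have "int p dvd disc g \<longleftrightarrow> int p dvd disc h" by (intro cong_dvd_iff disc_cong)
 then show "chi p g = chi p h" by (simp add: chi_def)
qed

lemma quadratic_roots_mod:
 assumes p: "prime p" and ne: "\<not> (int p dvd \<alpha> & int p dvd \<beta> & int p dvd \<gamma>)"
 shows "card {k\<in>{0..<int p}. int p dvd \<alpha> * k^2 + \<beta> * k + \<gamma>} <= 2"
proof (rule ccontr)
 let ?R = "{k\<in>{0..<int p}. int p dvd \<alpha> * k^2 + \<beta> * k + \<gamma>}"
 assume "\<not> card ?R <= 2"
 then have "3 <= card ?R" by simp
 then obtain T where T: "T \<subseteq> ?R" "card T = 3" "finite T" by (rule obtain_subset_with_card_n)
 from T(2) obtain x y z where e: "T = {x,y,z}" "x ~= y" "x ~= z" "y ~= z"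
  unfolding card_3_iff by blast
 have xyz: "x \<in> ?R" "y \<in> ?R" "z \<in> ?R" "x ~= y" "x ~= z" "y ~= z"
  using subsetD[OF T(1), of x] subsetD[OF T(1), of y] subsetD[OF T(1), of z] e by blast+
 have pp: "prime (int p)" using p by simp
 have nd: "\<not> int p dvd a - b" if "a \<in> {0..<int p}" "b \<in> {0..<int p}" "a ~= b" for a b
 proof
  assume "int p dvd a - b"
  then have "[a = b] (mod int p)" by (simp add: cong_iff_dvd_diff)
  then show False using that cong_less_unique_int by (auto simp: cong_def)
 qed
 have f: "int p dvd \<alpha> * (a + b) + \<beta>" if "a \<in> ?R" "b \<in> ?R" "a ~= b" for a b
 proof -
  have "(\<alpha> * a^2 + \<beta> * a + \<gamma>) - (\<alpha> * b^2 + \<beta> * b + \<gamma>) = (a - b) * (\<alpha> * (a + b) + \<beta>)"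
   by (simp add: algebra_simps power2_eq_square)
  then have "int p dvd (a - b) * (\<alpha> * (a + b) + \<beta>)" using that dvd_diff[of "int p" "\<alpha> * a^2 + \<beta> * a + \<gamma>" "\<alpha> * b^2 + \<beta> * b + \<gamma>"] by auto
  then show ?thesis using nd[of a b] that prime_dvd_mult_iff[OF pp] by auto
 qed
 have "int p dvd (\<alpha> * (x + y) + \<beta>) - (\<alpha> * (x + z) + \<beta>)" using f xyz by (intro dvd_diff) auto
 then have "int p dvd \<alpha> * (y - z)" by (simp add: algebra_simps)
 then have 1: "int p dvd \<alpha>" using nd[of y z] xyz prime_dvd_mult_iff[OF pp] by auto
 have "int p dvd \<alpha> * (x + y) + \<beta>" by (rule f[OF xyz(1,2,4)])
 moreover have "int p dvd \<alpha> * (x + y)" using 1 by (rule dvd_mult2)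
 ultimately have 2: "int p dvd \<beta>" using dvd_add_right_iff by blast
 have "int p dvd \<alpha> * x^2 + \<beta> * x + \<gamma>" using xyz(1) by simp
 moreover have "int p dvd \<alpha> * x^2 + \<beta> * x" using 1 2 by (intro dvd_add dvd_mult2)
 ultimately have "int p dvd \<gamma>" using dvd_add_right_iff by blast
 then show False using ne 1 2 by simp
qed

text \<open>Along the orbit \<open>ptr\<close> is a quadratic polynomial in x with coefficients A,
  B, \<open>ptr h\<close>. If p divided A and B, it would divide A (b^2 + d^2) - (B/2)^2, where (b,
  d) is the second column; but this equals (det h)^2. So each of ptr = 2 and ptr = -2 has at most
  two solutions.\<close>

lemma chi_unipotent_sum:
 assumes p: "prime p" "p >= 5" and h: "[det h = 1] (mod int p)"
 shows "(\<Sum>x<p. chi p (h ** un True (int x))) <= 4"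
proof -
 let ?a = "h$1$1" and ?b = "h$1$2" and ?c = "h$2$1" and ?d = "h$2$2"
 define A where "A = ?a^2 + ?c^2"
 define B where "B = 2 * (?a * ?b + ?c * ?d)"
 have pp: "prime (int p)" using p by simp
 have t: "ptr (h ** un True k) = A * k^2 + B * k + ptr h" for k
  by (simp add: ptr_eq mult_nth un_def A_def B_def power2_eq_square algebra_simps)
 have nd: "\<not> (int p dvd A & int p dvd B)"
 proof
  assume *: "int p dvd A & int p dvd B"
  have "\<not> int p dvd 2" using p by (auto dest: zdvd_imp_le)
  then have "int p dvd ?a * ?b + ?c * ?d"
   using * prime_dvd_mult_iff[OF pp, of 2 "?a * ?b + ?c * ?d"] unfolding B_def by blast
  then have "int p dvd A * (?b^2 + ?d^2) - (?a * ?b + ?c * ?d) * (?a * ?b + ?c * ?d)" using * by (intro dvd_diff dvd_mult2) auto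
  also have "A * (?b^2 + ?d^2) - (?a * ?b + ?c * ?d) * (?a * ?b + ?c * ?d) = (det h)^2"
   by (simp add: A_def det_2 power2_eq_square algebra_simps)
  finally have "int p dvd det h" using pp prime_dvd_power by blast
  then have "int p dvd 1" using h cong_dvd_iff cong_sym by blast
  then show False using p by simp
 qed
 define R where "R s = {k\<in>{0..<int p}. int p dvd A * k^2 + B * k + (ptr h - s)}" for s
 have R: "card (R s) <= 2" for s unfolding R_def by (rule quadratic_roots_mod[OF p(1)]) (use nd in auto)
 have fR: "finite (R s)" for s unfolding R_def by (rule finite_subset[of _ "{0..<int p}"]) auto
 have "(\<Sum>x<p. chi p (h ** un True (int x))) = card {x\<in>{..<p}. int p dvd disc (h ** un True (int x))}"
  by (simp add: chi_def sum.If_cases Int_def)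
 also have "card {x\<in>{..<p}. int p dvd disc (h ** un True (int x))} <= card (R 2 \<union> R (-2))"
 proof (rule card_inj_on_le[of int])
  show "int ` {x\<in>{..<p}. int p dvd disc (h ** un True (int x))} \<subseteq> R 2 \<union> R (-2)"
  proof (rule image_subsetI)
   fix x assume x: "x \<in> {x\<in>{..<p}. int p dvd disc (h ** un True (int x))}"
   then have "int p dvd (A * (int x)^2 + B * int x + ptr h - 2) * (A * (int x)^2 + B * int x + ptr h + 2)"
    by (simp only: disc_factor t mem_Collect_eq)
   then have "int p dvd A * (int x)^2 + B * int x + (ptr h - 2) \<or> int p dvd A * (int x)^2 + B * int x + (ptr h - (-2))"
    unfolding prime_dvd_mult_iff[OF pp] by (simp only: add_diff_eq diff_minus_eq_add add.assoc)
   then show "int x \<in> R 2 \<union> R (-2)" using x by (simp add: R_def)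
  qed
 qed (use fR in auto)
 also have "... <= 4" using card_Un_le[of "R 2" "R (-2)"] R[of 2] R[of "-2"] by linarith
 finally show ?thesis by simp
qed

lemma pmean_right_shift:
 assumes "qperiodic p f" "p > 0" "[det u = 1] (mod int p)"
 shows "pmean p (%h. f (h ** u)) = pmean p f"
 unfolding pmean_def by (simp add: sum_right_shift[OF assms])

lemma pmean_mono: "(!!h. [det h = 1] (mod int p) ==> f h <= g h) ==> pmean p f <= pmean p g"
 unfolding pmean_def by (intro divide_right_mono sum_mono) (auto dest: SL2_mod_det)

lemma pmean_const: "p > 0 ==> pmean p (%h. c) = c"
 using SL2_mod_nonempty by (simp add: pmean_def)

lemma pmean_add: "pmean p (%h. f h + g h) = pmean p f + pmean p g"
 by (simp add: pmean_def sum.distrib add_divide_distrib)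

lemma pmean_cmult: "pmean p (%h. c * f h) = c * pmean p f"
 by (simp add: pmean_def sum_distrib_left)

lemma pmean_diff: "pmean p (%h. f h - g h) = pmean p f - pmean p g"
 by (simp add: pmean_def sum_subtractf diff_divide_distrib)

lemma rho_nonneg [simp]: "rho p >= 0"
 unfolding rho_def pmean_def chi_def by (intro divide_nonneg_nonneg sum_nonneg) auto

lemma rho_le_1: "p > 0 ==> rho p <= 1"
 using pmean_mono[of p "chi p" "%_. 1"] by (simp add: rho_def pmean_const chi_def)

lemma rho_le:
 assumes p: "prime p" shows "rho p <= 4 / p"
proof (cases "p >= 5")
 case True
 have p0: "p > 0" using True by simp
 have "real p * rho p = (\<Sum>x<p. pmean p (%h. chi p (h ** un True (int x))))"
  by (simp add: pmean_right_shift[OF qperiodic_chi p0] rho_def)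
 also have "... = pmean p (%h. \<Sum>x<p. chi p (h ** un True (int x)))"
  unfolding pmean_def sum_divide_distrib[symmetric] by (subst sum.swap) (rule refl)
 also have "... <= pmean p (%h. 4)"
  by (rule pmean_mono) (rule chi_unipotent_sum[OF p True])
 finally show ?thesis using p0 by (simp add: pmean_const field_simps)
next
 case False
 then have "real p <= 4" "p > 0" using prime_gt_0_nat[OF p] by auto
 then have "rho p * real p <= 1 * real p" using rho_le_1[of p] by (intro mult_right_mono) auto
 then have "rho p * real p <= 4" using \<open>real p <= 4\<close> by linarith
 then show ?thesis using \<open>p > 0\<close> by (simp add: pos_le_divide_eq)
qed

text \<open>The matrix with rows (1, 1) and (0, 1) has \<open>disc\<close> equal to 5, so some
  residue survives at every p other than 5; at 5 the bound 4/5 is enough.\<close>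

lemma rho_less_1:
 assumes p: "prime p" shows "rho p < 1"
proof (cases "p = 5")
 case True
 then show ?thesis using rho_le[OF p] by simp
next
 case False
 have p0: "p > 0" using prime_gt_0_nat[OF p] .
 let ?g = "rmod p (mk 1 1 0 1)"
 have g: "?g \<in> SL2_mod p" by (rule rmod_SL2[OF p0]) simp
 have "\<not> int p dvd 5"
 proof
  assume "int p dvd 5"
  then have "p dvd 5" by presburger
  moreover have "prime (5::nat)" by simp
  ultimately show False using False p primes_dvd_imp_eq by blast
 qed
 moreover have "disc (mk 1 1 0 1) = 5" by (simp add: disc_def ptr_eq)
 ultimately have "chi p (mk 1 1 0 1) = 0" by (simp add: chi_def)
 then have c: "chi p ?g = 0" using qperiodicD[OF qperiodic_chi rmod_cong(1)] by simp
 have "(SUM h:SL2_mod p. chi p h) < (SUM h:SL2_mod p. 1)"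
  by (rule sum_strict_mono_ex1) (use g c in \<open>auto simp: chi_def intro!: bexI[of _ ?g]\<close>)
 then show ?thesis using card_SL2_mod_pos[OF p0] by (simp add: rho_def pmean_def)
qed

section \<open>Correlations of two translates modulo a prime\<close>

lemma card_SL2_mod_ge:
 assumes p: "prime p" shows "real p ^ 3 <= 2 * real (card (SL2_mod p))"
proof -
 have p2: "p >= 2" using p by (rule prime_ge_2_nat)
 have "\<exists>w. [int a * w = 1] (mod int p)" if "a \<in> {1..<p}" for a
  using cong_solve_coprime_int prime_coprime_less[OF p] that by simp
 then obtain w where w: "!!a. a \<in> {1..<p} ==> [int a * w a = 1] (mod int p)" by metis
 define f where "f = (%(a,b,c). rmod p (mk (int a) (int b) (int c) ((1 + int b * int c) * w a)))"
 have "card ({1..<p} \<times> {..<p} \<times> {..<p}) <= card (SL2_mod p)"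
 proof (rule card_inj_on_le[of f])
  show "inj_on f ({1..<p} \<times> {..<p} \<times> {..<p})"
   by (auto simp: inj_on_def f_def rmod_def mat2_eq_iff)
  show "f ` ({1..<p} \<times> {..<p} \<times> {..<p}) \<subseteq> SL2_mod p"
  proof clarify
   fix a b c assume a: "a \<in> {1..<p}"
   have "[(1 + int b * int c) * (int a * w a) - int b * int c = (1 + int b * int c) * 1 - int b * int c] (mod int p)"
    by (intro cong_diff cong_scalar_left w[OF a] cong_refl)
   then have "[det (mk (int a) (int b) (int c) ((1 + int b * int c) * w a)) = 1] (mod int p)"
    by (simp add: mult_ac)
   then show "f (a,b,c) \<in> SL2_mod p" unfolding f_def using p2 by (auto intro: rmod_SL2)
  qed
 qed simp
 then have "(p - 1) * (p * p) <= card (SL2_mod p)" by (simp add: card_cartesian_product)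
 moreover have "p * (p * p) <= 2 * ((p - 1) * (p * p))"
 proof -
  have "p <= 2 * (p - 1)" using p2 by simp
  then have "p * (p * p) <= (2 * (p - 1)) * (p * p)" by (rule mult_right_mono) simp
  then show ?thesis by (simp add: mult.assoc)
 qed
 ultimately have "p * (p * p) <= 2 * card (SL2_mod p)" by linarith
 then have "p ^ 3 <= 2 * card (SL2_mod p)" by (simp only: power3_eq_cube mult.assoc)
 then have "real (p ^ 3) <= real (2 * card (SL2_mod p))" by (simp only: of_nat_le_iff)
 then show ?thesis by simp
qed

text \<open>The entries 11, 12 and 22 of h^t h. As \<open>ptr (h ** g)\<close> is the trace of (h^t
  h)(g g^t), it is linear in them, and congruences for \<open>ptr\<close> become linear equations on
  the surface A C - B^2 = 1.\<close>

definition gram :: "int^2^2 => int \<times> int \<times> int" where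
 "gram h = ((h$1$1)^2 + (h$2$1)^2, h$1$1 * h$1$2 + h$2$1 * h$2$2, (h$1$2)^2 + (h$2$2)^2)"

lemma gram_det: "fst (gram h) * snd (snd (gram h)) - (fst (snd (gram h)))\<^sup>2 = (det h)^2"
 by (simp add: gram_def det_2 power2_eq_square algebra_simps)

lemma ptr_gram: "ptr h = fst (gram h) + snd (snd (gram h))"
 by (simp add: gram_def ptr_eq)

lemma ptr_mult_gram:
 "ptr (h ** g) = fst (gram (transpose g)) * fst (gram h) + 2 * fst (snd (gram (transpose g))) * fst (snd (gram h))
   + snd (snd (gram (transpose g))) * snd (snd (gram h))"
 by (simp add: gram_def ptr_eq mult_nth transpose_def power2_eq_square algebra_simps)

lemma quadratic_roots_mod_mono:
 assumes "prime p" "\<not> (int p dvd \<alpha> & int p dvd \<beta> & int p dvd \<gamma>)"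
  and "!!k. k \<in> K ==> k \<in> {0..<int p} & int p dvd \<alpha> * k^2 + \<beta> * k + \<gamma>"
 shows "finite K" "card K <= 2"
proof -
 let ?R = "{k\<in>{0..<int p}. int p dvd \<alpha> * k^2 + \<beta> * k + \<gamma>}"
 have f: "finite ?R" by (rule finite_subset[of _ "{0..<int p}"]) auto
 have s: "K \<subseteq> ?R" using assms(3) by blast
 show "finite K" by (rule finite_subset[OF s f])
 show "card K <= 2" using card_mono[OF f s] quadratic_roots_mod[OF assms(1,2)] by linarith
qed

lemma orthogonal_mod_eqs:
 fixes x y z w :: int
 assumes "[x\<^sup>2 + z^2 = 1] (mod q)" "[x*y + z*w = 0] (mod q)" "[y\<^sup>2 + w^2 = 1] (mod q)" "[x*w - y*z = 1] (mod q)"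
 shows "[w = x] (mod q)" "[z = - y] (mod q)"
proof -
 have d: "q dvd x\<^sup>2 + z^2 - 1" "q dvd x*y + z*w" "q dvd y\<^sup>2 + w^2 - 1" "q dvd x*w - y*z - 1"
  using assms by (simp_all add: cong_iff_dvd_diff)
 have "w - x = x * (x*w - y*z - 1) + z * (x*y + z*w) - w * (x^2 + z^2 - 1)"
  by (simp add: algebra_simps power2_eq_square)
 then show "[w = x] (mod q)" unfolding cong_iff_dvd_diff by (simp only:) (intro dvd_add dvd_diff dvd_mult d)
 have "z - (- y) = w * (x*y + z*w) - y * (x*w - y*z - 1) - z * (y^2 + w^2 - 1)"
  by (simp add: algebra_simps power2_eq_square)
 then show "[z = - y] (mod q)" unfolding cong_iff_dvd_diff by (simp only:) (intro dvd_add dvd_diff dvd_mult d)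
qed

lemma circle_mod_count:
 assumes p: "prime p"
 shows "finite {(x,y). x \<in> {0..<int p} & y \<in> {0..<int p} & int p dvd x\<^sup>2 + y^2 - 1}" (is "finite ?C")
  and "card {(x,y). x \<in> {0..<int p} & y \<in> {0..<int p} & int p dvd x\<^sup>2 + y^2 - 1} <= 2 * p"
proof -
 define Y where "Y x = {y \<in> {0..<int p}. int p dvd x\<^sup>2 + y^2 - 1}" for x
 have n1: "\<not> int p dvd 1" using prime_gt_1_nat[OF p] by simp
 have Y: "finite (Y x)" "card (Y x) <= 2" for x
  using quadratic_roots_mod_mono[OF p, of 1 0 "x^2 - 1" "Y x"] n1 by (auto simp: Y_def algebra_simps)
 have C: "?C = (SIGMA x:{0..<int p}. Y x)" by (auto simp: Y_def)
 show "finite ?C" unfolding C using Y by simp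
 have "card ?C = (SUM x:{0..<int p}. card (Y x))" unfolding C using Y by simp
 also have "... <= (SUM x:{0..<int p}. 2)" by (intro sum_mono Y)
 finally show "card ?C <= 2 * p" by simp
qed

text \<open>Two matrices with the same Gram entries differ by a left factor in SO_2(Z/p), hence by a
  point of the circle x^2 + y^2 = 1; each x leaves at most two y.\<close>

lemma gram_fibre_count:
 assumes p: "prime p"
  and H: "!!h. h \<in> H ==> h \<in> SL2_mod p"
   "!!h h'. h \<in> H ==> h' \<in> H ==> [fst (gram h) = fst (gram h')] (mod int p) &
     [fst (snd (gram h)) = fst (snd (gram h'))] (mod int p) & [snd (snd (gram h)) = snd (snd (gram h'))] (mod int p)"
 shows "card H <= 2 * p"
proof (cases "H = {}")
 case False
 then obtain h0 where h0: "h0 \<in> H" by blast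
 let ?C = "{(x,y). x \<in> {0..<int p} & y \<in> {0..<int p} & int p dvd x\<^sup>2 + y^2 - 1}"
 have p0: "int p > 0" using prime_gt_0_nat[OF p] by simp
 have d0: "[det h0 = 1] (mod int p)" using H(1)[OF h0] SL2_mod_det by blast
 define k where "k h = h ** adjm h0" for h :: "int^2^2"
 have K: "[k h$2$2 = k h$1$1] (mod int p) & [k h$2$1 = - k h$1$2] (mod int p) & [(k h$1$1)\<^sup>2 + (k h$1$2)^2 = 1] (mod int p)"
  if h: "h \<in> H" for h
 proof -
  have dh: "[det h = 1] (mod int p)" using H(1)[OF h] SL2_mod_det by blast
  let ?x = "h0$2$2" and ?y = "- h0$1$2" and ?z = "- h0$2$1" and ?w = "h0$1$1"
  have g: "gram (g ** adjm h0) = (fst (gram g) * ?x^2 + 2 * fst (snd (gram g)) * (?x * ?z) + snd (snd (gram g)) * ?z^2,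
    fst (gram g) * (?x * ?y) + fst (snd (gram g)) * (?x * ?w + ?z * ?y) + snd (snd (gram g)) * (?z * ?w),
    fst (gram g) * ?y^2 + 2 * fst (snd (gram g)) * (?y * ?w) + snd (snd (gram g)) * ?w^2)" for g :: "int^2^2"
   by (simp add: gram_def mult_nth adjm_def power2_eq_square algebra_simps)
  note hh = H(2)[OF h h0]
  note e = hh[THEN conjunct1] hh[THEN conjunct2, THEN conjunct1] hh[THEN conjunct2, THEN conjunct2]
  have g0: "gram (h0 ** adjm h0) = ((det h0)^2, 0, (det h0)^2)" by (simp add: mult_adjm gram_def)
  have d2: "[(det h0)\<^sup>2 = 1] (mod int p)" using cong_pow[OF d0, of 2] by simp
  have k1: "[fst (gram (k h)) = fst (gram (h0 ** adjm h0))] (mod int p)"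
   unfolding k_def g fst_conv by (intro cong_add cong_mult e cong_refl)
  have k2: "[fst (snd (gram (k h))) = fst (snd (gram (h0 ** adjm h0)))] (mod int p)"
   unfolding k_def g fst_conv snd_conv by (intro cong_add cong_mult e cong_refl)
  have k3: "[snd (snd (gram (k h))) = snd (snd (gram (h0 ** adjm h0)))] (mod int p)"
   unfolding k_def g fst_conv snd_conv by (intro cong_add cong_mult e cong_refl)
  have o1: "[(k h$1$1)\<^sup>2 + (k h$2$1)^2 = 1] (mod int p)"
   using cong_trans[OF k1[unfolded g0 fst_conv] d2] by (simp add: gram_def)
  have o2: "[k h$1$1 * k h$1$2 + k h$2$1 * k h$2$2 = 0] (mod int p)"
   using k2[unfolded g0 fst_conv snd_conv] by (simp add: gram_def)
  have o3: "[(k h$1$2)\<^sup>2 + (k h$2$2)^2 = 1] (mod int p)"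
   using cong_trans[OF k3[unfolded g0 snd_conv] d2] by (simp add: gram_def)
  have "[det (k h) = 1] (mod int p)" unfolding k_def by (intro det_mult_cong_one dh) (simp add: d0)
  then have o4: "[k h$1$1 * k h$2$2 - k h$1$2 * k h$2$1 = 1] (mod int p)" by (simp add: det_2)
  have w: "[k h$2$2 = k h$1$1] (mod int p)" and z: "[k h$2$1 = - k h$1$2] (mod int p)"
   using orthogonal_mod_eqs[OF o1 o2 o3 o4] by auto
  have "[(k h$2$1)\<^sup>2 = (- k h$1$2)^2] (mod int p)" by (rule cong_pow[OF z])
  then have "[(k h$1$1)\<^sup>2 + (k h$2$1)^2 = (k h$1$1)^2 + (k h$1$2)^2] (mod int p)"
   by (intro cong_add cong_refl) simp
  then show ?thesis using w z o1 cong_trans cong_sym by blast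
 qed
 define f where "f h = (k h$1$1 mod int p, k h$1$2 mod int p)" for h
 have "card H <= card ?C"
 proof (rule card_inj_on_le[of f])
  show "inj_on f H"
  proof
   fix h h' assume h: "h \<in> H" "h' \<in> H" "f h = f h'"
   then have e: "[k h$1$1 = k h'$1$1] (mod int p)" "[k h$1$2 = k h'$1$2] (mod int p)" by (auto simp: f_def cong_def)
   have "[k h$2$2 = k h'$2$2] (mod int p)" using K[OF h(1)] K[OF h(2)] e(1) by (meson cong_trans cong_sym)
   moreover have "[- k h$1$2 = - k h'$1$2] (mod int p)" using e(2) by (simp add: cong_minus_minus_iff)
   then have "[k h$2$1 = k h'$2$1] (mod int p)" using K[OF h(1)] K[OF h(2)] by (meson cong_trans cong_sym)
   ultimately have "matrix_cong p (k h) (k h')" using e by (simp add: matrix_cong_iff)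
   then have "rmod p (h ** adjm h0) = rmod p (h' ** adjm h0)" by (simp add: k_def rmod_eq_iff)
   then have "matrix_cong p h h'" by (subst (asm) rmod_mult_cancel_right) (use d0 in auto)
   then show "h = h'" using SL2_mod_eqI H(1) h by blast
  qed
  show "f ` H \<subseteq> ?C"
  proof (rule image_subsetI)
   fix h assume h: "h \<in> H"
   have "[(k h$1$1 mod int p)\<^sup>2 + (k h$1$2 mod int p)^2 = (k h$1$1)^2 + (k h$1$2)^2] (mod int p)"
    by (intro cong_add cong_pow) (simp_all add: cong_def)
   then have "[(k h$1$1 mod int p)\<^sup>2 + (k h$1$2 mod int p)^2 = 1] (mod int p)" using K[OF h] cong_trans by blast
   then show "f h \<in> ?C" using p0 by (simp add: f_def cong_iff_dvd_diff)
  qed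
  show "finite ?C" by (rule circle_mod_count(1)[OF p])
 qed
 also have "... <= 2 * p" by (rule circle_mod_count(2)[OF p])
 finally show ?thesis .
qed simp

text \<open>Both conditions are linear in the Gram entries (A, B, C). Since disc g = (\<alpha> -
  \<gamma>)^2 + 4 \<beta>^2 does not vanish modulo p, the line they cut out meets the surface A C -
  B^2 = 1 in at most two points, each with at most 2 p preimages. For \<beta> = 0 modulo p the line
  fixes A and C; otherwise it expresses B by A, which needs 2 to be invertible.\<close>

lemma two_gram_conditions_count:
 assumes p: "prime p" "p ~= 2" and g: "det g = 1" and nd: "\<not> int p dvd disc g"
 shows "card {h\<in>SL2_mod p. int p dvd ptr h - s & int p dvd ptr (h ** g) - s'} <= 2 * (2 * p)"
proof -
 let ?H = "{h\<in>SL2_mod p. int p dvd ptr h - s & int p dvd ptr (h ** g) - s'}"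
 have pp: "prime (int p)" using p by simp
 have p0: "int p > 0" using prime_gt_0_nat[OF p(1)] by simp
 have n2: "\<not> int p dvd 2"
 proof
  assume "int p dvd 2"
  then have "p <= 2" using zdvd_imp_le by fastforce
  then show False using p prime_ge_2_nat[OF p(1)] by simp
 qed
 define \<alpha> \<beta> \<gamma> where "\<alpha> = fst (gram (transpose g))" and "\<beta> = fst (snd (gram (transpose g)))" and "\<gamma> = snd (snd (gram (transpose g)))"
 define A B C where "A h = fst (gram h)" and "B h = fst (snd (gram h))" and "C h = snd (snd (gram h))" for h
 have dg: "\<alpha> * \<gamma> - \<beta>\<^sup>2 = 1" using gram_det[of "transpose g"] g by (simp add: \<alpha>_def \<beta>_def \<gamma>_def)
 have "ptr g = \<alpha> + \<gamma>" by (simp add: \<alpha>_def \<gamma>_def gram_def transpose_def ptr_eq)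
 then have "disc g = (\<alpha> - \<gamma>)^2 + 4 * \<beta>\<^sup>2"
  using dg by (simp add: disc_def power2_eq_square algebra_simps)
 then have nd': "\<not> int p dvd (\<alpha> - \<gamma>)\<^sup>2 + 4 * \<beta>\<^sup>2" using nd by simp
 have H1: "int p dvd A h + C h - s" "int p dvd \<alpha> * A h + 2 * \<beta> * B h + \<gamma> * C h - s'" "int p dvd A h * C h - (B h)\<^sup>2 - 1"
  if "h \<in> ?H" for h
 proof -
  show "int p dvd A h + C h - s" using that by (simp add: A_def C_def ptr_gram)
  show "int p dvd \<alpha> * A h + 2 * \<beta> * B h + \<gamma> * C h - s'"
   using that by (simp add: A_def B_def C_def \<alpha>_def \<beta>_def \<gamma>_def ptr_mult_gram)
  have "[det h = 1] (mod int p)" using that SL2_mod_det by blast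
  then have "[(det h)\<^sup>2 = 1^2] (mod int p)" by (rule cong_pow)
  then have "[A h * C h - (B h)\<^sup>2 = 1] (mod int p)" by (simp add: A_def B_def C_def gram_det)
  then show "int p dvd A h * C h - (B h)\<^sup>2 - 1" by (simp add: cong_iff_dvd_diff)
 qed
 define v where "v h = (A h mod int p, B h mod int p, C h mod int p)" for h
 have fH: "finite ?H" by (rule finite_subset[OF _ finite_SL2_mod]) auto
 have C': "[C h = s - A h] (mod int p)" if "h \<in> ?H" for h
  using H1(1)[OF that] by (simp add: cong_iff_dvd_diff algebra_simps)
 have lin: "int p dvd (\<alpha> - \<gamma>) * A h + 2 * \<beta> * B h - (s' - \<gamma> * s)" if "h \<in> ?H" for h
 proof -
  have "int p dvd (\<alpha> * A h + 2 * \<beta> * B h + \<gamma> * C h - s') - \<gamma> * (A h + C h - s)"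
   by (intro dvd_diff dvd_mult H1 that)
  then show ?thesis by (simp add: algebra_simps)
 qed
 have cv: "card (v ` ?H) <= 2"
 proof (cases "int p dvd \<beta>")
  case True
  then have "\<not> int p dvd \<alpha> - \<gamma>" using nd' by (metis dvd_add dvd_mult dvd_power_same dvd_trans dvd_power zero_less_numeral)
  then have cop: "coprime (\<alpha> - \<gamma>) (int p)" using pp prime_imp_coprime coprime_commute by blast
  have A': "[A h = A h'] (mod int p)" if "h \<in> ?H" "h' \<in> ?H" for h h'
  proof -
   have l: "int p dvd (\<alpha> - \<gamma>) * A k - (s' - \<gamma> * s)" if "k \<in> ?H" for k
   proof -
    have "int p dvd ((\<alpha> - \<gamma>) * A k + 2 * \<beta> * B k - (s' - \<gamma> * s)) - 2 * \<beta> * B k"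
     by (intro dvd_diff lin that dvd_mult2 dvd_mult True)
    then show ?thesis by (simp add: algebra_simps)
   qed
   have "int p dvd ((\<alpha> - \<gamma>) * A h - (s' - \<gamma> * s)) - ((\<alpha> - \<gamma>) * A h' - (s' - \<gamma> * s))"
    by (intro dvd_diff l that)
   then have "[(\<alpha> - \<gamma>) * A h = (\<alpha> - \<gamma>) * A h'] (mod int p)" by (simp add: cong_iff_dvd_diff)
   then show ?thesis using cop by (simp add: cong_mult_lcancel)
  qed
  have CC: "[C h = C h'] (mod int p)" if "h \<in> ?H" "h' \<in> ?H" for h h'
  proof -
   have "[s - A h = s - A h'] (mod int p)" by (intro cong_diff cong_refl A' that)
   then show ?thesis using C'[OF that(1)] C'[OF that(2)] by (meson cong_sym cong_trans)
  qed
  show ?thesis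
  proof (cases "?H = {}")
   case True
   then have "v ` ?H = {}" by (simp only: image_empty)
   then show ?thesis by (simp only:) simp
  next
   case False
   then obtain h0 where h0: "h0 \<in> ?H" by blast
   have inj: "inj_on (%t. fst (snd t)) (v ` ?H)"
   proof (rule inj_onI)
    fix t t' assume t: "t \<in> v ` ?H" "t' \<in> v ` ?H" "fst (snd t) = fst (snd t')"
    then obtain h h' where h: "h \<in> ?H" "h' \<in> ?H" "t = v h" "t' = v h'" by blast
    then show "t = t'" using A'[OF h(1,2)] CC[OF h(1,2)] t(3) by (simp add: v_def cong_def)
   qed
   have n1: "\<not> int p dvd 1" using prime_gt_1_nat[OF p(1)] by simp
   have "card (v ` ?H) = card ((%t. fst (snd t)) ` v ` ?H)" by (rule card_image[OF inj, symmetric])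
   also have "... <= 2"
   proof (rule quadratic_roots_mod_mono(2)[OF p(1), of 1 0 "1 - A h0 * C h0"])
    show "\<not> (int p dvd 1 & int p dvd 0 & int p dvd 1 - A h0 * C h0)" using n1 by simp
    fix k assume "k \<in> (%t. fst (snd t)) ` v ` ?H"
    then obtain h where h: "h \<in> ?H" "k = B h mod int p" by (auto simp: v_def)
    have "[k\<^sup>2 = (B h)^2] (mod int p)" unfolding h(2) by (intro cong_pow) (simp add: cong_def)
    moreover have "[(B h)\<^sup>2 = A h * C h - 1] (mod int p)"
     using H1(3)[OF h(1)] by (simp add: cong_iff_dvd_diff dvd_diff_commute algebra_simps)
    moreover have "[A h * C h - 1 = A h0 * C h0 - 1] (mod int p)"
     by (intro cong_diff cong_mult A' CC h h0 cong_refl)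
    ultimately have "[k\<^sup>2 = A h0 * C h0 - 1] (mod int p)" using cong_trans by blast
    then have "int p dvd k\<^sup>2 - (A h0 * C h0 - 1)" by (simp add: cong_iff_dvd_diff)
    then show "k \<in> {0..<int p} & int p dvd 1 * k^2 + 0 * k + (1 - A h0 * C h0)"
     using h(2) p0 by (simp add: algebra_simps)
   qed
   finally show ?thesis .
  qed
 next
  case False
  then have nb: "\<not> int p dvd 2 * \<beta>" using n2 prime_dvd_mult_iff[OF pp] by blast
  then have cop: "coprime (2 * \<beta>) (int p)" using pp prime_imp_coprime coprime_commute by blast
  define n where "n = s' - \<gamma> * s"
  have inj: "inj_on fst (v ` ?H)"
  proof (rule inj_onI)
   fix t t' assume t: "t \<in> v ` ?H" "t' \<in> v ` ?H" "fst t = fst t'"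
   then obtain h h' where h: "h \<in> ?H" "h' \<in> ?H" "t = v h" "t' = v h'" by blast
   have a: "[A h = A h'] (mod int p)" using t(3) h by (simp add: v_def cong_def)
   have "[s - A h = s - A h'] (mod int p)" by (intro cong_diff cong_refl a)
   then have c: "[C h = C h'] (mod int p)" using C'[OF h(1)] C'[OF h(2)] by (meson cong_sym cong_trans)
   have "int p dvd ((\<alpha> - \<gamma>) * A h + 2 * \<beta> * B h - n) - ((\<alpha> - \<gamma>) * A h' + 2 * \<beta> * B h' - n)"
    unfolding n_def by (intro dvd_diff lin h)
   moreover have "int p dvd (\<alpha> - \<gamma>) * (A h - A h')" using a by (intro dvd_mult) (simp add: cong_iff_dvd_diff)
   ultimately have "int p dvd (((\<alpha> - \<gamma>) * A h + 2 * \<beta> * B h - n) - ((\<alpha> - \<gamma>) * A h' + 2 * \<beta> * B h' - n)) - (\<alpha> - \<gamma>) * (A h - A h')"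
    by (rule dvd_diff)
   then have "[2 * \<beta> * B h = 2 * \<beta> * B h'] (mod int p)" by (simp add: cong_iff_dvd_diff algebra_simps)
   then have "[B h = B h'] (mod int p)" using cop by (simp add: cong_mult_lcancel)
   then show "t = t'" using a c h by (simp add: v_def cong_def)
  qed
  have "card (v ` ?H) = card (fst ` v ` ?H)" by (rule card_image[OF inj, symmetric])
  also have "... <= 2"
  proof (rule quadratic_roots_mod_mono(2)[OF p(1), of "- ((\<alpha> - \<gamma>)^2 + 4 * \<beta>\<^sup>2)" "4 * \<beta>\<^sup>2 * s + 2 * n * (\<alpha> - \<gamma>)" "- (n^2 + 4 * \<beta>\<^sup>2)"])
   let ?a = "- ((\<alpha> - \<gamma>)^2 + 4 * \<beta>\<^sup>2)" and ?b = "4 * \<beta>\<^sup>2 * s + 2 * n * (\<alpha> - \<gamma>)" and ?c = "- (n^2 + 4 * \<beta>\<^sup>2)"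
   show "\<not> (int p dvd ?a & int p dvd ?b & int p dvd ?c)" using nd' dvd_minus_iff by blast
   fix k assume "k \<in> fst ` v ` ?H"
   then obtain h where h: "h \<in> ?H" "k = A h mod int p" by (auto simp: v_def)
   have "[?a * k^2 + ?b * k + ?c = ?a * (A h)^2 + ?b * A h + ?c] (mod int p)"
    unfolding h(2) by (intro cong_add cong_mult cong_pow cong_refl) (simp_all add: cong_def)
   moreover have "int p dvd ?a * (A h)^2 + ?b * A h + ?c"
   proof -
    let ?l = "(\<alpha> - \<gamma>) * A h + 2 * \<beta> * B h - n"
    \<comment> \<open>The surface equation times 4 \<beta>^2, with s - A for C and n - (\<alpha> -
      \<gamma>) A for 2 \<beta> B, becomes a quadratic in A whose leading coefficient is minus disc
      g.\<close>
    have "?a * (A h)^2 + ?b * A h + ?c = 4 * \<beta>\<^sup>2 * (A h * C h - (B h)\<^sup>2 - 1) - 4 * \<beta>\<^sup>2 * A h * (A h + C h - s)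
      + ?l * (2 * \<beta> * B h - (\<alpha> - \<gamma>) * A h + n)"
     by (simp add: algebra_simps power2_eq_square)
    then show ?thesis
     using dvd_add[OF dvd_diff[OF dvd_mult[OF H1(3)[OF h(1)]] dvd_mult[OF H1(1)[OF h(1)]]] dvd_mult2[OF lin[OF h(1), folded n_def]]]
     by (simp only:)
   qed
   ultimately have "int p dvd ?a * k^2 + ?b * k + ?c" using cong_dvd_iff by blast
   then show "k \<in> {0..<int p} & int p dvd ?a * k^2 + ?b * k + ?c" using h(2) p0 by simp
  qed
  finally show ?thesis .
 qed
 have "card ?H = (SUM t:v ` ?H. card {h\<in>?H. v h = t})"
  using sum.group[of ?H "v ` ?H" v "%_. 1::nat"] fH by simp
 also have "... <= (SUM t:v ` ?H. 2 * p)"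
 proof (rule sum_mono)
  fix t
  show "card {h\<in>?H. v h = t} <= 2 * p"
   by (rule gram_fibre_count[OF p(1)]) (auto simp: v_def A_def B_def C_def cong_def)
 qed
 also have "... <= 2 * (2 * p)" using cv by simp
 finally show ?thesis .
qed

text \<open>\<open>disc\<close> is the product of ptr - 2 and ptr + 2, so there are four pairs of
  signs.\<close>

lemma correlation_count:
 assumes p: "prime p" "p ~= 2" and g: "det g = 1" and nd: "\<not> int p dvd disc g"
 shows "card {h\<in>SL2_mod p. int p dvd disc h & int p dvd disc (h ** g)} <= 16 * p"
proof -
 have pp: "prime (int p)" using p by simp
 define H where "H s s' = {h\<in>SL2_mod p. int p dvd ptr h - s & int p dvd ptr (h ** g) - s'}" for s s'
 have H: "card (H s s') <= 4 * p" "finite (H s s')" for s s'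
  using two_gram_conditions_count[OF p g nd, of s s'] by (auto simp: H_def)
 have "{h\<in>SL2_mod p. int p dvd disc h & int p dvd disc (h ** g)} \<subseteq> (H 2 2 \<union> H 2 (-2)) \<union> (H (-2) 2 \<union> H (-2) (-2))"
  unfolding H_def disc_factor prime_dvd_mult_iff[OF pp] by auto
 then have "card {h\<in>SL2_mod p. int p dvd disc h & int p dvd disc (h ** g)} <= card ((H 2 2 \<union> H 2 (-2)) \<union> (H (-2) 2 \<union> H (-2) (-2)))"
  by (intro card_mono) (auto simp: H)
 also have "... <= (card (H 2 2) + card (H 2 (-2))) + (card (H (-2) 2) + card (H (-2) (-2)))"
  by (intro order_trans[OF card_Un_le] add_mono card_Un_le)
 also have "... <= (4 * p + 4 * p) + (4 * p + 4 * p)" by (intro add_mono H)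
 finally show ?thesis by simp
qed

definition Fp :: "nat => int^2^2 => real" where "Fp p g = chi p g - rho p"

lemma qperiodic_Fp: "qperiodic p (Fp p)"
 using qperiodic_chi[of p] by (simp add: qperiodic_def Fp_def)

lemma chi_bounds: "0 <= chi p g" "chi p g <= 1" "(chi p g)^2 = chi p g"
 by (auto simp: chi_def)

lemma Fp_abs_le_1:
 assumes "prime p" shows "\<bar>Fp p g\<bar> <= 1"
 unfolding Fp_def using chi_bounds(1,2)[of p g] rho_nonneg[of p] rho_less_1[OF assms] by linarith

lemma pmean_chi_shift: "prime p ==> [det u = 1] (mod int p) ==> pmean p (%h. chi p (h ** u)) = rho p"
 using pmean_right_shift[OF qperiodic_chi] prime_gt_0_nat by (simp add: rho_def)

lemma pmean_Fp_shift:
 assumes "prime p" "[det u = 1] (mod int p)" shows "pmean p (%h. Fp p (h ** u)) = 0"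
 unfolding Fp_def pmean_diff pmean_chi_shift[OF assms] by (simp add: pmean_const prime_gt_0_nat assms(1))

lemma pmean_Fp_square:
 assumes "prime p" "[det u = 1] (mod int p)"
 shows "pmean p (%h. (Fp p (h ** u))^2) = rho p * (1 - rho p)"
proof -
 have "(Fp p (h ** u))^2 = (1 - 2 * rho p) * chi p (h ** u) + (rho p)^2" for h
  using chi_bounds(3)[of p "h ** u"] by (simp add: Fp_def power2_diff algebra_simps)
 then have "pmean p (%h. (Fp p (h ** u))^2) = (1 - 2 * rho p) * rho p + (rho p)^2"
  by (simp only: pmean_add pmean_cmult pmean_chi_shift[OF assms] pmean_const[OF prime_gt_0_nat[OF assms(1)]])
 then show ?thesis by (simp add: power2_eq_square algebra_simps)
qed

lemma pmean_Fp_square_le: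
 assumes "prime p" "[det u = 1] (mod int p)"
 shows "pmean p (%h. (Fp p (h ** u))^2) <= 4 / p"
proof -
 have "rho p * (1 - rho p) <= rho p * 1" by (intro mult_left_mono) auto
 then show ?thesis using pmean_Fp_square[OF assms] rho_le[OF assms(1)] by simp
qed

definition corr :: "nat => int^2^2 => int^2^2 => real" where
 "corr p u v = pmean p (%h. Fp p (h ** u) * Fp p (h ** v))"

lemma corr_abs_le:
 assumes p: "prime p" and u: "det u = 1" "det v = 1"
 shows "\<bar>corr p u v\<bar> <= 4 / p"
proof -
 have c: "[det u = 1] (mod int p)" "[det v = 1] (mod int p)" using u by simp_all
 have "\<bar>corr p u v\<bar> <= pmean p (%h. \<bar>Fp p (h ** u) * Fp p (h ** v)\<bar>)"
  unfolding corr_def pmean_def by (simp add: divide_right_mono sum_abs)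
 also have "... <= pmean p (%h. (1/2) * ((Fp p (h ** u))^2 + (Fp p (h ** v))^2))"
 proof (rule pmean_mono)
  fix h
  have "\<bar>x * y\<bar> <= (1/2) * (x^2 + y^2)" for x y :: real
   using sum_squares_bound[of "\<bar>x\<bar>" "\<bar>y\<bar>"] by (simp add: abs_mult)
  then show "\<bar>Fp p (h ** u) * Fp p (h ** v)\<bar> <= (1/2) * ((Fp p (h ** u))^2 + (Fp p (h ** v))^2)" .
 qed
 also have "... = (1/2) * (pmean p (%h. (Fp p (h ** u))^2) + pmean p (%h. (Fp p (h ** v))^2))"
  by (simp only: pmean_cmult pmean_add)
 also have "... <= (1/2) * (4 / p + 4 / p)"
  by (intro mult_left_mono add_mono pmean_Fp_square_le p c) simp
 finally show ?thesis by simp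
qed

text \<open>A translation moves u to the identity, so that only g = u^-1 v matters. If p does not
  divide disc g, at most 16 p of at least p^3/2 residues satisfy both divisibilities; otherwise, and
  at p = 2, the trivial bound 4/p is enough. The gcd puts the cases into one formula.\<close>

lemma corr_bound:
 assumes p: "prime p" and u: "det u = 1" "det v = 1"
 shows "\<bar>corr p u v\<bar> <= 32 * real (nat (gcd (int p) (disc (adjm u ** v)))) / (real p)^2"
proof -
 have c: "[det u = 1] (mod int p)" "[det v = 1] (mod int p)" using u by simp_all
 have p0: "real p > 0" "p > 0" using prime_gt_0_nat[OF p] by auto
 let ?g = "adjm u ** v"
 have dg: "det ?g = 1" using u by (simp add: det_mul)
 consider "p = 2" | "int p dvd disc ?g" | "p ~= 2" "\<not> int p dvd disc ?g" by blast
 then show ?thesis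
 proof cases
  case 1
  have "gcd (int p) (disc ?g) >= 1" using p0 by (simp add: int_one_le_iff_zero_less)
  then have "1 <= real (nat (gcd (int p) (disc ?g)))" by linarith
  then show ?thesis using corr_abs_le[OF p u] 1 by simp
 next
  case 2
  then have "gcd (int p) (disc ?g) = int p" by simp
  then have "32 * real (nat (gcd (int p) (disc ?g))) / (real p)^2 = 32 / real p"
   using p0 by (simp add: power2_eq_square)
  moreover have "4 / real p <= 32 / real p" using p0 by (simp add: divide_right_mono)
  ultimately show ?thesis using corr_abs_le[OF p u] by linarith
 next
  case 3
  have "coprime (int p) (disc ?g)" using 3(2) p by (simp add: prime_imp_coprime)
  then have g1: "gcd (int p) (disc ?g) = 1" by simp
  have e: "corr p u v = pmean p (%h. chi p (h ** u) * chi p (h ** v)) - (rho p)\<^sup>2"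
  proof -
   have "corr p u v = pmean p (%h. chi p (h ** u) * chi p (h ** v) - rho p * chi p (h ** u) - rho p * chi p (h ** v) + (rho p)^2)"
    unfolding corr_def Fp_def by (rule arg_cong[where f="pmean p"]) (auto simp: algebra_simps power2_eq_square)
   also have "... = pmean p (%h. chi p (h ** u) * chi p (h ** v)) - rho p * rho p - rho p * rho p + (rho p)^2"
    by (simp only: pmean_add pmean_diff pmean_cmult pmean_chi_shift[OF p c(1)] pmean_chi_shift[OF p c(2)] pmean_const[OF p0(2)])
   finally show ?thesis by (simp add: power2_eq_square)
  qed
  have per: "qperiodic p (%h. chi p (h ** u) * chi p (h ** v))"
   using qperiodic_right[OF qperiodic_chi] by (simp add: qperiodic_def)
  have "pmean p (%h. chi p (h ** u) * chi p (h ** v)) = pmean p (%h. chi p (h ** adjm u ** u) * chi p (h ** adjm u ** v))"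
   by (rule pmean_right_shift[OF per p0(2), symmetric]) (use u in simp)
  also have "... = pmean p (%h. chi p h * chi p (h ** ?g))"
  proof -
   have "h ** adjm u ** u = h" for h :: "int^2^2"
    using u by (simp add: matrix_mul_assoc[symmetric] mult_adjm mat_1_mk[symmetric])
   then show ?thesis by (simp add: matrix_mul_assoc)
  qed
  also have "... = real (card {h\<in>SL2_mod p. int p dvd disc h & int p dvd disc (h ** ?g)}) / card (SL2_mod p)"
  proof -
   have "chi p h * chi p (h ** ?g) = (if int p dvd disc h & int p dvd disc (h ** ?g) then 1 else 0)" for h
    by (simp add: chi_def)
   then show ?thesis by (simp add: pmean_def sum.If_cases Int_def)
  qed
  also have "... <= (16 * real p) / card (SL2_mod p)"
  proof (rule divide_right_mono)
   have "real (card {h\<in>SL2_mod p. int p dvd disc h & int p dvd disc (h ** ?g)}) <= real (16 * p)"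
    unfolding of_nat_le_iff by (rule correlation_count[OF p 3(1) dg 3(2)])
   then show "real (card {h\<in>SL2_mod p. int p dvd disc h & int p dvd disc (h ** ?g)}) <= 16 * real p" by simp
  qed simp
  also have "... <= (16 * real p) / (real p ^ 3 / 2)"
   using card_SL2_mod_ge[OF p] p0 by (intro divide_left_mono mult_pos_pos) (auto simp: card_SL2_mod_pos)
  also have "... = 32 / (real p)^2" using p0 by (simp add: power3_eq_cube power2_eq_square)
  finally have up: "corr p u v <= 32 / (real p)^2" using e zero_le_power2[of "rho p"] by linarith
  have pos: "0 <= pmean p (%h. chi p (h ** u) * chi p (h ** v))"
   unfolding pmean_def by (intro divide_nonneg_nonneg sum_nonneg mult_nonneg_nonneg) (auto simp: chi_bounds)
  have "(rho p)^2 <= (4 / real p)^2" by (intro power_mono rho_le p) simp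
  also have "... <= 32 / (real p)^2" by (simp add: power_divide divide_right_mono)
  finally have lo: "- corr p u v <= 32 / (real p)^2"
   using e pos by linarith
  show ?thesis using up lo g1 by simp
 qed
qed

section \<open>Continuants\<close>

definition pword :: "nat list => bool" where "pword w \<longleftrightarrow> (\<forall>a\<in>set w. 1 <= a)"

text \<open>The continuant: for positive letters it is the largest entry of the matrix, and it
  measures the size of a word throughout.\<close>

abbreviation KK :: "nat list => int" where "KK w \<equiv> word_matrix w $ 1 $ 1"

lemma word_matrix_Nil [simp]: "word_matrix [] = mat 1"
 by (simp add: word_matrix_def)

lemma cf_matrix_mk: "cf_matrix a = mk (int a) 1 1 0"
 by (simp add: cf_matrix_def mk_def)

lemma word_matrix_Cons: "word_matrix (a # w) = cf_matrix a ** word_matrix w"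
 by (simp add: word_matrix_def)

lemma word_matrix_Cons_nth:
 "word_matrix (a # w) $ 1 $ 1 = int a * word_matrix w $ 1 $ 1 + word_matrix w $ 2 $ 1"
 "word_matrix (a # w) $ 1 $ 2 = int a * word_matrix w $ 1 $ 2 + word_matrix w $ 2 $ 2"
 "word_matrix (a # w) $ 2 $ 1 = word_matrix w $ 1 $ 1"
 "word_matrix (a # w) $ 2 $ 2 = word_matrix w $ 1 $ 2"
 by (simp_all add: word_matrix_Cons cf_matrix_mk mult_nth)

lemma word_matrix_append: "word_matrix (u @ v) = word_matrix u ** word_matrix v"
 by (induction u) (simp_all add: word_matrix_Cons matrix_mul_assoc)

lemma det_word_matrix: "det (word_matrix w) = (-1) ^ length w"
proof (induction w)
 case (Cons a w)
 have "det (word_matrix (a # w)) = - det (word_matrix w)"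
  by (simp add: word_matrix_Cons det_mul cf_matrix_mk)
 then show ?case using Cons by simp
qed simp

lemma pword_Cons [simp]: "pword (a # w) \<longleftrightarrow> 1 <= a & pword w"
 by (auto simp: pword_def)

lemma pword_append [simp]: "pword (u @ v) \<longleftrightarrow> pword u & pword v"
 by (auto simp: pword_def)

text \<open>The empty word is set apart because the identity violates the inequalities between d and
  the off-diagonal entries.\<close>

lemma word_matrix_entries:
 assumes "pword w"
 shows "word_matrix w $ 1 $ 1 >= 1 & word_matrix w $ 1 $ 2 >= 0 & word_matrix w $ 2 $ 1 >= 0 & word_matrix w $ 2 $ 2 >= 0 &
   word_matrix w $ 1 $ 2 <= word_matrix w $ 1 $ 1 & word_matrix w $ 2 $ 1 <= word_matrix w $ 1 $ 1 &
   word_matrix w $ 2 $ 2 <= word_matrix w $ 1 $ 1 &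
   (w = [] \<or> (word_matrix w $ 2 $ 2 <= word_matrix w $ 2 $ 1 & word_matrix w $ 2 $ 2 <= word_matrix w $ 1 $ 2 &
    word_matrix w $ 2 $ 1 >= 1 & word_matrix w $ 1 $ 2 >= 1))"
 using assms
proof (induction w)
 case (Cons x w)
 let ?a = "word_matrix w $ 1 $ 1" and ?b = "word_matrix w $ 1 $ 2" and ?c = "word_matrix w $ 2 $ 1" and ?d = "word_matrix w $ 2 $ 2"
 have IH: "?a >= 1" "?b >= 0" "?c >= 0" "?d >= 0" "?b <= ?a" "?c <= ?a" "?d <= ?a"
   "w = [] \<or> (?d <= ?c & ?d <= ?b & ?c >= 1 & ?b >= 1)" using Cons by auto
 have x: "int x >= 1" using Cons.prems by simp
 have ab: "int x * ?b >= ?b" "int x * ?a >= ?a" using x IH mult_right_mono[of 1 "int x" ?a] mult_right_mono[of 1 "int x" ?b] by auto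
 have xab: "int x * ?b <= int x * ?a" using x IH by (intro mult_left_mono) auto
 show ?case
 proof (cases "w = []")
  case True
  then show ?thesis using x by (simp add: word_matrix_Cons_nth)
 next
  case False
  then have "?d <= ?c" "?d <= ?b" "?c >= 1" "?b >= 1" using IH by auto
  then show ?thesis unfolding word_matrix_Cons_nth using IH(1-7) ab xab by linarith
 qed
qed simp

text \<open>The first letter is a quotient with remainder: the 11 entry is a p + q with 0 <= q <= p.
  The ambiguity q = 0 against q = p would force one tail to be empty, and the second column then
  excludes it.\<close>

lemma word_matrix_inj:
 assumes "pword w" "pword v" "word_matrix w = word_matrix v" shows "w = v"
 using assms
proof (induction w arbitrary: v)
 case Nil
 then show ?case
 proof (cases v)
  case (Cons b v')
  then show ?thesis using Nil word_matrix_entries[of v] by (metis mat_1_nth(3) not_one_le_zero word_matrix_Nil list.distinct(1))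
 qed simp
next
 case (Cons a w)
 show ?case
 proof (cases v)
  case Nil
  then show ?thesis using Cons.prems word_matrix_entries[of "a # w"] by (metis mat_1_nth(3) not_one_le_zero word_matrix_Nil list.distinct(1))
 next
  case v: (Cons b v')
  have pw: "pword w" "pword v'" using Cons.prems v by auto
  have e: "word_matrix w $ 1 $ 1 = word_matrix v' $ 1 $ 1" "word_matrix w $ 1 $ 2 = word_matrix v' $ 1 $ 2"
   "int a * word_matrix w $ 1 $ 1 + word_matrix w $ 2 $ 1 = int b * word_matrix v' $ 1 $ 1 + word_matrix v' $ 2 $ 1"
   "int a * word_matrix w $ 1 $ 2 + word_matrix w $ 2 $ 2 = int b * word_matrix v' $ 1 $ 2 + word_matrix v' $ 2 $ 2"
   using Cons.prems(3) unfolding v by (metis word_matrix_Cons_nth)+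
  have no: False if h: "pword x" "pword y" "word_matrix x $ 1 $ 1 = word_matrix y $ 1 $ 1" "word_matrix x $ 1 $ 2 = word_matrix y $ 1 $ 2"
   "int m * word_matrix x $ 1 $ 1 + word_matrix x $ 2 $ 1 = int n * word_matrix y $ 1 $ 1 + word_matrix y $ 2 $ 1" "n < m"
   for x y m n
  proof -
   let ?p = "word_matrix x $ 1 $ 1"
   have p1: "?p >= 1" using word_matrix_entries[OF h(1)] by simp
   have r: "word_matrix y $ 2 $ 1 = (int m - int n) * ?p + word_matrix x $ 2 $ 1" using h(3,5) by (simp add: algebra_simps)
   have "(int m - int n) * ?p >= 1 * ?p" using h(6) p1 by (intro mult_right_mono) auto
   moreover have "word_matrix y $ 2 $ 1 <= ?p" using word_matrix_entries[OF h(2)] h(3) by simp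
   moreover have "word_matrix x $ 2 $ 1 >= 0" using word_matrix_entries[OF h(1)] by simp
   ultimately have "word_matrix x $ 2 $ 1 = 0" "word_matrix y $ 2 $ 1 = ?p" using r by linarith+
   then have "x = []" using word_matrix_entries[OF h(1)] by auto
   then have "word_matrix y $ 1 $ 2 = 0" using h(4) by simp
   then have "y = []" using word_matrix_entries[OF h(2)] by auto
   then show False using \<open>word_matrix y $ 2 $ 1 = ?p\<close> p1 by simp
  qed
  have "\<not> b < a" using no[OF pw e(1,2,3)] by blast
  moreover have "\<not> a < b" using no[OF pw(2,1) e(1,2,3)[symmetric]] by blast
  ultimately have ab: "a = b" by simp
  then have "word_matrix w = word_matrix v'" using e by (simp add: mat2_eq_iff)
  then show ?thesis using Cons.IH[OF pw] ab v by simp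
 qed
qed

lemma KK_append:
 assumes "pword u" "pword v"
 shows "KK u * KK v <= KK (u @ v)" "KK (u @ v) <= 2 * (KK u * KK v)"
proof -
 note U = word_matrix_entries[OF assms(1)] and V = word_matrix_entries[OF assms(2)]
 have e: "KK (u @ v) = KK u * KK v + word_matrix u $ 1 $ 2 * word_matrix v $ 2 $ 1"
  by (simp add: word_matrix_append mult_nth)
 have "word_matrix u $ 1 $ 2 * word_matrix v $ 2 $ 1 >= 0" using U V by (intro mult_nonneg_nonneg) auto
 then show "KK u * KK v <= KK (u @ v)" using e by simp
 have "word_matrix u $ 1 $ 2 * word_matrix v $ 2 $ 1 <= KK u * KK v" using U V by (intro mult_mono) auto
 then show "KK (u @ v) <= 2 * (KK u * KK v)" using e by simp
qed

lemma KK_ge_1: "pword w ==> KK w >= 1"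
 using word_matrix_entries by blast

lemma KK_append_ge: assumes "pword u" "pword v" shows "KK (u @ v) >= KK u" "KK (u @ v) >= KK v"
proof -
 have "KK u * 1 <= KK u * KK v" using KK_ge_1[OF assms(1)] KK_ge_1[OF assms(2)] by (intro mult_left_mono) auto
 then show "KK (u @ v) >= KK u" using KK_append(1)[OF assms] by simp
 have "1 * KK v <= KK u * KK v" using KK_ge_1[OF assms(1)] KK_ge_1[OF assms(2)] by (intro mult_right_mono) auto
 then show "KK (u @ v) >= KK v" using KK_append(1)[OF assms] by simp
qed

text \<open>A matrix of an even word is determined by its first column, since \<open>1 \<le> d \<le> c\<close>.\<close>

lemma even_word_column_inj:
 assumes w: "pword w" "even (length w)" and v: "pword v" "even (length v)"
  and e: "word_matrix w $ 1 $ 1 = word_matrix v $ 1 $ 1" "word_matrix w $ 2 $ 1 = word_matrix v $ 2 $ 1"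
 shows "w = v"
proof (cases "w = [] \<or> v = []")
 case True
 then show ?thesis using e(2) word_matrix_entries[OF w(1)] word_matrix_entries[OF v(1)]
  by (metis mat_1_nth(3) not_one_le_zero word_matrix_Nil)
next
 case False
 let ?a = "word_matrix w $ 1 $ 1" and ?c = "word_matrix w $ 2 $ 1"
 let ?b = "word_matrix w $ 1 $ 2" and ?d = "word_matrix w $ 2 $ 2"
 let ?b' = "word_matrix v $ 1 $ 2" and ?d' = "word_matrix v $ 2 $ 2"
 have d1: "?a * ?d - ?b * ?c = 1" using det_word_matrix[of w] w(2) by (simp add: det_2)
 have d2: "?a * ?d' - ?b' * ?c = 1" using det_word_matrix[of v] v(2) e by (simp add: det_2)
 have en: "?c >= 1" "?d <= ?c" "?d' <= ?c" "?d >= 0" "?d' >= 0" "?b >= 0" "?b' >= 0"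
  using word_matrix_entries[OF w(1)] word_matrix_entries[OF v(1)] False e by auto
 have "?b * ?c >= 0" "?b' * ?c >= 0" using en by auto
 then have d0: "?d ~= 0" "?d' ~= 0" using d1 d2 by auto
 have "?a * (?d - ?d') = ?c * (?b - ?b')" using d1 d2 by (simp add: algebra_simps)
 then have "?c dvd ?a * (?d - ?d')" by simp
 moreover have "coprime ?c ?a"
 proof (rule coprimeI)
  fix k assume "k dvd ?c" "k dvd ?a"
  then have "k dvd ?a * ?d - ?b * ?c" by simp
  then show "is_unit k" using d1 by simp
 qed
 ultimately have "?c dvd ?d - ?d'" by (simp add: coprime_dvd_mult_right_iff)
 moreover have "\<bar>?d - ?d'\<bar> < ?c" using en d0 by linarith
 ultimately have dd: "?d = ?d'" using zdvd_not_zless[of "\<bar>?d - ?d'\<bar>" ?c] by auto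
 have "?b * ?c = ?b' * ?c" using d1 d2 unfolding dd by linarith
 then have "?b = ?b'" using en by simp
 then have "word_matrix w = word_matrix v" using dd e by (simp add: mat2_eq_iff)
 then show ?thesis using word_matrix_inj w v by blast
qed

lemma even_words_count:
 fixes M :: nat
 shows "finite {w. pword w & even (length w) & KK w <= int M}"
  and "card {w. pword w & even (length w) & KK w <= int M} <= 2 * M^2"
proof -
 let ?W = "{w. pword w & even (length w) & KK w <= int M}"
 let ?f = "%w. (word_matrix w $ 1 $ 1, word_matrix w $ 2 $ 1)"
 have inj: "inj_on ?f ?W" by (auto simp: inj_on_def intro: even_word_column_inj)
 have sub: "?f ` ?W \<subseteq> {1..int M} \<times> {0..int M}"
 proof (rule image_subsetI)
  fix w assume "w \<in> ?W"
  then show "?f w \<in> {1..int M} \<times> {0..int M}" using word_matrix_entries[of w] by auto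
 qed
 show "finite ?W" using inj_on_finite[OF inj sub] by simp
 have "card ?W <= card ({1..int M} \<times> {0..int M})" by (rule card_inj_on_le[OF inj sub]) simp
 also have "... = M * (M + 1)" by (simp add: card_cartesian_product nat_add_distrib)
 also have "... <= 2 * M^2" by (cases M) (auto simp: power2_eq_square)
 finally show "card ?W <= 2 * M^2" .
qed

text \<open>For the quotient g, disc = 0 means ptr = 2, so (x - w)^2 + (y + z)^2 = ptr - 2 det = 0
  and g is an integral rotation. Of the four rotations only the identity keeps the entries of the
  first row positive, and this needs nonempty words.\<close>

lemma disc_eq_0:
 assumes w: "pword w" "even (length w)" "w ~= []" and v: "pword v" "even (length v)" "v ~= []"
  and z: "disc (adjm (word_matrix w) ** word_matrix v) = 0"
 shows "w = v"
proof -
 let ?W = "word_matrix w" and ?V = "word_matrix v"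
 define g where "g = adjm ?W ** ?V"
 let ?x = "g$1$1" and ?y = "g$1$2" and ?z = "g$2$1" and ?w = "g$2$2"
 have dW: "det ?W = 1" "det ?V = 1" using det_word_matrix w(2) v(2) by simp_all
 have V: "?V = ?W ** g" unfolding g_def matrix_mul_assoc mult_adjm dW
  by (simp flip: mat_1_mk)
 have "det g = 1" using dW by (simp add: g_def det_mul)
 then have d: "?x * ?w - ?y * ?z = 1" by (simp add: det_2)
 have p0: "ptr g >= 0" by (simp add: ptr_eq)
 have "(ptr g)^2 = 2^2" using z by (simp add: g_def disc_def)
 then have p2: "ptr g = 2" using p0 power2_eq_iff_nonneg[of "ptr g" 2] by simp
 have "(?x - ?w)^2 + (?y + ?z)^2 = ptr g - 2 * (?x * ?w - ?y * ?z)"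
  by (simp add: ptr_eq power2_eq_square algebra_simps)
 then have s0: "(?x - ?w)^2 + (?y + ?z)^2 = 0" using p2 d by simp
 then have xw: "?w = ?x" "?z = - ?y" by (auto simp: sum_power2_eq_zero_iff)
 have c: "?x^2 + ?y^2 = 1" using d xw by (simp add: power2_eq_square)
 have en: "?W$1$1 >= 1" "?W$1$2 >= 1" "?V$1$1 >= 1" "?V$1$2 >= 1"
  using word_matrix_entries[OF w(1)] word_matrix_entries[OF v(1)] w v by auto
 have VV: "?V$1$1 = ?W$1$1 * ?x - ?W$1$2 * ?y" "?V$1$2 = ?W$1$1 * ?y + ?W$1$2 * ?x"
  using arg_cong[OF V, of "%m. m$1$1"] arg_cong[OF V, of "%m. m$1$2"] xw by (simp_all add: mult_nth)
 have ux: "\<bar>?x\<bar> <= 1" "\<bar>?y\<bar> <= 1"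
 proof -
  have "?x^2 <= 1^2" "?y^2 <= 1^2" using c zero_le_power2[of ?x] zero_le_power2[of ?y] by (simp, linarith)+
  then show "\<bar>?x\<bar> <= 1" "\<bar>?y\<bar> <= 1" using abs_le_square_iff[of ?x 1] abs_le_square_iff[of ?y 1] by simp_all
 qed
 have "?x = 1 & ?y = 0"
 proof -
  have "?x \<in> {-1,0,1}" "?y \<in> {-1,0,1}" using ux by auto
  then show ?thesis using c VV en by auto
 qed
 then have "g = mat 1" using xw by (simp add: mat2_eq_iff)
 then have "?V = ?W" using V by simp
 then show ?thesis using word_matrix_inj w v by metis
qed

lemma disc_adjm_bound:
 assumes w: "pword w" "KK w <= M" and v: "pword v" "KK v <= M"
 shows "\<bar>disc (adjm (word_matrix w) ** word_matrix v)\<bar> <= 256 * M ^ 8"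
proof -
 define g where "g = adjm (word_matrix w) ** word_matrix v"
 have M: "M >= 0" using w word_matrix_entries[OF w(1)] by linarith
 have e: "\<bar>word_matrix w $ i $ j\<bar> <= M" "\<bar>word_matrix v $ i $ j\<bar> <= M" for i j :: 2
  using word_matrix_entries[OF w(1)] word_matrix_entries[OF v(1)] w(2) v(2) exhaust_2[of i] exhaust_2[of j] by auto
 have ea: "\<bar>adjm (word_matrix w) $ i $ j\<bar> <= M" for i j :: 2
  using e(1) exhaust_2[of i] exhaust_2[of j] by (auto simp: adjm_def)
 have g: "\<bar>g $ i $ j\<bar> <= 2 * M^2" for i j
 proof -
  have "\<bar>adjm (word_matrix w) $ i $ 1 * word_matrix v $ 1 $ j\<bar> <= M * M" "\<bar>adjm (word_matrix w) $ i $ 2 * word_matrix v $ 2 $ j\<bar> <= M * M"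
   unfolding abs_mult by (intro mult_mono ea e M; simp)+
  then show ?thesis unfolding g_def mult_nth by (simp add: power2_eq_square)
 qed
 have sq: "(g $ i $ j)^2 <= 4 * M ^ 4" for i j
 proof -
  have "\<bar>g $ i $ j\<bar>\<^sup>2 <= (2 * M^2)^2" by (intro power_mono g) simp
  then show ?thesis by (simp add: power_mult_distrib flip: power_mult)
 qed
 have p: "0 <= ptr g" "ptr g <= 16 * M ^ 4"
  using sq[of 1 1] sq[of 1 2] sq[of 2 1] sq[of 2 2] by (simp_all add: ptr_eq)
 have p2: "(ptr g)^2 <= (16 * M ^ 4)^2" using p by (intro power_mono)
 also have "(16 * M ^ 4)^2 = 256 * M ^ 8" by (simp add: power_mult_distrib flip: power_mult)
 finally have u: "(ptr g)^2 <= 256 * M ^ 8" .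
 have "M >= 1" using w KK_ge_1[OF w(1)] by linarith
 then have "M ^ 8 >= 1" by simp
 then show ?thesis using u zero_le_power2[of "ptr g"] unfolding g_def[symmetric] disc_def by linarith
qed

section \<open>Cutting words into blocks of prescribed size\<close>

definition evenw :: "nat => nat list => bool" where
 "evenw A w \<longleftrightarrow> set w \<subseteq> {1..A} & even (length w)"

lemma evenw_pword: "evenw A w ==> pword w"
 by (auto simp: evenw_def pword_def)

lemma evenw_append: "evenw A u ==> evenw A v ==> evenw A (u @ v)"
 by (simp add: evenw_def)

lemma evenw_Nil [simp]: "evenw A []" by (simp add: evenw_def)

lemma evenw_det: "evenw A w ==> det (word_matrix w) = 1"
 by (simp add: evenw_def det_word_matrix)

text \<open>Words at which the continuant first reaches \<tau>, read two letters at a time so that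
  all determinants are one. They form a prefix code of words whose continuants are comparable to
  \<tau>, up to a constant depending on A.\<close>

definition stop :: "nat => nat => nat list set" where
 "stop A \<tau> = {w. evenw A w & w ~= [] & int \<tau> <= KK w & KK (take (length w - 2) w) < int \<tau>}"

fun blocks :: "nat => nat => nat => nat list set" where
 "blocks A \<tau> 0 = {[]}"
| "blocks A \<tau> (Suc k) = {u @ v |u v. u \<in> stop A \<tau> & v \<in> blocks A \<tau> k}"

text \<open>Lengths are even, so a proper prefix of a stopping word is a prefix of that word without
  its last two letters. There the continuant is still below \<tau>, against monotonicity.\<close>

lemma stop_prefix:
 assumes "u \<in> stop A \<tau>" "u' \<in> stop A \<tau>" "u @ v = u' @ v'" shows "u = u'"
proof -
 have no: "\<not> length x < length y" if x: "x \<in> stop A \<tau>" "y \<in> stop A \<tau>" "x @ z = y @ z'" for x y z z'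
 proof
  assume l: "length x < length y"
  have ev: "even (length x)" "even (length y)" using x by (auto simp: stop_def evenw_def)
  then have l2: "length x <= length y - 2" using l by presburger
  let ?y = "take (length y - 2) y"
  have "take (length x) (x @ z) = take (length x) (y @ z')" using x(3) by simp
  then have "x = take (length x) y" using l by simp
  then have "?y = x @ drop (length x) ?y" using l2
   by (metis append_take_drop_id min.absorb1 take_take)
  moreover have "pword y" using x(2) evenw_pword by (auto simp: stop_def)
  then have "pword ?y" by (auto simp: pword_def dest: in_set_takeD)
  ultimately have "pword x" "pword (drop (length x) ?y)" by (metis pword_append)+
  then have "KK (x @ drop (length x) ?y) >= KK x" by (rule KK_append_ge(1))
  then have "KK ?y >= KK x" using \<open>?y = x @ drop (length x) ?y\<close> by simp
  then show False using x by (simp add: stop_def)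
 qed
 have "length u = length u'" using no[OF assms] no[OF assms(2,1) assms(3)[symmetric]] by simp
 then show ?thesis using assms(3) by simp
qed

lemma blocks_evenw: "w \<in> blocks A \<tau> k ==> evenw A w"
proof (induction k arbitrary: w)
 case (Suc k)
 then obtain u v where "w = u @ v" "u \<in> stop A \<tau>" "v \<in> blocks A \<tau> k" by auto
 then show ?case using Suc.IH by (auto simp: stop_def intro: evenw_append)
qed simp

lemma blocks_prefix:
 "u \<in> blocks A \<tau> i ==> u' \<in> blocks A \<tau> i ==> u @ v = u' @ v' ==> u = u' & v = v'"
proof (induction i arbitrary: u u')
 case (Suc i)
 obtain a b where u: "u = a @ b" "a \<in> stop A \<tau>" "b \<in> blocks A \<tau> i" using Suc.prems(1) by auto
 obtain a' b' where u': "u' = a' @ b'" "a' \<in> stop A \<tau>" "b' \<in> blocks A \<tau> i" using Suc.prems(2) by auto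
 have e: "a @ (b @ v) = a' @ (b' @ v')" using Suc.prems(3) u u' by simp
 have aa: "a = a'" by (rule stop_prefix[OF u(2) u'(2) e])
 then have "b @ v = b' @ v'" using e by simp
 then have "b = b' & v = v'" by (rule Suc.IH[OF u(3) u'(3)])
 then show ?case using aa u u' by simp
qed simp

lemma blocks_add: "blocks A \<tau> (i + j) = {u @ v |u v. u \<in> blocks A \<tau> i & v \<in> blocks A \<tau> j}"
proof (induction i)
 case (Suc i)
 have "blocks A \<tau> (Suc i + j) = {u @ v |u v. u \<in> stop A \<tau> & v \<in> {u @ v |u v. u \<in> blocks A \<tau> i & v \<in> blocks A \<tau> j}}"
  using Suc by simp
 also have "... = {u @ v |u v. u \<in> blocks A \<tau> (Suc i) & v \<in> blocks A \<tau> j}"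
 proof (intro equalityI subsetI)
  fix w assume "w \<in> {u @ v |u v. u \<in> stop A \<tau> & v \<in> {u @ v |u v. u \<in> blocks A \<tau> i & v \<in> blocks A \<tau> j}}"
  then obtain a b c where "w = a @ (b @ c)" "a \<in> stop A \<tau>" "b \<in> blocks A \<tau> i" "c \<in> blocks A \<tau> j" by blast
  moreover have "a @ (b @ c) = (a @ b) @ c" by simp
  ultimately show "w \<in> {u @ v |u v. u \<in> blocks A \<tau> (Suc i) & v \<in> blocks A \<tau> j}"
   unfolding blocks.simps by blast
 next
  fix w assume "w \<in> {u @ v |u v. u \<in> blocks A \<tau> (Suc i) & v \<in> blocks A \<tau> j}"
  then obtain a b c where "w = (a @ b) @ c" "a \<in> stop A \<tau>" "b \<in> blocks A \<tau> i" "c \<in> blocks A \<tau> j"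
   unfolding blocks.simps by blast
  moreover have "(a @ b) @ c = a @ (b @ c)" by simp
  ultimately show "w \<in> {u @ v |u v. u \<in> stop A \<tau> & v \<in> {u @ v |u v. u \<in> blocks A \<tau> i & v \<in> blocks A \<tau> j}}"
   by blast
 qed
 finally show ?case .
qed simp

lemma blocks_sum:
 "(SUM w:blocks A \<tau> (i + j). f (word_matrix w)) =
   (SUM v:blocks A \<tau> j. SUM u:blocks A \<tau> i. f (word_matrix u ** word_matrix v))"
proof -
 have inj: "inj_on (%(v,u). u @ v) (blocks A \<tau> j \<times> blocks A \<tau> i)"
 proof (rule inj_onI)
  fix x y assume xy: "x \<in> blocks A \<tau> j \<times> blocks A \<tau> i" "y \<in> blocks A \<tau> j \<times> blocks A \<tau> i"
   "(case x of (v,u) => u @ v) = (case y of (v,u) => u @ v)"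
  obtain v u v' u' where e: "x = (v,u)" "y = (v',u')" by (cases x, cases y)
  then show "x = y" using blocks_prefix[of u A \<tau> i u' v v'] xy by simp
 qed
 have "(SUM w:blocks A \<tau> (i + j). f (word_matrix w)) = (SUM w:(%(v,u). u @ v) ` (blocks A \<tau> j \<times> blocks A \<tau> i). f (word_matrix w))"
  unfolding blocks_add by (rule sum.cong) (auto simp: image_iff)
 also have "... = (SUM (v,u):blocks A \<tau> j \<times> blocks A \<tau> i. f (word_matrix (u @ v)))"
  unfolding sum.reindex[OF inj] by (simp add: case_prod_unfold)
 also have "... = (SUM v:blocks A \<tau> j. SUM u:blocks A \<tau> i. f (word_matrix u ** word_matrix v))"
  by (simp add: sum.cartesian_product word_matrix_append)
 finally show ?thesis .
qed

text \<open>Bounds twice the continuant of a stopping word: its last two letters contribute at most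
  2 (A^2 + 1). The further factor 2 absorbs the loss in \<open>KK_append\<close>, so that powers of
  \<open>bsize\<close> bound products of blocks.\<close>

definition bsize :: "nat => nat => nat" where "bsize A \<tau> = 4 * \<tau> * (A^2 + 1)"

lemma stop_KK_le:
 assumes "w \<in> stop A \<tau>" shows "2 * KK w <= int (bsize A \<tau>)"
proof -
 have w: "evenw A w" "w ~= []" "KK (take (length w - 2) w) < int \<tau>" using assms by (auto simp: stop_def)
 let ?u = "take (length w - 2) w" and ?v = "drop (length w - 2) w"
 have "length w >= 2" using w by (auto simp: evenw_def) (metis One_nat_def Suc_leI le_neq_implies_less length_greater_0_conv numeral_2_eq_2 odd_one)
 then have "length ?v = 2" by simp
 then obtain x y where xy: "?v = [x,y]"
  by (cases "?v"; cases "tl ?v") auto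
 have wuv: "w = ?u @ ?v" by simp
 have p: "pword ?u" "pword ?v" using evenw_pword[OF w(1)] wuv by (metis pword_append)+
 have "set ?v \<subseteq> {1..A}" using w(1) by (auto simp: evenw_def dest: in_set_dropD)
 then have "x <= A" "y <= A" using xy by auto
 then have "int x * int y <= int A * int A" by (intro mult_mono) auto
 then have kv: "KK ?v <= int (A^2 + 1)" unfolding xy by (simp add: word_matrix_Cons_nth power2_eq_square)
 have "KK w <= 2 * (KK ?u * KK ?v)" using KK_append(2)[OF p] by simp
 also have "KK ?u * KK ?v <= int \<tau> * int (A^2 + 1)"
  using w(3) kv KK_ge_1[OF p(1)] KK_ge_1[OF p(2)] by (intro mult_mono) auto
 finally show ?thesis by (simp add: bsize_def algebra_simps)
qed

lemma blocks_KK_le: "w \<in> blocks A \<tau> k ==> KK w <= int (bsize A \<tau> ^ k)"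
proof (induction k arbitrary: w)
 case (Suc k)
 then obtain u v where w: "w = u @ v" "u \<in> stop A \<tau>" "v \<in> blocks A \<tau> k" by auto
 have "evenw A u" "evenw A v" using w(2) blocks_evenw[OF w(3)] by (auto simp: stop_def)
 then have p: "pword u" "pword v" by (auto intro: evenw_pword)
 have "KK w <= 2 * (KK u * KK v)" unfolding w(1) by (rule KK_append(2)[OF p])
 also have "... = (2 * KK u) * KK v" by simp
 also have "... <= int (bsize A \<tau>) * int (bsize A \<tau> ^ k)"
  using stop_KK_le[OF w(2)] Suc.IH[OF w(3)] KK_ge_1[OF p(2)] by (intro mult_mono) auto
 finally show ?case by simp
qed simp

lemma blocks_KK_ge: "w \<in> blocks A \<tau> k ==> int (\<tau> ^ k) <= KK w"
proof (induction k arbitrary: w)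
 case (Suc k)
 then obtain u v where w: "w = u @ v" "u \<in> stop A \<tau>" "v \<in> blocks A \<tau> k" by auto
 have "evenw A u" "evenw A v" using w(2) blocks_evenw[OF w(3)] by (auto simp: stop_def)
 then have p: "pword u" "pword v" by (auto intro: evenw_pword)
 have "int \<tau> * int (\<tau> ^ k) <= KK u * KK v"
  using w(2) Suc.IH[OF w(3)] by (intro mult_mono) (auto simp: stop_def)
 also have "... <= KK w" unfolding w(1) by (rule KK_append(1)[OF p])
 finally show ?case by simp
qed simp

lemma blocks_finite_card:
 "finite (blocks A \<tau> k)" "card (blocks A \<tau> k) <= 2 * (bsize A \<tau> ^ k)^2"
proof -
 let ?W = "{w. pword w & even (length w) & KK w <= int (bsize A \<tau> ^ k)}"
 have sub: "blocks A \<tau> k \<subseteq> ?W"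
 proof
  fix w assume w: "w \<in> blocks A \<tau> k"
  then have "evenw A w" by (rule blocks_evenw)
  then show "w \<in> ?W" using blocks_KK_le[OF w] evenw_pword by (auto simp: evenw_def)
 qed
 note f = even_words_count[of "bsize A \<tau> ^ k"]
 show "finite (blocks A \<tau> k)" by (rule finite_subset[OF sub f(1)])
 show "card (blocks A \<tau> k) <= 2 * (bsize A \<tau> ^ k)^2" using card_mono[OF f(1) sub] f(2) by linarith
qed

lemma blocks_matrices:
 "inj_on word_matrix (blocks A \<tau> k)"
 "s \<in> word_matrix ` blocks A \<tau> k ==> det s = 1 & (\<forall>i j. s$i$j \<in> {0..int (bsize A \<tau> ^ k)})"
proof -
 show "inj_on word_matrix (blocks A \<tau> k)"
  by (rule inj_onI) (use word_matrix_inj blocks_evenw evenw_pword in blast)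
 assume "s \<in> word_matrix ` blocks A \<tau> k"
 then obtain w where w: "s = word_matrix w" "w \<in> blocks A \<tau> k" by blast
 have e: "evenw A w" by (rule blocks_evenw[OF w(2)])
 have b: "0 <= s$i$j & s$i$j <= KK w" for i j
  using word_matrix_entries[OF evenw_pword[OF e]] exhaust_2[of i] exhaust_2[of j] unfolding w(1) by auto
 then show "det s = 1 & (\<forall>i j. s$i$j \<in> {0..int (bsize A \<tau> ^ k)})"
  using evenw_det[OF e] blocks_KK_le[OF w(2)] w(1) by (auto intro: order_trans)
qed

text \<open>Cutting at the first even position where the continuant reaches \<tau> lowers it by a
  factor of at most \<open>bsize A \<tau>\<close>, so the hypothesis passes on to the rest of the
  word.\<close>

lemma blocks_decompose:
 assumes "\<tau> >= 2" "evenw A w" "int (bsize A \<tau> ^ n) <= KK w"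
 shows "\<exists>u v. w = u @ v & u \<in> blocks A \<tau> n & evenw A v"
 using assms(2,3)
proof (induction n arbitrary: w)
 case (Suc n)
 have b1: "bsize A \<tau> >= \<tau>" "bsize A \<tau> >= 1" using assms(1) by (auto simp: bsize_def)
 have pw: "pword w" by (rule evenw_pword[OF Suc.prems(1)])
 define P where "P m \<longleftrightarrow> int \<tau> <= KK (take (2 * m) w)" for m
 have "bsize A \<tau> * 1 <= bsize A \<tau> * bsize A \<tau> ^ n" using b1 by (intro mult_left_mono) auto
 from le_trans[OF b1(1) this[unfolded mult_1_right]]
 have "\<tau> <= bsize A \<tau> ^ Suc n" by (simp only: power_Suc)
 then have "int \<tau> <= int (bsize A \<tau> ^ Suc n)" by (simp only: of_nat_le_iff)
 then have "int \<tau> <= KK w" using Suc.prems(2) by linarith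
 moreover obtain l where l: "length w = 2 * l" using Suc.prems(1) by (auto simp: evenw_def elim: evenE)
 ultimately have "P l" by (simp add: P_def)
 then obtain m where m: "P m" "!!m'. m' < m ==> \<not> P m'" using exists_least_iff[of P] by blast
 have ml: "m <= l" using m(2)[of l] \<open>P l\<close> by (meson not_le)
 have m0: "m ~= 0"
 proof
  assume "m = 0" then show False using m(1) assms(1) by (simp add: P_def)
 qed
 let ?u = "take (2 * m) w" and ?v = "drop (2 * m) w"
 have len: "length ?u = 2 * m" using ml l by simp
 have eu: "evenw A ?u" "evenw A ?v" using Suc.prems(1) ml l unfolding evenw_def
  by (auto dest: in_set_takeD in_set_dropD)
 have "take (length ?u - 2) ?u = take (2 * (m - 1)) w" using len m0 by (simp add: min_def diff_mult_distrib2)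
 then have "KK (take (length ?u - 2) ?u) < int \<tau>" using m(2)[of "m - 1"] m0 by (simp add: P_def)
 moreover have "?u ~= []" using len m0 by auto
 ultimately have us: "?u \<in> stop A \<tau>" using eu m(1) by (simp add: stop_def P_def)
 have p: "pword ?u" "pword ?v" using eu evenw_pword by auto
 have "KK w <= 2 * (KK ?u * KK ?v)" using KK_append(2)[OF p] by simp
 also have "... = (2 * KK ?u) * KK ?v" by simp
 also have "... <= int (bsize A \<tau>) * KK ?v" using stop_KK_le[OF us] KK_ge_1[OF p(2)] by (intro mult_right_mono) auto
 finally have "int (bsize A \<tau>) * int (bsize A \<tau> ^ n) <= int (bsize A \<tau>) * KK ?v" using Suc.prems(2) by simp
 then have "int (bsize A \<tau> ^ n) <= KK ?v" using b1 by simp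
 from Suc.IH[OF eu(2) this] obtain u v where uv: "?v = u @ v" "u \<in> blocks A \<tau> n" "evenw A v" by blast
 have "w = (?u @ u) @ v" using uv(1) by (metis append.assoc append_take_drop_id)
 moreover have "?u @ u \<in> blocks A \<tau> (Suc n)" using us uv(2) by auto
 ultimately show ?case using uv(3) by blast
qed auto

lemma blocks_sum_peel4:
 assumes "4 * k <= n"
 shows "(SUM w:blocks A \<tau> n. f (word_matrix w)) =
   (SUM v:blocks A \<tau> (n - 4 * k). SUM s4:word_matrix ` blocks A \<tau> k. SUM s3:word_matrix ` blocks A \<tau> k.
    SUM s2:word_matrix ` blocks A \<tau> k. SUM s1:word_matrix ` blocks A \<tau> k. f (s1 ** (s2 ** (s3 ** (s4 ** word_matrix v)))))"
proof -
 let ?B = "blocks A \<tau>" and ?S = "word_matrix ` blocks A \<tau> k"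
 have im: "(SUM s:?S. g s) = (SUM u:?B k. g (word_matrix u))" for g :: "int^2^2 => 'a"
  by (simp add: sum.reindex[OF blocks_matrices(1)])
 have step: "(SUM w:?B (k + m). g (word_matrix w)) = (SUM v:?B m. SUM s:?S. g (s ** word_matrix v))"
  for m and g :: "int^2^2 => 'a"
  unfolding blocks_sum im by (rule refl)
 have n: "n = k + (k + (k + (k + (n - 4 * k))))" using assms by simp
 have "(SUM w:?B n. f (word_matrix w)) = (SUM w:?B (k + (k + (k + (k + (n - 4 * k))))). f (word_matrix w))"
  by (subst n) (rule refl)
 also have "... = (SUM w:?B (k + (k + (k + (n - 4 * k)))). (%W. SUM s1:?S. f (s1 ** W)) (word_matrix w))"
  by (rule step)
 also have "... = (SUM w:?B (k + (k + (n - 4 * k))). (%W. SUM s2:?S. SUM s1:?S. f (s1 ** (s2 ** W))) (word_matrix w))"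
  by (rule step)
 also have "... = (SUM w:?B (k + (n - 4 * k)). (%W. SUM s3:?S. SUM s2:?S. SUM s1:?S. f (s1 ** (s2 ** (s3 ** W)))) (word_matrix w))"
  by (rule step)
 also have "... = (SUM v:?B (n - 4 * k). SUM s4:?S. SUM s3:?S. SUM s2:?S. SUM s1:?S. f (s1 ** (s2 ** (s3 ** (s4 ** word_matrix v)))))"
  by (rule step)
 finally show ?thesis .
qed

lemma cpairs_blocks:
 assumes r: "r > 0" "r <= bsize A \<tau> ^ k"
  and Dv: "!!N. N ~= 0 ==> \<bar>N\<bar> <= 7 * int (bsize A \<tau> ^ k) ^ 4 ==> card {d::int. d dvd N} <= Dv" "Dv >= 1"
  and T: "T = real (bsize A \<tau> ^ k)"
 shows "real (cpairs r (word_matrix ` blocks A \<tau> k)) <= 2 * T^2 + 810 * real Dv * (T ^ 5 / real r ^ 4)"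
proof -
 let ?T = "bsize A \<tau> ^ k" and ?S = "word_matrix ` blocks A \<tau> k"
 have "cpairs r ?S <= card ?S + (2 * (?T div r) + 1) ^ 4 * ((?T + 1) * (Dv + 4))"
  by (rule cpairs_bound_nat[OF finite_imageI[OF blocks_finite_card(1)] blocks_matrices(2) r Dv(1)])
 also have "card ?S <= 2 * ?T^2" using card_image_le[OF blocks_finite_card(1), of word_matrix A \<tau> k] blocks_finite_card(2)[of A \<tau> k] by linarith
 finally have "cpairs r ?S <= 2 * ?T^2 + (2 * (?T div r) + 1) ^ 4 * ((?T + 1) * (Dv + 4))" by simp
 then have "real (cpairs r ?S) <= real (2 * ?T^2 + (2 * (?T div r) + 1) ^ 4 * ((?T + 1) * (Dv + 4)))"
  by (simp only: of_nat_le_iff)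
 also have "... = 2 * T^2 + (2 * real (?T div r) + 1) ^ 4 * ((T + 1) * (real Dv + 4))" by (simp add: T algebra_simps)
 \<comment> \<open>Uses 1 <= T/r and 1 <= Dv; the constant 810 is 3^4 * 2 * 5.\<close>
 also have "... <= 2 * T^2 + (3 * (T / r)) ^ 4 * ((2 * T) * (5 * real Dv))"
 proof -
  have "real (?T div r * r) <= real ?T" by (simp only: of_nat_le_iff div_times_less_eq_dividend)
  then have "real (?T div r) <= T / r" using r by (simp add: T pos_le_divide_eq)
  moreover have "1 <= T / r" using r by (simp add: T flip: of_nat_power)
  ultimately have "2 * real (?T div r) + 1 <= 3 * (T / r)" by linarith
  moreover have "T >= 1" using r by (simp add: T flip: of_nat_power)
  ultimately show ?thesis using Dv(2) by (intro add_left_mono mult_mono power_mono) auto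
 qed
 also have "(3 * (T / r)) ^ 4 * ((2 * T) * (5 * real Dv)) = 810 * real Dv * (T ^ 5 / real r ^ 4)"
  by (simp add: power_mult_distrib power_divide field_simps power_numeral_reduce)
 finally show ?thesis .
qed

text \<open>A segment of k blocks has size T = b^k and at most about T^2 elements; by
  \<open>cpairs_blocks\<close> it has about T^2 coincidences modulo r as long as T^3 <= r^4, so T is
  taken near r^(4/3). Then m segments save (r/T)^m = r^(-m/3) against the trivial bound, and m = 4
  is the first value that beats 1/r, as convergent Euler products require. Four segments make up
  16/3, and b^4 pays for rounding each T up to a power of b.\<close>

theorem block_mixing:
 fixes \<psi> :: "nat => int^2^2 => real"
 assumes E: "finite E" "!!p. p \<in> E ==> prime p"
  and t: "det t = 1"
  and per: "!!p. p \<in> E ==> qperiodic p (\<psi> p)"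
  and mean: "!!p. p \<in> E ==> pmean p (\<psi> p) = 0"
  and var: "!!p. p \<in> E ==> pmean p (%h. (\<psi> p h)^2) <= 4 / p"
  and \<tau>: "\<tau> >= 2" and b: "b = real (bsize A \<tau>)"
  and n: "real (\<Prod>E) powr (16/3) * b ^ 4 <= b ^ n"
  and Dv: "!!N. N ~= 0 ==> real_of_int \<bar>N\<bar> <= 7 * (b ^ n) ^ 4 ==> card {d::int. d dvd N} <= Dv" "Dv >= 1"
 shows "\<bar>SUM w:blocks A \<tau> n. PROD p:E. \<psi> p (word_matrix w ** t)\<bar>
   <= 2 * b ^ (2 * n) * 16 ^ card E * (812 * Dv * b ^ 3)^2 * real (\<Prod>E) powr (- 4/3)"
proof -
 obtain e where "prime_set E e" using prime_idempotents[OF E] by blast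
 then interpret ps: prime_set E e .
 define r where "r = ps.r"
 have rE: "r = \<Prod>E" by (simp add: r_def ps.r_def)
 have r0: "r > 0" using ps.r_pos by (simp add: r_def)
 define R where "R = real r"
 have R1: "R >= 1" using r0 by (simp add: R_def)
 have "\<tau> <= bsize A \<tau>" by (auto simp: bsize_def)
 then have b2: "b >= 2" using \<tau> unfolding b by linarith
 have "\<exists>k. R powr (4/3) <= b ^ k" using real_arch_pow[of b "R powr (4/3)"] b2 by (auto intro: less_imp_le)
 \<comment> \<open>Minimality of k gives T <= R^(4/3) b, hence T^5/R^4 <= T^2 b^3 in the coincidence
   bound.\<close>
 then obtain k where k: "R powr (4/3) <= b ^ k" "!!k'. k' < k ==> \<not> R powr (4/3) <= b ^ k'"
  using exists_least_iff[of "%k. R powr (4/3) <= b ^ k"] by blast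
 define T where "T = b ^ k"
 have T1: "T >= 1" using b2 by (simp add: T_def)
 have Tle: "T <= R powr (4/3) * b"
 proof (cases k)
  case 0
  have "1 <= R powr (4/3)" using R1 by (simp add: ge_one_powr_ge_zero)
  then have "1 * 1 <= R powr (4/3) * b" using b2 by (intro mult_mono) auto
  then show ?thesis using 0 by (simp add: T_def)
 next
  case (Suc k')
  then have "b ^ k' <= R powr (4/3)" using k(2)[of k'] by simp
  then have "b ^ k' * b <= R powr (4/3) * b" using b2 by (intro mult_right_mono) auto
  then show ?thesis using Suc by (simp add: T_def mult.commute)
 qed
 have "T ^ 4 <= (R powr (4/3) * b) ^ 4" using Tle T1 by (intro power_mono) auto
 also have "... = R powr (16/3) * b ^ 4" using R1 by (simp add: power_mult_distrib powr_power)
 also have "... <= b ^ n" using n by (simp add: R_def rE)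
 finally have "b ^ (4 * k) <= b ^ n" by (simp add: T_def power_mult[symmetric] mult.commute)
 then have kn: "4 * k <= n" using b2 by (simp add: power_increasing_iff)
 have RT: "R <= T"
 proof -
  have "R = R powr 1" using R1 by simp
  also have "... <= R powr (4/3)" using R1 by (intro powr_mono) auto
  finally show ?thesis using k(1) by (simp add: T_def)
 qed
 let ?S = "word_matrix ` blocks A \<tau> k"
 have bT: "real (bsize A \<tau> ^ k) = T" by (simp add: T_def b)
 have rT: "r <= bsize A \<tau> ^ k" using RT unfolding R_def bT[symmetric] by (simp only: of_nat_le_iff)
 have "T <= b ^ n" unfolding T_def using b2 kn by (intro power_increasing) auto
 then have T4: "7 * T ^ 4 <= 7 * (b ^ n) ^ 4" using T1 by (intro mult_left_mono power_mono) auto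
 have Dv': "card {d::int. d dvd N} <= Dv" if N: "N ~= 0" "\<bar>N\<bar> <= 7 * int (bsize A \<tau> ^ k) ^ 4" for N
 proof (rule Dv(1)[OF N(1)])
  have "real_of_int \<bar>N\<bar> <= real_of_int (7 * int (bsize A \<tau> ^ k) ^ 4)" using N(2) by (simp only: of_int_le_iff)
  also have "... = 7 * T ^ 4" by (simp add: bT[symmetric])
  finally show "real_of_int \<bar>N\<bar> <= 7 * (b ^ n) ^ 4" using T4 by linarith
 qed
 define P where "P = real (cpairs r ?S)"
 define D where "D = real Dv"
 have D1: "D >= 1" using Dv(2) by (simp add: D_def)
 have b31: "b ^ 3 >= 1" using b2 by (intro one_le_power) simp
 have P: "P <= 812 * D * b ^ 3 * T^2"
 proof -
  have "P <= 2 * T^2 + 810 * D * (T ^ 5 / R ^ 4)"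
   using cpairs_blocks[OF r0 rT Dv' Dv(2) bT[symmetric]] by (simp add: P_def D_def R_def)
  also have "T ^ 5 / R ^ 4 <= T^2 * b ^ 3"
  proof -
   have "T ^ 3 <= (R powr (4/3) * b) ^ 3" using Tle T1 by (intro power_mono) auto
   also have "... = R powr 4 * b ^ 3" using R1 by (simp add: power_mult_distrib powr_power)
   also have "R powr 4 = R ^ 4" using R1 powr_realpow[of R 4] by simp
   finally have "T ^ 3 / R ^ 4 <= b ^ 3" using R1 by (simp add: divide_le_eq mult.commute)
   then have "T^2 * (T ^ 3 / R ^ 4) <= T^2 * b ^ 3" by (rule mult_left_mono) simp
   then show ?thesis by (simp add: power_numeral_reduce)
  qed
  then have "2 * T^2 + 810 * D * (T ^ 5 / R ^ 4) <= 2 * T^2 + 810 * D * (T^2 * b ^ 3)"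
   using D1 by (intro add_left_mono mult_left_mono) auto
  also have "2 * T^2 <= 2 * (D * b ^ 3 * T^2)"
  proof -
   have "1 * 1 <= D * b ^ 3" using D1 b31 by (intro mult_mono) auto
   then have "1 * T^2 <= D * b ^ 3 * T^2" by (intro mult_right_mono) auto
   then show ?thesis by simp
  qed
  then have "2 * T^2 + 810 * D * (T^2 * b ^ 3) <= 812 * D * b ^ 3 * T^2" by (simp add: algebra_simps)
  finally show ?thesis .
 qed
 define \<Psi> where "\<Psi> h = (PROD p:E. \<psi> p (h ** t))" for h
 have pt: "qperiodic p (%h. \<psi> p (h ** t))" "pmean p (%h. \<psi> p (h ** t)) = 0"
   "pmean p (%h. (\<psi> p (h ** t))^2) <= 4 / p" if p: "p \<in> E" for p
 proof -
  have p0: "p > 0" using E(2)[OF p] prime_gt_0_nat by blast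
  have t': "[det t = 1] (mod int p)" using t by simp
  show "qperiodic p (%h. \<psi> p (h ** t))" by (rule qperiodic_right[OF per[OF p]])
  show "pmean p (%h. \<psi> p (h ** t)) = 0" using pmean_right_shift[OF per[OF p] p0 t'] mean[OF p] by simp
  have "qperiodic p (%h. (\<psi> p h)^2)" using per[OF p] by (simp add: qperiodic_def)
  from pmean_right_shift[OF this p0 t'] show "pmean p (%h. (\<psi> p (h ** t))^2) <= 4 / p" using var[OF p] by simp
 qed
 define G where "G v = (SUM s4:?S. SUM s3:?S. SUM s2:?S. SUM s1:?S. \<Psi> (s1 ** (s2 ** (s3 ** (s4 ** word_matrix v)))))" for v
 have G: "\<bar>G v\<bar> <= 16 ^ card E * P^2 * R ^ 4" if v: "v \<in> blocks A \<tau> (n - 4 * k)" for v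
  unfolding G_def \<Psi>_def P_def R_def r_def
 proof (rule ps.four_fold_sum_bound[where \<psi>="%p h. \<psi> p (h ** t)"])
  show "finite ?S" by (rule finite_imageI[OF blocks_finite_card(1)])
  show "det s = 1" if "s \<in> ?S" for s using blocks_matrices(2)[OF that] by blast
  show "det (word_matrix v) = 1" by (rule evenw_det[OF blocks_evenw[OF v]])
 qed (rule pt, assumption)+
 have "(SUM w:blocks A \<tau> n. PROD p:E. \<psi> p (word_matrix w ** t)) = (SUM v:blocks A \<tau> (n - 4 * k). G v)"
  using blocks_sum_peel4[OF kn, of \<Psi> A \<tau>] by (simp add: \<Psi>_def G_def)
 then have "\<bar>SUM w:blocks A \<tau> n. PROD p:E. \<psi> p (word_matrix w ** t)\<bar> <= (SUM v:blocks A \<tau> (n - 4 * k). \<bar>G v\<bar>)"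
  using sum_abs by metis
 also have "... <= (SUM v:blocks A \<tau> (n - 4 * k). 16 ^ card E * P^2 * R ^ 4)"
  by (intro sum_mono G)
 also have "... = card (blocks A \<tau> (n - 4 * k)) * (16 ^ card E * P^2 * R ^ 4)" by simp
 also have "... <= (2 * b ^ (2 * (n - 4 * k))) * (16 ^ card E * P^2 * R ^ 4)"
 proof (rule mult_right_mono)
  have "real (card (blocks A \<tau> (n - 4 * k))) <= real (2 * (bsize A \<tau> ^ (n - 4 * k))^2)"
   unfolding of_nat_le_iff by (rule blocks_finite_card(2))
  also have "... = 2 * b ^ (2 * (n - 4 * k))" by (simp add: b power_mult[symmetric] mult.commute)
  finally show "real (card (blocks A \<tau> (n - 4 * k))) <= 2 * b ^ (2 * (n - 4 * k))" .
 qed (use R1 in auto)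
 also have "... <= (2 * b ^ (2 * (n - 4 * k))) * (16 ^ card E * ((812 * D * b ^ 3)^2 * (T ^ 8 * R powr (-4/3))))"
 proof (intro mult_left_mono)
  have "P^2 <= (812 * D * b ^ 3 * T^2)^2" using P by (intro power_mono) (auto simp: P_def)
  also have "... = (812 * D * b ^ 3)^2 * T ^ 4" by (simp add: power_mult_distrib flip: power_mult)
  finally have "P^2 * R ^ 4 <= (812 * D * b ^ 3)^2 * T ^ 4 * R ^ 4" using R1 by (intro mult_right_mono) auto
  also have "T ^ 4 * R ^ 4 <= T ^ 8 * R powr (-4/3)"
  proof -
   have "(R powr (4/3)) ^ 4 <= T ^ 4" using k(1) R1 unfolding T_def by (intro power_mono) auto
   then have "R powr (16/3) <= T ^ 4" using R1 by (simp add: powr_power)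
   then have "R powr (16/3) * R powr (-4/3) <= T ^ 4 * R powr (-4/3)" by (intro mult_right_mono) auto
   then have "R powr 4 <= T ^ 4 * R powr (-4/3)" using R1 by (simp flip: powr_add)
   moreover have "R powr 4 = R ^ 4" using R1 powr_realpow[of R 4] by simp
   ultimately have "T ^ 4 * R ^ 4 <= T ^ 4 * (T ^ 4 * R powr (-4/3))" using T1 by (intro mult_left_mono) auto
   then show ?thesis by (simp add: power_numeral_reduce mult.assoc)
  qed
  then have "(812 * D * b ^ 3)^2 * T ^ 4 * R ^ 4 <= (812 * D * b ^ 3)^2 * (T ^ 8 * R powr (-4/3))"
   unfolding mult.assoc[of "(812 * D * b ^ 3)^2"] by (intro mult_left_mono) auto
  finally have "P^2 * R ^ 4 <= (812 * D * b ^ 3)^2 * (T ^ 8 * R powr (-4/3))" .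
  then show "16 ^ card E * P^2 * R ^ 4 <= 16 ^ card E * ((812 * D * b ^ 3)^2 * (T ^ 8 * R powr (-4/3)))"
   by (simp add: mult.assoc)
 qed (use b2 in auto)
 also have "... = 2 * (b ^ (2 * (n - 4 * k)) * T ^ 8) * 16 ^ card E * (812 * D * b ^ 3)^2 * R powr (-4/3)"
  by (simp only: mult_ac)
 also have "b ^ (2 * (n - 4 * k)) * T ^ 8 = b ^ (2 * n)"
 proof -
  have "2 * (n - 4 * k) + k * 8 = 2 * n" using kn by simp
  then show ?thesis unfolding T_def power_mult[symmetric] power_add[symmetric] by (simp only:)
 qed
 finally show ?thesis by (simp add: R_def rE D_def)
qed

section \<open>The dispersion estimate\<close>

definition FD :: "nat set => int^2^2 => real" where "FD D g = (PROD p:D. Fp p g)"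

definition symdiff :: "nat set => nat set => nat set" where "symdiff D D' = (D - D') \<union> (D' - D)"

lemma FD_abs_le_1: "(!!p. p \<in> D ==> prime p) ==> \<bar>FD D g\<bar> <= 1"
 unfolding FD_def abs_prod by (rule prod_le_1) (auto simp: Fp_abs_le_1)

text \<open>At a common prime the product of two \<open>Fp\<close> does not have mean zero.
  Splitting off its correlation leaves a mean-zero function at each prime of K and of the symmetric
  difference, and a constant at the others.\<close>

lemma FD_product_expand:
 fixes u v h :: "int^2^2"
 assumes fin: "finite D" "finite D'"
 defines "\<psi> \<equiv> (%p h. if p \<in> D \<inter> D' then Fp p (h ** u) * Fp p (h ** v) - corr p u v
   else if p \<in> D then Fp p (h ** u) else Fp p (h ** v))"
 shows "FD D (h ** u) * FD D' (h ** v) =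
  (SUM K:Pow (D \<inter> D'). (PROD p:D \<inter> D' - K. corr p u v) * (PROD p:K \<union> symdiff D D'. \<psi> p h))"
proof -
 let ?I = "D \<inter> D'"
 have D: "D = ?I \<union> (D - D')" "D' = ?I \<union> (D' - D)" by auto
 have "FD D (h ** u) = (PROD p:?I. Fp p (h ** u)) * (PROD p:D - D'. Fp p (h ** u))"
  unfolding FD_def using prod.union_disjoint[of ?I "D - D'" "%p. Fp p (h ** u)"] fin D(1) by auto
 moreover have "FD D' (h ** v) = (PROD p:?I. Fp p (h ** v)) * (PROD p:D' - D. Fp p (h ** v))"
  unfolding FD_def using prod.union_disjoint[of ?I "D' - D" "%p. Fp p (h ** v)"] fin D(2) by auto
 moreover have "(PROD p:symdiff D D'. \<psi> p h) = (PROD p:D - D'. Fp p (h ** u)) * (PROD p:D' - D. Fp p (h ** v))"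
  unfolding symdiff_def
  by (subst prod.union_disjoint) (use fin in \<open>auto simp: \<psi>_def intro!: arg_cong2[where f=times] prod.cong\<close>)
 moreover have "(PROD p:?I. Fp p (h ** u)) * (PROD p:?I. Fp p (h ** v)) = (PROD p:?I. \<psi> p h + corr p u v)"
  unfolding prod.distrib[symmetric] by (intro prod.cong refl) (simp add: \<psi>_def)
 moreover have "... = (SUM K:Pow ?I. (PROD p:K. \<psi> p h) * (PROD p:?I - K. corr p u v))"
  by (rule prod_add) (use fin in auto)
 ultimately have "FD D (h ** u) * FD D' (h ** v) =
   (SUM K:Pow ?I. (PROD p:K. \<psi> p h) * (PROD p:?I - K. corr p u v)) * (PROD p:symdiff D D'. \<psi> p h)"
  by (simp add: mult_ac)
 also have "... = (SUM K:Pow ?I. (PROD p:?I - K. corr p u v) * ((PROD p:K. \<psi> p h) * (PROD p:symdiff D D'. \<psi> p h)))"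
  unfolding sum_distrib_right by (rule sum.cong[OF refl]) (simp only: mult_ac)
 also have "... = (SUM K:Pow ?I. (PROD p:?I - K. corr p u v) * (PROD p:K \<union> symdiff D D'. \<psi> p h))"
 proof (intro sum.cong refl arg_cong2[where f=times])
  fix K assume K: "K \<in> Pow ?I"
  have "finite K" "finite (symdiff D D')" "K \<inter> symdiff D D' = {}"
   using K fin by (auto simp: symdiff_def intro: finite_subset)
  then show "(PROD p:K. \<psi> p h) * (PROD p:symdiff D D'. \<psi> p h) = (PROD p:K \<union> symdiff D D'. \<psi> p h)"
   by (simp add: prod.union_disjoint)
 qed
 finally show ?thesis .
qed

lemma prod_prime_le:
 assumes "finite B" "A \<subseteq> B" "!!p. p \<in> B ==> prime p" shows "\<Prod>A <= (\<Prod>B :: nat)"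
proof -
 have "\<Prod>A dvd \<Prod>B" by (rule prod_dvd_prod_subset[OF assms(1,2)])
 moreover have "\<Prod>B > 0" using assms by (auto intro!: prod_pos prime_gt_0_nat)
 ultimately show ?thesis by (rule dvd_imp_le)
qed

text \<open>The share of a single prime in the bound of \<open>block_mixing\<close>.\<close>

definition mixw :: "nat => real" where "mixw p = 16 * real p powr (- 4/3)"

lemma prod_mixw:
 assumes "!!p. p \<in> E ==> prime p"
 shows "(PROD p:E. mixw p) = 16 ^ card E * real (\<Prod>E) powr (- 4/3)"
proof -
 have "(PROD p:E. real p powr (- 4/3)) = (PROD p:E. real p) powr (- 4/3)"
  by (simp add: prod_powr_distrib)
 then show ?thesis by (simp add: mixw_def prod.distrib)
qed

text \<open>The local functions left by \<open>FD_product_expand\<close> meet the hypotheses of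
  \<open>block_mixing\<close>; their modulus divides the product over the union of D and D', whence
  Q * Q in the length condition. Subtracting the correlation does not increase the second moment,
  and |Fp| <= 1 reduces it to that of one factor.\<close>

lemma pair_sum_bound:
 assumes D: "finite D" "finite D'" "!!p. p \<in> D \<union> D' ==> prime p"
  and uv: "det u = 1" "det v = 1"
  and Q: "real (\<Prod>D) <= Q" "real (\<Prod>D') <= Q"
  and \<tau>: "\<tau> >= 2" and b: "b = real (bsize A \<tau>)"
  and n: "(Q * Q) powr (16/3) * b ^ 4 <= b ^ n"
  and Dv: "!!N. N ~= 0 ==> real_of_int \<bar>N\<bar> <= 7 * (b ^ n) ^ 4 ==> card {d::int. d dvd N} <= Dv" "Dv >= 1"
  and c: "c = 2 * b ^ (2 * n) * (812 * real Dv * b ^ 3)^2"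
 shows "\<bar>SUM w:blocks A \<tau> n. FD D (word_matrix w ** u) * FD D' (word_matrix w ** v)\<bar>
  <= c * (SUM K:Pow (D \<inter> D'). (PROD p:D \<inter> D' - K. \<bar>corr p u v\<bar>) * ((PROD p:K. mixw p) * (PROD p:D - D'. mixw p) * (PROD p:D' - D. mixw p)))"
proof -
 let ?I = "D \<inter> D'"
 define \<psi> where "\<psi> = (%p h. if p \<in> D \<inter> D' then Fp p (h ** u) * Fp p (h ** v) - corr p u v
   else if p \<in> D then Fp p (h ** u) else Fp p (h ** v))"
 have per: "qperiodic p (\<psi> p)" for p
  using qperiodic_right[OF qperiodic_Fp, of p] by (simp add: qperiodic_def \<psi>_def)
 have cu: "[det u = 1] (mod int p)" "[det v = 1] (mod int p)" for p using uv by simp_all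
 have mean: "pmean p (\<psi> p) = 0" if "prime p" for p
 proof -
  have "pmean p (%h. Fp p (h ** u) * Fp p (h ** v) - corr p u v) = 0"
   unfolding pmean_diff using prime_gt_0_nat[OF that] by (simp add: pmean_const corr_def)
  then show ?thesis using pmean_Fp_shift[OF that cu(1)] pmean_Fp_shift[OF that cu(2)]
   unfolding \<psi>_def by (cases "p \<in> D \<inter> D'"; cases "p \<in> D") simp_all
 qed
 have var: "pmean p (%h. (\<psi> p h)^2) <= 4 / p" if p: "prime p" for p
 proof (cases "p \<in> ?I")
  case True
  have "pmean p (%h. (Fp p (h ** u) * Fp p (h ** v) - corr p u v)^2)
    = pmean p (%h. (Fp p (h ** u) * Fp p (h ** v))^2 - (2 * corr p u v) * (Fp p (h ** u) * Fp p (h ** v)) + (corr p u v)^2)"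
   by (rule arg_cong[where f="pmean p"]) (auto simp: power2_diff fun_eq_iff)
  also have "... = pmean p (%h. (Fp p (h ** u) * Fp p (h ** v))^2) - (2 * corr p u v) * corr p u v + (corr p u v)^2"
   using prime_gt_0_nat[OF p] by (simp only: pmean_add pmean_diff pmean_cmult pmean_const corr_def[symmetric])
  also have "... <= pmean p (%h. (Fp p (h ** u) * Fp p (h ** v))^2)" by (simp add: power2_eq_square)
  also have "... <= pmean p (%h. (Fp p (h ** u))^2)"
  proof (rule pmean_mono)
   fix h
   have "(Fp p (h ** v))^2 <= 1" using Fp_abs_le_1[OF p, of "h ** v"] by (simp add: abs_square_le_1)
   then have "(Fp p (h ** u))^2 * (Fp p (h ** v))^2 <= (Fp p (h ** u))^2 * 1" by (rule mult_left_mono) simp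
   then show "(Fp p (h ** u) * Fp p (h ** v))^2 <= (Fp p (h ** u))^2" by (simp add: power_mult_distrib)
  qed
  also have "... <= 4 / p" by (rule pmean_Fp_square_le[OF p cu(1)])
  finally show ?thesis using True by (simp add: \<psi>_def)
 next
  case False
  then show ?thesis using pmean_Fp_square_le[OF p cu(1)] pmean_Fp_square_le[OF p cu(2)]
   unfolding \<psi>_def by (cases "p \<in> D"; cases "p \<in> D'") simp_all
 qed
 have Q0: "Q >= 0" using Q(1) by (meson of_nat_0_le_iff order_trans)
 have M: "\<bar>SUM w:blocks A \<tau> n. PROD p:K \<union> symdiff D D'. \<psi> p (word_matrix w)\<bar>
   <= c * ((PROD p:K. mixw p) * (PROD p:D - D'. mixw p) * (PROD p:D' - D. mixw p))" if K: "K \<subseteq> ?I" for K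
 proof -
  let ?E = "K \<union> symdiff D D'"
  have fK: "finite K" using K D(1) finite_subset by blast
  have fE: "finite ?E" using fK D(1,2) by (simp add: symdiff_def)
  have sub: "?E \<subseteq> D \<union> D'" using K by (auto simp: symdiff_def)
  have pE: "!!p. p \<in> ?E ==> prime p" using D(3) sub by blast
  have "\<Prod>?E <= \<Prod>(D \<union> D')" using D by (intro prod_prime_le sub) auto
  also have "... <= \<Prod>D * \<Prod>D'"
  proof -
   have "\<Prod>(D \<union> D') = \<Prod>D * \<Prod>(D' - D)" using prod.union_disjoint[of D "D' - D" "%x. x"] D by auto
   also have "... <= \<Prod>D * \<Prod>D'" using D by (intro mult_left_mono prod_prime_le) auto
   finally show ?thesis .
  qed
  finally have "real (\<Prod>?E) <= real (\<Prod>D * \<Prod>D')" by (simp only: of_nat_le_iff)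
  also have "... <= Q * Q" using Q Q0 by (simp only: of_nat_mult) (intro mult_mono, simp_all add: prod_nonneg)
  finally have "real (\<Prod>?E) powr (16/3) * b ^ 4 <= (Q * Q) powr (16/3) * b ^ 4"
   by (intro mult_right_mono powr_mono2) (auto simp: b prod_nonneg)
  then have n': "real (\<Prod>?E) powr (16/3) * b ^ 4 <= b ^ n" using n by linarith
  have "\<bar>SUM w:blocks A \<tau> n. PROD p:?E. \<psi> p (word_matrix w ** mat 1)\<bar>
    <= 2 * b ^ (2 * n) * 16 ^ card ?E * (812 * real Dv * b ^ 3)^2 * real (\<Prod>?E) powr (- 4/3)"
   by (rule block_mixing[OF fE pE _ per mean var \<tau> b n' Dv]) (auto simp: pE det_2)
  also have "... = c * (PROD p:?E. mixw p)"
  proof -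
   have mx: "(PROD p:?E. mixw p) = 16 ^ card ?E * real (\<Prod>?E) powr (- 4/3)" by (rule prod_mixw) (rule pE)
   show ?thesis unfolding mx c by (simp only: mult_ac)
  qed
  also have "(PROD p:?E. mixw p) = (PROD p:K. mixw p) * ((PROD p:D - D'. mixw p) * (PROD p:D' - D. mixw p))"
   unfolding symdiff_def using K fK D(1,2)
   by (subst prod.union_disjoint, simp_all, blast, subst prod.union_disjoint) auto
  finally show ?thesis by (simp add: mult.assoc)
 qed
 have "(SUM w:blocks A \<tau> n. FD D (word_matrix w ** u) * FD D' (word_matrix w ** v)) =
   (SUM w:blocks A \<tau> n. SUM K:Pow ?I. (PROD p:?I - K. corr p u v) * (PROD p:K \<union> symdiff D D'. \<psi> p (word_matrix w)))"
  unfolding \<psi>_def by (intro sum.cong refl FD_product_expand D)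
 also have "... = (SUM K:Pow ?I. (PROD p:?I - K. corr p u v) * (SUM w:blocks A \<tau> n. PROD p:K \<union> symdiff D D'. \<psi> p (word_matrix w)))"
  by (subst sum.swap) (simp add: sum_distrib_left)
 finally have "\<bar>SUM w:blocks A \<tau> n. FD D (word_matrix w ** u) * FD D' (word_matrix w ** v)\<bar> <=
   (SUM K:Pow ?I. \<bar>(PROD p:?I - K. corr p u v) * (SUM w:blocks A \<tau> n. PROD p:K \<union> symdiff D D'. \<psi> p (word_matrix w))\<bar>)"
  by (simp only: sum_abs)
 also have "... <= (SUM K:Pow ?I. (PROD p:?I - K. \<bar>corr p u v\<bar>) * (c * ((PROD p:K. mixw p) * (PROD p:D - D'. mixw p) * (PROD p:D' - D. mixw p))))"
  unfolding abs_mult abs_prod by (intro sum_mono mult_left_mono M prod_nonneg) auto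
 also have "... = c * (SUM K:Pow ?I. (PROD p:?I - K. \<bar>corr p u v\<bar>) * ((PROD p:K. mixw p) * (PROD p:D - D'. mixw p) * (PROD p:D' - D. mixw p)))"
  by (simp add: sum_distrib_left mult_ac)
 finally show ?thesis .
qed

lemma sum_Pow_prod: "finite P ==> (SUM J:Pow P. PROD p:J. w p) = (PROD p:P. 1 + (w p :: real))"
 using prod_add[of P w "%_. 1"] by (simp add: add.commute)

text \<open>The four sets in the summand determine (D, D', K). Letting them range independently over
  all subsets, without disjointness, only adds nonnegative terms and makes the sum a
  product.\<close>

lemma triple_sum_le:
 fixes g k e e' :: "nat set => real"
 assumes P: "finite P" and S: "S \<subseteq> Pow P" "S' \<subseteq> Pow P"
  and nn: "!!J. g J >= 0" "!!J. k J >= 0" "!!J. e J >= 0" "!!J. e' J >= 0"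
 shows "(SUM D:S. SUM D':S'. SUM K:Pow (D \<inter> D'). g (D \<inter> D' - K) * (k K * e (D - D') * e' (D' - D)))
   <= (SUM J:Pow P. g J) * (SUM J:Pow P. k J) * (SUM J:Pow P. e J) * (SUM J:Pow P. e' J)"
proof -
 have fS: "finite S" "finite S'" using finite_subset[OF S(1)] finite_subset[OF S(2)] P by simp_all
 have fD: "finite (Pow (D \<inter> D'))" if "D \<in> S" for D D'
 proof -
  have "D \<inter> D' \<subseteq> P" using that S(1) by auto
  then show ?thesis using finite_subset[of "D \<inter> D'" P] P by blast
 qed
 define X where "X = (SIGMA D:S. SIGMA D':S'. Pow (D \<inter> D'))"
 define f where "f = (%(D, D', K). (D \<inter> D' - K, K, D - D', D' - (D::nat set)))"
 define G where "G = (%(J, K, E, E'). g J * (k K * e E * e' E'))"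
 have "(SUM D:S. SUM D':S'. SUM K:Pow (D \<inter> D'). g (D \<inter> D' - K) * (k K * e (D - D') * e' (D' - D)))
   = (SUM D:S. SUM (D',K):(SIGMA D':S'. Pow (D \<inter> D')). g (D \<inter> D' - K) * (k K * e (D - D') * e' (D' - D)))"
  by (intro sum.cong refl sum.Sigma) (use fS fD in auto)
 also have "... = (SUM x:X. G (f x))"
  unfolding X_def by (subst sum.Sigma) (use fS fD in \<open>auto simp: G_def f_def case_prod_unfold\<close>)
 also have "... = (SUM y:f ` X. G y)"
 proof -
  have "inj_on f X"
  proof (rule inj_onI)
   fix x y assume xy: "x \<in> X" "y \<in> X" "f x = f y"
   obtain D D' K where x: "x = (D,D',K)" by (metis prod_cases3)
   obtain C C' L where y: "y = (C,C',L)" by (metis prod_cases3)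
   have K: "K \<subseteq> D \<inter> D'" "L \<subseteq> C \<inter> C'" using xy x y by (auto simp: X_def)
   have e: "D \<inter> D' - K = C \<inter> C' - L" "K = L" "D - D' = C - C'" "D' - D = C' - C" using xy(3) x y by (auto simp: f_def)
   have "D \<inter> D' = C \<inter> C'" using K e by blast
   then have "D = C" "D' = C'" using e by blast+
   then show "x = y" using x y e by simp
  qed
  then show ?thesis by (simp add: sum.reindex)
 qed
 also have "... <= (SUM y:Pow P \<times> Pow P \<times> Pow P \<times> Pow P. G y)"
 proof (rule sum_mono2)
  show "f ` X \<subseteq> Pow P \<times> Pow P \<times> Pow P \<times> Pow P"
  proof (rule image_subsetI)
   fix x assume x: "x \<in> X"
   obtain D D' K where xx: "x = (D,D',K)" by (metis prod_cases3)
   have "D \<subseteq> P" "D' \<subseteq> P" "K \<subseteq> D \<inter> D'" using x S unfolding xx X_def by blast+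
   then show "f x \<in> Pow P \<times> Pow P \<times> Pow P \<times> Pow P" unfolding xx f_def by auto
  qed
 qed (use P nn in \<open>auto simp: G_def\<close>)
 also have "... = (SUM J:Pow P. g J * ((SUM K:Pow P. k K * ((SUM E:Pow P. e E * (SUM E':Pow P. e' E'))))))"
  by (simp add: G_def sum.cartesian_product[symmetric] sum_distrib_left mult.assoc)
 also have "... = (SUM J:Pow P. g J) * (SUM J:Pow P. k J) * (SUM J:Pow P. e J) * (SUM J:Pow P. e' J)"
  by (simp add: sum_distrib_right[symmetric] mult.assoc)
 finally show ?thesis .
qed

lemma prod_split_inter:
 fixes f :: "nat => real"
 assumes "finite D" "K \<subseteq> D \<inter> D'"
 shows "prod f D = prod f (D \<inter> D' - K) * prod f K * prod f (D - D')"
proof -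
 have K: "finite K" using assms finite_subset by blast
 have "D = (D \<inter> D' - K) \<union> (K \<union> (D - D'))" using assms(2) by blast
 then have "prod f D = prod f ((D \<inter> D' - K) \<union> (K \<union> (D - D')))" by simp
 also have "... = prod f (D \<inter> D' - K) * prod f (K \<union> (D - D'))"
  by (rule prod.union_disjoint) (use assms K in auto)
 also have "prod f (K \<union> (D - D')) = prod f K * prod f (D - D')"
  by (rule prod.union_disjoint) (use assms K in auto)
 finally show ?thesis by (simp only: mult.assoc)
qed

lemma weighted_split:
 fixes l m :: "nat => real"
 assumes "finite D" "finite D'" "K \<subseteq> D \<inter> D'"
 shows "B ^ card D * B ^ card D' * prod l D *
   (prod a (D \<inter> D' - K) * (prod m K * prod m (D - D') * prod m (D' - D))) =
  (PROD p:D \<inter> D' - K. B^2 * a p * l p) * ((PROD p:K. B^2 * m p * l p) *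
   (PROD p:D - D'. B * m p * l p) * (PROD p:D' - D. B * m p))"
proof -
 have "B ^ card D = (PROD p:D. B)" "B ^ card D' = (PROD p:D'. B)" by simp_all
 moreover have "(PROD p:D. B) = (PROD p:D \<inter> D' - K. B) * (PROD p:K. B) * (PROD p:D - D'. B)"
  by (rule prod_split_inter) (use assms in auto)
 moreover have "(PROD p:D'. B) = (PROD p:D \<inter> D' - K. B) * (PROD p:K. B) * (PROD p:D' - D. B)"
  using prod_split_inter[of D' K D "%_. B"] assms by (simp add: Int_commute)
 moreover have "prod l D = prod l (D \<inter> D' - K) * prod l K * prod l (D - D')"
  by (rule prod_split_inter) (use assms in auto)
 ultimately show ?thesis unfolding prod.distrib power2_eq_square by (simp only: mult_ac)
qed

text \<open>The weights \<open>l\<close> and \<open>s\<close> are Rankin's trick: a lower bound for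
  the size of D is traded for a factor l p at each of its primes. Then D and D' may range over all
  subsets, and Euler products result for the four roles of a prime: common and absorbed in the
  correlation, common and mixed, only in D, only in D'.\<close>

lemma two_point_bound:
 fixes Dv :: nat and u v :: "int^2^2"
 assumes P: "finite P" "!!p. p \<in> P ==> prime p" and DD: "DD \<subseteq> Pow P"
  and uv: "det u = 1" "det v = 1"
  and Q: "!!D. D \<in> DD ==> real (\<Prod>D) <= Q"
  and \<tau>: "\<tau> >= 2" and b: "b = real (bsize A \<tau>)"
  and n: "(Q * Q) powr (16/3) * b ^ 4 <= b ^ n"
  and Dv: "!!N. N ~= 0 ==> real_of_int \<bar>N\<bar> <= 7 * (b ^ n) ^ 4 ==> card {d::int. d dvd N} <= Dv" "Dv >= 1"
  and c: "c = 2 * b ^ (2 * n) * (812 * real Dv * b ^ 3)^2"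
  and C: "!!D. D \<in> DD ==> \<bar>C D\<bar> <= c1 * B ^ card D" and B: "B >= 0" "c1 >= 0"
  and l: "!!D. D \<in> DD ==> 1 <= s * prod l D" "!!p. l p >= 0" "s >= 0"
 shows "\<bar>SUM w:blocks A \<tau> n. (SUM D:DD. C D * FD D (word_matrix w ** u)) * (SUM D:DD. C D * FD D (word_matrix w ** v))\<bar>
  <= c * c1^2 * s * ((PROD p:P. 1 + B^2 * \<bar>corr p u v\<bar> * l p) * (PROD p:P. 1 + B^2 * mixw p * l p) *
    (PROD p:P. 1 + B * mixw p * l p) * (PROD p:P. 1 + B * mixw p))"
proof -
 define S where "S = (%D D'. SUM w:blocks A \<tau> n. FD D (word_matrix w ** u) * FD D' (word_matrix w ** v))"
 define G where "G = (%D D'. (SUM K:Pow (D \<inter> D'). (PROD p:D \<inter> D' - K. \<bar>corr p u v\<bar>) *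
   ((PROD p:K. mixw p) * (PROD p:D - D'. mixw p) * (PROD p:D' - D. mixw p))))"
 define H where "H = (%D D'. (SUM K:Pow (D \<inter> D'). (PROD p:D \<inter> D' - K. B^2 * \<bar>corr p u v\<bar> * l p) *
   ((PROD p:K. B^2 * mixw p * l p) * (PROD p:D - D'. B * mixw p * l p) * (PROD p:D' - D. B * mixw p))))"
 have c0: "c >= 0" using b by (simp add: c)
 have mix0: "mixw p >= 0" for p by (simp add: mixw_def)
 have fD: "finite D" "D \<subseteq> P" if "D \<in> DD" for D using that DD P(1) finite_subset[of D P] by auto
 have S_le: "\<bar>S D D'\<bar> <= c * G D D'" if "D \<in> DD" "D' \<in> DD" for D D'
  unfolding S_def G_def
  by (rule pair_sum_bound[OF fD(1)[OF that(1)] fD(1)[OF that(2)] _ uv Q[OF that(1)] Q[OF that(2)] \<tau> b n Dv c])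
   (use fD(2)[OF that(1)] fD(2)[OF that(2)] P(2) in auto)
 have G0: "G D D' >= 0" for D D' unfolding G_def by (intro sum_nonneg mult_nonneg_nonneg prod_nonneg) (auto simp: mix0)
 have GH: "B ^ card D * B ^ card D' * G D D' <= s * H D D'" if D: "D \<in> DD" "D' \<in> DD" for D D'
 proof -
  have BG: "B ^ card D * B ^ card D' * G D D' >= 0" using B G0 by (intro mult_nonneg_nonneg) auto
  have "B ^ card D * B ^ card D' * G D D' * 1 <= B ^ card D * B ^ card D' * G D D' * (s * prod l D)"
   using l(1)[OF D(1)] BG by (rule mult_left_mono)
  also have "... = s * (B ^ card D * B ^ card D' * prod l D * G D D')" by (simp only: mult_ac)
  also have "B ^ card D * B ^ card D' * prod l D * G D D' = H D D'"
   unfolding G_def H_def sum_distrib_left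
   by (rule sum.cong[OF refl], rule weighted_split) (use fD D in auto)
  finally show ?thesis by simp
 qed
 have "(SUM w:blocks A \<tau> n. (SUM D:DD. C D * FD D (word_matrix w ** u)) * (SUM D:DD. C D * FD D (word_matrix w ** v)))
   = (SUM w:blocks A \<tau> n. SUM D:DD. SUM D':DD. (C D * FD D (word_matrix w ** u)) * (C D' * FD D' (word_matrix w ** v)))"
  by (rule sum.cong[OF refl]) (rule sum_product)
 also have "... = (SUM D:DD. SUM w:blocks A \<tau> n. SUM D':DD. (C D * FD D (word_matrix w ** u)) * (C D' * FD D' (word_matrix w ** v)))"
  by (rule sum.swap)
 also have "... = (SUM D:DD. SUM D':DD. SUM w:blocks A \<tau> n. (C D * FD D (word_matrix w ** u)) * (C D' * FD D' (word_matrix w ** v)))"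
  by (rule sum.cong[OF refl]) (rule sum.swap)
 also have "... = (SUM D:DD. SUM D':DD. C D * C D' * S D D')"
  unfolding S_def sum_distrib_left by (rule sum.cong[OF refl])+ (simp only: mult_ac)
 finally have "\<bar>SUM w:blocks A \<tau> n. (SUM D:DD. C D * FD D (word_matrix w ** u)) * (SUM D:DD. C D * FD D (word_matrix w ** v))\<bar>
   = \<bar>SUM D:DD. SUM D':DD. C D * C D' * S D D'\<bar>" by simp
 also have "... <= (SUM D:DD. SUM D':DD. \<bar>C D * C D' * S D D'\<bar>)"
  by (rule order_trans[OF sum_abs]) (rule sum_mono, rule sum_abs)
 also have "... <= (SUM D:DD. SUM D':DD. c * c1^2 * s * H D D')"
 proof (rule sum_mono, rule sum_mono)
  fix D D' assume D: "D \<in> DD" "D' \<in> DD"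
  have "\<bar>C D * C D' * S D D'\<bar> = \<bar>C D\<bar> * \<bar>C D'\<bar> * \<bar>S D D'\<bar>" by (simp add: abs_mult)
  also have "... <= (c1 * B ^ card D) * (c1 * B ^ card D') * (c * G D D')"
   by (intro mult_mono C S_le D mult_nonneg_nonneg) (use B in auto)
  also have "... = c * c1^2 * (B ^ card D * B ^ card D' * G D D')" by (simp only: mult_ac power2_eq_square)
  also have "... <= c * c1^2 * (s * H D D')" by (intro mult_left_mono GH D) (use c0 in auto)
  finally show "\<bar>C D * C D' * S D D'\<bar> <= c * c1^2 * s * H D D'" by (simp only: mult.assoc)
 qed
 also have "... = c * c1^2 * s * (SUM D:DD. SUM D':DD. H D D')" by (simp only: sum_distrib_left)
 also have "(SUM D:DD. SUM D':DD. H D D') <= (SUM J:Pow P. PROD p:J. B^2 * \<bar>corr p u v\<bar> * l p) * (SUM J:Pow P. PROD p:J. B^2 * mixw p * l p) *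
   (SUM J:Pow P. PROD p:J. B * mixw p * l p) * (SUM J:Pow P. PROD p:J. B * mixw p)"
  unfolding H_def by (rule triple_sum_le[OF P(1) DD DD]) (intro prod_nonneg ballI mult_nonneg_nonneg, auto simp: B l mix0)+
 also have "... = (PROD p:P. 1 + B^2 * \<bar>corr p u v\<bar> * l p) * (PROD p:P. 1 + B^2 * mixw p * l p) *
    (PROD p:P. 1 + B * mixw p * l p) * (PROD p:P. 1 + B * mixw p)"
  unfolding sum_Pow_prod[OF P(1)] ..
 finally show ?thesis using c0 B l by (simp add: mult_left_mono)
qed

text \<open>Opening the square over \<omega> leaves two-point sums. For distinct \<omega> the
  correlations are of order p^-2 except at primes dividing a nonzero integer \<open>disc\<close>,
  which cost \<open>U1\<close>, and Rankin's trick gains Q0^(-1/4). For equal \<omega> the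
  correlations cost \<open>U2\<close> and nothing is gained, but only \<open>card Om\<close> such
  pairs exist.\<close>

theorem dispersion_bound:
 fixes Dv :: nat and t :: "int^2^2" and M :: int
 assumes P: "finite P" "!!p. p \<in> P ==> prime p" and DD: "DD \<subseteq> Pow P"
  and t: "det t = 1"
  and Q: "!!D. D \<in> DD ==> real (\<Prod>D) <= Q" "!!D. D \<in> DD ==> Q0 <= real (\<Prod>D)" "Q0 > 0"
  and \<tau>: "\<tau> >= 2" and b: "b = real (bsize A \<tau>)"
  and n: "(Q * Q) powr (16/3) * b ^ 4 <= b ^ n"
  and Dv: "!!N. N ~= 0 ==> real_of_int \<bar>N\<bar> <= 7 * (b ^ n) ^ 4 ==> card {d::int. d dvd N} <= Dv" "Dv >= 1"
  and c: "c = 2 * b ^ (2 * n) * (812 * real Dv * b ^ 3)^2"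
  and C: "!!D. D \<in> DD ==> \<bar>C D\<bar> <= c1 * B ^ card D" and B: "B >= 1" "c1 >= 0"
  and Om: "finite Om" "!!w. w \<in> Om ==> pword w & even (length w) & w ~= [] & KK w <= M"
  and U1: "!!\<Delta>::int. \<Delta> ~= 0 ==> \<bar>\<Delta>\<bar> <= 256 * M ^ 8 ==> (1 + 32 * B^2) ^ card {p\<in>P. int p dvd \<Delta>} <= U1"
  and U2: "(PROD p:P. 1 + 4 * B^2 / real p) <= U2"
  and H: "(PROD p:P. 1 + 32 * B^2 * real p powr (- 13/12)) <= H"
 shows "(SUM w:blocks A \<tau> n. (SUM \<omega>:Om. SUM D:DD. C D * FD D (word_matrix w ** (t ** word_matrix \<omega>)))^2)
  <= c * c1^2 * H ^ 3 * ((real (card Om))^2 * Q0 powr (- 1/4) * (H * U1) + real (card Om) * U2)"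
proof -
 define h where "h = (%p. 32 * B^2 * real p powr (- 13/12))"
 define G where "G = (%\<omega> w. SUM D:DD. C D * FD D (word_matrix w ** (t ** word_matrix \<omega>)))"
 have c0: "c >= 0" using b by (simp add: c)
 have h0: "h p >= 0" for p using B by (simp add: h_def)
 have p2: "real p >= 2" if "p \<in> P" for p using prime_ge_2_nat[OF P(2)[OF that]] by simp
 have prodh: "(PROD p:P. 1 + h p) >= 1" by (rule prod_ge_1) (simp add: h0)
 have H': "(PROD p:P. 1 + h p) <= H" using H by (simp add: h_def)
 have H1: "H >= 1" using prodh H' by linarith
 have B2: "B <= B^2" "1 <= B^2" using B self_le_power[of B 2] by (auto simp: one_le_power)
 have le_H: "(PROD p:P. 1 + f p) <= H" if "!!p. p \<in> P ==> 0 <= f p & f p <= h p" for f :: "nat => real"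
 proof -
  have "(PROD p:P. 1 + f p) <= (PROD p:P. 1 + h p)" using that by (intro prod_mono) fastforce
  then show ?thesis using H' by linarith
 qed
 \<comment> \<open>The exponent 13/12 = 4/3 - 1/4 still exceeds 1, so the Rankin weights p^(1/4)
   leave the mixing factors summable over primes.\<close>
 have w13: "mixw p * real p powr (1/4) = 16 * real p powr (- 13/12)" for p
  by (simp add: mixw_def powr_add[symmetric])
 have w1: "0 <= B^2 * mixw p * real p powr (1/4) & B\<^sup>2 * mixw p * real p powr (1/4) <= h p" for p
  using B2 by (simp add: mult.assoc w13 h_def)
 have mono14: "mixw p <= mixw p * real p powr (1/4)" "mixw p >= 0" if "p \<in> P" for p
 proof -
  show m0: "mixw p >= 0" by (simp add: mixw_def)
  have "1 <= real p powr (1/4)" using p2[OF that] by (intro ge_one_powr_ge_zero) auto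
  then show "mixw p <= mixw p * real p powr (1/4)" using mult_left_mono[OF _ m0, of 1 "real p powr (1/4)"] by simp
 qed
 have small: "0 <= B' * mixw p * l & B' * mixw p * l <= h p"
  if "p \<in> P" "0 <= B'" "B' <= B^2" "0 <= l" "l <= real p powr (1/4)" for p B' l
 proof -
  have "B' * mixw p * l <= B^2 * mixw p * real p powr (1/4)"
   using that mono14[OF that(1)] by (intro mult_mono mult_nonneg_nonneg) auto
  then show ?thesis using w1[of p] that mono14[OF that(1)] by (auto intro!: mult_nonneg_nonneg)
 qed
 have one14: "1 <= real p powr (1/4)" if "p \<in> P" for p using p2[OF that] by (intro ge_one_powr_ge_zero) auto
 have dU: "det (t ** word_matrix \<omega>) = 1" if "\<omega> \<in> Om" for \<omega>
  using Om(2)[OF that] t by (simp add: det_mul det_word_matrix)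
 have off: "\<bar>SUM w:blocks A \<tau> n. G \<omega> w * G \<omega>' w\<bar> <= c * c1^2 * Q0 powr (- 1/4) * (H * U1 * H * H * H)"
  if \<omega>: "\<omega> \<in> Om" "\<omega>' \<in> Om" "\<omega> ~= \<omega>'" for \<omega> \<omega>'
 proof -
  let ?u = "t ** word_matrix \<omega>" and ?v = "t ** word_matrix \<omega>'"
  define \<Delta> where "\<Delta> = disc (adjm (word_matrix \<omega>) ** word_matrix \<omega>')"
  note W = Om(2)[OF \<omega>(1)] Om(2)[OF \<omega>(2)]
  have \<Delta>0: "\<Delta> ~= 0" using disc_eq_0[of \<omega> \<omega>'] W \<omega>(3) by (auto simp: \<Delta>_def)
  have \<Delta>1: "\<bar>\<Delta>\<bar> <= 256 * M ^ 8" unfolding \<Delta>_def by (rule disc_adjm_bound) (use W in auto)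
  have "(0::real) <= (1 + 32 * B^2) ^ card {p\<in>P. int p dvd \<Delta>}" by auto
  then have U1p: "0 <= U1" using U1[OF \<Delta>0 \<Delta>1] by linarith
  have ad: "adjm ?u ** ?v = adjm (word_matrix \<omega>) ** word_matrix \<omega>'"
  proof -
   have "adjm ?u = adjm (word_matrix \<omega>) ** adjm t"
    unfolding adjm_def by (auto simp: mat2_eq_iff mult_nth algebra_simps)
   then have "adjm ?u ** ?v = adjm (word_matrix \<omega>) ** (adjm t ** t) ** word_matrix \<omega>'"
    by (simp only: matrix_mul_assoc)
   then show ?thesis using t by (simp add: mult_adjm(2) mat_1_mk[symmetric])
  qed
  have "\<bar>SUM w:blocks A \<tau> n. G \<omega> w * G \<omega>' w\<bar> <= c * c1^2 * Q0 powr (- 1/4) *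
    ((PROD p:P. 1 + B^2 * \<bar>corr p ?u ?v\<bar> * real p powr (1/4)) * (PROD p:P. 1 + B^2 * mixw p * real p powr (1/4)) *
    (PROD p:P. 1 + B * mixw p * real p powr (1/4)) * (PROD p:P. 1 + B * mixw p))"
   unfolding G_def
  proof (rule two_point_bound[OF P DD dU[OF \<omega>(1)] dU[OF \<omega>(2)] Q(1) \<tau> b n Dv c C])
   fix D assume D: "D \<in> DD"
   have "(PROD p:D. real p powr (1/4)) = real (\<Prod>D) powr (1/4)" by (simp add: prod_powr_distrib)
   moreover have "Q0 powr (1/4) <= real (\<Prod>D) powr (1/4)" using Q(2)[OF D] Q(3) by (intro powr_mono2) auto
   moreover have "Q0 powr (- 1/4) * Q0 powr (1/4) = 1" using Q(3) by (simp add: powr_add[symmetric])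
   ultimately show "1 <= Q0 powr (- 1/4) * (PROD p:D. real p powr (1/4))"
    using mult_left_mono[of "Q0 powr (1/4)" "real (\<Prod>D) powr (1/4)" "Q0 powr (- 1/4)"] by simp
  qed (use B in auto)
  also have "... <= c * c1^2 * Q0 powr (- 1/4) * (H * U1 * H * H * H)"
  proof (intro mult_left_mono mult_mono mult_nonneg_nonneg prod_nonneg ballI)
   let ?Z = "{p\<in>P. int p dvd \<Delta>}"
   have "(PROD p:P. 1 + B^2 * \<bar>corr p ?u ?v\<bar> * real p powr (1/4)) <= (PROD p:P. (1 + h p) * (if int p dvd \<Delta> then 1 + 32 * B^2 else 1))"
   proof (intro prod_mono conjI)
    fix p assume p: "p \<in> P"
    show "0 <= 1 + B^2 * \<bar>corr p ?u ?v\<bar> * real p powr (1/4)" by (intro add_nonneg_nonneg mult_nonneg_nonneg) auto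
    have cb: "\<bar>corr p ?u ?v\<bar> <= 32 * real (nat (gcd (int p) \<Delta>)) / (real p)^2"
     using corr_bound[OF P(2)[OF p] dU[OF \<omega>(1)] dU[OF \<omega>(2)]] unfolding ad \<Delta>_def .
    have pp: "1 / (real p)^2 = real p powr (- 2)" using p2[OF p] by (simp add: powr_minus_divide)
    show "1 + B^2 * \<bar>corr p ?u ?v\<bar> * real p powr (1/4) <= (1 + h p) * (if int p dvd \<Delta> then 1 + 32 * B^2 else 1)"
    proof (cases "int p dvd \<Delta>")
     case True
     have "gcd (int p) \<Delta> = int p" using True by (simp add: gcd_proj1_iff)
     then have "\<bar>corr p ?u ?v\<bar> <= 32 * real p powr (-1)" using cb p2[OF p] by (simp add: power2_eq_square powr_minus_divide)
     then have "\<bar>corr p ?u ?v\<bar> * real p powr (1/4) <= 32 * real p powr (-1) * real p powr (1/4)" by (intro mult_right_mono) auto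
     also have "... = 32 * real p powr (- 3/4)" by (simp only: powr_add[symmetric] mult.assoc) simp
     also have "... <= 32 * 1" using p2[OF p] powr_mono[of "-3/4" 0 "real p"] by (intro mult_left_mono) auto
     finally have "B^2 * (\<bar>corr p ?u ?v\<bar> * real p powr (1/4)) <= B^2 * 32" using B by (intro mult_left_mono) auto
     then have "1 + B^2 * \<bar>corr p ?u ?v\<bar> * real p powr (1/4) <= 1 * (1 + 32 * B^2)" by (simp add: mult.assoc)
     also have "... <= (1 + h p) * (1 + 32 * B^2)" using h0[of p] by (intro mult_right_mono) auto
     finally show ?thesis using True by simp
    next
     case False
     then have "gcd (int p) \<Delta> = 1" using P(2)[OF p] by (simp add: prime_imp_coprime coprime_imp_gcd_eq_1)
     then have "\<bar>corr p ?u ?v\<bar> <= 32 * real p powr (-2)" using cb by (simp add: pp[symmetric])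
     then have "\<bar>corr p ?u ?v\<bar> * real p powr (1/4) <= 32 * real p powr (-2) * real p powr (1/4)" by (intro mult_right_mono) auto
     also have "... = 32 * real p powr (- 7/4)" by (simp add: powr_add[symmetric])
     also have "... <= 32 * real p powr (- 13/12)" using p2[OF p] by (intro mult_left_mono powr_mono) auto
     finally have "B^2 * (\<bar>corr p ?u ?v\<bar> * real p powr (1/4)) <= B^2 * (32 * real p powr (- 13/12))" using B by (intro mult_left_mono) auto
     then show ?thesis using False by (simp add: h_def mult_ac)
    qed
   qed
   also have "... = (PROD p:P. 1 + h p) * (PROD p:P. (if int p dvd \<Delta> then 1 + 32 * B^2 else 1))" by (rule prod.distrib)
   also have "(PROD p:P. (if int p dvd \<Delta> then 1 + 32 * B^2 else 1)) = (1 + 32 * B^2) ^ card ?Z"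
    by (simp add: prod.If_cases[OF P(1)] Int_def)
   also have "(PROD p:P. 1 + h p) * (1 + 32 * B^2) ^ card ?Z <= H * U1"
    by (intro mult_mono H' U1 \<Delta>0 \<Delta>1) (use H1 B in auto)
   finally show "(PROD p:P. 1 + B^2 * \<bar>corr p ?u ?v\<bar> * real p powr (1/4)) <= H * U1" .
   show "(PROD p:P. 1 + B^2 * mixw p * real p powr (1/4)) <= H" by (rule le_H) (rule w1)
   show "(PROD p:P. 1 + B * mixw p * real p powr (1/4)) <= H" by (rule le_H, rule small) (use B B2 in auto)
   show "(PROD p:P. 1 + B * mixw p) <= H"
    by (rule le_H) (use small[of _ B 1] B B2 one14 in auto)
  qed (use H1 B c0 mono14 U1p in \<open>auto intro!: add_nonneg_nonneg mult_nonneg_nonneg\<close>)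
  finally show ?thesis .
 qed
 have diag: "\<bar>SUM w:blocks A \<tau> n. G \<omega> w * G \<omega> w\<bar> <= c * c1^2 * 1 * (U2 * H * H * H)" if \<omega>: "\<omega> \<in> Om" for \<omega>
 proof -
  let ?u = "t ** word_matrix \<omega>"
  have "(PROD p:P. 1 + 4 * B^2 / real p) >= 0" by (intro prod_nonneg) auto
  then have U2p: "0 <= U2" using U2 by linarith
  have "\<bar>SUM w:blocks A \<tau> n. G \<omega> w * G \<omega> w\<bar> <= c * c1^2 * 1 *
    ((PROD p:P. 1 + B^2 * \<bar>corr p ?u ?u\<bar> * 1) * (PROD p:P. 1 + B^2 * mixw p * 1) *
    (PROD p:P. 1 + B * mixw p * 1) * (PROD p:P. 1 + B * mixw p))"
   unfolding G_def
   by (rule two_point_bound[OF P DD dU[OF \<omega>] dU[OF \<omega>] Q(1) \<tau> b n Dv c C]) (use B in auto)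
  also have "... <= c * c1^2 * 1 * (U2 * H * H * H)"
  proof (intro mult_left_mono mult_mono mult_nonneg_nonneg prod_nonneg ballI)
   have "(PROD p:P. 1 + B^2 * \<bar>corr p ?u ?u\<bar> * 1) <= (PROD p:P. 1 + 4 * B^2 / real p)"
   proof (intro prod_mono conjI)
    fix p assume p: "p \<in> P"
    have "B^2 * \<bar>corr p ?u ?u\<bar> <= B^2 * (4 / real p)"
     by (intro mult_left_mono corr_abs_le[OF P(2)[OF p] dU[OF \<omega>] dU[OF \<omega>]]) auto
    then show "1 + B^2 * \<bar>corr p ?u ?u\<bar> * 1 <= 1 + 4 * B^2 / real p" by (simp add: mult.commute)
   qed auto
   then show "(PROD p:P. 1 + B^2 * \<bar>corr p ?u ?u\<bar> * 1) <= U2" using U2 by linarith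
   show "(PROD p:P. 1 + B^2 * mixw p * 1) <= H" by (rule le_H, rule small) (use one14 in auto)
   show "(PROD p:P. 1 + B * mixw p * 1) <= H" by (rule le_H, rule small) (use one14 B B2 in auto)
   show "(PROD p:P. 1 + B * mixw p) <= H"
    by (rule le_H) (use small[of _ B 1] B B2 one14 in auto)
  qed (use H1 B c0 mono14 U2p in \<open>auto intro!: add_nonneg_nonneg mult_nonneg_nonneg\<close>)
  finally show ?thesis .
 qed
 let ?off = "c * c1^2 * Q0 powr (- 1/4) * (H * U1 * H * H * H)" and ?di = "c * c1^2 * 1 * (U2 * H * H * H)"
 have U10: "U1 >= 0" if "\<omega> \<in> Om" for \<omega>
 proof -
  have "M >= 1" using Om(2)[OF that] KK_ge_1[of \<omega>] by linarith
  then have "M ^ 8 >= 1" by (rule one_le_power)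
  then have "(1 + 32 * B^2) ^ card {p\<in>P. int p dvd 1} <= U1" by (intro U1) auto
  moreover have "(0::real) <= (1 + 32 * B^2) ^ card {p\<in>P. int p dvd 1}" by auto
  ultimately show ?thesis by linarith
 qed
 have "(SUM w:blocks A \<tau> n. (SUM \<omega>:Om. G \<omega> w)^2) = (SUM w:blocks A \<tau> n. SUM \<omega>:Om. SUM \<omega>':Om. G \<omega> w * G \<omega>' w)"
  by (rule sum.cong[OF refl]) (simp add: power2_eq_square sum_product)
 also have "... = (SUM \<omega>:Om. SUM w:blocks A \<tau> n. SUM \<omega>':Om. G \<omega> w * G \<omega>' w)" by (rule sum.swap)
 also have "... = (SUM \<omega>:Om. SUM \<omega>':Om. SUM w:blocks A \<tau> n. G \<omega> w * G \<omega>' w)"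
  by (rule sum.cong[OF refl]) (rule sum.swap)
 also have "... <= (SUM \<omega>:Om. SUM \<omega>':Om. ?off + (if \<omega>' = \<omega> then ?di else 0))"
 proof (rule sum_mono, rule sum_mono)
  fix \<omega> \<omega>' assume \<omega>: "\<omega> \<in> Om" "\<omega>' \<in> Om"
  have o: "?off >= 0" using c0 U10[OF \<omega>(1)] H1 by (intro mult_nonneg_nonneg) auto
  show "(SUM w:blocks A \<tau> n. G \<omega> w * G \<omega>' w) <= ?off + (if \<omega>' = \<omega> then ?di else 0)"
  proof (cases "\<omega>' = \<omega>")
   case True
   then show ?thesis using o diag[OF \<omega>(1)] unfolding True if_P[OF refl] by linarith
  next
   case False
   then show ?thesis using off[OF \<omega>(1,2)] by (simp only: if_False) (metis add.right_neutral abs_le_D1)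
  qed
 qed
 also have "... = (real (card Om))^2 * ?off + real (card Om) * ?di"
  by (simp add: sum.distrib Om(1) power2_eq_square algebra_simps)
 also have "... = c * c1^2 * H ^ 3 * ((real (card Om))^2 * Q0 powr (- 1/4) * (H * U1) + real (card Om) * U2)"
  by (simp add: algebra_simps power3_eq_cube)
 finally show ?thesis unfolding G_def .
qed

section \<open>Cancellation from the equidistribution of the middle factor\<close>

lemma FD_periodic: "finite D ==> qperiodic (\<Prod>D) (FD D)"
 unfolding qperiodic_def FD_def
proof (intro allI impI prod.cong refl)
 fix g h p assume D: "finite D" "matrix_cong (\<Prod>D) g h" "p \<in> D"
 have "p dvd \<Prod>D" using D by (intro dvd_prodI)
 from matrix_cong_dvd[OF D(2) this] show "Fp p g = Fp p h" by (rule qperiodicD[OF qperiodic_Fp])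
qed

lemma sum_FD_mod:
 assumes D: "finite D" "D ~= {}" "!!p. p \<in> D ==> prime p"
  and uv: "det u = 1" "det v = 1"
 shows "(SUM h:SL2_mod (\<Prod>D). FD D (u ** h ** v)) = 0"
proof -
 have d0: "\<Prod>D > 0" using D by (auto intro!: prod_pos prime_gt_0_nat)
 obtain E where "prime_set D E" using prime_idempotents[OF D(1,3)] by blast
 then interpret ps: prime_set D E .
 have r: "ps.r = \<Prod>D" by (simp add: ps.r_def)
 have "(SUM h:SL2_mod (\<Prod>D). FD D (u ** h ** v)) = (SUM h:SL2_mod (\<Prod>D). FD D (h ** v))"
  by (rule sum_left_shift[OF qperiodic_right[OF FD_periodic[OF D(1)]] d0]) (simp add: uv)
 also have "... = (SUM h:SL2_mod (\<Prod>D). FD D h)"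
  by (rule sum_right_shift[OF FD_periodic[OF D(1)] d0]) (simp add: uv)
 also have "... = card (SL2_mod (\<Prod>D)) * (PROD p:D. pmean p (Fp p))"
  using ps.sum_prod_independent[OF order.refl, of Fp] qperiodic_Fp by (simp add: r FD_def)
 also have "(PROD p:D. pmean p (Fp p)) = 0"
 proof -
  obtain p where p: "p \<in> D" using D(2) by blast
  have "pmean p (%h. Fp p (h ** mat 1)) = 0" by (rule pmean_Fp_shift) (use D(3)[OF p] in \<open>auto simp: det_2\<close>)
  then show ?thesis using D(1) p by (intro prod_zero) auto
 qed
 finally show ?thesis by simp
qed

text \<open>The main term is a full sum of \<open>FD D\<close> over SL_2 modulo the product of D,
  which vanishes as the local factors have mean zero; the error is added up over at most d^3
  classes.\<close>

lemma equidistributed_sum_FD: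
 assumes eq: "equidistributed_set C \<Theta> K Y S" and fS: "finite S" and dS: "!!a. a \<in> S ==> det a = 1"
  and D: "finite D" "D ~= {}" "!!p. p \<in> D ==> prime p"
  and uv: "det u = 1" "det v = 1"
 shows "\<bar>SUM a:S. FD D (u ** a ** v)\<bar> <= real (\<Prod>D) ^ 3 * (\<bar>K\<bar> * (real (card S) * real (\<Prod>D) powr C * Y powr (- \<Theta>)))"
proof -
 define d where "d = \<Prod>D"
 define f where "f = (%h. FD D (u ** h ** v))"
 have d0: "d > 0" unfolding d_def using D by (auto intro!: prod_pos prime_gt_0_nat)
 have per: "qperiodic d f"
  using qperiodic_left[OF qperiodic_right[OF FD_periodic[OF D(1)], of v], of u] by (simp add: f_def d_def)
 have f1: "\<bar>f h\<bar> <= 1" for h unfolding f_def by (rule FD_abs_le_1) (rule D(3))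
 define m where "m = (%g. real (card {a\<in>S. matrix_cong d a g}))"
 have cls: "{a\<in>S. matrix_cong d a g} = {a\<in>S. rmod d a = g}" if "g \<in> SL2_mod d" for g
  using rmod_eqI[of d] rmod_SL2_id[OF that] rmod_cong(2)[of d] by (metis (mono_tags, lifting))
 have "(SUM a:S. f a) = (SUM g:SL2_mod d. SUM a:{a\<in>S. rmod d a = g}. f a)"
  by (rule sum.group[symmetric]) (use fS dS d0 in \<open>auto intro!: rmod_SL2\<close>)
 also have "... = (SUM g:SL2_mod d. m g * f g)"
 proof (rule sum.cong[OF refl])
  fix g assume g: "g \<in> SL2_mod d"
  have "(SUM a:{a\<in>S. matrix_cong d a g}. f a) = (SUM a:{a\<in>S. matrix_cong d a g}. f g)"
   by (rule sum.cong[OF refl], rule qperiodicD[OF per]) simp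
  then show "(SUM a:{a\<in>S. rmod d a = g}. f a) = m g * f g" by (simp add: cls[OF g, symmetric] m_def)
 qed
 also have "... = (SUM g:SL2_mod d. (m g - card S / card (SL2_mod d)) * f g) + card S / card (SL2_mod d) * (SUM g:SL2_mod d. f g)"
  by (simp add: left_diff_distrib sum_subtractf sum_distrib_left)
 also have "(SUM g:SL2_mod d. f g) = 0" unfolding f_def d_def by (rule sum_FD_mod[OF D uv])
 finally have "\<bar>SUM a:S. f a\<bar> = \<bar>SUM g:SL2_mod d. (m g - card S / card (SL2_mod d)) * f g\<bar>" by simp
 also have "... <= (SUM g:SL2_mod d. \<bar>(m g - card S / card (SL2_mod d)) * f g\<bar>)" by (rule sum_abs)
 also have "... <= (SUM g:SL2_mod d. \<bar>K\<bar> * (real (card S) * real d powr C * Y powr (- \<Theta>)))"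
 proof (rule sum_mono)
  fix g assume g: "g \<in> SL2_mod d"
  have "\<bar>m g - card S / card (SL2_mod d)\<bar> <= K * (real (card S) * real d powr C * Y powr (- \<Theta>))"
   using eq g d0 unfolding equidistributed_set_def m_def by auto
  also have "... <= \<bar>K\<bar> * (real (card S) * real d powr C * Y powr (- \<Theta>))" by (intro mult_right_mono) auto
  finally have 1: "\<bar>m g - card S / card (SL2_mod d)\<bar> <= \<bar>K\<bar> * (real (card S) * real d powr C * Y powr (- \<Theta>))" .
  have "\<bar>m g - card S / card (SL2_mod d)\<bar> * \<bar>f g\<bar> <= \<bar>m g - card S / card (SL2_mod d)\<bar> * 1"
   by (intro mult_left_mono f1) auto
  then show "\<bar>(m g - card S / card (SL2_mod d)) * f g\<bar> <= \<bar>K\<bar> * (real (card S) * real d powr C * Y powr (- \<Theta>))"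
   using 1 by (simp only: abs_mult mult_1_right)
 qed
 also have "... = real (card (SL2_mod d)) * (\<bar>K\<bar> * (real (card S) * real d powr C * Y powr (- \<Theta>)))" by simp
 also have "... <= real d ^ 3 * (\<bar>K\<bar> * (real (card S) * real d powr C * Y powr (- \<Theta>)))"
 proof (rule mult_right_mono)
  show "real (card (SL2_mod d)) <= real d ^ 3" using card_SL2_mod_le[of d] by (metis of_nat_le_iff of_nat_power)
 qed auto
 finally show ?thesis unfolding f_def d_def .
qed

section \<open>Sums over primes\<close>

definition primes_upto :: "real => nat set" where "primes_upto z = {p. prime p & real p <= z}"

lemma finite_primes_upto [simp]: "finite (primes_upto z)"
proof (rule finite_subset)
 show "primes_upto z \<subseteq> {..nat \<lfloor>z\<rfloor>}" by (auto simp: primes_upto_def le_nat_floor)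
qed simp

lemma prime_power_dvd_fact: "p > 0 ==> p ^ k dvd (fact (p * k) :: nat)"
proof (induction k)
 case (Suc k)
 have e: "p * Suc k = Suc (p * k + (p - 1))" using Suc.prems by (simp add: algebra_simps)
 have "p ^ k dvd (fact (p * k + (p - 1)) :: nat)"
  using Suc by (meson dvd_trans fact_dvd le_add1)
 then have "p * p ^ k dvd (p * Suc k) * fact (p * k + (p - 1))" by (intro mult_dvd_mono) simp_all
 then show ?case unfolding e by (simp add: e)
qed simp

lemma prod_coprime_dvd:
 fixes f :: "'a => nat"
 assumes "!!x. x \<in> S ==> f x dvd m" "!!x y. x \<in> S ==> y \<in> S ==> x ~= y ==> coprime (f x) (f y)"
 shows "prod f S dvd m"
 using assms
proof (induction S rule: infinite_finite_induct)
 case (insert x S)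
 have "coprime (f x) (prod f S)" using insert by (intro prod_coprime_right) auto
 then show ?case using insert by (simp add: divides_mult)
qed simp_all

text \<open>An elementary upper bound of Mertens type from p^(m div p) dividing m!. Taking m = k n
  instead of n limits the rounding: for p <= n, m div p >= m/p - 1 >= n (k - 1)/p.\<close>

lemma sum_log_prime_div_le:
 assumes "n >= 1" "k >= 2"
 shows "(SUM p:primes_upto (real n). ln (real p) / real p) <= k / (k - 1) * (ln (real n) + ln (real k))"
proof -
 let ?P = "primes_upto (real n)"
 define m where "m = k * n"
 have "(PROD p:?P. p ^ (m div p)) dvd (fact m :: nat)"
 proof (rule prod_coprime_dvd)
  fix p assume "p \<in> ?P"
  then have "p > 0" by (auto simp: primes_upto_def prime_gt_0_nat)
  then show "p ^ (m div p) dvd fact m"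
   by (meson prime_power_dvd_fact dvd_trans fact_dvd times_div_less_eq_dividend)
 next
  fix p q assume "p \<in> ?P" "q \<in> ?P" "p ~= q"
  then show "coprime (p ^ (m div p)) (q ^ (m div q))" by (auto simp: primes_upto_def primes_coprime)
 qed
 then have "(PROD p:?P. p ^ (m div p)) <= fact m" by (rule dvd_imp_le) simp
 also have "(fact m :: nat) <= m ^ m" using fact_le_power[of m, where 'a=nat] by simp
 finally have "real (PROD p:?P. p ^ (m div p)) <= real (m ^ m)" by (simp only: of_nat_le_iff)
 moreover have pos: "(PROD p:?P. real p ^ (m div p)) > 0"
  by (rule prod_pos) (auto simp: primes_upto_def prime_gt_0_nat)
 ultimately have "ln (PROD p:?P. real p ^ (m div p)) <= ln (real m ^ m)" by (subst ln_le_cancel_iff) auto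
 moreover have "ln (PROD p:?P. real p ^ (m div p)) = (SUM p:?P. real (m div p) * ln (real p))"
  by (subst ln_prod) (auto simp: primes_upto_def prime_gt_0_nat ln_realpow)
 moreover have "ln (real m ^ m) = real m * ln (real m)"
  using assms by (simp add: ln_realpow m_def)
 ultimately have 1: "(SUM p:?P. real (m div p) * ln (real p)) <= real m * ln (real m)" by simp
 have "(SUM p:?P. real n * (real k - 1) * (ln (real p) / real p)) <= (SUM p:?P. real (m div p) * ln (real p))"
 proof (rule sum_mono)
  fix p assume p: "p \<in> ?P"
  have p0: "p > 0" "real p <= real n" "p >= 1" using p by (auto simp: primes_upto_def prime_gt_0_nat Suc_le_eq)
  have "m < p * (m div p) + p" using p0 mod_less_divisor[of p m] mult_div_mod_eq[of p m] by linarith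
  then have "real m < real (p * (m div p) + p)" by (simp only: of_nat_less_iff)
  then have "real m <= real p * (real (m div p) + 1)" by (simp add: algebra_simps)
  then have "real m / real p <= real (m div p) + 1" using p0 by (simp add: divide_le_eq mult.commute)
  moreover have "1 <= real n / real p" using p0 by (simp add: le_divide_eq)
  ultimately have "real n * (real k - 1) / real p <= real (m div p)"
   by (simp add: m_def algebra_simps diff_divide_distrib)
  then have "real n * (real k - 1) / real p * ln (real p) <= real (m div p) * ln (real p)"
   using p0 by (intro mult_right_mono) auto
  then show "real n * (real k - 1) * (ln (real p) / real p) <= real (m div p) * ln (real p)" by simp
 qed
 then have "real n * (real k - 1) * (SUM p:?P. ln (real p) / real p) <= real m * ln (real m)"
  using 1 by (simp only: sum_distrib_left)
 also have "real m * ln (real m) = real n * (real k - 1) * (k / (k - 1) * (ln (real n) + ln (real k)))"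
  using assms by (simp add: m_def ln_mult)
 finally show ?thesis using assms by (subst (asm) mult_le_cancel_left_pos) auto
qed

text \<open>Large k would give any constant above 1. The choice k = 11 gives 1.1, and 0.02 absorbs
  the additive term; the numbers in the sieve are tuned to 1.12.\<close>

lemma eventually_sum_log_prime:
 "\<forall>\<^sub>F z in at_top. (SUM p:primes_upto z. ln (real p) / real p) <= 1.12 * ln z"
proof -
 have "\<forall>\<^sub>F z in at_top. 0.02 * ln z >= (1.1 * ln 11 :: real)" by real_asymp
 moreover have "\<forall>\<^sub>F z in at_top. z >= (1::real)" by (rule eventually_ge_at_top)
 ultimately show ?thesis
 proof eventually_elim
  case (elim z)
  define n where "n = nat \<lfloor>z\<rfloor>"
  have n: "n >= 1" "real n <= z" using elim by (auto simp: n_def le_nat_iff le_floor_iff)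
  have "primes_upto z = primes_upto (real n)"
  proof -
   have "real p <= z \<longleftrightarrow> p <= n" for p
    using n(2) le_nat_floor[of p z] by (fastforce simp: n_def)
   then show ?thesis by (simp add: primes_upto_def)
  qed
  then have "(SUM p:primes_upto z. ln (real p) / real p) <= 11 / (11 - 1) * (ln (real n) + ln (real 11))"
   using sum_log_prime_div_le[OF n(1), of 11] by simp
  also have "... <= 1.1 * (ln z + ln 11)" using n by simp
  finally show ?case using elim by simp
 qed
qed

lemma eventually_sum_inverse_prime:
 assumes "\<epsilon> > 0"
 shows "\<forall>\<^sub>F z in at_top. (SUM p:primes_upto z. 1 / real p) <= \<epsilon> * ln z"
proof -
 \<comment> \<open>Beyond y, 1/p <= ln p/(p ln y), and 1.12/ln y = \<epsilon>/2; the primes up to y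
   contribute a constant.\<close>
 define y where "y = exp (2.24 / \<epsilon>)"
 have y: "y > 1" "ln y = 2.24 / \<epsilon>" using assms by (auto simp: y_def)
 have "\<forall>\<^sub>F z in at_top. \<epsilon> / 2 * ln z >= card (primes_upto y)" using assms by real_asymp
 with eventually_sum_log_prime show ?thesis
 proof eventually_elim
  case (elim z)
  have "(SUM p:primes_upto z. 1 / real p) <= (SUM p:primes_upto z. (if p \<in> primes_upto y then 1 else 0) + ln (real p) / real p / ln y)"
  proof (rule sum_mono)
   fix p assume p: "p \<in> primes_upto z"
   then have p1: "real p >= 1" by (auto simp: primes_upto_def dest: prime_ge_1_nat)
   show "1 / real p <= (if p \<in> primes_upto y then 1 else 0) + ln (real p) / real p / ln y"
   proof (cases "real p <= y")
    case True
    then have "p \<in> primes_upto y" using p by (simp add: primes_upto_def)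
    moreover have "1 / real p <= 1" "ln (real p) / real p / ln y >= 0"
     using p1 y(1) by (auto intro!: divide_nonneg_nonneg)
    ultimately show ?thesis by auto
   next
    case False
    then have "ln y <= ln (real p)" using y(1) p1 by (subst ln_le_cancel_iff) auto
    then have "1 <= ln (real p) / ln y" using ln_gt_zero[OF y(1)] by (simp only: le_divide_eq if_True mult_1_left)
    then have "1 / real p <= ln (real p) / ln y / real p" using p1 by (intro divide_right_mono) auto
    then show ?thesis using y assms by (auto simp: mult.commute)
   qed
  qed
  also have "... = real (card (primes_upto z \<inter> primes_upto y)) + (SUM p:primes_upto z. ln (real p) / real p) / ln y"
   by (simp add: sum.distrib sum_divide_distrib flip: sum.inter_restrict)
  also have "... <= \<epsilon> / 2 * ln z + 1.12 * ln z / ln y"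
  proof (rule add_mono)
   have "card (primes_upto z \<inter> primes_upto y) <= card (primes_upto y)" by (intro card_mono) auto
   then show "real (card (primes_upto z \<inter> primes_upto y)) <= \<epsilon> / 2 * ln z" using elim by linarith
   show "(SUM p:primes_upto z. ln (real p) / real p) / ln y <= 1.12 * ln z / ln y"
    using elim y assms by (intro divide_right_mono) auto
  qed
  also have "... = \<epsilon> * ln z" using y assms by (simp add: field_simps)
  finally show ?case .
 qed
qed

lemma eventually_prod_prime:
 assumes "\<epsilon> > 0" "c >= 0"
 shows "\<forall>\<^sub>F z in at_top. (PROD p:primes_upto z. 1 + c / real p) <= z powr \<epsilon>"
proof -
 have "\<epsilon> / (c + 1) > 0" using assms by simp
 from eventually_sum_inverse_prime[OF this] eventually_gt_at_top[of "1::real"] show ?thesis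
 proof eventually_elim
  case (elim z)
  have "(PROD p:primes_upto z. 1 + c / real p) <= (PROD p:primes_upto z. exp (c / real p))"
   using assms by (intro prod_mono conjI exp_ge_add_one_self add_nonneg_nonneg) auto
  also have "... = exp (c * (SUM p:primes_upto z. 1 / real p))" by (simp add: exp_sum sum_distrib_left)
  also have "... <= exp (c * (\<epsilon> / (c + 1) * ln z))"
   unfolding exp_le_cancel_iff using elim(1) assms(2) by (rule mult_left_mono)
  also have "c * (\<epsilon> / (c + 1) * ln z) <= \<epsilon> * ln z"
  proof -
   have "c * (\<epsilon> / (c + 1) * ln z) = (c / (c + 1)) * (\<epsilon> * ln z)" by simp
   also have "... <= 1 * (\<epsilon> * ln z)" using assms elim by (intro mult_right_mono) auto
   finally show ?thesis by simp
  qed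
  finally show ?case using elim by (simp add: powr_def)
 qed
qed

section \<open>The sieve weights\<close>

text \<open>As \<open>chi\<close> takes the values 0 and 1, \<open>Fp\<close> satisfies a quadratic
  equation; so products of the \<open>FD\<close> stay in their span.\<close>

lemma Fp_square: "(Fp p g)^2 = (1 - 2 * rho p) * Fp p g + rho p * (1 - rho p)"
 by (cases "int p dvd disc g") (simp_all add: Fp_def chi_def power2_eq_square algebra_simps)

lemma FD_mult:
 assumes "finite I" "finite J"
 shows "FD I g * FD J g = (SUM K:Pow (I \<inter> J). (PROD p:K. 1 - 2 * rho p) * (PROD p:I \<inter> J - K. rho p * (1 - rho p)) * FD (K \<union> symdiff I J) g)"
proof -
 let ?f = "%p. Fp p g" and ?X = "I \<inter> J"
 have "FD I g = prod ?f ?X * prod ?f (I - J)" "FD J g = prod ?f ?X * prod ?f (J - I)"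
  using prod_split_inter[of I "{}" J ?f] prod_split_inter[of J "{}" I ?f] assms
  by (simp_all add: FD_def Int_commute)
 then have "FD I g * FD J g = (PROD p:?X. (Fp p g)^2) * (prod ?f (I - J) * prod ?f (J - I))"
  by (simp add: power2_eq_square prod.distrib mult_ac)
 also have "prod ?f (I - J) * prod ?f (J - I) = FD (symdiff I J) g"
  unfolding FD_def symdiff_def by (rule prod.union_disjoint[symmetric]) (use assms in auto)
 also have "(PROD p:?X. (Fp p g)^2) = (PROD p:?X. (1 - 2 * rho p) * Fp p g + rho p * (1 - rho p))"
  by (simp add: Fp_square)
 also have "... = (SUM K:Pow ?X. (PROD p:K. (1 - 2 * rho p) * Fp p g) * (PROD p:?X - K. rho p * (1 - rho p)))"
  by (rule prod_add) (use assms in auto)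
 finally show ?thesis unfolding sum_distrib_right
 proof (rule trans, intro sum.cong[OF refl])
  fix K assume K: "K \<in> Pow ?X"
  have "FD (K \<union> symdiff I J) g = FD K g * FD (symdiff I J) g"
   unfolding FD_def by (rule prod.union_disjoint) (use assms K in \<open>auto simp: symdiff_def intro: finite_subset\<close>)
  then show "(PROD p:K. (1 - 2 * rho p) * Fp p g) * (PROD p:?X - K. rho p * (1 - rho p)) * FD (symdiff I J) g
    = (PROD p:K. 1 - 2 * rho p) * (PROD p:?X - K. rho p * (1 - rho p)) * FD (K \<union> symdiff I J) g"
   by (simp add: prod.distrib FD_def mult_ac)
 qed
qed

text \<open>Shares the growth a^(card I + card J) between the primes that disappear from a product
  \<open>FD I * FD J\<close> and those that remain in it.\<close>

lemma card_symdiff_split: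
 assumes "finite I" "finite J" "K \<subseteq> I \<inter> J"
 shows "card I + card J <= 2 * card (I \<inter> J - K) + 2 * card (K \<union> symdiff I J)"
proof -
 have fK: "finite K" using assms finite_subset by blast
 have "card (A - B) + card (A \<inter> B) = card A" if "finite A" for A B :: "nat set"
  using that by (metis card_Diff_subset_Int card_Int_Diff add.commute finite_Int)
 from this[OF assms(1), of J] this[OF assms(2), of I]
 have "card I + card J = 2 * card (I \<inter> J) + card (I - J) + card (J - I)" by (simp add: Int_commute)
 moreover have "card (I \<inter> J) = card (I \<inter> J - K) + card K"
  using assms fK by (metis card_Diff_subset card_mono finite_Int le_add_diff_inverse2)
 moreover have "card (K \<union> symdiff I J) = card K + (card (I - J) + card (J - I))"
  unfolding symdiff_def using assms fK
  by (subst card_Un_disjoint, simp, simp, blast, subst card_Un_disjoint) auto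
 ultimately show ?thesis by linarith
qed

text \<open>Given D, a triple (I, J, K) producing it is determined by the vanished primes M = I Int
  J - K and by two subsets of D, namely K and I - J. The sum over M is the Euler product, the two
  subsets give 4^(card D).\<close>

lemma square_expansion:
 fixes t :: "nat set => real"
 assumes P: "finite P" "!!p. p \<in> P ==> prime p"
  and t: "!!I. I \<subseteq> P ==> \<bar>t I\<bar> <= a ^ card I" and a: "a >= 1"
 shows "\<exists>c. (\<forall>g. (SUM I:Pow P. t I * FD I g)^2 = (SUM D:Pow P. c D * FD D g)) &
   (\<forall>D\<in>Pow P. \<bar>c D\<bar> <= (PROD p:P. 1 + a^2 * rho p) * (4 * a^2) ^ card D) &
   (\<forall>D\<in>Pow P. c D ~= 0 --> (\<exists>I\<in>Pow P. \<exists>J\<in>Pow P. t I ~= 0 & t J ~= 0 & D \<subseteq> I \<union> J))"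
proof -
 define X where "X = (SIGMA I:Pow P. SIGMA J:Pow P. Pow (I \<inter> J))"
 define wt where "wt = (%(I, J, K). t I * t J * ((PROD p:K. 1 - 2 * rho p) * (PROD p:I \<inter> J - K. rho p * (1 - rho p))))"
 define dd where "dd = (%(I, J, K). K \<union> symdiff I J)"
 define c where "c = (%D. SUM x:{x\<in>X. dd x = D}. wt x)"
 have fP: "finite I" if "I \<in> Pow P" for I using that P(1) finite_subset by auto
 have fX: "finite X" unfolding X_def using P(1) fP by (intro finite_SigmaI) auto
 have XP: "I \<subseteq> P & J \<subseteq> P & K \<subseteq> I \<inter> J" if "(I, J, K) \<in> X" for I J K using that by (auto simp: X_def)
 have r01: "0 <= rho p" "rho p <= 1" if "p \<in> P" for p using rho_less_1[OF P(2)[OF that]] by auto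
 have 1: "(SUM I:Pow P. t I * FD I g)^2 = (SUM D:Pow P. c D * FD D g)" for g
 proof -
  have "(SUM I:Pow P. t I * FD I g)^2 = (SUM I:Pow P. SUM J:Pow P. (t I * t J) * (FD I g * FD J g))"
   unfolding power2_eq_square sum_product by (rule sum.cong[OF refl])+ (simp only: mult_ac)
  also have "... = (SUM I:Pow P. SUM J:Pow P. SUM K:Pow (I \<inter> J). wt (I, J, K) * FD (dd (I, J, K)) g)"
  proof (rule sum.cong[OF refl], rule sum.cong[OF refl])
   fix I J assume IJ: "I \<in> Pow P" "J \<in> Pow P"
   show "(t I * t J) * (FD I g * FD J g) = (SUM K:Pow (I \<inter> J). wt (I, J, K) * FD (dd (I, J, K)) g)"
    unfolding FD_mult[OF fP[OF IJ(1)] fP[OF IJ(2)]] sum_distrib_left wt_def dd_def by (simp add: mult.assoc)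
  qed
  also have "... = (SUM I:Pow P. SUM (J, K):(SIGMA J:Pow P. Pow (I \<inter> J)). wt (I, J, K) * FD (dd (I, J, K)) g)"
   by (rule sum.cong[OF refl], rule sum.Sigma) (use P fP in auto)
  also have "... = (SUM x:X. wt x * FD (dd x) g)"
   unfolding X_def by (subst sum.Sigma) (use P fP in \<open>auto simp: case_prod_unfold\<close>)
  also have "... = (SUM D:Pow P. SUM x:{x\<in>X. dd x = D}. wt x * FD (dd x) g)"
  proof (rule sum.group[symmetric, OF fX])
   show "dd ` X \<subseteq> Pow P"
   proof (rule image_subsetI)
    fix x assume "x \<in> X"
    moreover obtain I J K where xx: "x = (I, J, K)" by (metis prod_cases3)
    ultimately have "I \<subseteq> P" "J \<subseteq> P" "K \<subseteq> I \<inter> J" using XP by auto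
    then show "dd x \<in> Pow P" unfolding xx dd_def symdiff_def by auto
   qed
  qed (use P in auto)
  also have "... = (SUM D:Pow P. c D * FD D g)"
   unfolding c_def sum_distrib_right by (rule sum.cong[OF refl], rule sum.cong[OF refl]) auto
  finally show ?thesis .
 qed
 have 2: "\<bar>c D\<bar> <= (PROD p:P. 1 + a^2 * rho p) * (4 * a^2) ^ card D" if D: "D \<in> Pow P" for D
 proof -
  let ?X = "{x\<in>X. dd x = D}"
  define k where "k = (%(I, J, K). (I \<inter> J - K, K, I - (J :: nat set)))"
  define q where "q = (%(M, K :: nat set, E :: nat set). (PROD p:M. a^2 * rho p) * (a^2) ^ card D)"
  have wk: "\<bar>wt x\<bar> <= q (k x)" if x: "x \<in> ?X" for x
  proof -
   obtain I J K where xx: "x = (I, J, K)" by (metis prod_cases3)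
   have s: "I \<subseteq> P" "J \<subseteq> P" "K \<subseteq> I \<inter> J" "K \<union> symdiff I J = D" using x XP[of I J K] by (auto simp: xx dd_def)
   let ?M = "I \<inter> J - K"
   have "\<bar>PROD p:K. 1 - 2 * rho p\<bar> <= 1"
    unfolding abs_prod by (rule prod_le_1) (use s(1,3) r01 in \<open>auto simp: abs_le_iff subset_iff\<close>)
   moreover have "\<bar>PROD p:?M. rho p * (1 - rho p)\<bar> <= (PROD p:?M. rho p)"
    unfolding abs_prod
   proof (rule prod_mono)
    fix p assume "p \<in> ?M"
    then have "p \<in> P" using s(1) by auto
    from r01[OF this] show "0 <= \<bar>rho p * (1 - rho p)\<bar> & \<bar>rho p * (1 - rho p)\<bar> <= rho p"
     by (simp add: abs_mult mult_left_le)
   qed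
   moreover have "\<bar>t I * t J\<bar> <= (a^2) ^ card ?M * (a^2) ^ card D"
   proof -
    have "\<bar>t I * t J\<bar> <= a ^ card I * a ^ card J"
     unfolding abs_mult by (intro mult_mono t s) (use a in auto)
    also have "... = a ^ (card I + card J)" by (simp add: power_add)
    also have "... <= a ^ (2 * card ?M + 2 * card D)"
     using card_symdiff_split[of I J K] s fP by (intro power_increasing a) auto
    also have "... = (a^2) ^ card ?M * (a^2) ^ card D" by (simp add: power_add power_mult)
    finally show ?thesis .
   qed
   ultimately have "\<bar>t I * t J\<bar> * (\<bar>PROD p:K. 1 - 2 * rho p\<bar> * \<bar>PROD p:?M. rho p * (1 - rho p)\<bar>)
     <= ((a^2) ^ card ?M * (a^2) ^ card D) * (1 * (PROD p:?M. rho p))"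
    by (intro mult_mono mult_nonneg_nonneg) auto
   also have "... = q (k x)" by (simp add: q_def k_def xx prod.distrib)
   finally show ?thesis by (simp add: xx wt_def abs_mult)
  qed
  have inj: "inj_on k ?X"
  proof (rule inj_onI)
   fix x y assume xy: "x \<in> ?X" "y \<in> ?X" "k x = k y"
   obtain I J K where x: "x = (I, J, K)" by (metis prod_cases3)
   obtain I' J' K' where y: "y = (I', J', K')" by (metis prod_cases3)
   have s: "K \<subseteq> I \<inter> J" "K' \<subseteq> I' \<inter> J'" "K \<union> symdiff I J = K' \<union> symdiff I' J'"
    using xy XP[of I J K] XP[of I' J' K'] by (auto simp: x y dd_def)
   have e: "I \<inter> J - K = I' \<inter> J' - K'" "K = K'" "I - J = I' - J'" using xy(3) by (auto simp: x y k_def)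
   have ij: "I \<inter> J = I' \<inter> J'" using s e by blast
   have "symdiff I J \<inter> K = {}" "symdiff I' J' \<inter> K' = {}" using s(1,2) by (auto simp: symdiff_def)
   then have "symdiff I J = symdiff I' J'" using s(3) e(2) by blast
   then have "J - I = J' - I'" using e(3) unfolding symdiff_def by blast
   then have "I = I'" "J = J'" using ij e(3) by blast+
   then show "x = y" using e(2) x y by simp
  qed
  have "\<bar>c D\<bar> <= (SUM x:?X. q (k x))"
   unfolding c_def by (rule order_trans[OF sum_abs], rule sum_mono, rule wk)
  also have "... = (SUM y:k ` ?X. q y)" using inj by (simp add: sum.reindex)
  also have "... <= (SUM y:Pow P \<times> Pow D \<times> Pow D. q y)"
  proof (rule sum_mono2)
   show "finite (Pow P \<times> Pow D \<times> Pow D)" using P fP[OF D] by auto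
   show "k ` ?X \<subseteq> Pow P \<times> Pow D \<times> Pow D"
   proof (rule image_subsetI)
    fix x assume x: "x \<in> ?X"
    obtain I J K where xx: "x = (I, J, K)" by (metis prod_cases3)
    have "I \<subseteq> P" "K \<union> symdiff I J = D" using x XP[of I J K] by (auto simp: xx dd_def)
    then show "k x \<in> Pow P \<times> Pow D \<times> Pow D" unfolding xx k_def symdiff_def by auto
   qed
   show "0 <= q y" for y unfolding q_def by (auto simp: case_prod_unfold intro!: mult_nonneg_nonneg prod_nonneg)
  qed
  also have "... = (SUM M:Pow P. PROD p:M. a^2 * rho p) * (real (card (Pow D)) * real (card (Pow D)) * (a^2) ^ card D)"
   by (simp add: q_def sum.cartesian_product[symmetric] sum_distrib_left sum_distrib_right card_cartesian_product mult_ac)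
  also have "... = (PROD p:P. 1 + a^2 * rho p) * (4 * a^2) ^ card D"
  proof -
   have "real (card (Pow D)) * real (card (Pow D)) = 4 ^ card D"
    using fP[OF D] by (simp add: card_Pow power_mult_distrib[symmetric])
   then show ?thesis by (simp only: sum_Pow_prod[OF P(1)] power_mult_distrib)
  qed
  finally show ?thesis .
 qed
 have 3: "\<exists>I\<in>Pow P. \<exists>J\<in>Pow P. t I ~= 0 & t J ~= 0 & D \<subseteq> I \<union> J" if "c D ~= 0" for D
 proof -
  have "(SUM x:{x\<in>X. dd x = D}. wt x) ~= 0" using that by (simp add: c_def)
  then obtain x where "x \<in> {x\<in>X. dd x = D}" and wx: "wt x ~= 0"
   by (rule sum.not_neutral_contains_not_neutral)
  then have x: "x \<in> X" "dd x = D" by simp_all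
  obtain I J K where xx: "x = (I, J, K)" by (metis prod_cases3)
  have "I \<subseteq> P" "J \<subseteq> P" "D \<subseteq> I \<union> J" using x XP[of I J K] by (auto simp: xx dd_def symdiff_def)
  moreover have "t I ~= 0" "t J ~= 0" using wx by (auto simp: xx wt_def)
  ultimately show ?thesis by blast
 qed
 show ?thesis by (intro exI[of _ c] conjI allI ballI impI 1 2 3)
qed

lemma sum_Pow_remove:
 assumes "finite P" "p \<in> P"
 shows "(SUM D:Pow P. f D) = (SUM D:Pow (P - {p}). f D + (f (insert p D) :: real))"
proof -
 have P: "P = insert p (P - {p})" using assms by auto
 have "(SUM D:Pow P. f D) = (SUM D:Pow (P - {p}) \<union> insert p ` Pow (P - {p}). f D)"
  by (subst P, subst Pow_insert) simp
 also have "... = (SUM D:Pow (P - {p}). f D) + (SUM D:insert p ` Pow (P - {p}). f D)"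
  by (rule sum.union_disjoint) (use assms in auto)
 also have "(SUM D:insert p ` Pow (P - {p}). f D) = (SUM D:Pow (P - {p}). f (insert p D))"
  by (subst sum.reindex) (auto simp: inj_on_def)
 finally show ?thesis by (simp add: sum.distrib)
qed

text \<open>With chi p = rho p + Fp p only multiplication by a single \<open>Fp p\<close> matters.
  It adds p to a set without p, and by \<open>Fp_square\<close> keeps or removes a p already
  present, so the level grows by one prime at most.\<close>

lemma chi_expansion:
 assumes P: "finite P" "!!p. p \<in> P ==> prime p"
  and \<Phi>: "!!g. \<Phi> g = (SUM D:Pow P. c D * FD D g)"
  and c: "!!D. D \<in> Pow P ==> \<bar>c D\<bar> <= c1 * B ^ card D" and B: "B >= 1" "c1 >= 0"
 shows "\<exists>c'. (\<forall>g. \<Phi> g * (1 - (SUM p:P. chi p g)) = (SUM D:Pow P. c' D * FD D g)) &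
   (\<forall>D\<in>Pow P. \<bar>c' D\<bar> <= c1 * ((1 + (SUM p:P. rho p)) * (3 + B)) * (2 * B) ^ card D) &
   (\<forall>D\<in>Pow P. c' D ~= 0 --> (\<exists>D'\<in>Pow P. c D' ~= 0 & (D \<subseteq> D' \<or> (\<exists>p\<in>P. D \<subseteq> insert p D'))))"
proof -
 let ?S = "SUM p:P. rho p"
 \<comment> \<open>\<open>e p D\<close> is the coefficient of \<open>FD D\<close> in the product of
   \<open>Fp p\<close> and \<Phi>.\<close>
 define e where "e = (%p D. if p \<in> D then c (D - {p}) + (1 - 2 * rho p) * c D else rho p * (1 - rho p) * c (insert p D))"
 define c' where "c' = (%D. (1 - ?S) * c D - (SUM p:P. e p D))"
 have r01: "0 <= rho p" "rho p <= 1" if "p \<in> P" for p using rho_less_1[OF P(2)[OF that]] by auto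
 have fP: "finite D" if "D \<in> Pow P" for D using that P(1) finite_subset by auto
 have Fe: "Fp p g * \<Phi> g = (SUM D:Pow P. e p D * FD D g)" if p: "p \<in> P" for p g
 proof -
  have "Fp p g * \<Phi> g = (SUM D:Pow P. Fp p g * (c D * FD D g))" by (simp add: \<Phi> sum_distrib_left)
  also have "... = (SUM D:Pow (P - {p}). Fp p g * (c D * FD D g) + Fp p g * (c (insert p D) * FD (insert p D) g))"
   by (rule sum_Pow_remove[OF P(1) p])
  also have "... = (SUM D:Pow (P - {p}). e p D * FD D g + e p (insert p D) * FD (insert p D) g)"
  proof (rule sum.cong[OF refl])
   fix D assume D: "D \<in> Pow (P - {p})"
   have fD: "finite D" "p \<notin> D" using D P(1) finite_subset[of D P] by auto
   have "FD (insert p D) g = Fp p g * FD D g" using fD by (simp add: FD_def)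
   moreover have "Fp p g * (c (insert p D) * (Fp p g * FD D g)) =
     c (insert p D) * ((1 - 2 * rho p) * Fp p g + rho p * (1 - rho p)) * FD D g"
    unfolding Fp_square[symmetric] power2_eq_square by (simp only: mult_ac)
   ultimately show "Fp p g * (c D * FD D g) + Fp p g * (c (insert p D) * FD (insert p D) g)
     = e p D * FD D g + e p (insert p D) * FD (insert p D) g"
    using fD by (simp add: e_def algebra_simps)
  qed
  also have "... = (SUM D:Pow P. e p D * FD D g)" by (rule sum_Pow_remove[OF P(1) p, symmetric])
  finally show ?thesis .
 qed
 have 1: "\<Phi> g * (1 - (SUM p:P. chi p g)) = (SUM D:Pow P. c' D * FD D g)" for g
 proof -
  have "(SUM p:P. chi p g) = ?S + (SUM p:P. Fp p g)" by (simp add: Fp_def sum_subtractf)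
  then have "\<Phi> g * (1 - (SUM p:P. chi p g)) = (1 - ?S) * \<Phi> g - (SUM p:P. Fp p g * \<Phi> g)"
   by (simp add: algebra_simps sum_distrib_left)
  also have "(SUM p:P. Fp p g * \<Phi> g) = (SUM p:P. SUM D:Pow P. e p D * FD D g)" by (rule sum.cong[OF refl], rule Fe)
  also have "... = (SUM D:Pow P. SUM p:P. e p D * FD D g)" by (rule sum.swap)
  finally show ?thesis
   by (simp add: \<Phi> c'_def left_diff_distrib sum_subtractf sum_distrib_left sum_distrib_right mult.assoc)
 qed
 have 2: "\<bar>c' D\<bar> <= c1 * ((1 + ?S) * (3 + B)) * (2 * B) ^ card D" if D: "D \<in> Pow P" for D
 proof -
  let ?n = "card D"
  have Bn: "c1 * B ^ ?n >= 0" using B by simp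
  have S0: "?S >= 0" by (intro sum_nonneg) simp
  have "\<bar>e p D\<bar> <= (if p \<in> D then 2 else 0) * (c1 * B ^ ?n) + rho p * (B * (c1 * B ^ ?n))" if p: "p \<in> P" for p
  proof (cases "p \<in> D")
   case True
   have "\<bar>c (D - {p})\<bar> <= c1 * B ^ card (D - {p})" using D by (intro c) auto
   also have "... <= c1 * B ^ ?n" using B fP[OF D] by (intro mult_left_mono power_increasing card_mono) auto
   finally have "\<bar>c (D - {p})\<bar> <= c1 * B ^ ?n" .
   moreover have "\<bar>(1 - 2 * rho p) * c D\<bar> <= 1 * (c1 * B ^ ?n)"
    unfolding abs_mult using r01[OF p] by (intro mult_mono c D) (auto simp: abs_le_iff)
   ultimately have "\<bar>c (D - {p}) + (1 - 2 * rho p) * c D\<bar> <= 2 * (c1 * B ^ ?n)" by linarith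
   moreover have "0 <= rho p * (B * (c1 * B ^ ?n))" using B by auto
   ultimately show ?thesis using True by (simp add: e_def)
  next
   case False
   have "\<bar>c (insert p D)\<bar> <= c1 * B ^ card (insert p D)" using D p by (intro c) auto
   also have "... = B * (c1 * B ^ ?n)" using False fP[OF D] by simp
   finally have "\<bar>c (insert p D)\<bar> <= B * (c1 * B ^ ?n)" .
   moreover have "\<bar>rho p * (1 - rho p)\<bar> <= rho p" using r01[OF p] by (simp add: abs_mult mult_left_le)
   ultimately have "\<bar>rho p * (1 - rho p) * c (insert p D)\<bar> <= rho p * (B * (c1 * B ^ ?n))"
    unfolding abs_mult[of "rho p * (1 - rho p)"] by (intro mult_mono) auto
   then show ?thesis using False by (simp add: e_def)
  qed
  then have "\<bar>SUM p:P. e p D\<bar> <= (SUM p:P. (if p \<in> D then 2 else 0) * (c1 * B ^ ?n) + rho p * (B * (c1 * B ^ ?n)))"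
   by (intro order_trans[OF sum_abs] sum_mono)
  also have "... = 2 * real ?n * (c1 * B ^ ?n) + ?S * (B * (c1 * B ^ ?n))"
  proof -
   have "(SUM p:P. (if p \<in> D then 2 else 0 :: real)) = 2 * real ?n"
    using D P(1) by (simp add: sum.If_cases Int_absorb1)
   then show ?thesis by (simp add: sum.distrib sum_distrib_right[symmetric])
  qed
  finally have "\<bar>SUM p:P. e p D\<bar> <= 2 * real ?n * (c1 * B ^ ?n) + ?S * (B * (c1 * B ^ ?n))" .
  moreover have "\<bar>(1 - ?S) * c D\<bar> <= (1 + ?S) * (c1 * B ^ ?n)"
   unfolding abs_mult using S0 by (intro mult_mono c D) auto
  ultimately have "\<bar>c' D\<bar> <= (1 + ?S) * (c1 * B ^ ?n) + (2 * real ?n * (c1 * B ^ ?n) + ?S * (B * (c1 * B ^ ?n)))"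
   unfolding c'_def by linarith
  also have "... = ((1 + ?S) + 2 * real ?n + ?S * B) * (c1 * B ^ ?n)" by (simp add: algebra_simps)
  also have "... <= (((1 + ?S) * (3 + B)) * 2 ^ ?n) * (c1 * B ^ ?n)"
  proof (rule mult_right_mono[OF _ Bn])
   have n2: "real ?n <= 2 ^ ?n" using less_exp[of ?n] by (metis of_nat_le_iff of_nat_power of_nat_numeral less_imp_le)
   have one: "(1::real) <= 2 ^ ?n" by simp
   have i1: "(1 + ?S) <= (1 + ?S) * 2 ^ ?n" using mult_left_mono[OF one, of "1 + ?S"] S0 by simp
   have "1 * 2 ^ ?n <= (1 + ?S) * 2 ^ ?n" using S0 by (intro mult_right_mono) auto
   then have i2: "2 * real ?n <= 2 * ((1 + ?S) * 2 ^ ?n)" using n2 by linarith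
   have "?S * B * 1 <= (1 + ?S) * B * 2 ^ ?n" using S0 one B by (intro mult_mono mult_nonneg_nonneg) auto
   then have i3: "?S * B <= (1 + ?S) * B * 2 ^ ?n" by simp
   have *: "s * m + 2 * (s * m) + s * B * m = s * (3 + B) * m" for s m :: real by (simp add: algebra_simps)
   show "(1 + ?S) + 2 * real ?n + ?S * B <= (1 + ?S) * (3 + B) * 2 ^ ?n"
    using add_mono[OF add_mono[OF i1 i2] i3] unfolding * .
  qed
  also have "... = c1 * ((1 + ?S) * (3 + B)) * (2 * B) ^ ?n" by (simp only: power_mult_distrib mult_ac)
  finally show ?thesis .
 qed
 have 3: "\<exists>D'\<in>Pow P. c D' ~= 0 & (D \<subseteq> D' \<or> (\<exists>p\<in>P. D \<subseteq> insert p D'))" if D: "D \<in> Pow P" and nz: "c' D ~= 0" for D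
 proof (rule ccontr)
  assume no: "\<not> ?thesis"
  have "c D = 0" using no D by blast
  moreover have "e p D = 0" if p: "p \<in> P" for p
  proof -
   have "D - {p} \<in> Pow P" "D \<subseteq> insert p (D - {p})" using D by auto
   then have "c (D - {p}) = 0" using no p by meson
   moreover have "c (insert p D) = 0"
   proof -
    have "insert p D \<in> Pow P" "D \<subseteq> insert p D" using D p by auto
    then show ?thesis using no by meson
   qed
   ultimately show ?thesis using \<open>c D = 0\<close> by (simp add: e_def)
  qed
  ultimately show False using nz by (simp add: c'_def)
 qed
 show ?thesis by (intro exI[of _ c'] conjI allI ballI impI 1 2 3)
qed

section \<open>The constant term of the sieve\<close>

lemma pmean_sum: "pmean r (%h. SUM i:I. f i h) = (SUM i:I. pmean r (f i))"
 unfolding pmean_def by (subst sum.swap) (simp add: sum_divide_distrib)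

lemma pmean_prod:
 assumes P: "finite P" "!!p. p \<in> P ==> prime p" and f: "!!p. p \<in> P ==> qperiodic p (f p)"
 shows "pmean (\<Prod>P) (%h. PROD p:P. f p h) = (PROD p:P. pmean p (f p))"
proof -
 have r0: "\<Prod>P > 0" using P by (auto intro!: prod_pos prime_gt_0_nat)
 obtain E where "prime_set P E" using prime_idempotents[OF P] by blast
 then interpret ps: prime_set P E .
 have r: "ps.r = \<Prod>P" by (simp add: ps.r_def)
 show ?thesis using ps.sum_prod_independent[OF order.refl, of f] f SL2_mod_nonempty[OF r0]
  unfolding r pmean_def[of "\<Prod>P"] by simp
qed

text \<open>By independence of the primes: a prime in exactly one of M and M' contributes a factor
  of mean zero.\<close>

lemma pmean_FD_FD_chi:
 assumes P: "finite P" "!!p. p \<in> P ==> prime p" and X: "X \<subseteq> P" and M: "M \<subseteq> P - X" "M' \<subseteq> P - X"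
 shows "pmean (\<Prod>P) (%h. FD M h * FD M' h * (PROD q:X. chi q h)) =
  (if M = M' then (PROD q:X. rho q) * (PROD q:M. rho q * (1 - rho q)) else 0)"
proof -
 define f where "f = (%q h. (if q \<in> M then Fp q h else 1) * (if q \<in> M' then Fp q h else 1) * (if q \<in> X then chi q h else 1))"
 have sub: "P \<inter> M = M" "P \<inter> M' = M'" "P \<inter> X = X" using M X by auto
 have inter: "(PROD q:P. if q \<in> S then g q else 1) = (PROD q:P \<inter> S. g q)" for S and g :: "nat => real"
  by (simp add: prod.inter_restrict[OF P(1)])
 have e: "FD M h * FD M' h * (PROD q:X. chi q h) = (PROD q:P. f q h)" for h
  unfolding f_def prod.distrib inter sub FD_def ..
 have per: "qperiodic q (f q)" for q
  unfolding qperiodic_def f_def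
  using qperiodicD[OF qperiodic_Fp[of q]] qperiodicD[OF qperiodic_chi[of q]] by (intro allI impI) presburger
 have "pmean (\<Prod>P) (%h. FD M h * FD M' h * (PROD q:X. chi q h)) = (PROD q:P. pmean q (f q))"
  unfolding e by (rule pmean_prod[OF P per])
 also have "... = (if M = M' then (PROD q:X. rho q) * (PROD q:M. rho q * (1 - rho q)) else 0)"
 proof (cases "M = M'")
  case True
  have "pmean q (f q) = (if q \<in> X then rho q else 1) * (if q \<in> M then rho q * (1 - rho q) else 1)" if q: "q \<in> P" for q
  proof -
   have q0: "q > 0" using P(2)[OF q] by (rule prime_gt_0_nat)
   consider "q \<in> X" "q \<notin> M" | "q \<notin> X" "q \<in> M" | "q \<notin> X" "q \<notin> M" using M by blast
   then show ?thesis
   proof cases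
    case 1 then show ?thesis by (simp add: f_def True[symmetric] rho_def)
   next
    case 2
    have "pmean q (%h. (Fp q (h ** mat 1))^2) = rho q * (1 - rho q)"
     by (rule pmean_Fp_square) (use P(2)[OF q] in \<open>auto simp: det_2\<close>)
    then show ?thesis using 2 by (simp add: f_def True[symmetric] power2_eq_square)
   next
    case 3 then show ?thesis by (simp add: f_def True[symmetric] pmean_const q0)
   qed
  qed
  then have "(PROD q:P. pmean q (f q)) = (PROD q:P. (if q \<in> X then rho q else 1) * (if q \<in> M then rho q * (1 - rho q) else 1))"
   by (rule prod.cong[OF refl])
  then show ?thesis using True unfolding prod.distrib inter sub by simp
 next
  case False
  then obtain q where q: "q \<in> M & q \<notin> M' \<or> q \<in> M' & q \<notin> M" by blast
  then have qP: "q \<in> P" "q \<notin> X" using M by auto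
  have "pmean q (%h. Fp q (h ** mat 1)) = 0" by (rule pmean_Fp_shift) (use P(2)[OF qP(1)] in \<open>auto simp: det_2\<close>)
  then have "pmean q (f q) = 0" using q qP(2) by (auto simp: f_def)
  then show ?thesis using False qP(1) P(1) by auto
 qed
 finally show ?thesis .
qed

lemma pmean_square_chi:
 assumes P: "finite P" "!!p. p \<in> P ==> prime p" and X: "X \<subseteq> P"
 shows "pmean (\<Prod>P) (%h. (SUM M:Pow (P - X). s M * FD M h)^2 * (PROD q:X. chi q h)) =
  (PROD q:X. rho q) * (SUM M:Pow (P - X). (s M)^2 * (PROD q:M. rho q * (1 - rho q)))"
proof -
 let ?Q = "Pow (P - X)"
 have "(SUM M:?Q. s M * FD M h)^2 * (PROD q:X. chi q h)
   = (SUM M:?Q. SUM M':?Q. (s M * s M') * (FD M h * FD M' h * (PROD q:X. chi q h)))" for h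
  by (subst power2_eq_square, subst sum_product, subst sum_distrib_right, rule sum.cong[OF refl],
    subst sum_distrib_right, rule sum.cong[OF refl]) (simp only: mult_ac)
 then have "pmean (\<Prod>P) (%h. (SUM M:?Q. s M * FD M h)^2 * (PROD q:X. chi q h)) =
   (SUM M:?Q. SUM M':?Q. (s M * s M') * pmean (\<Prod>P) (%h. FD M h * FD M' h * (PROD q:X. chi q h)))"
  by (simp only: pmean_sum pmean_cmult)
 also have "... = (SUM M:?Q. SUM M':?Q. if M = M' then (s M)\<^sup>2 * ((PROD q:X. rho q) * (PROD q:M. rho q * (1 - rho q))) else 0)"
 proof (rule sum.cong[OF refl], rule sum.cong[OF refl])
  fix M M' assume M: "M \<in> ?Q" "M' \<in> ?Q"
  have e: "pmean (\<Prod>P) (%h. FD M h * FD M' h * (PROD q:X. chi q h)) =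
   (if M = M' then (PROD q:X. rho q) * (PROD q:M. rho q * (1 - rho q)) else 0)"
   by (rule pmean_FD_FD_chi[OF P X]) (use M in auto)
  show "s M * s M' * pmean (\<Prod>P) (%h. FD M h * FD M' h * (PROD q:X. chi q h)) =
    (if M = M' then (s M)\<^sup>2 * ((PROD q:X. rho q) * (PROD q:M. rho q * (1 - rho q))) else 0)"
   unfolding e by (simp add: power2_eq_square)
 qed
 also have "... = (PROD q:X. rho q) * (SUM M:?Q. (s M)^2 * (PROD q:M. rho q * (1 - rho q)))"
  using P(1) by (simp add: sum_distrib_left mult_ac)
 finally show ?thesis .
qed

text \<open>Where p divides \<open>disc\<close>, \<open>Fp p\<close> is the constant 1 - rho p, so
  the sum over I collapses to one over sets without p; orthogonality of the \<open>FD\<close> does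
  the rest.\<close>

lemma pmean_sieve:
 assumes P: "finite P" "!!p. p \<in> P ==> prime p"
 shows "pmean (\<Prod>P) (%h. (SUM I:Pow P. t I * FD I h)^2 * (1 - (SUM p:P. chi p h))) =
  (SUM I:Pow P. (t I)^2 * (PROD q:I. rho q * (1 - rho q))) -
  (SUM p:P. rho p * (SUM M:Pow (P - {p}). (t M + (1 - rho p) * t (insert p M))^2 * (PROD q:M. rho q * (1 - rho q))))"
proof -
 define v where "v = (%p M. t M + (1 - rho p) * t (insert p M))"
 let ?G = "%h. SUM I:Pow P. t I * FD I h"
 have red: "(?G h)^2 * chi p h = (SUM M:Pow (P - {p}). v p M * FD M h)^2 * (PROD q:{p}. chi q h)"
  if p: "p \<in> P" for p h
 proof (cases "int p dvd disc h")
  case True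
  have "?G h = (SUM M:Pow (P - {p}). t M * FD M h + t (insert p M) * FD (insert p M) h)"
   by (rule sum_Pow_remove[OF P(1) p])
  also have "... = (SUM M:Pow (P - {p}). v p M * FD M h)"
  proof (rule sum.cong[OF refl])
   fix M assume M: "M \<in> Pow (P - {p})"
   have "finite M" "p \<notin> M" using M P(1) finite_subset[of M P] by auto
   then have F: "FD (insert p M) h = (1 - rho p) * FD M h" using True by (simp add: FD_def Fp_def chi_def)
   show "t M * FD M h + t (insert p M) * FD (insert p M) h = v p M * FD M h"
    unfolding F v_def by (simp add: algebra_simps)
  qed
  finally show ?thesis by simp
 qed (simp add: chi_def)
 have "pmean (\<Prod>P) (%h. (?G h)^2 * (1 - (SUM p:P. chi p h))) =
   pmean (\<Prod>P) (%h. (SUM I:Pow (P - {}). t I * FD I h)^2 * (PROD q:{}. chi q h)) - (SUM p:P. pmean (\<Prod>P) (%h. (?G h)^2 * chi p h))"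
  unfolding pmean_sum[symmetric] pmean_diff[symmetric]
  by (simp add: right_diff_distrib sum_distrib_left)
 also have "... = (SUM I:Pow P. (t I)^2 * (PROD q:I. rho q * (1 - rho q))) -
   (SUM p:P. rho p * (SUM M:Pow (P - {p}). (v p M)^2 * (PROD q:M. rho q * (1 - rho q))))"
 proof (rule arg_cong2[where f = "(-)"])
  show "pmean (\<Prod>P) (%h. (SUM I:Pow (P - {}). t I * FD I h)^2 * (PROD q:{}. chi q h)) = (SUM I:Pow P. (t I)^2 * (PROD q:I. rho q * (1 - rho q)))"
   by (subst pmean_square_chi[OF P]) auto
  show "(SUM p:P. pmean (\<Prod>P) (%h. (?G h)^2 * chi p h)) = (SUM p:P. rho p * (SUM M:Pow (P - {p}). (v p M)^2 * (PROD q:M. rho q * (1 - rho q))))"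
  proof (rule sum.cong[OF refl])
   fix p assume p: "p \<in> P"
   have "pmean (\<Prod>P) (%h. (?G h)^2 * chi p h) =
    pmean (\<Prod>P) (%h. (SUM M:Pow (P - {p}). v p M * FD M h)^2 * (PROD q:{p}. chi q h))"
    by (simp only: red[OF p])
   also have "... = (PROD q:{p}. rho q) * (SUM M:Pow (P - {p}). (v p M)^2 * (PROD q:M. rho q * (1 - rho q)))"
    by (rule pmean_square_chi[OF P]) (use p in auto)
   finally show "pmean (\<Prod>P) (%h. (?G h)^2 * chi p h) = rho p * (SUM M:Pow (P - {p}). (v p M)^2 * (PROD q:M. rho q * (1 - rho q)))"
    by simp
  qed
 qed
 finally show ?thesis unfolding v_def .
qed

text \<open>Allows the constant coefficient to be computed as a mean, without tracing it through the
  two expansions.\<close>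

lemma pmean_FD_sum:
 assumes P: "finite P" "!!p. p \<in> P ==> prime p"
 shows "pmean (\<Prod>P) (%h. SUM D:Pow P. c D * FD D h) = c {}"
proof -
 have "pmean (\<Prod>P) (FD D) = (if D = {} then 1 else 0)" if D: "D \<in> Pow P" for D
  using pmean_FD_FD_chi[OF P, of "{}" D "{}"] D by (simp add: FD_def[of "{}"])
 then have "pmean (\<Prod>P) (%h. SUM D:Pow P. c D * FD D h) = (SUM D:Pow P. c D * (if D = {} then 1 else 0))"
  unfolding pmean_sum pmean_cmult by (intro sum.cong[OF refl]) simp
 also have "... = c {}" using P(1) by (simp add: if_distrib[of "times (c _)"] sum.delta' cong: if_cong)
 finally show ?thesis .
qed

definition hh :: "nat => real" where "hh p = rho p / (1 - rho p)"

text \<open>Selberg's diagonalising variables: in terms of y the combination t M + (1 - rho p) t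
  (insert p M) is a multiple of y M - y (insert p M), and both quadratic forms carry the
  multiplicative weight \<open>hh\<close>.\<close>

definition sievet :: "(nat set => real) => nat set => real" where
 "sievet y I = (- 1) ^ card I * y I / (PROD p:I. 1 - rho p)"

lemma pmean_sievet:
 assumes P: "finite P" "!!p. p \<in> P ==> prime p"
 shows "pmean (\<Prod>P) (%h. (SUM I:Pow P. sievet y I * FD I h)^2 * (1 - (SUM p:P. chi p h))) =
  (SUM I:Pow P. prod hh I * (y I)^2) -
  (SUM p:P. rho p * (SUM M:Pow (P - {p}). prod hh M * (y M - y (insert p M))^2))"
proof -
 have r1: "1 - rho p > 0" if "p \<in> P" for p using rho_less_1[OF P(2)[OF that]] by simp
 have key: "((- 1) ^ card I * v / (PROD p:I. 1 - rho p))^2 * (PROD q:I. rho q * (1 - rho q)) = prod hh I * v^2" if I: "I \<subseteq> P" for I v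
 proof -
  have pp: "(PROD p:I. 1 - rho p) > 0" by (rule prod_pos) (use I r1 in auto)
  define d where "d = (PROD p:I. 1 - rho p)"
  have h: "prod hh I = (PROD p:I. rho p) / d" by (simp add: hh_def prod_dividef d_def)
  have w: "(PROD q:I. rho q * (1 - rho q)) = (PROD p:I. rho p) * d" by (simp add: prod.distrib d_def)
  have "((- 1) ^ card I * v / d)^2 = v^2 / d^2"
   by (simp add: power_divide power_mult_distrib flip: power_mult)
  then show ?thesis using pp unfolding h w d_def[symmetric] by (simp add: power2_eq_square)
 qed
 show ?thesis
 proof (rule trans[OF pmean_sieve[OF P]], assumption, rule arg_cong2[where f = "(-)"])
  show "(SUM I:Pow P. (sievet y I)^2 * (PROD q:I. rho q * (1 - rho q))) = (SUM I:Pow P. prod hh I * (y I)^2)"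
   unfolding sievet_def by (rule sum.cong[OF refl]) (simp only: key Pow_iff)
  show "(SUM p:P. rho p * (SUM M:Pow (P - {p}). (sievet y M + (1 - rho p) * sievet y (insert p M))^2 * (PROD q:M. rho q * (1 - rho q)))) =
    (SUM p:P. rho p * (SUM M:Pow (P - {p}). prod hh M * (y M - y (insert p M))^2))"
  proof (rule sum.cong[OF refl], rule arg_cong2[where f = times, OF refl], rule sum.cong[OF refl])
   fix p M assume p: "p \<in> P" and M: "M \<in> Pow (P - {p})"
   have fM: "finite M" "p \<notin> M" "M \<subseteq> P" using M P(1) finite_subset[of M P] by auto
   have "(1 - rho p) * sievet y (insert p M) = - ((- 1) ^ card M * y (insert p M) / (PROD p:M. 1 - rho p))"
    using fM r1[OF p] by (simp add: sievet_def)
   then have "sievet y M + (1 - rho p) * sievet y (insert p M) = (- 1) ^ card M * (y M - y (insert p M)) / (PROD p:M. 1 - rho p)"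
    by (simp add: sievet_def right_diff_distrib diff_divide_distrib)
   then show "(sievet y M + (1 - rho p) * sievet y (insert p M))^2 * (PROD q:M. rho q * (1 - rho q)) = prod hh M * (y M - y (insert p M))^2"
    by (simp only: key[OF fM(3)])
  qed
 qed
qed

text \<open>With y I = prod x I the positive form would be the product \<open>M2\<close>.
  Subtracting e and truncating at 0 yields finite level at the price \<open>a2\<close>, by (X - e)^2
  >= X^2 - 2 e X. Truncation is 1-Lipschitz, so the differences in the negative form are at most
  those of prod x, and p loses at most rho p (1 - x p)^2 of \<open>M2\<close>; together this is
  \<open>a1\<close>.\<close>

lemma sieve_main_term:
 assumes P: "finite P" "!!p. p \<in> P ==> prime p"
  and x: "!!p. p \<in> P ==> 0 <= x p & x p <= 1" and e: "e >= 0"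
  and y: "!!I. y I = max 0 (prod x I - e)"
  and a1: "(SUM p:P. rho p * (1 - x p)^2) <= a1"
  and a2: "2 * e * exp (SUM p:P. hh p * (1 - x p)) <= a2" and a12: "a1 + a2 <= 1"
 shows "1 - a1 - a2 <= pmean (\<Prod>P) (%h. (SUM I:Pow P. sievet y I * FD I h)^2 * (1 - (SUM p:P. chi p h)))"
proof -
 define M1 where "M1 = (PROD p:P. 1 + hh p * x p)"
 define M2 where "M2 = (PROD p:P. 1 + hh p * (x p)^2)"
 have h0: "hh p >= 0" if "p \<in> P" for p using rho_less_1[OF P(2)[OF that]] by (simp add: hh_def)
 have ph: "prod hh I >= 0" if "I \<subseteq> P" for I by (rule prod_nonneg) (use that h0 in auto)
 have M2: "M2 >= 1" unfolding M2_def by (rule prod_ge_1) (simp add: h0)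
 have 1: "(SUM I:Pow P. prod hh I * (y I)^2) >= M2 - 2 * e * M1"
 proof -
  have "(SUM I:Pow P. prod hh I * (y I)^2) >= (SUM I:Pow P. prod hh I * ((prod x I)^2 - 2 * e * prod x I))"
  proof (intro sum_mono mult_left_mono)
   fix I assume I: "I \<in> Pow P"
   have x0: "prod x I >= 0" by (rule prod_nonneg) (use I x in auto)
   show "(prod x I)^2 - 2 * e * prod x I <= (y I)^2"
   proof (cases "prod x I >= e")
    case True
    then show ?thesis by (simp add: y max_def power2_eq_square algebra_simps)
   next
    case False
    have "prod x I * prod x I <= (2 * e) * prod x I" using False x0 e by (intro mult_right_mono) auto
    then show ?thesis using False by (simp add: y max_def power2_eq_square)
   qed
  qed (use ph in auto)
  also have "(SUM I:Pow P. prod hh I * ((prod x I)^2 - 2 * e * prod x I)) =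
    (SUM I:Pow P. PROD p:I. hh p * (x p)^2) - 2 * e * (SUM I:Pow P. PROD p:I. hh p * x p)"
   by (simp add: right_diff_distrib sum_subtractf sum_distrib_left prod.distrib prod_power_distrib mult_ac)
  finally show ?thesis unfolding sum_Pow_prod[OF P(1)] M1_def M2_def .
 qed
 have 2: "(SUM M:Pow (P - {p}). prod hh M * (y M - y (insert p M))^2) <= (1 - x p)^2 * M2" if p: "p \<in> P" for p
 proof -
  have "(SUM M:Pow (P - {p}). prod hh M * (y M - y (insert p M))^2) <= (SUM M:Pow (P - {p}). prod hh M * ((1 - x p)^2 * (prod x M)^2))"
  proof (intro sum_mono mult_left_mono)
   fix M assume M: "M \<in> Pow (P - {p})"
   have fM: "finite M" "p \<notin> M" "M \<subseteq> P" using M P(1) finite_subset[of M P] by auto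
   have "\<bar>y M - y (insert p M)\<bar> <= \<bar>prod x M - prod x (insert p M)\<bar>" by (auto simp: y max_def)
   also have "prod x M - prod x (insert p M) = (1 - x p) * prod x M" using fM by (simp add: algebra_simps)
   finally have "(y M - y (insert p M))^2 <= ((1 - x p) * prod x M)^2" by (rule abs_le_square_iff[THEN iffD1])
   then show "(y M - y (insert p M))^2 <= (1 - x p)^2 * (prod x M)^2" by (simp add: power_mult_distrib)
  qed (use ph in auto)
  also have "... = (1 - x p)^2 * (SUM M:Pow (P - {p}). PROD q:M. hh q * (x q)^2)"
   by (simp add: sum_distrib_left prod.distrib prod_power_distrib mult_ac)
  also have "(SUM M:Pow (P - {p}). PROD q:M. hh q * (x q)^2) <= (SUM M:Pow P. PROD q:M. hh q * (x q)^2)"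
  proof (rule sum_mono2)
   fix M assume "M \<in> Pow P - Pow (P - {p})"
   then show "0 <= (PROD q:M. hh q * (x q)^2)" using h0 by (intro prod_nonneg) auto
  qed (use P in auto)
  also have "... = M2" unfolding sum_Pow_prod[OF P(1)] M2_def ..
  finally show ?thesis by (simp add: mult_left_mono)
 qed
 have 3: "M1 <= exp (SUM p:P. hh p * (1 - x p)) * M2"
 proof -
  have "M1 <= (PROD p:P. exp (hh p * (1 - x p)) * (1 + hh p * (x p)^2))"
   unfolding M1_def
  proof (intro prod_mono conjI)
   fix p assume p: "p \<in> P"
   show "0 <= 1 + hh p * x p" using h0[OF p] x[OF p] by simp
   have n: "0 <= hh p * (1 - x p)" using h0[OF p] x[OF p] by simp
   have "x p <= (1 - x p) + (x p)^2"
    using zero_le_power2[of "x p - 1"] by (simp add: power2_eq_square algebra_simps)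
   then have "hh p * x p <= hh p * ((1 - x p) + (x p)^2)" using h0[OF p] by (rule mult_left_mono)
   then have "1 + hh p * x p <= 1 + hh p * (1 - x p) + hh p * (x p)^2" by (simp add: algebra_simps)
   also have "... <= (1 + hh p * (1 - x p)) * (1 + hh p * (x p)^2)"
    using mult_nonneg_nonneg[OF n, of "hh p * (x p)^2"] h0[OF p] by (simp add: distrib_left distrib_right)
   also have "... <= exp (hh p * (1 - x p)) * (1 + hh p * (x p)^2)"
    using h0[OF p] by (intro mult_right_mono exp_ge_add_one_self) auto
   finally show "1 + hh p * x p <= exp (hh p * (1 - x p)) * (1 + hh p * (x p)^2)" .
  qed
  then show ?thesis unfolding prod.distrib M2_def by (simp add: exp_sum[OF P(1)])
 qed
 have "(SUM p:P. rho p * (SUM M:Pow (P - {p}). prod hh M * (y M - y (insert p M))^2)) <= (SUM p:P. rho p * ((1 - x p)^2 * M2))"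
  by (intro sum_mono mult_left_mono 2) auto
 also have "... = (SUM p:P. rho p * (1 - x p)^2) * M2" by (simp add: sum_distrib_right mult.assoc)
 also have "... <= a1 * M2" using a1 M2 by (intro mult_right_mono) auto
 finally have 4: "(SUM p:P. rho p * (SUM M:Pow (P - {p}). prod hh M * (y M - y (insert p M))^2)) <= a1 * M2" .
 have "2 * e * M1 <= 2 * e * (exp (SUM p:P. hh p * (1 - x p)) * M2)" using 3 e by (intro mult_left_mono) auto
 also have "... = (2 * e * exp (SUM p:P. hh p * (1 - x p))) * M2" by simp
 also have "... <= a2 * M2" using a2 M2 by (intro mult_right_mono) auto
 finally have 5: "2 * e * M1 <= a2 * M2" .
 have "(1 - a1 - a2) * 1 <= (1 - a1 - a2) * M2" using a12 M2 by (intro mult_left_mono) auto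
 then have "1 - a1 - a2 <= M2 - a1 * M2 - a2 * M2" by (simp add: algebra_simps)
 then show ?thesis using 1 4 5 pmean_sievet[OF P, of y] by linarith
qed

lemma rho_uniform: "\<exists>a\<ge>2. \<forall>p. prime p --> 1 / (1 - rho p) <= a"
proof -
 define a where "a = 2 + (SUM p:primes_upto 8. 1 / (1 - rho p))"
 have pos: "0 <= 1 / (1 - rho p)" if "prime p" for p using rho_less_1[OF that] by simp
 have S0: "(SUM p:primes_upto 8. 1 / (1 - rho p)) >= 0" by (intro sum_nonneg pos) (simp add: primes_upto_def)
 have "1 / (1 - rho p) <= a" if p: "prime p" for p
 proof (cases "real p <= 8")
  case True
  then have "1 / (1 - rho p) <= (SUM p:primes_upto 8. 1 / (1 - rho p))"
   by (intro member_le_sum) (use p pos in \<open>auto simp: primes_upto_def\<close>)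
  then show ?thesis by (simp add: a_def)
 next
  case False
  have "rho p <= 4 / p" by (rule rho_le[OF p])
  also have "4 / real p <= 1 / 2" using False by (simp add: divide_le_eq)
  finally have "1 / (1 - rho p) <= 2" by (simp add: divide_le_eq)
  then show ?thesis using S0 by (simp add: a_def)
 qed
 moreover have "a >= 2" using S0 by (simp add: a_def)
 ultimately show ?thesis by blast
qed

lemma eventually_sum_hh:
 "\<forall>\<^sub>F z in at_top. (SUM p:primes_upto z. hh p * ln (real p)) <= 4.7 * ln z"
proof -
 obtain a where a: "a >= 2" "!!p. prime p ==> 1 / (1 - rho p) <= a" using rho_uniform by blast
 \<comment> \<open>From 164 on 4/(p - 4) <= 4.1/p. Then 4.1 * 1.12 = 4.592, and 0.1 for the small
   primes stays within 4.7.\<close>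
 define C where "C = (SUM p:primes_upto 164. hh p * ln (real p))"
 have "\<forall>\<^sub>F z in at_top. 0.1 * ln z >= C" by real_asymp
 with eventually_sum_log_prime show ?thesis
 proof eventually_elim
  case (elim z)
  have nn: "hh p * ln (real p) >= 0" "ln (real p) >= 0" "real p > 0" if "prime p" for p
   using rho_less_1[OF that] prime_gt_0_nat[OF that] by (auto simp: hh_def)
  have "(SUM p:primes_upto z. hh p * ln (real p)) <=
    (SUM p:primes_upto z. 4.1 * (ln (real p) / real p) + (if p \<in> primes_upto 164 then hh p * ln (real p) else 0))"
  proof (rule sum_mono)
   fix p assume "p \<in> primes_upto z"
   then have p: "prime p" by (simp add: primes_upto_def)
   show "hh p * ln (real p) <= 4.1 * (ln (real p) / real p) + (if p \<in> primes_upto 164 then hh p * ln (real p) else 0)"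
   proof (cases "real p <= 164")
    case True
    then have "p \<in> primes_upto 164" using p by (simp add: primes_upto_def)
    then show ?thesis using nn[OF p] by simp
   next
    case False
    have r: "rho p <= 4 / p" by (rule rho_le[OF p])
    have "hh p <= (4 / p) / (1 - 4 / p)"
     unfolding hh_def using r False by (intro frac_le) auto
    also have "... <= 4.1 / p" using False by (simp add: field_simps)
    finally have "hh p * ln (real p) <= 4.1 / p * ln (real p)" using nn[OF p] by (intro mult_right_mono) auto
    moreover have "(if p \<in> primes_upto 164 then hh p * ln (real p) else 0) >= 0" using nn[OF p] by simp
    ultimately show ?thesis by simp
   qed
  qed
  also have "... = 4.1 * (SUM p:primes_upto z. ln (real p) / real p) + (SUM p:primes_upto z \<inter> primes_upto 164. hh p * ln (real p))"
   by (simp add: sum.distrib sum_distrib_left sum.inter_restrict)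
  also have "(SUM p:primes_upto z \<inter> primes_upto 164. hh p * ln (real p)) <= C"
   unfolding C_def by (rule sum_mono2) (use nn in \<open>auto simp: primes_upto_def\<close>)
  finally have "(SUM p:primes_upto z. hh p * ln (real p)) <= 4.1 * (SUM p:primes_upto z. ln (real p) / real p) + C" by simp
  moreover have "4.1 * (SUM p:primes_upto z. ln (real p) / real p) <= 574 / 125 * ln z" using elim(1) by simp
  moreover have "C <= 0.1 * ln z" by (rule elim(2))
  moreover have "ln z >= 0"
  proof -
   have "C >= 0" unfolding C_def by (intro sum_nonneg nn) (simp add: primes_upto_def)
   then show ?thesis using elim(2) by simp
  qed
  ultimately show ?case by linarith
 qed
qed

lemma exp_sieve_constant: "2 * exp (- 4.8) * exp 1.88 <= (0.18 :: real)"
proof -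
 have "(1.365::real) ^ 8 <= exp 0.365 ^ 8" using exp_ge_add_one_self[of "0.365::real"] by (intro power_mono) auto
 also have "exp (0.365::real) ^ 8 = exp 2.92" by (simp flip: exp_of_nat_mult)
 finally have "exp (2.92::real) >= 12" by (simp add: power_numeral_reduce)
 moreover have "exp (- 4.8) * exp 1.88 = exp (- (2.92::real))" unfolding exp_add[symmetric] by simp
 moreover have "exp (- (2.92::real)) * exp 2.92 = 1" unfolding exp_add[symmetric] by simp
 moreover have "exp (- (2.92::real)) * 12 <= exp (- (2.92::real)) * exp 2.92" using calculation(1) by (intro mult_left_mono) auto
 ultimately show ?thesis by simp
qed

lemma one_plus_sum_le_prod:
 fixes f :: "'a => real"
 assumes "!!x. x \<in> S ==> f x >= 0" shows "1 + (SUM x:S. f x) <= (PROD x:S. 1 + f x)"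
 using assms
proof (induction S rule: infinite_finite_induct)
 case (insert x S)
 have "1 + (f x + (SUM x:S. f x)) <= (1 + f x) * (1 + (SUM x:S. f x))"
  using insert.prems by (simp add: algebra_simps sum_nonneg)
 also have "... <= (1 + f x) * (PROD x:S. 1 + f x)" using insert by (intro mult_left_mono) auto
 finally show ?case using insert.hyps by simp
qed simp_all

text \<open>The properties by which the weights are used later: expansion, growth of coefficients,
  level, main term, and the bound for G^2 on sieved matrices that converts the weighted sum into a
  count.\<close>

definition sieve_system :: "real => real => real => (int^2^2 => real) => (nat set => real) => bool" where
 "sieve_system z \<epsilon> B G c \<longleftrightarrow>
   (\<forall>g. (G g)^2 * (1 - (SUM p:primes_upto z. chi p g)) = (SUM D:Pow (primes_upto z). c D * FD D g)) &
   (\<forall>D\<in>Pow (primes_upto z). \<bar>c D\<bar> <= z powr \<epsilon> * B ^ card D) &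
   (\<forall>D\<in>Pow (primes_upto z). c D ~= 0 --> real (\<Prod>D) <= z powr 25) &
   c {} >= 1 / 10 &
   (\<forall>g. (\<forall>p\<in>primes_upto z. \<not> int p dvd disc g) --> (G g)\<^sup>2 <= z powr \<epsilon>)"

lemma sieve_weights_at:
 fixes z \<epsilon> a :: real
 assumes a: "a >= 2" "!!p. prime p ==> 1 / (1 - rho p) <= a" and B: "B = 2 * (4 * a^2)"
  and elim: "(PROD p:primes_upto z. 1 + 4 * a^2 / real p) <= z powr (\<epsilon> / 3)"
   "3 + 4 * a^2 <= z powr (\<epsilon> / 3)"
   "(SUM p:primes_upto z. hh p * ln (real p)) <= 4.7 * ln z"
   "(SUM p:primes_upto z. ln (real p) / real p) <= 1.12 * ln z"
   "1 < z" and \<epsilon>: "\<epsilon> > 0"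
 shows "\<exists>G c. sieve_system z \<epsilon> B G c"
proof -
 have "1 <= a^2" using a(1) by (intro one_le_power) simp
 then have a4: "4 * a^2 >= 1" by linarith
 have B1: "B >= 1" using a4 by (simp add: B)
 define P where "P = primes_upto z"
 have P: "finite P" "!!p. p \<in> P ==> prime p" unfolding P_def by simp (simp add: primes_upto_def)
 have pz: "real p <= z" "real p >= 2" if "p \<in> P" for p
  using that prime_ge_2_nat[of p] by (auto simp: P_def primes_upto_def)
 have lz: "ln z > 0" using elim by simp
 \<comment> \<open>With this \<theta>, y I can be nonzero only if \<theta> ln(prod I) < 4.8, that is
   below z^12. The losses are 4 * 0.4 * 0.4 * 1.12 < 0.72 and 2 exp(-4.8 + 0.4 * 4.7) < 0.18, which
   leaves 1/10.\<close>
 define \<theta> where "\<theta> = 0.4 / ln z"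
 define e where "e = exp (- 4.8 :: real)"
 define x where "x = (%p::nat. real p powr (- \<theta>))"
 define y where "y = (%I. max 0 (prod x I - e))"
 define G where "G = (%g. SUM I:Pow P. sievet y I * FD I g)"
 have e0: "e >= 0" by (simp add: e_def)
 have th: "\<theta> > 0" using lz by (simp add: \<theta>_def)
 have x01: "0 <= x p & x p <= 1" if "p \<in> P" for p
  using pz[OF that] th powr_mono[of "-\<theta>" 0 "real p"] by (simp add: x_def)
 have px: "0 <= prod x I" "prod x I <= 1" if "I \<subseteq> P" for I
  using that x01 by (auto intro!: prod_nonneg prod_le_1)
 have y01: "0 <= y I" "y I <= 1" if "I \<subseteq> P" for I
  using px[OF that] e0 by (simp_all add: y_def)
 have r: "0 < 1 - rho p" "1 / (1 - rho p) <= a" "rho p <= 4 / p" if "p \<in> P" for p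
  using rho_less_1[OF P(2)[OF that]] a(2)[OF P(2)[OF that]] rho_le[OF P(2)[OF that]] by auto
 have t: "\<bar>sievet y I\<bar> <= a ^ card I" if I: "I \<subseteq> P" for I
 proof -
  have d0: "(PROD p:I. 1 - rho p) > 0" by (rule prod_pos) (use r I in auto)
  have "\<bar>sievet y I\<bar> = y I * (PROD p:I. 1 / (1 - rho p))"
   unfolding sievet_def using d0 y01[OF I] by (simp add: abs_mult power_abs prod_dividef)
  also have "... <= 1 * (PROD p:I. a)"
   using I r y01[OF I] by (intro mult_mono prod_mono prod_nonneg conjI) (auto intro: less_imp_le)
  finally show ?thesis by simp
 qed
 from a have a1: "a >= 1" by simp
 have "\<exists>c. (\<forall>g. (G g)^2 = (SUM D:Pow P. c D * FD D g)) &
   (\<forall>D\<in>Pow P. \<bar>c D\<bar> <= (PROD p:P. 1 + a^2 * rho p) * (4 * a^2) ^ card D) &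
   (\<forall>D\<in>Pow P. c D ~= 0 --> (\<exists>I\<in>Pow P. \<exists>J\<in>Pow P. sievet y I ~= 0 & sievet y J ~= 0 & D \<subseteq> I \<union> J))" (is "Ex ?Q")
  unfolding G_def by (rule square_expansion[OF P(1) P(2) t a1])
 then obtain c0 where q: "?Q c0" by (rule exE)
 note c0 = conjunct1[OF q, THEN spec] conjunct1[OF conjunct2[OF q], THEN bspec] conjunct2[OF conjunct2[OF q], THEN bspec, THEN mp]
 define c1 where "c1 = (PROD p:P. 1 + a^2 * rho p)"
 have Pr: "(PROD p:P. 1 + a^2 * rho p) <= (PROD p:P. 1 + 4 * a^2 / real p)"
 proof (intro prod_mono conjI)
  fix p assume p: "p \<in> P"
  have "a^2 * rho p <= a^2 * (4 / p)" using r(3)[OF p] by (rule mult_left_mono) simp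
  then show "1 + a^2 * rho p <= 1 + 4 * a^2 / real p" by (simp add: mult.commute)
 qed simp
 have c1: "0 <= c1" "c1 <= z powr (\<epsilon> / 3)"
  using Pr elim(1) unfolding c1_def P_def[symmetric] by (auto intro!: prod_nonneg)
 have c0b: "!!D. D \<in> Pow P ==> \<bar>c0 D\<bar> <= c1 * (4 * a^2) ^ card D" using c0(2) by (simp add: c1_def)
 have "\<exists>c. (\<forall>g. (G g)^2 * (1 - (SUM p:P. chi p g)) = (SUM D:Pow P. c D * FD D g)) &
   (\<forall>D\<in>Pow P. \<bar>c D\<bar> <= c1 * ((1 + (SUM p:P. rho p)) * (3 + 4 * a^2)) * (2 * (4 * a^2)) ^ card D) &
   (\<forall>D\<in>Pow P. c D ~= 0 --> (\<exists>D'\<in>Pow P. c0 D' ~= 0 & (D \<subseteq> D' \<or> (\<exists>p\<in>P. D \<subseteq> insert p D'))))" (is "Ex ?Q")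
  by (rule chi_expansion[where \<Phi> = "%g. (G g)^2", OF P(1) P(2) c0(1) c0b a4 c1(1)])
 then obtain c where q': "?Q c" by (rule exE)
 note c = conjunct1[OF q', THEN spec] conjunct1[OF conjunct2[OF q'], THEN bspec, folded B] conjunct2[OF conjunct2[OF q'], THEN bspec, THEN mp]
 have Sr: "1 + (SUM p:P. rho p) <= z powr (\<epsilon> / 3)"
 proof -
  have "1 + (SUM p:P. rho p) <= (PROD p:P. 1 + rho p)"
   by (rule one_plus_sum_le_prod) simp
  also have "... <= (PROD p:P. 1 + a^2 * rho p)"
  proof (intro prod_mono conjI)
   fix p
   have "1 * rho p <= a^2 * rho p" using a power_mono[of 1 a 2] by (intro mult_right_mono) auto
   then show "1 + rho p <= 1 + a^2 * rho p" by simp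
  qed simp
  finally show ?thesis using c1(2) by (simp add: c1_def)
 qed
 have cb: "\<bar>c D\<bar> <= z powr \<epsilon> * B ^ card D" if D: "D \<in> Pow P" for D
 proof -
  have S0: "(SUM p:P. rho p) >= 0" by (intro sum_nonneg) simp
  have "c1 * ((1 + (SUM p:P. rho p)) * (3 + 4 * a^2)) <= z powr (\<epsilon> / 3) * (z powr (\<epsilon> / 3) * z powr (\<epsilon> / 3))"
   using c1 Sr elim(2) S0 a4 by (intro mult_mono mult_nonneg_nonneg) auto
  also have "... = z powr \<epsilon>" by (simp flip: powr_add)
  finally have "c1 * ((1 + (SUM p:P. rho p)) * (3 + 4 * a^2)) * B ^ card D <= z powr \<epsilon> * B ^ card D"
   using B1 by (intro mult_right_mono) auto
  then show ?thesis using c(2)[OF D] by linarith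
 qed
 have dx: "prod x I = real (\<Prod>I) powr (- \<theta>)" for I by (simp add: x_def prod_powr_distrib)
 have supp1: "real (\<Prod>I) <= z powr 12" if "I \<subseteq> P" "sievet y I ~= 0" for I
 proof -
  have "\<Prod>I > 0" by (rule prod_pos) (use that(1) P(2) prime_gt_0_nat in blast)
  then have I0: "real (\<Prod>I) > 0" by (simp only: of_nat_0_less_iff)
  have "y I ~= 0" using that by (auto simp: sievet_def)
  then have "exp (- 4.8) < real (\<Prod>I) powr (- \<theta>)" by (auto simp: y_def dx e_def max_def split: if_splits)
  also have "... = exp (- (\<theta> * ln (real (\<Prod>I))))" using I0 by (simp add: powr_def)
  finally have "\<theta> * ln (real (\<Prod>I)) < 4.8" unfolding exp_less_cancel_iff by linarith
  then have "ln (real (\<Prod>I)) < 12 * ln z" using lz by (simp add: \<theta>_def field_simps)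
  then have "exp (ln (real (\<Prod>I))) <= exp (12 * ln z)" by (simp only: exp_le_cancel_iff less_imp_le)
  then show ?thesis using elim(5) unfolding exp_ln[OF I0] by (simp add: powr_def)
 qed
 \<comment> \<open>The square of G has level 12 + 12 in powers of z, and the factor 1 - sum of chi
   adds one prime.\<close>
 have supp: "real (\<Prod>D) <= z powr 25" if D: "D \<in> Pow P" "c D ~= 0" for D
 proof -
  obtain D' p where D': "D' \<in> Pow P" "c0 D' ~= 0" "p \<in> P & D \<subseteq> insert p D' \<or> D \<subseteq> D'" using c(3)[OF D] by blast
  obtain I J where IJ: "I \<in> Pow P" "J \<in> Pow P" "sievet y I ~= 0" "sievet y J ~= 0" "D' \<subseteq> I \<union> J" using c0(3)[OF D'(1,2)] by blast
  have fin: "finite I" "finite J" "finite D'" using IJ D' P(1) finite_subset by auto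
  have ge1: "(1::nat) <= \<Prod>A" if "A \<subseteq> P" for A
   by (rule prod_ge_1) (use that P(2) prime_ge_1_nat in blast)
  have "\<Prod>D' <= \<Prod>(I \<union> J)" by (rule prod_prime_le) (use IJ fin P(2) in auto)
  also have "... <= \<Prod>I * \<Prod>J"
  proof -
   have "\<Prod>(I \<union> J) = \<Prod>I * \<Prod>(J - I)" using prod.union_disjoint[of I "J - I" "%x. x"] fin by auto
   also have "... <= \<Prod>I * \<Prod>J" using IJ fin P(2) by (intro mult_left_mono prod_prime_le) auto
   finally show ?thesis .
  qed
  finally have "real (\<Prod>D') <= real (\<Prod>I * \<Prod>J)" by (simp only: of_nat_le_iff)
  also have "... <= z powr 12 * z powr 12"
   using supp1[of I] supp1[of J] IJ by (simp only: of_nat_mult) (intro mult_mono, auto simp: prod_nonneg)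
  also have "... = z powr 24" by (simp flip: powr_add)
  finally have D24: "real (\<Prod>D') <= z powr 24" .
  have z25: "z powr 25 = z * z powr 24" using elim(5) powr_add[of z 1 24] by simp
  show ?thesis
  proof (cases "D \<subseteq> D'")
   case True
   have "real (\<Prod>D) <= real (\<Prod>D')" using prod_prime_le[of D' D] True fin D' P(2) by (auto simp del: of_nat_prod)
   also have "... <= z powr 24" by (rule D24)
   also have "... <= z powr 25" using elim(5) by (intro powr_mono) auto
   finally show ?thesis .
  next
   case False
   then have p: "p \<in> P" "D \<subseteq> insert p D'" using D'(3) by auto
   have "\<Prod>D <= \<Prod>(insert p D')" by (rule prod_prime_le) (use p fin D' P(2) in auto)
   also have "... <= p * \<Prod>D'" using fin ge1[of D'] D' prime_ge_1_nat[OF P(2)[OF p(1)]] by (cases "p \<in> D'") (auto simp: insert_absorb)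
   finally have "real (\<Prod>D) <= real p * real (\<Prod>D')" by (simp only: of_nat_le_iff of_nat_mult[symmetric])
   also have "... <= z * z powr 24" using pz[OF p(1)] D24 by (intro mult_mono) (auto simp: prod_nonneg)
   finally show ?thesis by (simp only: z25)
  qed
 qed
 have x1: "0 <= 1 - x p" "1 - x p <= \<theta> * ln (real p)" "\<theta> * ln (real p) <= 0.4" if p: "p \<in> P" for p
 proof -
  show "0 <= 1 - x p" using x01[OF p] by simp
  have "x p = exp (- (\<theta> * ln (real p)))" using pz[OF p] by (simp add: x_def powr_def)
  then show "1 - x p <= \<theta> * ln (real p)" using exp_ge_add_one_self[of "- (\<theta> * ln (real p))"] by simp
  have "ln (real p) <= ln z" using pz[OF p] by simp
  then have "\<theta> * ln (real p) <= \<theta> * ln z" using th by (intro mult_left_mono) auto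
  then show "\<theta> * ln (real p) <= 0.4" using lz by (simp add: \<theta>_def)
 qed
 have A1: "(SUM p:P. rho p * (1 - x p)^2) <= 0.72"
 proof -
  have "(SUM p:P. rho p * (1 - x p)^2) <= (SUM p:P. (1.6 * \<theta>) * (ln (real p) / real p))"
  proof (rule sum_mono)
   fix p assume p: "p \<in> P"
   have l0: "0 <= \<theta> * ln (real p)" using th pz[OF p] by simp
   have "(1 - x p)^2 <= (\<theta> * ln (real p)) * 0.4"
    unfolding power2_eq_square using x1[OF p] l0 by (intro mult_mono) auto
   then have "rho p * (1 - x p)^2 <= (4 / p) * ((\<theta> * ln (real p)) * 0.4)"
    using r(3)[OF p] by (intro mult_mono) auto
   then show "rho p * (1 - x p)^2 <= (1.6 * \<theta>) * (ln (real p) / real p)" by simp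
  qed
  also have "... = (1.6 * \<theta>) * (SUM p:P. ln (real p) / real p)" by (simp add: sum_distrib_left)
  also have "... <= (1.6 * \<theta>) * (1.12 * ln z)" using elim(4) th unfolding P_def by (intro mult_left_mono) auto
  also have "... <= 0.72" using lz by (simp add: \<theta>_def)
  finally show ?thesis .
 qed
 have A2: "2 * e * exp (SUM p:P. hh p * (1 - x p)) <= 0.18"
 proof -
  have h0: "hh p >= 0" if "p \<in> P" for p using r(1)[OF that] by (simp add: hh_def)
  have "(SUM p:P. hh p * (1 - x p)) <= (SUM p:P. hh p * (\<theta> * ln (real p)))"
   by (intro sum_mono mult_left_mono x1 h0)
  also have "... = \<theta> * (SUM p:P. hh p * ln (real p))" by (simp add: sum_distrib_left mult_ac)
  also have "... <= \<theta> * (4.7 * ln z)" using elim(3) th unfolding P_def by (intro mult_left_mono) auto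
  also have "... = 1.88" using lz by (simp add: \<theta>_def)
  finally have "exp (SUM p:P. hh p * (1 - x p)) <= exp 1.88" by (simp only: exp_le_cancel_iff)
  then have "2 * e * exp (SUM p:P. hh p * (1 - x p)) <= 2 * e * exp 1.88" using e0 by (intro mult_left_mono) auto
  also have "... <= 0.18" unfolding e_def by (rule exp_sieve_constant)
  finally show ?thesis .
 qed
 have c00: "c {} >= 1 / 10"
 proof -
  have "1 - 0.72 - 0.18 <= pmean (\<Prod>P) (%h. (G h)^2 * (1 - (SUM p:P. chi p h)))"
   unfolding G_def by (rule sieve_main_term[where x = x and e = e, OF P(1) P(2) x01 _ _ A1 A2]) (auto simp: y_def e_def)
  also have "... = c {}" unfolding c(1) by (rule pmean_FD_sum[OF P])
  finally show ?thesis by simp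
 qed
 \<comment> \<open>On sieved matrices each \<open>Fp p\<close> equals - rho p, so the signs in
   \<open>sievet\<close> cancel and G is the sum of y I prod hh I, at most the product of the 1 + hh
   p.\<close>
 have Gb: "(G g)^2 <= z powr \<epsilon>" if g: "\<forall>p\<in>P. \<not> int p dvd disc g" for g
 proof -
  have F: "sievet y I * FD I g = y I * prod hh I" if I: "I \<in> Pow P" for I
  proof -
   have "FD I g = (PROD p:I. (- 1) * rho p)"
    unfolding FD_def by (rule prod.cong[OF refl]) (use g I in \<open>auto simp: Fp_def chi_def\<close>)
   then have "FD I g = (- 1) ^ card I * (PROD p:I. rho p)" by (simp only: prod.distrib prod_constant)
   then show ?thesis by (simp add: sievet_def hh_def prod_dividef flip: power_add)
  qed
  have h0: "hh p >= 0" if "p \<in> P" for p using r(1)[OF that] by (simp add: hh_def)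
  have ph: "prod hh I >= 0" if "I \<in> Pow P" for I by (rule prod_nonneg) (use that h0 in auto)
  have "G g = (SUM I:Pow P. y I * prod hh I)" unfolding G_def by (rule sum.cong[OF refl F])
  then have "\<bar>G g\<bar> = (SUM I:Pow P. y I * prod hh I)" using ph y01 by (auto intro!: sum_nonneg abs_of_nonneg)
  also have "... <= (SUM I:Pow P. 1 * prod hh I)" using ph y01 by (intro sum_mono mult_right_mono) auto
  also have "... = (PROD p:P. 1 + hh p)" using sum_Pow_prod[OF P(1), of hh] by simp
  also have "... <= (PROD p:P. 1 + 4 * a^2 / real p)"
  proof (intro prod_mono conjI)
   fix p assume p: "p \<in> P"
   show "0 <= 1 + hh p" using h0[OF p] by simp
   have "hh p = rho p * (1 / (1 - rho p))" by (simp add: hh_def)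
   also have "... <= (4 / p) * a" using r[OF p] by (intro mult_mono) auto
   also have "... <= (4 / p) * a^2" using a self_le_power[of a 2] by (intro mult_left_mono) auto
   finally show "1 + hh p <= 1 + 4 * a^2 / real p" by simp
  qed
  also have "... <= z powr (\<epsilon> / 3)" using elim(1) by (simp add: P_def)
  finally have "\<bar>G g\<bar>\<^sup>2 <= (z powr (\<epsilon> / 3))^2" by (intro power_mono) auto
  also have "... = z powr (\<epsilon> / 3 + \<epsilon> / 3)" by (simp only: power2_eq_square powr_add)
  also have "... <= z powr \<epsilon>" using elim(5) \<epsilon> by (intro powr_mono) auto
  finally show ?thesis by simp
 qed
 show ?thesis
  by (rule exI[of _ G], rule exI[of _ c], unfold sieve_system_def P_def[symmetric], intro conjI allI ballI impI c(1) cb supp c00) (erule Gb | assumption)+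
qed

theorem sieve_weights:
 "\<exists>B\<ge>1. \<forall>\<epsilon>>0. \<forall>\<^sub>F z in at_top. \<exists>G c. sieve_system z \<epsilon> B G c"
proof -
 obtain a where a: "a >= 2" "!!p. prime p ==> 1 / (1 - rho p) <= a" using rho_uniform by blast
 define B where "B = 2 * (4 * a^2)"
 have "1 <= a^2" using a(1) by (intro one_le_power) simp
 then have B1: "B >= 1" unfolding B_def by linarith
 have "\<forall>\<^sub>F z in at_top. \<exists>G c. sieve_system z \<epsilon> B G c" if \<epsilon>: "\<epsilon> > 0" for \<epsilon> :: real
 proof -
  have "\<epsilon> / 3 > 0" "4 * a^2 >= 0" using \<epsilon> by auto
  from eventually_prod_prime[OF this]
  have E1: "\<forall>\<^sub>F z in at_top. (PROD p:primes_upto z. 1 + 4 * a^2 / real p) <= z powr (\<epsilon> / 3)" .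
  have E2: "\<forall>\<^sub>F z in at_top. 3 + 4 * a^2 <= z powr (\<epsilon> / 3)" using \<epsilon> by real_asymp
  show ?thesis using E1 E2 eventually_sum_hh eventually_sum_log_prime eventually_gt_at_top[of "1::real"]
   by eventually_elim (rule sieve_weights_at[OF a B_def _ _ _ _ _ \<epsilon>])
 qed
 then show ?thesis using B1 by blast
qed

section \<open>The Hausdorff dimension\<close>

fun cfv :: "nat list => real => real" where
 "cfv [] t = t"
| "cfv (a # w) t = 1 / (real a + cfv w t)"

text \<open>The denominator of the Moebius map t -> \<open>cfv w t\<close>; it has the form q + q' t
  with consecutive convergent denominators.\<close>

fun den :: "nat list => real => real" where
 "den [] t = 1"
| "den (a # w) t = (real a + cfv w t) * den w t"

text \<open>The length of the cylinder of w, the interval between \<open>cfv w 0\<close> and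
  \<open>cfv w 1\<close>.\<close>

definition len :: "nat list => real" where "len w = 1 / (den w 0 * den w 1)"

definition digits :: "nat list => bool" where "digits w \<longleftrightarrow> (\<forall>a\<in>set w. 1 <= a)"

lemma digits_simps [simp]: "digits []" "digits (a # w) \<longleftrightarrow> 1 <= a & digits w" "digits (u @ v) \<longleftrightarrow> digits u & digits v"
 by (auto simp: digits_def)

lemma finite_cf_eq: "finite_cf w = cfv w 0"
 by (induction w) auto

lemma cfv_nonneg: "t >= 0 ==> cfv w t >= 0"
 by (induction w) auto

lemma den_pos: "digits w ==> t >= 0 ==> den w t > 0"
proof (induction w)
 case (Cons a w)
 then show ?case using cfv_nonneg[of t w] by (auto intro!: mult_pos_pos)
qed simp

lemma cfv_le_1: "digits w ==> 0 <= t ==> t <= 1 ==> cfv w t <= 1"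
proof (cases w)
 case (Cons a v)
 moreover assume "digits w" "0 <= t"
 ultimately have "real a + cfv v t >= 1" using cfv_nonneg[of t v] by (auto intro: add_increasing2)
 then show ?thesis using Cons by simp
qed simp

lemma cfv_append: "cfv (u @ v) t = cfv u (cfv v t)"
 by (induction u) auto

lemma den_append: "den (u @ v) t = den u (cfv v t) * den v t"
 by (induction u) (auto simp: cfv_append)

lemma one_div_diff: "x > 0 ==> y > 0 ==> 1 / x - 1 / y = (y - x) / (x * (y :: real))"
 by (simp add: field_simps)

lemma cfv_diff:
 assumes "digits w" "s >= 0" "t >= 0"
 shows "\<bar>cfv w s - cfv w t\<bar> = \<bar>s - t\<bar> / (den w s * den w t)"
 using assms(1)
proof (induction w)
 case (Cons a w)
 define x y where "x = cfv w s" and "y = cfv w t"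
 have xy: "x >= 0" "y >= 0" using cfv_nonneg assms by (auto simp: x_def y_def)
 have p: "real a + x > 0" "real a + y > 0" using Cons.prems xy by auto
 have "1 / (a + x) - 1 / (a + y) = (y - x) / ((a + x) * (a + y))" using p by (simp add: field_simps)
 then have "\<bar>1 / (a + x) - 1 / (a + y)\<bar> = \<bar>x - y\<bar> / ((a + x) * (a + y))"
  using p by (simp add: abs_divide abs_mult abs_minus_commute)
 also have "\<bar>x - y\<bar> = \<bar>s - t\<bar> / (den w s * den w t)" using Cons by (simp add: x_def y_def)
 finally show ?case by (simp add: x_def y_def mult_ac)
qed simp

lemma den_linear:
 assumes "digits w"
 shows "\<exists>D D'. D >= 1 & 0 <= D' & D' <= D & (\<forall>t\<ge>0. den w t = D + D' * t)"
 using assms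
proof (induction w rule: rev_induct)
 case (snoc a w)
 then obtain D D' where D: "D >= 1" "0 <= D'" "D' <= D" "!!t. t >= 0 ==> den w t = D + D' * t" by auto
 have a: "real a >= 1" using snoc by auto
 have Da: "D <= D * real a" using mult_left_mono[OF a, of D] D by simp
 have "den (w @ [a]) t = (D * a + D') + D * t" if t: "t >= 0" for t
 proof -
  have "den (w @ [a]) t = (D + D' * (1 / (a + t))) * (a + t)" using D(4)[of "1 / (a + t)"] t a by (simp add: den_append)
  also have "... = D * (a + t) + D' * ((1 / (a + t)) * (a + t))" by (simp only: distrib_right mult.assoc)
  also have "(1 / (a + t)) * (a + t) = 1" using t a by simp
  finally show ?thesis by (simp add: algebra_simps)
 qed
 then show ?case
  by (intro exI[of _ "D * a + D'"] exI[of _ D] conjI allI impI) (use D(1,2) Da in linarith)+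
qed (intro exI[of _ 1] exI[of _ 0], simp)

lemma len_pos: "digits w ==> len w > 0"
 by (simp add: len_def den_pos)

lemma len_Nil [simp]: "len [] = 1" by (simp add: len_def)

lemma cfv_diff_bounds:
 assumes "digits w" "0 <= s" "s <= 1" "0 <= t" "t <= 1"
 shows "\<bar>cfv w s - cfv w t\<bar> >= \<bar>s - t\<bar> * len w / 4" "\<bar>cfv w s - cfv w t\<bar> <= 2 * len w"
proof -
 obtain D D' where D: "D >= 1" "0 <= D'" "D' <= D" "!!t. t >= 0 ==> den w t = D + D' * t" using den_linear[OF assms(1)] by blast
 have d: "D <= den w t" "den w t <= 2 * D" if "0 <= t" "t <= 1" for t
 proof -
  have "D' * t <= D * 1" using D that by (intro mult_mono) auto
  then show "D <= den w t" "den w t <= 2 * D" using D that by auto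
 qed
 have le: "den w s * den w t <= 4 * (den w 0 * den w 1)"
 proof -
  have "den w s * den w t <= (2 * D) * (2 * D)" using d assms D by (intro mult_mono) (auto intro: order_trans[OF _ d(1)])
  moreover have "D * D <= den w 0 * den w 1" using d D by (intro mult_mono) (auto intro: order_trans[OF _ d(1)])
  ultimately show ?thesis by simp
 qed
 have ge: "den w 0 * den w 1 <= 2 * (den w s * den w t)"
 proof -
  have "den w 0 * den w 1 <= D * (2 * D)" using d D by (intro mult_mono) auto
  moreover have "D * D <= den w s * den w t" using d assms D by (intro mult_mono) (auto intro: order_trans[OF _ d(1)])
  ultimately show ?thesis by simp
 qed
 have p: "den w s * den w t > 0" "den w 0 * den w 1 > 0" using den_pos[OF assms(1)] assms by auto
 have "len w / 4 <= 1 / (den w s * den w t)" using le p by (simp add: len_def field_simps)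
 then have "\<bar>s - t\<bar> * (len w / 4) <= \<bar>s - t\<bar> * (1 / (den w s * den w t))" by (intro mult_left_mono) auto
 then show "\<bar>cfv w s - cfv w t\<bar> >= \<bar>s - t\<bar> * len w / 4" using assms by (simp add: cfv_diff)
 have "1 / (den w s * den w t) <= 2 * len w" using ge p by (simp add: len_def field_simps)
 then have "\<bar>s - t\<bar> * (1 / (den w s * den w t)) <= 1 * (2 * len w)"
  using assms p by (intro mult_mono) auto
 then show "\<bar>cfv w s - cfv w t\<bar> <= 2 * len w" using assms by (simp add: cfv_diff)
qed

text \<open>The children are adjacent intervals, so their lengths telescope. The digits above A take
  away a share (D + D')/(D (A + 1) + D'), at most 2/(A + 2) because D' <= D.\<close>

lemma len_children:
 assumes "digits w"
 shows "a >= 1 ==> len (w @ [a]) <= len w / 2"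
  and "(\<Sum>a=1..A. len (w @ [a])) >= len w * (real A / (real A + 2))"
proof -
 obtain D D' where D: "D >= 1" "0 <= D'" "D' <= D" "!!t. t >= 0 ==> den w t = D + D' * t" using den_linear[OF assms] by blast
 have lw: "len w = 1 / (D * (D + D'))" using D by (simp add: len_def)
 have ch: "den (w @ [a]) 0 = D * a + D'" "den (w @ [a]) 1 = D * (real a + 1) + D'" if "a >= 1" for a
  using that D(4)[of "1 / a"] D(4)[of "1 / (real a + 1)"] by (simp_all add: den_append field_simps)
 show "len (w @ [a]) <= len w / 2" if a: "a >= 1"
 proof -
  have a1: "real a >= 1" using a by simp
  have Da: "D <= D * real a" using mult_left_mono[OF a1, of D] D by simp
  have "D + D' <= D * a + D'" "2 * D <= D * (real a + 1) + D'"
   using Da D unfolding distrib_left mult_1_right by linarith+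
  then have "(D + D') * (2 * D) <= (D * a + D') * (D * (real a + 1) + D')"
   using D by (intro mult_mono) auto
  moreover have "(D + D') * (2 * D) > 0" using D by (intro mult_pos_pos) auto
  ultimately have "1 / ((D * a + D') * (D * (real a + 1) + D')) <= 1 / ((D + D') * (2 * D))" by (intro frac_le) auto
  then show ?thesis unfolding lw using ch[OF a] by (simp add: len_def mult_ac)
 qed
 have sum: "(\<Sum>a=1..A. len (w @ [a])) = (1 / D) * (1 / (D + D') - 1 / (D * (real A + 1) + D'))"
 proof (induction A)
  case (Suc A)
  have p: "D * (real A + 1) + D' > 0" "D * (real A + 2) + D' > 0" "D > 0"
   using D mult_pos_pos[of D "real A + 1"] mult_pos_pos[of D "real A + 2"] by linarith+
  have "len (w @ [Suc A]) = 1 / ((D * (real A + 1) + D') * (D * (real A + 2) + D'))"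
   unfolding len_def using ch[of "Suc A"] by (simp add: add_ac)
  also have "... = (1 / D) * (1 / (D * (real A + 1) + D') - 1 / (D * (real A + 2) + D'))"
   using one_div_diff[OF p(1,2)] p by (simp add: algebra_simps)
  finally have "len (w @ [Suc A]) = (1 / D) * (1 / (D * (real A + 1) + D') - 1 / (D * (real A + 2) + D'))" .
  moreover have "real (Suc A) + 1 = real A + 2" by simp
  ultimately show ?case using Suc by (simp add: algebra_simps)
 qed simp
 have "0 < D * (real A + 1)" using D by (intro mult_pos_pos) linarith+
 then have q: "D + D' > 0" "D * (real A + 1) + D' > 0" "D > 0" using D by linarith+
 have "(1 / D) * (1 / (D + D') - 1 / (D * (real A + 1) + D')) = real A / ((D + D') * (D * (real A + 1) + D'))"
 proof -
  have "(D * (real A + 1) + D') - (D + D') = D * real A" by (simp add: algebra_simps)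
  then show ?thesis using one_div_diff[OF q(1,2)] q(3) by simp
 qed
 also have "... >= real A / ((D + D') * (D * (real A + 2)))"
  using q D by (intro divide_left_mono mult_left_mono mult_pos_pos) (auto simp: algebra_simps)
 also have "real A / ((D + D') * (D * (real A + 2))) = len w * (real A / (real A + 2))" unfolding lw by (simp add: mult_ac)
 finally show "(\<Sum>a=1..A. len (w @ [a])) >= len w * (real A / (real A + 2))" unfolding sum .
qed

text \<open>Each child has at most half the length, so passing to the power s gains a factor 2^(1 -
  s); this pays for the digits above A.\<close>

lemma len_powr_children:
 assumes w: "digits w" and s: "0 < s" "s <= 1" and A: "2 powr (1 - s) * (real A / (real A + 2)) >= 1"
 shows "len w powr s <= (\<Sum>a=1..A. len (w @ [a]) powr s)"
proof -
 have lw: "len w > 0" by (rule len_pos[OF w])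
 have "len (w @ [a]) powr s >= len (w @ [a]) * (len w / 2) powr (s - 1)" if "a \<in> {1..A}" for a
 proof -
  have l: "len (w @ [a]) > 0" using that w by (intro len_pos) auto
  have "(len w / 2) powr (s - 1) <= len (w @ [a]) powr (s - 1)"
   using that s l len_children(1)[OF w, of a] by (intro powr_mono2') auto
  then have "len (w @ [a]) * (len w / 2) powr (s - 1) <= len (w @ [a]) powr 1 * len (w @ [a]) powr (s - 1)"
   using l by (intro mult_mono) auto
  also have "... = len (w @ [a]) powr s" unfolding powr_add[symmetric] by simp
  finally show ?thesis .
 qed
 then have "(\<Sum>a=1..A. len (w @ [a]) powr s) >= (\<Sum>a=1..A. len (w @ [a])) * (len w / 2) powr (s - 1)"
  unfolding sum_distrib_right by (intro sum_mono)
 moreover have "(\<Sum>a=1..A. len (w @ [a])) * (len w / 2) powr (s - 1) >= len w * (real A / (real A + 2)) * (len w / 2) powr (s - 1)"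
  using mult_right_mono[OF len_children(2)[OF w, of A], of "(len w / 2) powr (s - 1)"] by simp
 moreover have "len w * (real A / (real A + 2)) * (len w / 2) powr (s - 1) = (2 powr (1 - s) * (real A / (real A + 2))) * len w powr s"
 proof -
  have "(len w / 2) powr (s - 1) = len w powr (s - 1) / 2 powr (s - 1)" using lw by (simp add: powr_divide)
  also have "... = len w powr (s - 1) * 2 powr (1 - s)" by (metis minus_diff_eq powr_minus_divide divide_inverse inverse_eq_divide mult.commute)
  finally have "(len w / 2) powr (s - 1) = len w powr (s - 1) * 2 powr (1 - s)" .
  moreover have "len w powr s = len w * len w powr (s - 1)" using lw powr_add[of "len w" 1 "s - 1"] by simp
  ultimately show ?thesis by (simp add: mult_ac)
 qed
 moreover have "(2 powr (1 - s) * (real A / (real A + 2))) * len w powr s >= 1 * len w powr s" using A by (intro mult_right_mono) auto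
 ultimately show ?thesis by linarith
qed

section \<open>Digit sequences, their values and the gaps between cylinders\<close>

definition code :: "nat => (nat => nat) => bool" where "code A \<alpha> \<longleftrightarrow> (\<forall>j. 1 <= \<alpha> j & \<alpha> j <= A)"

definition word :: "(nat => nat) => nat => nat list" where "word \<alpha> n = map \<alpha> [0..<n]"

definition xval :: "(nat => nat) => real" where "xval \<alpha> = lim (%n. finite_cf (word \<alpha> n))"

lemma word_digits: "code A \<alpha> ==> digits (word \<alpha> n)"
 by (auto simp: code_def word_def digits_def)

lemma word_Suc: "word \<alpha> (Suc n) = word \<alpha> n @ [\<alpha> n]"
 by (simp add: word_def)

lemma word_add: "word \<alpha> (m + n) = word \<alpha> m @ word (%j. \<alpha> (j + m)) n"
 by (induction n) (simp_all add: word_def add.commute)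

lemma length_word [simp]: "length (word \<alpha> n) = n" by (simp add: word_def)

lemma code_shift: "code A \<alpha> ==> code A (%j. \<alpha> (j + m))"
 by (simp add: code_def)

lemma len_word_le: "code A \<alpha> ==> len (word \<alpha> n) <= (1 / 2) ^ n"
proof (induction n)
 case (Suc n)
 have "len (word \<alpha> (Suc n)) <= len (word \<alpha> n) / 2"
  unfolding word_Suc by (rule len_children(1)[OF word_digits[OF Suc.prems]]) (use Suc.prems in \<open>simp add: code_def\<close>)
 then show ?case using Suc by simp
qed (simp add: word_def)

lemma xval_tendsto:
 assumes "code A \<alpha>" shows "(%n. finite_cf (word \<alpha> n)) \<longlonglongrightarrow> xval \<alpha>"
proof -
 have close: "\<bar>finite_cf (word \<alpha> m) - finite_cf (word \<alpha> (m + k))\<bar> <= 2 * (1 / 2) ^ m" for m k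
 proof -
  have "finite_cf (word \<alpha> (m + k)) = cfv (word \<alpha> m) (cfv (word (%j. \<alpha> (j + m)) k) 0)"
   by (simp add: finite_cf_eq word_add cfv_append)
  moreover have "\<bar>cfv (word \<alpha> m) 0 - cfv (word \<alpha> m) (cfv (word (%j. \<alpha> (j + m)) k) 0)\<bar> <= 2 * len (word \<alpha> m)"
   by (rule cfv_diff_bounds(2)) (use word_digits[OF assms] word_digits[OF code_shift[OF assms]] cfv_nonneg cfv_le_1 in auto)
  ultimately show ?thesis using len_word_le[OF assms, of m] by (simp add: finite_cf_eq)
 qed
 have "Cauchy (%n. finite_cf (word \<alpha> n))"
 proof (rule metric_CauchyI)
  fix e :: real assume e: "e > 0"
  obtain M where M: "(1 / 2 :: real) ^ M < e / 4" using real_arch_pow_inv[of "e / 4" "1 / 2"] e by auto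
  have "dist (finite_cf (word \<alpha> m)) (finite_cf (word \<alpha> n)) < e" if "m >= M" "n >= M" for m n
  proof -
   have "\<bar>finite_cf (word \<alpha> M) - finite_cf (word \<alpha> m)\<bar> <= 2 * (1 / 2) ^ M" using close[of M "m - M"] that by simp
   moreover have "\<bar>finite_cf (word \<alpha> M) - finite_cf (word \<alpha> n)\<bar> <= 2 * (1 / 2) ^ M" using close[of M "n - M"] that by simp
   ultimately show ?thesis using M unfolding dist_real_def by linarith
  qed
  then show "\<exists>M. \<forall>m\<ge>M. \<forall>n\<ge>M. dist (finite_cf (word \<alpha> m)) (finite_cf (word \<alpha> n)) < e" by blast
 qed
 then show ?thesis unfolding xval_def by (simp add: Cauchy_convergent_iff convergent_LIMSEQ_iff)
qed

lemma bounded_cf_set_eq: "bounded_cf_set A = xval ` {\<alpha>. code A \<alpha>}"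
proof -
 have "x \<in> bounded_cf_set A \<longleftrightarrow> (\<exists>\<alpha>. code A \<alpha> & (%n. finite_cf (word \<alpha> n)) \<longlonglongrightarrow> x)" for x
  unfolding bounded_cf_set_def code_def word_def by blast
 moreover have "(%n. finite_cf (word \<alpha> n)) \<longlonglongrightarrow> x \<longleftrightarrow> x = xval \<alpha>" if "code A \<alpha>" for x \<alpha>
  using LIMSEQ_unique[OF _ xval_tendsto[OF that]] xval_tendsto[OF that] by blast
 ultimately show ?thesis by blast
qed

lemma xval_bounds:
 assumes "code A \<alpha>" shows "0 <= xval \<alpha>" "xval \<alpha> <= 1"
proof -
 show "0 <= xval \<alpha>" by (rule LIMSEQ_le_const[OF xval_tendsto[OF assms]]) (auto simp: finite_cf_eq cfv_nonneg)
 show "xval \<alpha> <= 1" by (rule LIMSEQ_le_const2[OF xval_tendsto[OF assms]])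
   (auto simp: finite_cf_eq intro!: cfv_le_1 word_digits[OF assms])
qed

lemma xval_step:
 assumes "code A \<alpha>" shows "xval \<alpha> = 1 / (\<alpha> 0 + xval (%j. \<alpha> (j + 1)))"
proof -
 let ?\<beta> = "%j. \<alpha> (j + 1)"
 have b: "code A ?\<beta>" by (rule code_shift[OF assms])
 have a: "real (\<alpha> 0) >= 1" using assms by (simp add: code_def)
 have "(%n. 1 / (real (\<alpha> 0) + finite_cf (word ?\<beta> n))) \<longlonglongrightarrow> 1 / (\<alpha> 0 + xval ?\<beta>)"
  by (intro tendsto_intros xval_tendsto[OF b]) (use a xval_bounds[OF b] in auto)
 moreover have "1 / (real (\<alpha> 0) + finite_cf (word ?\<beta> n)) = finite_cf (word \<alpha> (Suc n))" for n
  using word_add[of \<alpha> 1 n] by (simp add: word_def)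
 moreover have "(%n. finite_cf (word \<alpha> (Suc n))) \<longlonglongrightarrow> xval \<alpha>"
  by (rule LIMSEQ_Suc[OF xval_tendsto[OF assms]])
 ultimately show ?thesis using LIMSEQ_unique by auto
qed

lemma xval_word:
 assumes "code A \<alpha>" shows "xval \<alpha> = cfv (word \<alpha> n) (xval (%j. \<alpha> (j + n)))"
proof (induction n)
 case (Suc n)
 have "xval (%j. \<alpha> (j + n)) = 1 / (\<alpha> n + xval (%j. \<alpha> (j + Suc n)))"
  using xval_step[OF code_shift[OF assms, of n]] by simp
 then show ?case using Suc by (simp add: word_Suc cfv_append)
qed (simp add: word_def)

text \<open>Digits bounded by A confine every value to the interval from 1/(A + 1) to 1 - 1/(A + 2).
  So a digit plus its tail differs by at least 1/(A + 2) for distinct digits, and inversion costs at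
  most (A + 2)^2.\<close>

lemma xval_gap_first:
 assumes a: "code A \<alpha>" and b: "code A \<beta>" and ne: "\<alpha> 0 ~= \<beta> 0"
 shows "\<bar>xval \<alpha> - xval \<beta>\<bar> >= 1 / (real A + 2) ^ 3"
proof -
 have bd: "1 / (real A + 1) <= xval \<gamma> & xval \<gamma> <= (real A + 1) / (real A + 2)" if g: "code A \<gamma>" for \<gamma>
 proof -
  have lo: "1 / (real A + 1) <= xval \<gamma>'" if g': "code A \<gamma>'" for \<gamma>'
  proof -
   have "real (\<gamma>' 0) + xval (%j. \<gamma>' (j + 1)) <= real A + 1"
    using g' xval_bounds(2)[OF code_shift[OF g', of 1]] by (intro add_mono) (auto simp: code_def)
   moreover have "real (\<gamma>' 0) + xval (%j. \<gamma>' (j + 1)) > 0"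
    using g' xval_bounds(1)[OF code_shift[OF g', of 1]] by (intro add_pos_nonneg) (auto simp: code_def Suc_le_eq)
   ultimately show ?thesis unfolding xval_step[OF g'] by (intro divide_left_mono) auto
  qed
  have "1 + 1 / (real A + 1) <= real (\<gamma> 0) + xval (%j. \<gamma> (j + 1))"
   using g lo[OF code_shift[OF g, of 1]] by (intro add_mono) (auto simp: code_def)
  then have "1 / (real (\<gamma> 0) + xval (%j. \<gamma> (j + 1))) <= 1 / (1 + 1 / (real A + 1))"
   using g xval_bounds(1)[OF code_shift[OF g, of 1]]
   by (intro divide_left_mono mult_pos_pos add_pos_nonneg) (auto simp: code_def Suc_le_eq)
  also have "... = (real A + 1) / (real A + 2)" by (simp add: field_simps)
  finally show ?thesis using lo[OF g] xval_step[OF g] by simp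
 qed
 define x where "x = xval (%j. \<alpha> (j + 1))"
 define y where "y = xval (%j. \<beta> (j + 1))"
 have x: "0 <= x" "x <= (real A + 1) / (real A + 2)" and y: "0 <= y" "y <= (real A + 1) / (real A + 2)"
  using bd[OF code_shift[OF a, of 1]] bd[OF code_shift[OF b, of 1]] xval_bounds[OF code_shift[OF a, of 1]] xval_bounds[OF code_shift[OF b, of 1]]
  by (auto simp: x_def y_def)
 have ab: "real (\<alpha> 0) >= 1" "real (\<alpha> 0) <= A" "real (\<beta> 0) >= 1" "real (\<beta> 0) <= A" using a b by (auto simp: code_def)
 have p: "real (\<alpha> 0) + x > 0" "real (\<beta> 0) + y > 0" using ab x y by auto
 have d: "1 <= \<bar>real (\<alpha> 0) - real (\<beta> 0)\<bar>" using ne by linarith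
 have frac: "(real A + 1) / (real A + 2) = 1 - 1 / (real A + 2)" by (simp add: field_simps)
 have num: "\<bar>(real (\<beta> 0) + y) - (real (\<alpha> 0) + x)\<bar> >= 1 / (real A + 2)"
  using d x y unfolding frac by linarith
 have "x <= 1" "y <= 1" using x y frac by (auto intro: order_trans)
 then have "(real (\<alpha> 0) + x) * (real (\<beta> 0) + y) <= (real A + 2) * (real A + 2)" using ab x y by (intro mult_mono) auto
 then have "1 / (real A + 2) / ((real A + 2) * (real A + 2)) <= \<bar>(real (\<beta> 0) + y) - (real (\<alpha> 0) + x)\<bar> / ((real (\<alpha> 0) + x) * (real (\<beta> 0) + y))"
  using num p by (intro frac_le) auto
 also have "... = \<bar>((real (\<beta> 0) + y) - (real (\<alpha> 0) + x)) / ((real (\<alpha> 0) + x) * (real (\<beta> 0) + y))\<bar>"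
  using p by (simp add: abs_divide abs_mult)
 also have "((real (\<beta> 0) + y) - (real (\<alpha> 0) + x)) / ((real (\<alpha> 0) + x) * (real (\<beta> 0) + y)) = xval \<alpha> - xval \<beta>"
 proof -
  have "xval \<alpha> = 1 / (real (\<alpha> 0) + x)" "xval \<beta> = 1 / (real (\<beta> 0) + y)"
   using xval_step[OF a] xval_step[OF b] by (simp_all add: x_def y_def)
  then show ?thesis using one_div_diff[OF p] by simp
 qed
 finally show ?thesis by (simp add: power3_eq_cube mult_ac)
qed

lemma xval_gap:
 assumes a: "code A \<alpha>" and b: "code A \<beta>" and w: "word \<alpha> n = word \<beta> n" and n: "\<alpha> n ~= \<beta> n"
 shows "\<bar>xval \<alpha> - xval \<beta>\<bar> >= len (word \<alpha> n) / (4 * (real A + 2) ^ 3)"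
proof -
 let ?x = "xval (%j. \<alpha> (j + n))" and ?y = "xval (%j. \<beta> (j + n))"
 have g: "\<bar>?x - ?y\<bar> >= 1 / (real A + 2) ^ 3"
  by (rule xval_gap_first[OF code_shift[OF a] code_shift[OF b]]) (use n in simp)
 have "\<bar>xval \<alpha> - xval \<beta>\<bar> = \<bar>cfv (word \<alpha> n) ?x - cfv (word \<alpha> n) ?y\<bar>"
  using xval_word[OF a, of n] xval_word[OF b, of n] w by simp
 also have "... >= \<bar>?x - ?y\<bar> * len (word \<alpha> n) / 4"
  by (rule cfv_diff_bounds(1)) (use word_digits[OF a] xval_bounds[OF code_shift[OF a]] xval_bounds[OF code_shift[OF b]] in auto)
 also have "\<bar>?x - ?y\<bar> * len (word \<alpha> n) / 4 >= 1 / (real A + 2) ^ 3 * len (word \<alpha> n) / 4"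
  using g len_pos[OF word_digits[OF a, of n]] by (intro divide_right_mono mult_right_mono) auto
 finally show ?thesis by (simp add: mult_ac)
qed

text \<open>Replaces a covering set by the cylinder of the longest prefix common to all codes with
  value in U: two codes that part after it are separated by a fixed proportion of its length, so the
  diameter of U controls it. If only one code has its value in U, a deep cylinder of that code costs
  less than e; if there is none, any code will do.\<close>

lemma covering_node:
 fixes U :: "real set"
 assumes A: "A >= 1" and s: "s > 0" and U: "bounded U" and e: "e > 0"
 shows "\<exists>w. digits w & (\<forall>\<alpha>. code A \<alpha> --> xval \<alpha> \<in> U --> word \<alpha> (length w) = w) &
  len w powr s <= diameter U powr s * (4 * (real A + 2) ^ 3) powr s + e"
proof (cases "\<exists>n \<alpha> \<beta>. code A \<alpha> & code A \<beta> & xval \<alpha> \<in> U & xval \<beta> \<in> U & \<alpha> n ~= \<beta> n")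
 case True
 define n where "n = (LEAST n. \<exists>\<alpha> \<beta>. code A \<alpha> & code A \<beta> & xval \<alpha> \<in> U & xval \<beta> \<in> U & \<alpha> n ~= \<beta> n)"
 obtain \<alpha> \<beta> where ab: "code A \<alpha>" "code A \<beta>" "xval \<alpha> \<in> U" "xval \<beta> \<in> U" "\<alpha> n ~= \<beta> n"
  using LeastI_ex[OF True] unfolding n_def by blast
 have same: "\<gamma> j = \<alpha> j" if "code A \<gamma>" "xval \<gamma> \<in> U" "j < n" for \<gamma> j
  using not_less_Least[OF that(3)[unfolded n_def]] that ab(1,3) by blast
 have w: "word \<gamma> n = word \<alpha> n" if "code A \<gamma>" "xval \<gamma> \<in> U" for \<gamma>
  using same[OF that] by (simp add: word_def)
 have gap: "len (word \<alpha> n) / (4 * (real A + 2) ^ 3) <= \<bar>xval \<alpha> - xval \<beta>\<bar>"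
  by (rule xval_gap[OF ab(1,2) w[OF ab(2,4), symmetric] ab(5)])
 also have "... <= diameter U"
  using diameter_bounded_bound[OF U ab(3,4)] by (simp add: dist_real_def)
 finally have "len (word \<alpha> n) <= diameter U * (4 * (real A + 2) ^ 3)" by (simp add: divide_le_eq)
 moreover have "len (word \<alpha> n) > 0" by (rule len_pos[OF word_digits[OF ab(1)]])
 ultimately have "len (word \<alpha> n) powr s <= (diameter U * (4 * (real A + 2) ^ 3)) powr s"
  using s by (intro powr_mono2) auto
 also have "... = diameter U powr s * (4 * (real A + 2) ^ 3) powr s"
  by (rule powr_mult)
 finally show ?thesis using w e word_digits[OF ab(1)] by (intro exI[of _ "word \<alpha> n"]) auto
next
 case False
 obtain \<alpha> where a: "code A \<alpha>" "!!\<gamma>. code A \<gamma> ==> xval \<gamma> \<in> U ==> \<gamma> = \<alpha>"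
 proof (cases "\<exists>\<alpha>. code A \<alpha> & xval \<alpha> \<in> U")
  case True
  then obtain \<alpha> where \<alpha>: "code A \<alpha>" "xval \<alpha> \<in> U" by blast
  have "\<gamma> = \<alpha>" if "code A \<gamma>" "xval \<gamma> \<in> U" for \<gamma> using False \<alpha> that by (intro ext) blast
  then show ?thesis using that \<alpha> by blast
 next
  case False
  have "code A (%_. 1)" using A by (simp add: code_def)
  then show ?thesis using that False by blast
 qed
 have "\<exists>k. ((1 / 2) powr s) ^ k < e"
  by (rule real_arch_pow_inv[OF e]) (use s powr_less_mono2[of s "1 / 2" 1] in auto)
 then obtain k where k: "((1 / 2) powr s) ^ k < e" by blast
 have "len (word \<alpha> k) powr s <= ((1 / 2) ^ k) powr s"
  using len_word_le[OF a(1), of k] len_pos[OF word_digits[OF a(1), of k]] s by (intro powr_mono2) auto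
 also have "... = ((1 / 2) powr s) ^ k" by (simp add: powr_realpow[symmetric] powr_powr mult.commute)
 finally have "len (word \<alpha> k) powr s <= e" using k by simp
 moreover have "0 <= diameter U powr s * (4 * (real A + 2) ^ 3) powr s" by simp
 ultimately have "len (word \<alpha> k) powr s <= diameter U powr s * (4 * (real A + 2) ^ 3) powr s + e" by linarith
 moreover have "word \<gamma> (length (word \<alpha> k)) = word \<alpha> k" if "code A \<gamma>" "xval \<gamma> \<in> U" for \<gamma> using a(2)[OF that] by simp
 ultimately show ?thesis using word_digits[OF a(1)] by blast
qed

text \<open>A cheap covering gives cylinders \<open>W i\<close> of total weight below that of the
  root. A node weighs at most as much as its children together, so an undercovered node has an
  undercovered child. The infinite code so obtained has its value in some \<open>U i\<close>,
  although its path meets only undercovered nodes; no compactness is involved.\<close>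

lemma hausdorff_measure_pos:
 assumes A: "A >= 1" and s: "0 < s" "s <= 1" and c: "2 powr (1 - s) * (real A / (real A + 2)) >= 1"
 shows "hausdorff_measure s (bounded_cf_set A) ~= 0"
proof
 assume zero: "hausdorff_measure s (bounded_cf_set A) = 0"
 define \<kappa> where "\<kappa> = (4 * (real A + 2) ^ 3) powr s"
 have k0: "\<kappa> > 0" by (simp add: \<kappa>_def)
 have "hausdorff_premeasure s 1 (bounded_cf_set A) <= hausdorff_measure s (bounded_cf_set A)"
  unfolding hausdorff_measure_def by (rule SUP_upper) simp
 then have "hausdorff_premeasure s 1 (bounded_cf_set A) < ennreal (1 / (2 * \<kappa>))"
  using zero k0 by simp
 then obtain U where U: "bounded_cf_set A \<subseteq> (\<Union>i. U i)" "!!i. bounded (U i)"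
   and Us: "(\<Sum>i. ennreal (diameter (U i) powr s)) < ennreal (1 / (2 * \<kappa>))"
  unfolding hausdorff_premeasure_def by (auto simp: INF_less_iff)
 have "\<exists>w. digits w & (\<forall>\<alpha>. code A \<alpha> --> xval \<alpha> \<in> U i --> word \<alpha> (length w) = w) &
   len w powr s <= diameter (U i) powr s * \<kappa> + (1 / 2) ^ i / 4" for i
  unfolding \<kappa>_def by (rule covering_node[OF A s(1) U(2)]) simp
 then obtain W where W: "!!i. digits (W i)" "!!i \<alpha>. code A \<alpha> ==> xval \<alpha> \<in> U i ==> word \<alpha> (length (W i)) = W i"
   "!!i. len (W i) powr s <= diameter (U i) powr s * \<kappa> + (1 / 2) ^ i / 4" by metis
 \<comment> \<open>The total weight of the covering cylinders contained in that of u; u is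
   undercovered if this is less than its own weight.\<close>
 define m where "m = (%u. \<Sum>i. if take (length u) (W i) = u then ennreal (len (W i) powr s) else 0)"
 have m0: "m [] < ennreal (len [] powr s)"
 proof -
  have "m [] <= (\<Sum>i. ennreal (diameter (U i) powr s) * ennreal \<kappa> + ennreal ((1 / 2) ^ i / 4))"
   unfolding m_def
  proof (intro suminf_le)
   fix i
   have "ennreal (len (W i) powr s) <= ennreal (diameter (U i) powr s * \<kappa> + (1 / 2) ^ i / 4)"
    by (rule ennreal_leI[OF W(3)])
   also have "... = ennreal (diameter (U i) powr s) * ennreal \<kappa> + ennreal ((1 / 2) ^ i / 4)"
    using k0 by (subst ennreal_plus) (auto simp: ennreal_mult)
   finally show "(if take (length []) (W i) = [] then ennreal (len (W i) powr s) else 0) <=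
     ennreal (diameter (U i) powr s) * ennreal \<kappa> + ennreal ((1 / 2) ^ i / 4)" by simp
  qed auto
  also have "... = (\<Sum>i. ennreal (diameter (U i) powr s)) * ennreal \<kappa> + (\<Sum>i. ennreal ((1 / 2) ^ i / 4))"
   by (subst suminf_add[symmetric]) auto
  also have "(\<Sum>i. ennreal ((1 / 2) ^ i / 4)) = ennreal (1 / 2)"
  proof (rule suminf_ennreal_eq)
   show "(%i. (1 / 2) ^ i / 4) sums (1 / 2 :: real)"
    using sums_divide[OF geometric_sums[of "1 / 2 :: real"], of 4] by simp
  qed simp
  also have "(\<Sum>i. ennreal (diameter (U i) powr s)) * ennreal \<kappa> + ennreal (1 / 2) < ennreal (1 / 2) + ennreal (1 / 2)"
  proof -
   have "(\<Sum>i. ennreal (diameter (U i) powr s)) * ennreal \<kappa> < ennreal (1 / (2 * \<kappa>)) * ennreal \<kappa>"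
    using Us k0 by (intro ennreal_mult_strict_right_mono) auto
   also have "... = ennreal (1 / 2)" using k0 by (simp add: ennreal_mult[symmetric])
   finally show ?thesis by (simp add: ennreal_add_left_cancel_less add.commute)
  qed
  also have "ennreal (1 / 2) + ennreal (1 / 2) = ennreal (len [] powr s)"
   by (subst ennreal_plus[symmetric]) auto
  finally show ?thesis .
 qed
 \<comment> \<open>A word extends u by at most one digit, so the covering weights of the children
   add up to at most that of u.\<close>
 have step: "\<exists>a\<in>{1..A}. m (u @ [a]) < ennreal (len (u @ [a]) powr s)"
  if u: "digits u" "m u < ennreal (len u powr s)" for u
 proof (rule ccontr)
  assume no: "\<not> ?thesis"
  have "ennreal (len u powr s) <= ennreal (\<Sum>a=1..A. len (u @ [a]) powr s)"
   by (rule ennreal_leI[OF len_powr_children[OF u(1) s c]])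
  also have "... = (\<Sum>a=1..A. ennreal (len (u @ [a]) powr s))" by (rule sum_ennreal[symmetric]) simp
  also have "... <= (\<Sum>a=1..A. m (u @ [a]))" using no by (intro sum_mono) (simp add: not_less)
  also have "... = (\<Sum>i. \<Sum>a=1..A. if take (length (u @ [a])) (W i) = u @ [a] then ennreal (len (W i) powr s) else 0)"
   unfolding m_def by (rule suminf_sum[symmetric]) simp
  also have "... <= m u"
   unfolding m_def
  proof (intro suminf_le)
   fix i
   let ?L = "ennreal (len (W i) powr s)"
   show "(\<Sum>a=1..A. if take (length (u @ [a])) (W i) = u @ [a] then ?L else 0) <= (if take (length u) (W i) = u then ?L else 0)"
   proof (cases "\<exists>b\<in>{1..A}. take (length (u @ [b])) (W i) = u @ [b]")
    case True
    then obtain b where b: "b \<in> {1..A}" "take (Suc (length u)) (W i) = u @ [b]" by auto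
    have "take (length u) (take (Suc (length u)) (W i)) = u" using b(2) by simp
    then have t: "take (length u) (W i) = u" by (simp add: take_take min_def)
    have "(\<Sum>a=1..A. if take (length (u @ [a])) (W i) = u @ [a] then ?L else 0) = (\<Sum>a=1..A. if a = b then ?L else 0)"
     using b(2) by (intro sum.cong refl) auto
    also have "... = ?L" using b(1) by simp
    finally show ?thesis using t by simp
   next
    case False
    then have "(\<Sum>a=1..A. if take (length (u @ [a])) (W i) = u @ [a] then ?L else 0) = 0" by (intro sum.neutral) auto
    then show ?thesis by simp
   qed
  qed auto
  finally show False using u(2) by simp
 qed
 obtain f where f: "!!n. set (f n) \<subseteq> {1..A} & m (f n) < ennreal (len (f n) powr s)" "!!n. \<exists>a. f (Suc n) = f n @ [a]" and f0: "f 0 = []"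
 proof -
  have "\<exists>f. \<forall>n. ((set (f n) \<subseteq> {1..A} & m (f n) < ennreal (len (f n) powr s)) & (n = 0 --> f n = [])) & (\<exists>a. f (Suc n) = f n @ [a])"
  proof (rule dependent_nat_choice)
   show "\<exists>x. (set x \<subseteq> {1..A} & m x < ennreal (len x powr s)) & ((0::nat) = 0 --> x = [])" using m0 by auto
   fix x and n :: nat assume x: "(set x \<subseteq> {1..A} & m x < ennreal (len x powr s)) & (n = 0 --> x = [])"
   then have "digits x" by (auto simp: digits_def)
   from step[OF this] x obtain a where "a \<in> {1..A}" "m (x @ [a]) < ennreal (len (x @ [a]) powr s)" by blast
   then show "\<exists>y. ((set y \<subseteq> {1..A} & m y < ennreal (len y powr s)) & (Suc n = 0 --> y = [])) & (\<exists>a. y = x @ [a])"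
    using x by (intro exI[of _ "x @ [a]"]) auto
  qed
  then show ?thesis using that by blast
 qed
 define \<alpha> where "\<alpha> = (%n. last (f (Suc n)))"
 have fS: "f (Suc n) = f n @ [\<alpha> n]" for n
 proof -
  obtain a where a: "f (Suc n) = f n @ [a]" using f(2) by blast
  then show ?thesis by (simp add: \<alpha>_def)
 qed
 have fw: "f n = word \<alpha> n" for n by (induction n) (simp_all add: f0 fS word_Suc, simp add: word_def)
 have "code A \<alpha>" unfolding code_def
 proof
  fix j
  have "\<alpha> j \<in> set (f (Suc j))" by (simp add: fS)
  then show "1 <= \<alpha> j & \<alpha> j <= A" using f(1)[of "Suc j"] by auto
 qed
 then have "xval \<alpha> \<in> bounded_cf_set A" by (simp add: bounded_cf_set_eq)
 then obtain i where i: "xval \<alpha> \<in> U i" using U(1) by blast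
 have w: "word \<alpha> (length (W i)) = W i" by (rule W(2)[OF \<open>code A \<alpha>\<close> i])
 \<comment> \<open>The path passes through \<open>W i\<close>, and this cylinder alone covers its
   own weight.\<close>
 have "ennreal (len (W i) powr s) = (SUM j:{i}. if take (length (W i)) (W j) = W i then ennreal (len (W j) powr s) else 0)" by simp
 also have "... <= m (W i)" unfolding m_def by (rule sum_le_suminf) auto
 finally show False using f(1)[of "length (W i)"] w unfolding fw w by (meson not_le)
qed

text \<open>N intervals of length 1/N cover the unit interval at cost 1/N. A finite dimension is
  what is wanted, and the exponent 2 gives it with no finer geometry.\<close>

lemma hausdorff_measure_2_eq_0:
 "hausdorff_measure 2 (bounded_cf_set A) = 0"
proof -
 let ?S = "bounded_cf_set A"
 have "hausdorff_premeasure 2 d ?S <= 0" if d: "d > 0" for d :: real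
 proof (rule ennreal_le_epsilon)
  fix e :: real assume e: "e > 0"
  obtain n :: nat where n: "1 / real (Suc n) < min d e" using nat_approx_posE[of "min d e"] d e by (metis min_less_iff_conj)
  define N where "N = Suc n"
  have N: "real N > 0" "1 / real N <= d" "1 / real N <= e" using n by (auto simp: N_def)
  define U where "U = (%i::nat. if i < N then {real i / N .. (real i + 1) / N} else {})"
  have di: "diameter (U i) = (if i < N then 1 / N else 0)" for i
  proof -
   have "real i / N <= (real i + 1) / N" using N by (intro divide_right_mono) auto
   then show ?thesis by (auto simp: U_def diameter_closed_interval diff_divide_distrib[symmetric] simp del: divide_le_cancel)
  qed
  have cover: "?S \<subseteq> (\<Union>i. U i)"
  proof
   fix x assume "x \<in> ?S"
   then have x: "0 <= x" "x <= 1" using xval_bounds by (auto simp: bounded_cf_set_eq)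
   define i where "i = (if x = 1 then N - 1 else nat \<lfloor>x * N\<rfloor>)"
   have "i < N & real i / N <= x & x <= (real i + 1) / N"
   proof (cases "x = 1")
    case True
    then show ?thesis using N by (auto simp: i_def N_def)
   next
    case False
    have fl: "0 <= \<lfloor>x * N\<rfloor>" using x N by simp
    have "x * real N < 1 * real N" using x False N by (intro mult_strict_right_mono) auto
    then have "i < N" using fl False by (simp add: i_def nat_less_iff floor_less_iff)
    moreover have "real i <= x * N" "x * N <= real i + 1" using fl False by (auto simp: i_def)
    ultimately show ?thesis using N by (simp add: divide_le_eq le_divide_eq)
   qed
   then show "x \<in> (\<Union>i. U i)" by (auto simp: U_def)
  qed
  have "hausdorff_premeasure 2 d ?S <= (\<Sum>i. ennreal (diameter (U i) powr 2))"
   unfolding hausdorff_premeasure_def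
   by (rule INF_lower) (use cover N d in \<open>auto simp: di\<close>, simp add: U_def)
  also have "... = (\<Sum>i<N. ennreal (diameter (U i) powr 2))" by (rule suminf_finite) (auto simp: di)
  also have "... = (\<Sum>i<N. ennreal ((1 / N)^2))"
   by (intro sum.cong refl) (use N in \<open>auto simp: di powr_numeral\<close>)
  also have "... = ennreal (1 / N)" using N by (simp add: ennreal_of_nat_eq_real_of_nat ennreal_mult[symmetric] power2_eq_square)
  also have "... <= ennreal e" using N by (intro ennreal_leI) auto
  finally show "hausdorff_premeasure 2 d ?S <= 0 + ennreal e" by simp
 qed
 then show ?thesis unfolding hausdorff_measure_def by (auto simp: SUP_eq_const intro!: antisym SUP_least)
qed

lemma hausdorff_dimension_le: "hausdorff_dimension (bounded_cf_set A) <= ennreal 2"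
 unfolding hausdorff_dimension_def
 by (rule Inf_lower, rule CollectI, rule exI[of _ 2]) (simp add: hausdorff_measure_2_eq_0)

theorem cf_dim_le_2: "cf_dim A <= 2"
 unfolding cf_dim_def by (rule enn2real_leI[OF _ hausdorff_dimension_le]) simp

theorem cf_dim_near_1:
 assumes s: "0 < s" "s < 1"
 shows "\<forall>\<^sub>F A in sequentially. s <= cf_dim A"
proof -
 have q: "2 powr (1 - s) > 1" using s by simp
 have "\<forall>\<^sub>F A in sequentially. 2 powr (1 - s) * (real A / (real A + 2)) >= 1"
 proof -
  have "(%A. 2 powr (1 - s) * (real A / (real A + 2))) \<longlonglongrightarrow> 2 powr (1 - s) * 1"
   by (intro tendsto_mult tendsto_const) real_asymp
  then have "\<forall>\<^sub>F A in sequentially. 2 powr (1 - s) * (real A / (real A + 2)) > 1"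
   by (rule order_tendstoD(1)) (use q in simp)
  then show ?thesis by eventually_elim simp
 qed
 moreover have "\<forall>\<^sub>F A in sequentially. A >= (1::nat)" by (rule eventually_ge_at_top)
 ultimately show ?thesis
 proof eventually_elim
  case (elim A)
  let ?d = "hausdorff_dimension (bounded_cf_set A)"
  have "ennreal s <= ?d"
   unfolding hausdorff_dimension_def
  proof (rule Inf_greatest)
   fix x assume "x \<in> {ennreal s |s. 0 < s & hausdorff_measure s (bounded_cf_set A) = 0}"
   then obtain s' where s': "x = ennreal s'" "0 < s'" "hausdorff_measure s' (bounded_cf_set A) = 0" by blast
   have "s <= s'"
   proof (rule ccontr)
    assume lt: "\<not> s <= s'"
    have "2 powr (1 - s) * (real A / (real A + 2)) <= 2 powr (1 - s') * (real A / (real A + 2))"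
     using lt by (intro mult_right_mono powr_mono) auto
    then have "1 <= 2 powr (1 - s') * (real A / (real A + 2))" using elim(1) by (rule order_trans[rotated])
    then show False using hausdorff_measure_pos[OF elim(2) s'(2)] s'(3) lt s(2) by simp
   qed
   then show "ennreal s <= x" using s' by (simp add: ennreal_leI)
  qed
  \<comment> \<open>Finiteness matters because \<open>enn2real\<close> sends infinity to 0.\<close>
  moreover have "?d < Orderings.top" using hausdorff_dimension_le[of A] by (rule le_less_trans) simp
  ultimately have "enn2real (ennreal s) <= enn2real ?d" by (rule enn2real_mono)
  then show ?case using s by (simp add: cf_dim_def)
 qed
qed

section \<open>The final count\<close>

text \<open>After Cauchy--Schwarz the summands are squares, so WX may be enlarged to all words u @ v
  with u a product of n blocks and v an even word of continuant at most X/\<tau>^n. Moving v into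
  the fixed right factor leaves the block sum, bounded by V, for at most 2 (X/\<tau>^n)^2 words
  v.\<close>

lemma large_sum_bound:
 fixes f :: "int^2^2 => real" and X :: real
 assumes WX: "finite WX" "!!w. w \<in> WX ==> evenw A w & int (bsize A \<tau> ^ n) <= KK w & real_of_int (KK w) <= X"
  and \<tau>: "\<tau> >= 2" and a: "det a = 1"
  and V: "!!t. det t = 1 ==> (SUM u:blocks A \<tau> n. (f (word_matrix u ** t))^2) <= V"
 shows "(SUM w:WX. \<bar>f (word_matrix w ** a)\<bar>)^2 <= real (card WX) * (2 * (X / real \<tau> ^ n)^2 * V)"
proof (cases "WX = {}")
 case False
 then obtain w0 where w0: "w0 \<in> WX" by blast
 have "1 <= KK w0" using WX(2)[OF w0] KK_ge_1 evenw_pword by blast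
 then have X0: "X >= 0" using WX(2)[OF w0] by linarith
 define M where "M = nat \<lfloor>X / real \<tau> ^ n\<rfloor>"
 have Mle: "real M <= X / real \<tau> ^ n" using X0 by (simp add: M_def)
 define R where "R = {v. evenw A v & KK v <= int M}"
 have sub: "R \<subseteq> {w. pword w & even (length w) & KK w <= int M}" by (auto simp: R_def evenw_pword evenw_def pword_def)
 have fR: "finite R" by (rule finite_subset[OF sub even_words_count(1)])
 have "card R <= 2 * M^2" using card_mono[OF even_words_count(1) sub] even_words_count(2)[of M] by linarith
 then have "real (card R) <= 2 * (real M)^2" by (metis of_nat_le_iff of_nat_mult of_nat_numeral of_nat_power)
 also have "... <= 2 * (X / real \<tau> ^ n)^2" using Mle by (intro mult_left_mono power_mono) auto
 finally have cR: "real (card R) <= 2 * (X / real \<tau> ^ n)^2" .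
 have fB: "finite (blocks A \<tau> n)" by (rule blocks_finite_card)
 have dec: "WX \<subseteq> (%(u, v). u @ v) ` (blocks A \<tau> n \<times> R)"
 proof
  fix w assume w: "w \<in> WX"
  obtain u v where uv: "w = u @ v" "u \<in> blocks A \<tau> n" "evenw A v"
   using blocks_decompose[OF \<tau>, of A w n] WX(2)[OF w] by blast
  have pu: "pword u" "pword v" using blocks_evenw[OF uv(2)] uv(3) evenw_pword by auto
  have "int (\<tau> ^ n) * KK v <= KK u * KK v" using blocks_KK_ge[OF uv(2)] KK_ge_1[OF pu(2)] by (intro mult_right_mono) auto
  also have "... <= KK w" unfolding uv(1) by (rule KK_append(1)[OF pu])
  finally have "real_of_int (int (\<tau> ^ n) * KK v) <= X" using WX(2)[OF w] by linarith
  then have "real_of_int (KK v) <= X / real \<tau> ^ n" using \<tau> by (simp add: le_divide_eq mult.commute)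
  then have "KK v <= int M" using KK_ge_1[OF pu(2)] X0 unfolding M_def by (simp add: le_floor_iff)
  then show "w \<in> (%(u, v). u @ v) ` (blocks A \<tau> n \<times> R)" using uv by (auto simp: R_def)
 qed
 have V0: "V >= 0" by (rule order_trans[OF sum_nonneg V[OF a]]) simp
 have "(SUM w:WX. \<bar>f (word_matrix w ** a)\<bar>)^2 <= (SUM w:WX. \<bar>f (word_matrix w ** a)\<bar>\<^sup>2) * real (card WX)"
  by (rule sum_squared_le_sum_of_squares)
 note CS = this
 have "(SUM w:WX. \<bar>f (word_matrix w ** a)\<bar>\<^sup>2) = (SUM w:WX. (f (word_matrix w ** a))^2)" by simp
 also have "... <= (SUM w:(%(u, v). u @ v) ` (blocks A \<tau> n \<times> R). (f (word_matrix w ** a))^2)"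
  by (rule sum_mono2) (use fB fR dec in auto)
 also have "... <= (SUM x:blocks A \<tau> n \<times> R. ((%w. (f (word_matrix w ** a))^2) \<circ> (%(u, v). u @ v)) x)"
  by (rule sum_image_le) (use fB fR in auto)
 also have "... = (SUM u:blocks A \<tau> n. SUM v:R. (f (word_matrix u ** (word_matrix v ** a)))^2)"
  by (simp add: sum.cartesian_product case_prod_unfold word_matrix_append matrix_mul_assoc)
 also have "... = (SUM v:R. SUM u:blocks A \<tau> n. (f (word_matrix u ** (word_matrix v ** a)))^2)" by (rule sum.swap)
 also have "... <= (SUM v:R. V)"
 proof (intro sum_mono V)
  fix v assume "v \<in> R"
  then have "evenw A v" by (simp add: R_def)
  then show "det (word_matrix v ** a) = 1" using a evenw_det[of A v] by (simp add: det_mul)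
 qed
 also have "... = real (card R) * V" by simp
 also have "... <= 2 * (X / real \<tau> ^ n)^2 * V" using cR V0 by (rule mult_right_mono)
 finally have "(SUM w:WX. \<bar>f (word_matrix w ** a)\<bar>\<^sup>2) * real (card WX) <= 2 * (X / real \<tau> ^ n)^2 * V * real (card WX)"
  by (rule mult_right_mono) simp
 then show ?thesis using CS by (simp only: mult.commute[of "real (card WX)"])
qed simp

lemma prod_primes_inj:
 assumes "finite P" "!!p. p \<in> P ==> prime (p :: nat)"
 shows "inj_on (%D. \<Prod>D) (Pow P)"
proof (rule inj_onI)
 fix D E assume DE: "D \<in> Pow P" "E \<in> Pow P" "\<Prod>D = \<Prod>E"
 have "p \<in> D \<longleftrightarrow> p dvd \<Prod>D" if "D \<in> Pow P" "prime p" for D p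
 proof -
  have fD: "finite D" using that assms(1) finite_subset by auto
  have "p dvd \<Prod>D \<longleftrightarrow> (\<exists>q\<in>D. p dvd q)" using prime_dvd_prod_iff[OF fD that(2), of "%x. x"] by simp
  also have "... \<longleftrightarrow> p \<in> D" using that assms(2) by (auto simp: primes_dvd_imp_eq intro: bexI[of _ p] dest: primes_dvd_imp_eq[OF that(2)])
  finally show ?thesis by simp
 qed
 then have "p \<in> D \<longleftrightarrow> p \<in> E" if "prime p" for p using DE that by metis
 then show "D = E" using DE(1,2) assms(2) by blast
qed

text \<open>Crude bounds suffice since Q0 will be a tiny power of N: there are at most Q0 sets D,
  B^(card D) is at most Q0^(log 2 B), and the classes and the dependence on the modulus contribute 3
  + C.\<close>

lemma small_sum_bound:
 assumes eq: "equidistributed_set C \<Theta> K Y S" and fS: "finite S" and dS: "!!a. a \<in> S ==> det a = 1"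
  and P: "finite P" "!!p. p \<in> P ==> prime p"
  and DS: "DS \<subseteq> Pow P" "{} \<notin> DS" "!!D. D \<in> DS ==> real (\<Prod>D) <= Q0"
  and c: "!!D. D \<in> DS ==> \<bar>c D\<bar> <= c1 * B ^ card D" and B: "B >= 1" "c1 >= 0" and C: "C > 0"
  and Q0: "Q0 >= 1" and uv: "det u = 1" "det v = 1"
 shows "\<bar>SUM a:S. SUM D:DS. c D * FD D (u ** a ** v)\<bar> <=
  c1 * \<bar>K\<bar> * real (card S) * Q0 powr (4 + log 2 B + C) * Y powr (- \<Theta>)"
proof -
 have fD: "finite D" "D ~= {}" "!!p. p \<in> D ==> prime p" if "D \<in> DS" for D
 proof -
  have DP: "D \<subseteq> P" using that DS(1) by blast
  show "finite D" by (rule finite_subset[OF DP P(1)])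
  show "D ~= {}" using that DS(2) by blast
  show "!!p. p \<in> D ==> prime p" using DP P(2) by blast
 qed
 have d1: "1 <= \<Prod>D" if "D \<in> DS" for D
  by (rule prod_ge_1) (use fD(3)[OF that] prime_ge_1_nat in blast)
 have l0: "log 2 B >= 0" using B by simp
 have one: "\<bar>c D\<bar> * \<bar>SUM a:S. FD D (u ** a ** v)\<bar> <= c1 * \<bar>K\<bar> * real (card S) * Q0 powr (3 + log 2 B + C) * Y powr (- \<Theta>)"
  if D: "D \<in> DS" for D
 proof -
  let ?d = "real (\<Prod>D)"
  have d: "1 <= ?d" "?d <= Q0" using d1[OF D] DS(3)[OF D] by (simp_all only: real_of_nat_ge_one_iff)
  have "2 ^ card D <= ?d"
  proof -
   have "(PROD p:D. 2) <= \<Prod>D" by (rule prod_mono) (use fD(3)[OF D] prime_ge_2_nat in auto)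
   then have "2 ^ card D <= \<Prod>D" by simp
   then have "real (2 ^ card D) <= ?d" by (simp only: of_nat_le_iff)
   then show ?thesis by simp
  qed
  then have "(2 ^ card D) powr (log 2 B) <= Q0 powr (log 2 B)" using l0 d by (intro powr_mono2) auto
  moreover have "(2 ^ card D) powr (log 2 B) = B ^ card D"
  proof -
   have "(2 ^ card D) powr (log 2 B) = (2 powr log 2 B) powr real (card D)"
    by (simp add: powr_powr powr_realpow[symmetric] mult.commute)
   then show ?thesis using B by (simp add: powr_realpow)
  qed
  ultimately have cD: "\<bar>c D\<bar> <= c1 * Q0 powr (log 2 B)" using c[OF D] B(2) mult_left_mono[of "B ^ card D" "Q0 powr (log 2 B)" c1] by linarith
  have "\<bar>SUM a:S. FD D (u ** a ** v)\<bar> <= ?d ^ 3 * (\<bar>K\<bar> * (real (card S) * ?d powr C * Y powr (- \<Theta>)))"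
   by (rule equidistributed_sum_FD[OF eq fS dS fD(1,2)[OF D] fD(3)[OF D] uv])
  also have "... <= Q0 ^ 3 * (\<bar>K\<bar> * (real (card S) * Q0 powr C * Y powr (- \<Theta>)))"
  proof -
   have "?d powr C <= Q0 powr C" using d C by (intro powr_mono2) auto
   then show ?thesis using d Q0 by (intro mult_mono power_mono mult_nonneg_nonneg) (auto simp: prod_nonneg)
  qed
  finally have "\<bar>SUM a:S. FD D (u ** a ** v)\<bar> <= Q0 ^ 3 * (\<bar>K\<bar> * (real (card S) * Q0 powr C * Y powr (- \<Theta>)))" .
  with cD have "\<bar>c D\<bar> * \<bar>SUM a:S. FD D (u ** a ** v)\<bar> <= (c1 * Q0 powr (log 2 B)) * (Q0 ^ 3 * (\<bar>K\<bar> * (real (card S) * Q0 powr C * Y powr (- \<Theta>))))"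
   using B by (intro mult_mono) auto
  also have "... = c1 * \<bar>K\<bar> * real (card S) * (Q0 ^ 3 * Q0 powr (log 2 B) * Q0 powr C) * Y powr (- \<Theta>)" by (simp only: mult_ac)
  also have "Q0 ^ 3 * Q0 powr (log 2 B) * Q0 powr C = Q0 powr (3 + log 2 B + C)"
   using Q0 by (simp add: powr_add powr_numeral)
  finally show ?thesis .
 qed
 have cardDS: "real (card DS) <= Q0"
 proof -
  have "card DS = card ((%D. \<Prod>D) ` DS)"
   by (rule card_image[symmetric], rule inj_on_subset[OF prod_primes_inj[OF P] DS(1)]) assumption
  also have "... <= card {1..nat \<lfloor>Q0\<rfloor>}"
  proof (rule card_mono, simp, rule image_subsetI)
   fix D assume D: "D \<in> DS"
   show "\<Prod>D \<in> {1..nat \<lfloor>Q0\<rfloor>}" using d1[OF D] le_nat_floor[OF DS(3)[OF D]] by simp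
  qed
  finally have "card DS <= nat \<lfloor>Q0\<rfloor>" by simp
  then show ?thesis using Q0 by linarith
 qed
 have "\<bar>SUM a:S. SUM D:DS. c D * FD D (u ** a ** v)\<bar> = \<bar>SUM D:DS. c D * (SUM a:S. FD D (u ** a ** v))\<bar>"
  by (subst sum.swap) (simp add: sum_distrib_left)
 also have "... <= (SUM D:DS. \<bar>c D\<bar> * \<bar>SUM a:S. FD D (u ** a ** v)\<bar>)"
  using sum_abs[of "%D. c D * (SUM a:S. FD D (u ** a ** v))" DS] by (simp add: abs_mult)
 also have "... <= (SUM D:DS. c1 * \<bar>K\<bar> * real (card S) * Q0 powr (3 + log 2 B + C) * Y powr (- \<Theta>))" by (rule sum_mono) (rule one)
 also have "... = real (card DS) * (c1 * \<bar>K\<bar> * real (card S) * Q0 powr (3 + log 2 B + C) * Y powr (- \<Theta>))" by simp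
 also have "... <= Q0 * (c1 * \<bar>K\<bar> * real (card S) * Q0 powr (3 + log 2 B + C) * Y powr (- \<Theta>))"
  using cardDS B by (intro mult_right_mono) auto
 also have "... = c1 * \<bar>K\<bar> * real (card S) * Q0 powr (4 + log 2 B + C) * Y powr (- \<Theta>)"
  using Q0 powr_add[of Q0 1 "3 + log 2 B + C"] by (simp add: add_ac mult_ac)
 finally show ?thesis .
qed

lemma Gamma_words:
 assumes sub: "S \<subseteq> {g \<in> Gamma_semigroup A. matrix_norm g < X}"
 obtains W where "finite W" "inj_on word_matrix W" "S = word_matrix ` W"
  "!!w. w \<in> W ==> evenw A w & w ~= [] & real_of_int (KK w) <= X"
proof -
 define W where "W = {w. evenw A w & w ~= [] & word_matrix w \<in> S}"
 have KX: "real_of_int (KK w) <= X" if w: "w \<in> W" for w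
 proof -
  have "matrix_norm (word_matrix w) < X" using w sub by (auto simp: W_def)
  moreover have "real_of_int (KK w) <= matrix_norm (word_matrix w)"
   unfolding matrix_norm_def ptr_def[symmetric] ptr_eq
   by (rule real_le_rsqrt) simp
  ultimately show ?thesis by simp
 qed
 have "W \<subseteq> {w. pword w & even (length w) & KK w <= int (nat \<lfloor>X\<rfloor>)}"
 proof
  fix w assume w: "w \<in> W"
  have "pword w" "even (length w)" using w by (auto simp: W_def evenw_def pword_def)
  moreover have "KK w <= \<lfloor>X\<rfloor>" using KX[OF w] by (simp add: le_floor_iff)
  then have "KK w <= int (nat \<lfloor>X\<rfloor>)" by linarith
  ultimately show "w \<in> {w. pword w & even (length w) & KK w <= int (nat \<lfloor>X\<rfloor>)}" by blast
 qed
 then have fin: "finite W" by (rule finite_subset[OF _ even_words_count(1)])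
 have inj: "inj_on word_matrix W"
  by (rule inj_onI) (auto simp: W_def intro: word_matrix_inj evenw_pword)
 have im: "S = word_matrix ` W"
  using sub by (fastforce simp: W_def Gamma_semigroup_def evenw_def)
 show ?thesis by (rule that[OF fin inj im]) (use KX in \<open>auto simp: W_def\<close>)
qed

lemma Omega_set_words:
 assumes "Omega_set A c X \<Omega>"
 obtains W l where "finite W" "inj_on word_matrix W" "\<Omega> = word_matrix ` W"
  "!!w. w \<in> W ==> evenw A w & w ~= [] & length w = l & real_of_int (KK w) <= X"
proof -
 obtain W where W: "finite W" "inj_on word_matrix W" "\<Omega> = word_matrix ` W"
  "!!w. w \<in> W ==> evenw A w & w ~= [] & real_of_int (KK w) <= X"
  using Gamma_words[of \<Omega> A X] assms unfolding Omega_set_def by blast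
 obtain l where l: "!!g. g \<in> \<Omega> ==> \<exists>w. length w = l & set w \<subseteq> {1..A} & g = word_matrix w"
  using assms unfolding Omega_set_def same_word_length_def by blast
 have len: "length w = l" if w: "w \<in> W" for w
 proof -
  obtain w' where w': "length w' = l" "set w' \<subseteq> {1..A}" "word_matrix w = word_matrix w'" using l[of "word_matrix w"] w W(3) by blast
  have "pword w'" using w'(2) by (auto simp: pword_def)
  then have "w = w'" using word_matrix_inj[OF _ _ w'(3)] W(4)[OF w] evenw_pword by blast
  then show ?thesis using w' by simp
 qed
 show ?thesis by (rule that[OF W(1-3)]) (use W(4) len in auto)
qed

lemma equidistributed_set_words:
 assumes "equidistributed_set C \<Theta> K Y S"
 obtains W where "finite W" "inj_on word_matrix W" "S = word_matrix ` W" "!!w. w \<in> W ==> evenw 2 w & w ~= []"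
proof -
 have sub: "S \<subseteq> {g \<in> Gamma_semigroup 2. matrix_norm g < Y}" using assms by (simp add: equidistributed_set_def)
 show ?thesis by (rule Gamma_words[OF sub], rule that) auto
qed

text \<open>The sieve weight is nonpositive where some p in P divides \<open>disc\<close>, and at
  most U elsewhere, so its sum bounds the count from below. Small and large sets D each consume
  1/100 of the main term 1/10, and more than 1/20 remains.\<close>

lemma weighted_count:
 fixes G :: "int^2^2 => real" and WX WS WZ :: "nat list set"
 assumes fin: "finite WX" "finite WS" "finite WZ"
  and ev: "!!w. w \<in> WX ==> det (word_matrix w) = 1" "!!w. w \<in> WS ==> det (word_matrix w) = 1" "!!w. w \<in> WZ ==> det (word_matrix w) = 1"
  and P: "finite P" "!!p. p \<in> P ==> prime p" and Q0: "Q0 >= 1"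
  and G: "!!g. (G g)^2 * (1 - (SUM p:P. chi p g)) = (SUM D:Pow P. c D * FD D g)" and c0: "c {} >= 1 / 10"
  and U: "!!g. (\<forall>p\<in>P. \<not> int p dvd disc g) ==> (G g)^2 <= U"
  and small: "!!u v. det u = 1 ==> det v = 1 ==>
   \<bar>SUM s:WS. \<Sum>D | D \<in> Pow P & D ~= {} & real (\<Prod>D) <= Q0. c D * FD D (u ** word_matrix s ** v)\<bar> <= real (card WS) / 100"
  and large: "!!a. det a = 1 ==>
   (SUM w:WX. \<bar>SUM \<omega>:WZ. \<Sum>D | D \<in> Pow P & c D ~= 0 & Q0 < real (\<Prod>D). c D * FD D (word_matrix w ** a ** word_matrix \<omega>)\<bar>)^2
    <= (real (card WX) * real (card WZ) / 100)^2"
 shows "real (card {(w, s, \<omega>) \<in> WX \<times> WS \<times> WZ. \<forall>p\<in>P. \<not> int p dvd disc (word_matrix w ** word_matrix s ** word_matrix \<omega>)}) * U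
  >= real (card WX) * real (card WS) * real (card WZ) / 20"
proof -
 define gg where "gg = (%w s \<omega>. word_matrix w ** word_matrix s ** word_matrix \<omega>)"
 define DS where "DS = {D. D \<in> Pow P & D ~= {} & real (\<Prod>D) <= Q0}"
 define DL where "DL = {D. D \<in> Pow P & c D ~= 0 & Q0 < real (\<Prod>D)}"
 define L where "L = (%g. SUM D:Pow P. c D * FD D g)"
 define Ls where "Ls = (%g. SUM D:DS. c D * FD D g)"
 define Ll where "Ll = (%g. SUM D:DL. c D * FD D g)"
 define n1 where "n1 = real (card WX)"
 define n2 where "n2 = real (card WS)"
 define n3 where "n3 = real (card WZ)"
 have L_split: "L g = c {} + Ls g + Ll g" for g
 proof -
  have "L g = (SUM D:{{}} \<union> (DS \<union> DL). c D * FD D g)"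
   unfolding L_def
  proof (rule sum.mono_neutral_right)
   show "\<forall>D\<in>Pow P - ({{}} \<union> (DS \<union> DL)). c D * FD D g = 0" by (auto simp: DS_def DL_def not_le)
  qed (use P in \<open>auto simp: DS_def DL_def\<close>)
  also have "... = (SUM D:{{}}. c D * FD D g) + (SUM D:DS \<union> DL. c D * FD D g)"
   by (rule sum.union_disjoint) (use P Q0 in \<open>auto simp: DS_def DL_def\<close>)
  also have "(SUM D:DS \<union> DL. c D * FD D g) = Ls g + Ll g"
   unfolding Ls_def Ll_def by (rule sum.union_disjoint) (use P in \<open>auto simp: DS_def DL_def\<close>)
  finally show ?thesis by (simp add: FD_def)
 qed
 let ?S = "%f. SUM w:WX. SUM s:WS. SUM \<omega>:WZ. f (gg w s \<omega>) :: real"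
 have S_main: "?S (%g. c {}) = c {} * (n1 * n2 * n3)" by (simp add: n1_def n2_def n3_def)
 have S_small: "\<bar>?S Ls\<bar> <= n1 * n2 * n3 / 100"
 proof -
  have "?S Ls = (SUM w:WX. SUM \<omega>:WZ. SUM s:WS. Ls (gg w s \<omega>))" by (rule sum.cong[OF refl]) (rule sum.swap)
  also have "\<bar>...\<bar> <= (SUM w:WX. SUM \<omega>:WZ. \<bar>SUM s:WS. Ls (gg w s \<omega>)\<bar>)"
   by (rule order_trans[OF sum_abs]) (rule sum_mono, rule sum_abs)
  also have "... <= (SUM w:WX. SUM \<omega>:WZ. n2 / 100)"
   unfolding Ls_def gg_def n2_def DS_def by (intro sum_mono small ev) auto
  also have "... = n1 * n2 * n3 / 100" by (simp add: n1_def n3_def)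
  finally show ?thesis .
 qed
 have S_large: "\<bar>?S Ll\<bar> <= n1 * n2 * n3 / 100"
 proof -
  have "?S Ll = (SUM s:WS. SUM w:WX. SUM \<omega>:WZ. Ll (gg w s \<omega>))" by (rule sum.swap)
  also have "\<bar>...\<bar> <= (SUM s:WS. SUM w:WX. \<bar>SUM \<omega>:WZ. Ll (gg w s \<omega>)\<bar>)"
   by (rule order_trans[OF sum_abs]) (rule sum_mono, rule sum_abs)
  also have "... <= (SUM s:WS. n1 * n3 / 100)"
  proof (rule sum_mono)
   fix s assume s: "s \<in> WS"
   have "(SUM w:WX. \<bar>SUM \<omega>:WZ. Ll (gg w s \<omega>)\<bar>)^2 <= (n1 * n3 / 100)^2"
    unfolding Ll_def gg_def n1_def n3_def DL_def by (rule large[OF ev(2)[OF s]])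
   then show "(SUM w:WX. \<bar>SUM \<omega>:WZ. Ll (gg w s \<omega>)\<bar>) <= n1 * n3 / 100"
    by (rule power2_le_imp_le) (simp add: n1_def n3_def)
  qed
  also have "... = n1 * n2 * n3 / 100" by (simp add: n2_def)
  finally show ?thesis .
 qed
 have "?S L = ?S (%g. c {}) + ?S Ls + ?S Ll" unfolding L_split by (simp only: sum.distrib)
 moreover have "1 / 10 * (n1 * n2 * n3) <= c {} * (n1 * n2 * n3)"
  using c0 by (rule mult_right_mono) (simp add: n1_def n2_def n3_def)
 moreover have "n1 * n2 * n3 >= 0" by (simp add: n1_def n2_def n3_def)
 ultimately have lower: "n1 * n2 * n3 / 20 <= ?S L"
  using S_main S_small S_large by linarith
 define AP where "AP = {x \<in> WX \<times> WS \<times> WZ. \<forall>p\<in>P. \<not> int p dvd disc (gg (fst x) (fst (snd x)) (snd (snd x)))}"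
 have fT: "finite (WX \<times> WS \<times> WZ)" using fin by auto
 have "?S L = (SUM x:WX \<times> WS \<times> WZ. L (gg (fst x) (fst (snd x)) (snd (snd x))))"
  by (simp add: sum.cartesian_product case_prod_unfold)
 also have "... <= (SUM x:WX \<times> WS \<times> WZ. if x \<in> AP then U else 0)"
 proof (rule sum_mono)
  fix x assume x: "x \<in> WX \<times> WS \<times> WZ"
  let ?g = "gg (fst x) (fst (snd x)) (snd (snd x))"
  have Lg: "L ?g = (G ?g)^2 * (1 - (SUM p:P. chi p ?g))" by (simp add: G L_def)
  show "L ?g <= (if x \<in> AP then U else 0)"
  proof (cases "x \<in> AP")
   case True
   then have a: "\<forall>p\<in>P. \<not> int p dvd disc ?g" by (simp add: AP_def)
   then have "(SUM p:P. chi p ?g) = 0" by (simp add: chi_def)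
   then show ?thesis using True U[OF a] Lg by simp
  next
   case False
   then obtain p where p: "p \<in> P" "int p dvd disc ?g" using x by (auto simp: AP_def)
   have "chi p ?g <= (SUM p:P. chi p ?g)" by (rule member_le_sum) (use p P in \<open>auto simp: chi_def\<close>)
   then have "1 - (SUM p:P. chi p ?g) <= 0" using p by (simp add: chi_def)
   then have "L ?g <= 0" unfolding Lg by (intro mult_nonneg_nonpos) auto
   then show ?thesis using False by simp
  qed
 qed
 also have "... = (SUM x:AP. U)"
  using fT by (subst sum.inter_restrict[symmetric]) (auto simp: AP_def Int_def intro!: arg_cong2[where f = times] arg_cong[where f = card])
 also have "... = real (card AP) * U" by simp
 finally have "?S L <= real (card AP) * U" .
 moreover have "AP = {(w, s, \<omega>) \<in> WX \<times> WS \<times> WZ. \<forall>p\<in>P. \<not> int p dvd disc (word_matrix w ** word_matrix s ** word_matrix \<omega>)}"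
  by (auto simp: AP_def gg_def)
 ultimately show ?thesis using lower by (simp add: n1_def n2_def n3_def)
qed

text \<open>The first words share one length, and so do the last ones. A concatenation therefore
  determines its three parts, although the middle words vary in length.\<close>

lemma card_almost_primes_ge:
 assumes WX: "finite WX" "!!w. w \<in> WX ==> pword w & length w = lX & word_matrix w \<in> \<Omega>X"
  and WS: "finite WS" "!!w. w \<in> WS ==> pword w & word_matrix w \<in> S"
  and WZ: "finite WZ" "!!w. w \<in> WZ ==> pword w & length w = lZ & word_matrix w \<in> \<Omega>Z"
  and fin: "finite \<Omega>X" "finite S" "finite \<Omega>Z"
  and N: "N > 0"
 shows "card {(w, s, \<omega>) \<in> WX \<times> WS \<times> WZ. \<forall>p\<in>primes_upto (N powr (1/350)). \<not> int p dvd disc (word_matrix w ** word_matrix s ** word_matrix \<omega>)}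
  <= card (almost_primes N (Pi_set \<Omega>X S \<Omega>Z))"
proof -
 define T where "T = {(w, s, \<omega>) \<in> WX \<times> WS \<times> WZ. \<forall>p\<in>primes_upto (N powr (1/350)). \<not> int p dvd disc (word_matrix w ** word_matrix s ** word_matrix \<omega>)}"
 define h where "h = (%(w, s, \<omega>). word_matrix w ** word_matrix s ** word_matrix \<omega>)"
 have inj: "inj_on h T"
 proof (rule inj_onI)
  fix x y assume xy: "x \<in> T" "y \<in> T" "h x = h y"
  obtain w s v where x: "x = (w, s, v)" by (metis prod_cases3)
  obtain w' s' v' where y: "y = (w', s', v')" by (metis prod_cases3)
  have m: "w \<in> WX" "s \<in> WS" "v \<in> WZ" "w' \<in> WX" "s' \<in> WS" "v' \<in> WZ" using xy x y by (auto simp: T_def)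
  note p = WX(2)[OF m(1)] WX(2)[OF m(4)] WS(2)[OF m(2)] WS(2)[OF m(5)] WZ(2)[OF m(3)] WZ(2)[OF m(6)]
  have "word_matrix (w @ s @ v) = word_matrix (w' @ s' @ v')"
   using xy(3) by (simp add: x y h_def word_matrix_append matrix_mul_assoc)
  moreover have "pword (w @ s @ v)" "pword (w' @ s' @ v')" using p by simp_all
  ultimately have e: "w @ s @ v = w' @ s' @ v'" using word_matrix_inj by blast
  have "length w = length w'" using p by simp
  then have 1: "w = w'" "s @ v = s' @ v'" using e by auto
  have "length v = length v'" using p by simp
  then have "s = s'" "v = v'" using 1(2) by auto
  then show "x = y" using 1 x y by simp
 qed
 have "h ` T \<subseteq> almost_primes N (Pi_set \<Omega>X S \<Omega>Z)"
 proof (rule image_subsetI)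
  fix x assume x: "x \<in> T"
  obtain w s v where xx: "x = (w, s, v)" by (metis prod_cases3)
  have m: "w \<in> WX" "s \<in> WS" "v \<in> WZ" using x by (auto simp: T_def xx)
  have pi: "h x \<in> Pi_set \<Omega>X S \<Omega>Z" unfolding Pi_set_def xx h_def using WX(2)[OF m(1)] WS(2)[OF m(2)] WZ(2)[OF m(3)] by auto
  have "real_of_int p > N powr (1 / 350)" if p: "prime p" "p dvd (trace (h x ** transpose (h x)))\<^sup>2 - 4" for p :: int
  proof (rule ccontr)
   assume le: "\<not> real_of_int p > N powr (1 / 350)"
   have p0: "p > 0" using p(1) by (simp add: prime_gt_0_int)
   have "nat p \<in> primes_upto (N powr (1/350))"
    unfolding primes_upto_def using p p0 le by (simp add: not_less)
   moreover have "int (nat p) dvd disc (h x)" using p p0 by (simp add: disc_def ptr_def)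
   ultimately show False using x by (auto simp: T_def xx h_def)
  qed
  then show "h x \<in> almost_primes N (Pi_set \<Omega>X S \<Omega>Z)" using pi by (simp add: almost_primes_def)
 qed
 moreover have "finite (almost_primes N (Pi_set \<Omega>X S \<Omega>Z))"
 proof (rule finite_subset)
  show "almost_primes N (Pi_set \<Omega>X S \<Omega>Z) \<subseteq> (%(x, a, w). x ** a ** w) ` (\<Omega>X \<times> S \<times> \<Omega>Z)"
   by (auto simp: almost_primes_def Pi_set_def image_def)
 qed (use fin in auto)
 ultimately have "card (h ` T) <= card (almost_primes N (Pi_set \<Omega>X S \<Omega>Z))" by (intro card_mono)
 then show ?thesis using card_image[OF inj] by (simp add: T_def)
qed

lemma eventually_divisors_le:
 assumes "e > 0" "k >= 0" "c >= 1"
 shows "\<forall>\<^sub>F N in at_top. \<forall>M::int. M ~= 0 --> real_of_int \<bar>M\<bar> <= c * N powr k --> real (card {d. d dvd M}) <= N powr e"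
proof -
 define e1 where "e1 = e / (2 * (k + 1))"
 have e1: "e1 > 0" "k * e1 <= e / 2" using assms by (auto simp: e1_def field_simps)
 obtain C1 where C1: "C1 >= 1" "!!n. n > 0 ==> real (dcount n) <= C1 * real n powr e1"
  using dcount_bound[OF e1(1)] by blast
 have "\<forall>\<^sub>F N in at_top. 2 * C1 * c powr e1 <= N powr (e / 2)" using assms by real_asymp
 then show ?thesis using eventually_gt_at_top[of "1::real"]
 proof eventually_elim
  case (elim N)
  show ?case
  proof (intro allI impI)
   fix M :: int assume M: "M ~= 0" "real_of_int \<bar>M\<bar> <= c * N powr k"
   have n: "real (nat \<bar>M\<bar>) = real_of_int \<bar>M\<bar>" by simp
   have "real (card {d. d dvd M}) <= 2 * real (dcount (nat \<bar>M\<bar>))"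
    using int_divisors_card(2)[OF M(1)] by linarith
   also have "... <= 2 * (C1 * real (nat \<bar>M\<bar>) powr e1)" using C1(2)[of "nat \<bar>M\<bar>"] M(1) by simp
   also have "... <= 2 * (C1 * (c * N powr k) powr e1)"
    using M(2) e1 C1 unfolding n by (intro mult_left_mono powr_mono2) auto
   also have "... = (2 * C1 * c powr e1) * N powr (k * e1)" using assms by (simp add: powr_mult powr_powr)
   also have "... <= N powr (e / 2) * N powr (e / 2)"
    using elim e1 C1 assms by (intro mult_mono powr_mono) auto
   also have "... = N powr e" by (simp flip: powr_add)
   finally show "real (card {d. d dvd M}) <= N powr e" .
  qed
 qed
qed

text \<open>Distinct sets of prime divisors have distinct products, all of which divide
  \<Delta>.\<close>

lemma two_power_prime_divisors_le:
 assumes "finite P" "!!p. p \<in> P ==> prime (p::nat)" "\<Delta> ~= (0::int)"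
 shows "2 ^ card {p\<in>P. int p dvd \<Delta>} <= card {d. d dvd \<Delta>}"
proof -
 let ?Z = "{p\<in>P. int p dvd \<Delta>}"
 have "card ((%D. int (\<Prod>D)) ` Pow ?Z) <= card {d. d dvd \<Delta>}"
 proof (rule card_mono[OF int_divisors_card(1)[OF assms(3)]], rule image_subsetI)
  fix D assume D: "D \<in> Pow ?Z"
  have "\<Prod>D dvd nat \<bar>\<Delta>\<bar>"
  proof (rule prod_coprime_dvd)
   show "p dvd nat \<bar>\<Delta>\<bar>" if "p \<in> D" for p using D that by (auto simp: int_dvd_int_iff[symmetric])
   show "coprime p q" if "p \<in> D" "q \<in> D" "p ~= q" for p q
   proof -
    have "p \<in> P" "q \<in> P" using D that by auto
    then show ?thesis using assms(2) that(3) by (simp add: primes_coprime)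
   qed
  qed
  then have "int (\<Prod>D) dvd int (nat \<bar>\<Delta>\<bar>)" by (simp only: int_dvd_int_iff)
  then show "int (\<Prod>D) \<in> {d. d dvd \<Delta>}" by simp
 qed
 moreover have "inj_on (%D. int (\<Prod>D)) (Pow ?Z)"
 proof (rule inj_onI)
  fix D E assume "D \<in> Pow ?Z" "E \<in> Pow ?Z" "int (\<Prod>D) = int (\<Prod>E)"
  then show "D = E" using inj_onD[OF prod_primes_inj[OF assms(1)], of D E] assms(2) by (auto simp del: of_nat_prod)
 qed
 ultimately show ?thesis using assms(1) by (simp add: card_image card_Pow)
qed

text \<open>The balance of exponents: the dispersion saves \<kappa>/4, enlarging WX costs
  \<kappa>/20, the powers of b left over from block mixing cost 6 \<beta>, and constants, divisor
  bounds and Euler products cost 10 \<epsilon>.\<close>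

lemma large_estimate:
 fixes N \<beta> \<epsilon> \<kappa> B :: real and WX WZ :: "nat list set"
 assumes N: "N > 1" and P: "finite P" "!!p. p \<in> P ==> prime p"
  and \<tau>: "\<tau> >= 2" "real \<tau> <= 2 * N powr \<beta>" "N powr \<beta> <= real \<tau>" and b: "b = real (bsize A \<tau>)"
  and k: "\<beta> * real k >= 16/21"
  and WX: "finite WX" "!!w. w \<in> WX ==> evenw A w & int (bsize A \<tau> ^ (4 + k)) <= KK w & real_of_int (KK w) <= X"
  and WZ: "finite WZ" "!!w. w \<in> WZ ==> evenw A w & w ~= [] & KK w <= M"
  and Dv: "!!M. M ~= 0 ==> real_of_int \<bar>M\<bar> <= 7 * (b ^ (4 + k)) ^ 4 ==> real (card {d::int. d dvd M}) <= N powr \<epsilon>"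
  and U1: "!!\<Delta>::int. \<Delta> ~= 0 ==> \<bar>\<Delta>\<bar> <= 256 * M ^ 8 ==> (1 + 32 * B^2) ^ card {p\<in>P. int p dvd \<Delta>} <= N powr \<epsilon>"
  and U2: "(PROD p:P. 1 + 32 * B^2 / real p) <= N powr \<epsilon>"
  and c: "!!D. D \<in> Pow P ==> \<bar>c D\<bar> <= N powr \<epsilon> * B ^ card D" and B: "B >= 1"
  and supp: "!!D. D \<in> Pow P ==> c D ~= 0 ==> real (\<Prod>D) <= N powr (1/14)"
  and n1: "X^2 <= real (card WX) * N powr (\<kappa> / 20)" and n3: "N powr (\<kappa> / 4) <= real (card WZ)"
  and exps: "6 * \<beta> <= \<kappa> / 100" "10 * \<epsilon> <= \<kappa> / 100" "\<kappa> > 0" "\<epsilon> > 0"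
  and const: "10000 * (8 * 812^2 * (4 * (real A ^ 2 + 1)) ^ (2 * (4 + k)) * (8 * (real A ^ 2 + 1)) ^ 6) <= N powr \<epsilon>"
  and a: "det a = 1"
 shows "(SUM w:WX. \<bar>SUM \<omega>:WZ. \<Sum>D | D \<in> Pow P & c D ~= 0 & N powr \<kappa> < real (\<Prod>D). c D * FD D (word_matrix w ** a ** word_matrix \<omega>)\<bar>)^2
  <= (real (card WX) * real (card WZ) / 100)^2"
proof -
 define n where "n = 4 + k"
 define DL where "DL = {D. D \<in> Pow P & c D ~= 0 & N powr \<kappa> < real (\<Prod>D)}"
 define q where "q = 4 * (real A ^ 2 + 1)"
 define v1 where "v1 = real (card WX)"
 define v3 where "v3 = real (card WZ)"
 define E where "E = N powr \<epsilon>"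
 define Dn where "Dn = nat \<lfloor>E\<rfloor>"
 have q1: "q >= 1" by (simp add: q_def)
 have E1: "E >= 1" using N exps by (simp add: E_def ge_one_powr_ge_zero)
 have bq: "b = q * real \<tau>" by (simp add: b bsize_def q_def algebra_simps)
 have t0: "real \<tau> > 0" using \<tau>(1) by simp
 have b0: "b > 0" using bq q1 t0 by simp
 have Dn: "real Dn <= E" "Dn >= 1" using E1 by (auto simp: Dn_def le_nat_iff)
 have P2: "real p >= 2" if "p \<in> P" for p using prime_ge_2_nat[OF P(2)[OF that]] by simp
 define cV where "cV = 2 * b ^ (2 * n) * (812 * real Dn * b ^ 3)^2"
 define V where "V = cV * E^2 * E ^ 3 * (v3^2 * (N powr \<kappa>) powr (- 1/4) * (E * E) + v3 * E)"
 have V: "(SUM u:blocks A \<tau> n. (SUM \<omega>:WZ. SUM D:DL. c D * FD D (word_matrix u ** t ** word_matrix \<omega>))^2) <= V"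
  if t: "det t = 1" for t :: "int^2^2"
  unfolding V_def v3_def matrix_mul_assoc[symmetric]
 proof (rule dispersion_bound[OF P _ t _ _ _ \<tau>(1) b _ _ Dn(2) cV_def _ B])
  show "DL \<subseteq> Pow P" by (auto simp: DL_def)
  show "real (\<Prod>D) <= N powr (1/14)" if "D \<in> DL" for D using supp that by (simp add: DL_def)
  show "N powr \<kappa> <= real (\<Prod>D)" if "D \<in> DL" for D using that by (simp add: DL_def)
  show "N powr \<kappa> > 0" using N by simp
  \<comment> \<open>Two sets of level N^(1/14) give moduli up to N^(1/7), whose power 16/3 is
    N^(16/21). That is reached by k blocks; the 4 extra blocks supply b^4.\<close>
  show "(N powr (1/14) * N powr (1/14)) powr (16/3) * b ^ 4 <= b ^ n"
  proof -
   have "(N powr (1/14) * N powr (1/14)) powr (16/3) = N powr (16/21)" by (simp add: powr_powr flip: powr_add)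
   also have "... <= N powr (\<beta> * real k)" using k N by (intro powr_mono) auto
   also have "... = (N powr \<beta>) ^ k" using N by (simp add: powr_powr flip: powr_realpow)
   also have "... <= b ^ k"
   proof (rule power_mono)
    have "1 * real \<tau> <= q * real \<tau>" using q1 by (intro mult_right_mono) auto
    then show "N powr \<beta> <= b" using \<tau>(3) bq by linarith
   qed simp
   finally show ?thesis using b0 unfolding n_def power_add[of b 4] by (simp add: mult.commute[of "b ^ 4"])
  qed
  show "card {d. d dvd M} <= Dn" if "M ~= 0" "real_of_int \<bar>M\<bar> <= 7 * (b ^ n) ^ 4" for M :: int
   using Dv[OF that(1)] that(2) unfolding n_def Dn_def E_def by (intro le_nat_floor) auto
  show "\<bar>c D\<bar> <= E * B ^ card D" if "D \<in> DL" for D using c[of D] that by (simp add: DL_def E_def)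
  show "E >= 0" using E1 by simp
  show "finite WZ" by (rule WZ(1))
  show "pword w & even (length w) & w ~= [] & KK w <= M" if "w \<in> WZ" for w
   using WZ(2)[OF that] evenw_pword by (auto simp: evenw_def)
  show "(1 + 32 * B^2) ^ card {p\<in>P. int p dvd \<Delta>} <= E" if "\<Delta> ~= 0" "\<bar>\<Delta>\<bar> <= 256 * M ^ 8" for \<Delta>
   unfolding E_def by (rule U1[OF that])
  have "(PROD p:P. 1 + 4 * B^2 / real p) <= (PROD p:P. 1 + 32 * B^2 / real p)"
   by (intro prod_mono conjI add_left_mono divide_right_mono) auto
  then show "(PROD p:P. 1 + 4 * B^2 / real p) <= E" using U2 by (simp add: E_def)
  have "(PROD p:P. 1 + 32 * B^2 * real p powr (- 13/12)) <= (PROD p:P. 1 + 32 * B^2 / real p)"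
  proof (intro prod_mono conjI add_left_mono)
   fix p assume p: "p \<in> P"
   have "real p powr (- 13/12) <= real p powr (- 1)" using P2[OF p] by (intro powr_mono) auto
   then have "32 * B^2 * real p powr (- 13/12) <= 32 * B^2 * real p powr (- 1)" by (rule mult_left_mono) simp
   then show "32 * B^2 * real p powr (- 13/12) <= 32 * B^2 / real p" using P2[OF p] by (simp add: powr_minus_divide)
  qed auto
  then show "(PROD p:P. 1 + 32 * B^2 * real p powr (- 13/12)) <= E" using U2 by (simp add: E_def)
 qed
 have Q: "(N powr \<kappa>) powr (- 1/4) = N powr (- \<kappa> / 4)" by (simp add: powr_powr)
 define s where "s = N powr (- \<kappa> / 4)"
 have s: "s > 0" "v3 * s >= 1"
 proof -
  show "s > 0" using N by (simp add: s_def)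
  have "N powr (\<kappa> / 4) * s <= v3 * s" using n3 N by (intro mult_right_mono) (auto simp: v3_def s_def)
  then show "v3 * s >= 1" using N by (simp add: s_def flip: powr_add)
 qed
 have v0: "v1 >= 0" "v3 >= 0" by (auto simp: v1_def v3_def)
 have S: "(SUM w:WX. \<bar>SUM \<omega>:WZ. SUM D:DL. c D * FD D (word_matrix w ** a ** word_matrix \<omega>)\<bar>)^2 <= v1 * (2 * (X / real \<tau> ^ n)^2 * V)"
  unfolding v1_def
  by (rule large_sum_bound[where f = "%g. SUM \<omega>:WZ. SUM D:DL. c D * FD D (g ** word_matrix \<omega>)", OF WX(1) _ \<tau>(1) a V])
   (use WX(2) in \<open>auto simp: n_def\<close>)
 \<comment> \<open>The diagonal is dominated because WZ has at least N^(\<kappa>/4) elements, the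
   inverse of the saving.\<close>
 have brk: "v3^2 * s * (E * E) + v3 * E <= 2 * (v3^2 * s * E^2)"
 proof -
  have "v3 * E * 1 <= v3 * E * (v3 * s * E)"
   using s E1 v0 by (intro mult_left_mono) (auto intro!: mult_ge1_I mult_nonneg_nonneg)
  then show ?thesis by (simp add: power2_eq_square mult_ac)
 qed
 have cV: "cV <= 2 * b ^ (2 * n) * (812^2 * E^2 * ((2 * q) ^ 6 * N powr (6 * \<beta>)))"
 proof -
  have "b <= 2 * q * N powr \<beta>" using \<tau>(2) q1 bq by (simp add: mult_left_mono)
  then have "b ^ 6 <= (2 * q * N powr \<beta>) ^ 6" using b0 by (intro power_mono) auto
  also have "... = (2 * q) ^ 6 * N powr (6 * \<beta>)" using N by (simp add: power_mult_distrib powr_powr mult.commute flip: powr_realpow)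
  finally have "812^2 * (real Dn)^2 * b ^ 6 <= 812^2 * E^2 * ((2 * q) ^ 6 * N powr (6 * \<beta>))"
   using Dn b0 by (intro mult_mono power_mono) auto
  moreover have "(812 * real Dn * b ^ 3)^2 = 812^2 * (real Dn)^2 * b ^ 6" by (simp add: power_mult_distrib flip: power_mult)
  ultimately show ?thesis unfolding cV_def using b0 by (intro mult_left_mono) auto
 qed
 have "V <= 2 * b ^ (2 * n) * (812^2 * E^2 * ((2 * q) ^ 6 * N powr (6 * \<beta>))) * E^2 * E ^ 3 * (2 * (v3^2 * s * E^2))"
  unfolding V_def Q s_def[symmetric] using cV brk E1 s v0 b0 q1 by (intro mult_mono mult_nonneg_nonneg add_nonneg_nonneg) auto
 then have "v1 * (2 * (X / real \<tau> ^ n)^2 * V) <= v1 * (2 * (X / real \<tau> ^ n)^2 * (2 * b ^ (2 * n) * (812^2 * E^2 * ((2 * q) ^ 6 * N powr (6 * \<beta>))) * E^2 * E ^ 3 * (2 * (v3^2 * s * E^2))))"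
  using v0 by (intro mult_left_mono) auto
 also have "... = v1 * v3^2 * ((8 * 812^2 * q ^ (2 * n) * (2 * q) ^ 6) * X^2 * (N powr (6 * \<beta>) * E ^ 9 * s))"
 proof -
  have "(X / real \<tau> ^ n)^2 * b ^ (2 * n) = X^2 * q ^ (2 * n)"
   using t0 by (simp add: bq power_mult_distrib power_divide power_mult[symmetric] mult.commute[of n])
  then have *: "(X / real \<tau> ^ n)^2 * (b ^ (2 * n) * r) = X^2 * q ^ (2 * n) * r" for r by (simp add: mult.assoc[symmetric])
  have E9: "E^2 * (E^2 * (E ^ 3 * E^2)) = E ^ 9" by (simp flip: power_add)
  have "v1 * (2 * (X / real \<tau> ^ n)^2 * (2 * b ^ (2 * n) * (812^2 * E^2 * ((2 * q) ^ 6 * N powr (6 * \<beta>))) * E^2 * E ^ 3 * (2 * (v3^2 * s * E^2))))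
    = 8 * v1 * ((X / real \<tau> ^ n)^2 * (b ^ (2 * n) * (812^2 * ((2 * q) ^ 6 * N powr (6 * \<beta>)) * (v3^2 * s) * (E^2 * (E^2 * (E ^ 3 * E^2))))))"
   by (simp add: mult_ac)
  then show ?thesis unfolding * E9 by (simp add: mult_ac)
 qed
 also have "... <= v1 * v3^2 * ((E / 10000) * (v1 * N powr (\<kappa> / 20)) * (N powr (6 * \<beta>) * E ^ 9 * s))"
 proof -
  have "8 * 812^2 * q ^ (2 * n) * (2 * q) ^ 6 <= E / 10000" using const by (simp add: q_def n_def E_def)
  then show ?thesis using n1 v0 E1 s q1 unfolding v1_def[symmetric] by (intro mult_left_mono mult_mono mult_nonneg_nonneg) auto
 qed
 also have "... = v1^2 * v3^2 / 10000 * (N powr (\<kappa> / 20) * N powr (6 * \<beta>) * E ^ 10 * s)"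
 proof -
  have "E ^ 10 = E * E ^ 9" by (simp flip: power_Suc)
  then show ?thesis by (simp add: power2_eq_square mult_ac)
 qed
 also have "... <= v1^2 * v3^2 / 10000 * 1"
 proof (rule mult_left_mono)
  have "E ^ 10 = N powr (10 * \<epsilon>)" using N by (simp add: E_def powr_powr mult.commute flip: powr_realpow)
  then have "N powr (\<kappa> / 20) * N powr (6 * \<beta>) * E ^ 10 * s = N powr (\<kappa> / 20 + 6 * \<beta> + 10 * \<epsilon> + - \<kappa> / 4)"
   by (simp only: s_def powr_add)
  also have "... <= N powr 0" using N exps by (intro powr_mono) auto
  finally show "N powr (\<kappa> / 20) * N powr (6 * \<beta>) * E ^ 10 * s <= 1" using N by simp
 qed simp
 also have "... = (v1 * v3 / 100)^2" by (simp add: power2_eq_square)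
 finally show ?thesis using S unfolding DL_def v1_def v3_def by linarith
qed

lemma Omega_card_ge:
 assumes "Omega_set A c (N powr x) \<Omega>" and N: "N > 1" and x: "0 < x" "x <= 1" and c: "c > 0"
  and E: "ln N <= N powr \<epsilon>" "4 / c <= N powr \<epsilon>"
 shows "4 * N powr (2 * cf_dim A * x - 2 * \<epsilon>) <= real (card \<Omega>)"
proof -
 have l: "0 < ln (N powr x)" "ln (N powr x) <= N powr \<epsilon>"
 proof -
  show "0 < ln (N powr x)" using N x by (simp add: ln_powr)
  have "x * ln N <= 1 * ln N" using N x by (intro mult_right_mono) auto
  moreover have "ln (N powr x) = x * ln N" using N by (simp add: ln_powr)
  ultimately show "ln (N powr x) <= N powr \<epsilon>" using E by linarith
 qed
 have "N powr (2 * cf_dim A * x - 2 * \<epsilon>) = N powr (2 * cf_dim A * x) * (N powr (- \<epsilon>) * N powr (- \<epsilon>))"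
  by (simp flip: powr_add)
 moreover have "4 * N powr (- \<epsilon>) <= c"
 proof -
  have "4 / c * c <= N powr \<epsilon> * c" using E(2) c by (intro mult_right_mono) auto
  then show ?thesis using c N by (simp add: powr_minus field_simps)
 qed
 ultimately have "4 * N powr (2 * cf_dim A * x - 2 * \<epsilon>) <= c * (N powr (2 * cf_dim A * x) * N powr (- \<epsilon>))"
  using mult_right_mono[of "4 * N powr (- \<epsilon>)" c "N powr (2 * cf_dim A * x) * N powr (- \<epsilon>)"] by (simp add: mult_ac)
 also have "... <= c * ((N powr x) powr (2 * cf_dim A) / ln (N powr x))"
 proof (rule mult_left_mono)
  have "N powr (2 * cf_dim A * x) / N powr \<epsilon> <= N powr (2 * cf_dim A * x) / ln (N powr x)"
   using l by (intro divide_left_mono mult_pos_pos) auto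
  then show "N powr (2 * cf_dim A * x) * N powr (- \<epsilon>) <= (N powr x) powr (2 * cf_dim A) / ln (N powr x)"
   by (simp add: powr_powr powr_minus divide_inverse mult_ac)
 qed (use c in simp)
 also have "... <= real (card \<Omega>)" using assms(1) by (simp add: Omega_set_def)
 finally show ?thesis .
qed

lemma count_at:
 fixes N \<beta> \<epsilon> \<kappa> y0 \<Theta> C K B c \<eta> :: real and j A :: nat
 assumes N: "N > 1" and C: "C > 0" and \<Theta>: "\<Theta> > 0" and c: "c > 0" and B: "B >= 1"
  and y0: "0 < y0" "y0 < 1/100" "\<eta> = 10 * y0" and \<kappa>: "0 < \<kappa>" "\<kappa> <= y0" "\<kappa> * (4 + log 2 B + C) <= y0 * \<Theta> / 2"
  and \<epsilon>: "0 < \<epsilon>" "\<epsilon> <= \<kappa> / 1000" "\<epsilon> <= y0 * \<Theta> / 8"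
  and j: "real j >= 1000 / \<kappa>" and \<beta>: "\<beta> = 1 / (21 * real j)" and A: "1 - \<kappa> / 100 <= cf_dim A"
  and lnN: "ln N <= N powr \<epsilon>"
  and const: "10000 * (8 * 812^2 * (4 * (real A ^ 2 + 1)) ^ (2 * (4 + 16 * j)) * (8 * (real A ^ 2 + 1)) ^ 6) <= N powr \<epsilon>"
   "2 * (8 * (real A ^ 2 + 1)) ^ (2 * (4 + 16 * j)) <= N powr \<epsilon>" "4 / c <= N powr \<epsilon>" "5 <= N powr \<epsilon>" "100 * \<bar>K\<bar> <= N powr \<epsilon>"
  and N\<beta>: "2 <= N powr \<beta>"
  and div: "!!M::int. M ~= 0 ==> real_of_int \<bar>M\<bar> <= 7 * (8 * (real A ^ 2 + 1)) ^ (4 * (4 + 16 * j)) * N powr (4 * real (4 + 16 * j) * \<beta>) ==> real (card {d. d dvd M}) <= N powr \<epsilon>"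
  and div': "!!M::int. M ~= 0 ==> real_of_int \<bar>M\<bar> <= 256 * N powr (8 * y0) ==> real (card {d. d dvd M}) <= N powr (\<epsilon> / log 2 (1 + 32 * B^2))"
  and U2: "(PROD p:primes_upto (N powr (1/350)). 1 + 32 * B^2 / real p) <= (N powr (1/350)) powr \<epsilon>"
  and sieve: "\<exists>G c. sieve_system (N powr (1/350)) \<epsilon> B G c"
  and OX: "Omega_set A c (N powr (1 - 2 * y0)) \<Omega>X" and eq: "equidistributed_set C \<Theta> K (N powr y0) S"
  and OZ: "Omega_set A c (N powr y0) \<Omega>Z"
 shows "N powr (2 * cf_dim A - \<eta>) < real (card (almost_primes N (Pi_set \<Omega>X S \<Omega>Z)))"
proof -
 define \<delta> where "\<delta> = cf_dim A"
 define x1 where "x1 = 1 - 2 * y0"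
 \<comment> \<open>Together with \<beta> = 1/(21 j) this makes \<beta> k exactly 16/21, while a
   large j keeps single blocks a small power of N.\<close>
 define k where "k = 16 * j"
 define P where "P = primes_upto (N powr (1/350))"
 define E where "E = N powr \<epsilon>"
 define \<tau> where "\<tau> = nat \<lceil>N powr \<beta>\<rceil>"
 define b where "b = real (bsize A \<tau>)"
 define q where "q = 8 * (real A ^ 2 + 1)"
 have P: "finite P" "!!p. p \<in> P ==> prime p" unfolding P_def by simp (simp add: primes_upto_def)
 have E1: "E >= 1" using N \<epsilon> by (simp add: E_def ge_one_powr_ge_zero)
 have zE: "(N powr (1/350)) powr \<epsilon> <= E" using N \<epsilon> by (simp add: powr_powr E_def)
 have \<delta>: "0.99 <= \<delta>" "\<delta> <= 2" "1 - \<kappa> / 100 <= \<delta>" using A \<kappa> y0 cf_dim_le_2[of A] by (auto simp: \<delta>_def)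
 have x1: "0.98 <= x1" "x1 <= 1" using y0 by (auto simp: x1_def)
 have j0: "real j > 0" using j divide_pos_pos[of 1000 \<kappa>] \<kappa> by linarith
 have \<beta>0: "\<beta> > 0" "\<beta> * real k = 16/21" using j0 by (auto simp: \<beta> k_def)
 have \<beta>1: "\<beta> <= \<kappa> / 1000"
 proof -
  have "1000 <= real j * \<kappa>" using j \<kappa> by (simp add: divide_le_eq)
  then have "1000 <= \<kappa> * (21 * real j)" using j0 \<kappa> by (simp add: mult_ac)
  then show ?thesis using j0 by (simp add: \<beta> field_simps)
 qed
 have \<tau>: "\<tau> >= 2" "real \<tau> <= 2 * N powr \<beta>" "N powr \<beta> <= real \<tau>"
  using N\<beta> unfolding \<tau>_def by linarith+
 have bq: "b <= q * N powr \<beta>" "b > 0"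
 proof -
  have "b = (4 * (real A ^ 2 + 1)) * real \<tau>" by (simp add: b_def bsize_def algebra_simps)
  also have "... <= (4 * (real A ^ 2 + 1)) * (2 * N powr \<beta>)" using \<tau> by (intro mult_left_mono) auto
  finally show "b <= q * N powr \<beta>" by (simp add: q_def algebra_simps)
  show "b > 0" using \<tau>(1) by (simp add: b_def bsize_def add_pos_nonneg)
 qed
 have bpow: "b ^ i <= q ^ i * N powr (real i * \<beta>)" for i
 proof -
  have "b ^ i <= (q * N powr \<beta>) ^ i" using bq by (intro power_mono) auto
  then show ?thesis using N by (simp add: power_mult_distrib powr_powr mult.commute flip: powr_realpow)
 qed
 obtain WX0 lX where WX0: "finite WX0" "inj_on word_matrix WX0" "\<Omega>X = word_matrix ` WX0"
  "!!w. w \<in> WX0 ==> evenw A w & w ~= [] & length w = lX & real_of_int (KK w) <= N powr (1 - 2 * y0)"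
  using Omega_set_words[OF OX] by blast
 obtain WZ lZ where WZ: "finite WZ" "inj_on word_matrix WZ" "\<Omega>Z = word_matrix ` WZ"
  "!!w. w \<in> WZ ==> evenw A w & w ~= [] & length w = lZ & real_of_int (KK w) <= N powr y0"
  using Omega_set_words[OF OZ] by blast
 obtain WS where WS: "finite WS" "inj_on word_matrix WS" "S = word_matrix ` WS" "!!w. w \<in> WS ==> evenw 2 w & w ~= []"
  using equidistributed_set_words[OF eq] by blast
 define WX where "WX = {w\<in>WX0. int (bsize A \<tau> ^ (4 + k)) <= KK w}"
 define W where "W = N powr (2 * \<delta> * x1 - 2 * \<epsilon>)"
 have cX0: "4 * W <= real (card WX0)"
  using Omega_card_ge[OF OX N _ _ c lnN const(3)] y0 card_image[OF WX0(2)] by (simp add: W_def \<delta>_def x1_def WX0(3))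
 have cZ: "4 * N powr (2 * \<delta> * y0 - 2 * \<epsilon>) <= real (card WZ)"
  using Omega_card_ge[OF OZ N _ _ c lnN const(3)] y0 card_image[OF WZ(2)] by (simp add: \<delta>_def WZ(3))
 have \<delta>x: "2 * \<delta> * x1 >= 1.94"
 proof -
  have "0.99 * 0.98 <= \<delta> * x1" using \<delta> x1 by (intro mult_mono) auto
  then show ?thesis by simp
 qed
 have cX: "W <= real (card WX)"
 proof -
  let ?M = "bsize A \<tau> ^ (4 + k)"
  have sub: "WX0 - WX \<subseteq> {w. pword w & even (length w) & KK w <= int ?M}"
  proof
   fix w assume w: "w \<in> WX0 - WX"
   then have "evenw A w" "KK w <= int ?M" using WX0(4) by (auto simp: WX_def)
   then show "w \<in> {w. pword w & even (length w) & KK w <= int ?M}" using evenw_pword[of A w] by (simp add: evenw_def)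
  qed
  have "card (WX0 - WX) <= 2 * ?M^2"
   using card_mono[OF even_words_count(1) sub] even_words_count(2)[of ?M] by linarith
  then have "real (card (WX0 - WX)) <= real (2 * ?M^2)" by (simp only: of_nat_le_iff)
  also have "... = 2 * b ^ (2 * (4 + k))" by (simp add: b_def power_mult[symmetric] mult.commute)
  also have "... <= 2 * (q ^ (2 * (4 + k)) * N powr (real (2 * (4 + k)) * \<beta>))" by (intro mult_left_mono bpow) simp
  also have "... = 2 * q ^ (2 * (4 + k)) * N powr (real (2 * (4 + k)) * \<beta>)" by simp
  also have "... <= N powr \<epsilon> * N powr (real (2 * (4 + k)) * \<beta>)"
   using const(2) by (intro mult_right_mono) (auto simp: q_def k_def)
  also have "... = N powr (\<epsilon> + real (2 * (4 + k)) * \<beta>)" by (simp add: powr_add)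
  also have "... <= W"
  proof -
   have "real (2 * (4 + k)) * \<beta> = 8 * \<beta> + 2 * (\<beta> * real k)" by (simp add: algebra_simps)
   also have "... = 8 * \<beta> + 32/21" using \<beta>0 by simp
   finally show ?thesis unfolding W_def using N \<beta>1 \<epsilon> \<kappa> y0 \<delta>x by (intro powr_mono) auto
  qed
  finally have "real (card (WX0 - WX)) <= W" .
  moreover have "card WX0 = card WX + card (WX0 - WX)"
   using WX0(1) by (subst card_Un_disjoint[symmetric]) (auto simp: WX_def intro!: arg_cong[where f = card])
  moreover have "W >= 0" by (simp add: W_def)
  ultimately show ?thesis using cX0 by linarith
 qed
 have n1: "(N powr x1)^2 <= real (card WX) * N powr (\<kappa> / 20)"
 proof -
  \<comment> \<open>The cost of enlarging WX: with this, X^2 exceeds \<open>card WX\<close> by at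
    most N^(\<kappa>/20). The dimension is bounded above only by 2 here, hence the case \<delta> >
    1.\<close>
  have "(1 - \<delta>) * x1 <= \<kappa> / 100 * 1"
  proof (cases "\<delta> <= 1")
   case True
   then show ?thesis using \<delta> x1 by (intro mult_mono) auto
  next
   case False
   then have "(1 - \<delta>) * x1 <= 0" using x1 by (intro mult_nonpos_nonneg) auto
   then show ?thesis using \<kappa> by simp
  qed
  then have ex: "2 * x1 <= 2 * \<delta> * x1 - 2 * \<epsilon> + \<kappa> / 20" using \<epsilon> \<kappa> by (simp add: algebra_simps)
  have "(N powr x1)^2 = N powr (2 * x1)" using N by (simp add: powr_powr mult.commute flip: powr_numeral)
  also have "... <= N powr (2 * \<delta> * x1 - 2 * \<epsilon> + \<kappa> / 20)" using N ex by (intro powr_mono) auto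
  also have "... = W * N powr (\<kappa> / 20)" by (simp only: W_def powr_add)
  also have "... <= real (card WX) * N powr (\<kappa> / 20)" using cX by (intro mult_right_mono) auto
  finally show ?thesis .
 qed
 have n3: "N powr (\<kappa> / 4) <= real (card WZ)"
 proof -
  have "99 / 100 * y0 <= \<delta> * y0" using \<delta> y0 by (intro mult_right_mono) auto
  then have "\<kappa> / 4 <= 2 * (\<delta> * y0) - 2 * \<epsilon>" using \<epsilon>(1,2) \<kappa>(1,2) by linarith
  then have "\<kappa> / 4 <= 2 * \<delta> * y0 - 2 * \<epsilon>" by (simp only: mult.assoc)
  then have "N powr (\<kappa> / 4) <= N powr (2 * \<delta> * y0 - 2 * \<epsilon>)" using N by (intro powr_mono) auto
  then show ?thesis using cZ powr_ge_zero[of N "2 * \<delta> * y0 - 2 * \<epsilon>"] by linarith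
 qed
 from sieve[unfolded sieve_system_def, folded P_def] obtain G cc where sv: "!!g. (G g)^2 * (1 - (SUM p:P. chi p g)) = (SUM D:Pow P. cc D * FD D g)"
   and cb: "!!D. D \<in> Pow P ==> \<bar>cc D\<bar> <= (N powr (1/350)) powr \<epsilon> * B ^ card D"
   and supp: "!!D. D \<in> Pow P ==> cc D ~= 0 ==> real (\<Prod>D) <= (N powr (1/350)) powr 25"
   and c0: "cc {} >= 1 / 10"
   and GU: "!!g. (\<forall>p\<in>P. \<not> int p dvd disc g) ==> (G g)^2 <= (N powr (1/350)) powr \<epsilon>" by blast
 have cb': "\<bar>cc D\<bar> <= E * B ^ card D" if "D \<in> Pow P" for D
  by (rule order_trans[OF cb[OF that] mult_right_mono[OF zE]]) (use B in simp)
 define M where "M = \<lfloor>N powr y0\<rfloor>"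
 have M0: "M >= 0" by (simp add: M_def)
 have large: "(SUM w:WX. \<bar>SUM \<omega>:WZ. \<Sum>D | D \<in> Pow P & cc D ~= 0 & N powr \<kappa> < real (\<Prod>D). cc D * FD D (word_matrix w ** a ** word_matrix \<omega>)\<bar>)^2
  <= (real (card WX) * real (card WZ) / 100)^2" if a: "det a = 1" for a :: "int^2^2"
 proof (rule large_estimate[where \<tau> = \<tau> and b = b and k = k and \<beta> = \<beta> and \<epsilon> = \<epsilon> and X = "N powr x1" and M = M and A = A, OF N P \<tau> b_def])
  show "16/21 <= \<beta> * real k" using \<beta>0 by simp
  show "finite WX" "finite WZ" using WX0(1) WZ(1) by (auto simp: WX_def)
  show "evenw A w & int (bsize A \<tau> ^ (4 + k)) <= KK w & real_of_int (KK w) <= N powr x1" if "w \<in> WX" for w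
   using WX0(4) that by (auto simp: WX_def x1_def)
  show "evenw A w & w ~= [] & KK w <= M" if "w \<in> WZ" for w using WZ(4)[OF that] by (simp add: M_def le_floor_iff)
  show "real (card {d. d dvd M}) <= N powr \<epsilon>" if M: "M ~= 0" "real_of_int \<bar>M\<bar> <= 7 * (b ^ (4 + k)) ^ 4" for M :: int
  proof (rule div[OF M(1)])
   have "(b ^ (4 + k)) ^ 4 = b ^ (4 * (4 + k))" by (simp add: mult.commute flip: power_mult)
   also have "... <= q ^ (4 * (4 + k)) * N powr (real (4 * (4 + k)) * \<beta>)" by (rule bpow)
   also have "real (4 * (4 + k)) = 4 * real (4 + k)" by simp
   finally show "real_of_int \<bar>M\<bar> <= 7 * (8 * (real A ^ 2 + 1)) ^ (4 * (4 + 16 * j)) * N powr (4 * real (4 + 16 * j) * \<beta>)"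
    using M(2) unfolding q_def k_def by linarith
  qed
  show "(1 + 32 * B^2) ^ card {p\<in>P. int p dvd \<Delta>} <= N powr \<epsilon>" if \<Delta>: "\<Delta> ~= 0" "\<bar>\<Delta>\<bar> <= 256 * M ^ 8" for \<Delta>
  proof -
   let ?l = "log 2 (1 + 32 * B^2)" and ?m = "card {p\<in>P. int p dvd \<Delta>}"
   have B2: "1 + 32 * B^2 > 1" using B by (simp add: add_pos_nonneg)
   then have l: "?l > 0" by (intro zero_less_log_cancel_iff[THEN iffD2]) linarith+
   have "real_of_int \<bar>\<Delta>\<bar> <= real_of_int (256 * M ^ 8)" using \<Delta>(2) by (simp only: of_int_le_iff)
   also have "... <= 256 * (N powr y0) ^ 8"
   proof -
    have "real_of_int M ^ 8 <= (N powr y0) ^ 8" using M0 by (intro power_mono) (auto simp: M_def)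
    then show ?thesis by simp
   qed
   also have "... = 256 * N powr (8 * y0)" using N by (simp add: powr_powr mult.commute flip: powr_numeral)
   finally have "real (card {d. d dvd \<Delta>}) <= N powr (\<epsilon> / ?l)" by (rule div'[OF \<Delta>(1)])
   moreover have "real (2 ^ ?m) <= real (card {d. d dvd \<Delta>})" by (simp only: of_nat_le_iff) (rule two_power_prime_divisors_le[OF P \<Delta>(1)])
   ultimately have "real (2 ^ ?m) <= N powr (\<epsilon> / ?l)" by linarith
   then have "2 ^ ?m <= N powr (\<epsilon> / ?l)" by simp
   then have "(2 ^ ?m) powr ?l <= (N powr (\<epsilon> / ?l)) powr ?l" using l by (intro powr_mono2) auto
   moreover have "(2 ^ ?m) powr ?l = (2 powr ?l) powr real ?m"
    by (simp add: powr_powr powr_realpow[symmetric] mult.commute)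
   moreover have "(2 powr ?l) powr real ?m = (1 + 32 * B^2) ^ ?m"
   proof -
    have B0: "0 < 1 + 32 * B^2" using B2 by linarith
    then have "2 powr ?l = 1 + 32 * B^2" by (intro powr_log_cancel) auto
    then show ?thesis using powr_realpow[OF B0] by simp
   qed
   moreover have "(N powr (\<epsilon> / ?l)) powr ?l = N powr \<epsilon>" using l by (simp add: powr_powr)
   ultimately show ?thesis by simp
  qed
  show "(PROD p:P. 1 + 32 * B^2 / real p) <= N powr \<epsilon>" using U2 zE unfolding P_def E_def by linarith
  show "\<bar>cc D\<bar> <= N powr \<epsilon> * B ^ card D" if "D \<in> Pow P" for D using cb'[OF that] by (simp add: E_def)
  show "real (\<Prod>D) <= N powr (1/14)" if "D \<in> Pow P" "cc D ~= 0" for D using supp[OF that] by (simp add: powr_powr)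
  show "(N powr x1)^2 <= real (card WX) * N powr (\<kappa> / 20)" by (rule n1)
  show "N powr (\<kappa> / 4) <= real (card WZ)" by (rule n3)
  show "6 * \<beta> <= \<kappa> / 100" "10 * \<epsilon> <= \<kappa> / 100" using \<beta>1 \<epsilon> \<kappa> by auto
  show "10000 * (8 * 812^2 * (4 * (real A ^ 2 + 1)) ^ (2 * (4 + k)) * (8 * (real A ^ 2 + 1)) ^ 6) <= N powr \<epsilon>"
   using const(1) by (simp add: k_def)
 qed (use B \<kappa> \<epsilon> a in auto)
 have dW: "det (word_matrix w) = 1" if "w \<in> WX \<or> w \<in> WS \<or> w \<in> WZ" for w
  using that WX0(4) WZ(4) WS(4) evenw_det[of A w] evenw_det[of 2 w] by (auto simp: WX_def)
 have small: "\<bar>SUM s:WS. \<Sum>D | D \<in> Pow P & D ~= {} & real (\<Prod>D) <= N powr \<kappa>. cc D * FD D (u ** word_matrix s ** v)\<bar> <= real (card WS) / 100"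
  if uv: "det u = 1" "det v = 1" for u v
 proof -
  let ?DS = "{D. D \<in> Pow P & D ~= {} & real (\<Prod>D) <= N powr \<kappa>}"
  have "(SUM s:WS. SUM D:?DS. cc D * FD D (u ** word_matrix s ** v)) = (SUM a:S. SUM D:?DS. cc D * FD D (u ** a ** v))"
   unfolding WS(3) by (simp add: sum.reindex[OF WS(2)])
  also have "\<bar>...\<bar> <= E * \<bar>K\<bar> * real (card S) * (N powr \<kappa>) powr (4 + log 2 B + C) * (N powr y0) powr (- \<Theta>)"
  proof (rule small_sum_bound[OF eq _ _ P])
   show "finite S" using WS by simp
   show "det a = 1" if "a \<in> S" for a using that dW unfolding WS(3) by auto
   show "1 <= N powr \<kappa>" using N \<kappa> by (simp add: ge_one_powr_ge_zero)
   show "\<bar>cc D\<bar> <= E * B ^ card D" if "D \<in> ?DS" for D using cb' that by simp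
  qed (use uv B E1 C in auto)
  also have "... = real (card S) * (\<bar>K\<bar> * N powr (\<epsilon> + \<kappa> * (4 + log 2 B + C) - y0 * \<Theta>))"
  proof -
   have "E * ((N powr \<kappa>) powr r * (N powr y0) powr (- \<Theta>)) = N powr (\<epsilon> + \<kappa> * r - y0 * \<Theta>)" for r
    unfolding E_def powr_powr powr_add[symmetric] by (simp add: algebra_simps)
   note pw = this[symmetric]
   show ?thesis unfolding pw by (simp only: mult_ac)
  qed
  also have "... <= real (card S) * (N powr \<epsilon> / 100 * N powr (\<epsilon> + \<kappa> * (4 + log 2 B + C) - y0 * \<Theta>))"
   using const(5) by (intro mult_left_mono mult_right_mono) auto
  also have "N powr \<epsilon> / 100 * N powr (\<epsilon> + \<kappa> * (4 + log 2 B + C) - y0 * \<Theta>) = N powr (\<epsilon> + (\<epsilon> + \<kappa> * (4 + log 2 B + C) - y0 * \<Theta>)) / 100"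
   by (simp only: powr_add times_divide_eq_left)
  also have "... <= N powr 0 / 100"
  proof (intro divide_right_mono powr_mono)
   have "0 < y0 * \<Theta>" using y0 \<Theta> by simp
   then show "\<epsilon> + (\<epsilon> + \<kappa> * (4 + log 2 B + C) - y0 * \<Theta>) <= 0" using \<epsilon>(3) \<kappa>(3) by linarith
  qed (use N in auto)
  finally show ?thesis using N card_image[OF WS(2)] by (simp add: WS(3) mult_left_mono)
 qed
 define T where "T = {(w, s, \<omega>) \<in> WX \<times> WS \<times> WZ. \<forall>p\<in>P. \<not> int p dvd disc (word_matrix w ** word_matrix s ** word_matrix \<omega>)}"
 have wc: "real (card WX) * real (card WS) * real (card WZ) / 20 <= real (card T) * E"
  unfolding T_def
 proof (rule weighted_count[where ?Q0.0 = "N powr \<kappa>", OF _ WS(1) WZ(1) _ _ _ P _ sv c0 _ small large])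
  show "finite WX" using WX0(1) by (simp add: WX_def)
  show "1 <= N powr \<kappa>" using N \<kappa> by (simp add: ge_one_powr_ge_zero)
  show "(G g)^2 <= E" if "\<forall>p\<in>P. \<not> int p dvd disc g" for g using GU[OF that] zE by linarith
 qed (use dW in auto)
 have TA: "card T <= card (almost_primes N (Pi_set \<Omega>X S \<Omega>Z))"
  unfolding T_def P_def
 proof (rule card_almost_primes_ge)
  show "pword w & length w = lX & word_matrix w \<in> \<Omega>X" if "w \<in> WX" for w
   using WX0(3,4) that evenw_pword[of A w] by (auto simp: WX_def)
  show "pword w & word_matrix w \<in> S" if "w \<in> WS" for w using WS(3,4) that evenw_pword[of 2 w] by auto
  show "pword w & length w = lZ & word_matrix w \<in> \<Omega>Z" if "w \<in> WZ" for w using WZ(3,4) that evenw_pword[of A w] by auto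
 qed (use WX0 WS WZ N in \<open>auto simp: WX_def\<close>)
 have S1: "real (card WS) >= 1"
 proof -
  have "S ~= {}" using eq by (simp add: equidistributed_set_def)
  then have "WS ~= {}" using WS(3) by auto
  then show ?thesis using WS(1) by (simp add: Suc_le_eq card_gt_0_iff)
 qed
 have "W * 1 * (4 * N powr (2 * \<delta> * y0 - 2 * \<epsilon>)) / 20 <= real (card WX) * real (card WS) * real (card WZ) / 20"
  using cX cZ S1 by (intro divide_right_mono mult_mono mult_nonneg_nonneg) (auto simp: W_def)
 also have "... <= real (card T) * E" by (rule wc)
 finally have "W * N powr (2 * \<delta> * y0 - 2 * \<epsilon>) <= real (card T) * E * 5" by simp
 also have "... <= real (card T) * E * E" using const(4) E1 by (intro mult_left_mono) (auto simp: E_def)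
 finally have lb: "W * N powr (2 * \<delta> * y0 - 2 * \<epsilon>) * (N powr (- \<epsilon>) * N powr (- \<epsilon>)) <= real (card T) * E * E * (N powr (- \<epsilon>) * N powr (- \<epsilon>))"
  by (rule mult_right_mono) simp
 have "real (card T) * E * E * (N powr (- \<epsilon>) * N powr (- \<epsilon>)) = real (card T)"
 proof -
  have "E * N powr (- \<epsilon>) = 1" using N by (simp add: E_def flip: powr_add)
  then have "real (card T) * (E * N powr (- \<epsilon>)) * (E * N powr (- \<epsilon>)) = real (card T)" by simp
  then show ?thesis by (simp only: mult_ac)
 qed
 moreover have "W * N powr (2 * \<delta> * y0 - 2 * \<epsilon>) * (N powr (- \<epsilon>) * N powr (- \<epsilon>)) = N powr ((2 * \<delta> * x1 - 2 * \<epsilon>) + (2 * \<delta> * y0 - 2 * \<epsilon>) + (- \<epsilon> + - \<epsilon>))"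
  unfolding W_def powr_add ..
 \<comment> \<open>The middle factor is counted as a single element. Its absence costs 2 \<delta> y0
   <= 4 y0 in the exponent, and everything else 6 \<epsilon>; both together stay below \<eta> = 10
   y0.\<close>
 moreover have "N powr (2 * \<delta> - \<eta>) < N powr ((2 * \<delta> * x1 - 2 * \<epsilon>) + (2 * \<delta> * y0 - 2 * \<epsilon>) + (- \<epsilon> + - \<epsilon>))"
 proof (rule powr_less_mono)
  have "\<delta> * y0 <= 2 * y0" using \<delta> y0 by (intro mult_right_mono) auto
  moreover have "2 * \<delta> * x1 = 2 * \<delta> - 4 * (\<delta> * y0)" by (simp add: x1_def algebra_simps)
  moreover have "2 * \<delta> * y0 = 2 * (\<delta> * y0)" by simp
  ultimately show "2 * \<delta> - \<eta> < (2 * \<delta> * x1 - 2 * \<epsilon>) + (2 * \<delta> * y0 - 2 * \<epsilon>) + (- \<epsilon> + - \<epsilon>)"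
   using \<epsilon>(1,2) \<kappa>(1,2) y0(1,3) by linarith
 qed (use N in simp)
 moreover have "real (card T) <= real (card (almost_primes N (Pi_set \<Omega>X S \<Omega>Z)))" using TA by simp
 ultimately show ?thesis using lb unfolding \<delta>_def by linarith
qed

theorem theorem3p1:
  fixes C \<Theta> K :: real
  assumes "C > 0" and "\<Theta> > 0"
    and "\<exists>Y0. \<forall>Y\<ge>Y0. \<exists>S. equidistributed_set C \<Theta> K Y S"
  shows "\<exists>\<eta>0>0. \<forall>\<eta>. 0 < \<eta> \<longrightarrow> \<eta> < \<eta>0 \<longrightarrow>
    (\<forall>A0::nat. \<exists>A\<ge>A0. A \<ge> 1 \<and>
      (\<exists>X Y Z :: real \<Rightarrow> real.
         (\<forall>N>0. X N * Y N * Z N = N) \<and>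
         filterlim X at_top at_top \<and> filterlim Y at_top at_top \<and> filterlim Z at_top at_top \<and>
         (\<forall>c>0. \<forall>\<^sub>F N in at_top. \<forall>\<Omega>X S \<Omega>Z.
            Omega_set A c (X N) \<Omega>X \<longrightarrow> equidistributed_set C \<Theta> K (Y N) S \<longrightarrow>
            Omega_set A c (Z N) \<Omega>Z \<longrightarrow>
              real (card (almost_primes N (Pi_set \<Omega>X S \<Omega>Z))) > N powr (2 * cf_dim A - \<eta>))))"
proof -
 obtain B where B: "B >= 1" and sieve: "!!\<epsilon>. \<epsilon> > 0 ==> \<forall>\<^sub>F z in at_top. \<exists>G c. sieve_system z \<epsilon> B G c"
  using sieve_weights by blast
 show ?thesis
 \<comment> \<open>Keeps y0 below 1/100, so that X = N^(1 - 2 y0) remains long enough for the block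
   argument.\<close>
 proof (rule exI[of _ "1/10"], intro conjI allI impI, goal_cases)
  case (2 \<eta> A0)
  note \<eta> = 2
  define y0 where "y0 = \<eta> / 10"
  define l where "l = log 2 B"
  \<comment> \<open>Small enough for the equidistribution error, of exponent \<kappa> (4 + l + C) -
    y0 \<Theta>, to decay for all moduli up to N^\<kappa>.\<close>
  define \<kappa> where "\<kappa> = min y0 (y0 * \<Theta> / (2 * (4 + l + C)))"
  define \<epsilon> where "\<epsilon> = min (\<kappa> / 1000) (y0 * \<Theta> / 8)"
  define j where "j = nat \<lceil>1000 / \<kappa>\<rceil>"
  define \<beta> where "\<beta> = 1 / (21 * real j)"
  have y0: "0 < y0" "y0 < 1/100" "\<eta> = 10 * y0" using \<eta> by (auto simp: y0_def)
  have l0: "l >= 0" using B by (simp add: l_def)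
  have den: "2 * (4 + l + C) > 0" using l0 assms(1) by simp
  have yT: "y0 * \<Theta> > 0" using y0 assms by simp
  have \<kappa>: "0 < \<kappa>" "\<kappa> <= y0" "\<kappa> * (4 + log 2 B + C) <= y0 * \<Theta> / 2"
  proof -
   show "0 < \<kappa>" using y0 yT den by (simp add: \<kappa>_def)
   show "\<kappa> <= y0" by (simp add: \<kappa>_def)
   have "\<kappa> * (2 * (4 + l + C)) <= y0 * \<Theta> / (2 * (4 + l + C)) * (2 * (4 + l + C))"
    using den by (intro mult_right_mono) (auto simp: \<kappa>_def)
   also have "... = y0 * \<Theta>" using den by simp
   also have "\<kappa> * (2 * (4 + l + C)) = 2 * (\<kappa> * (4 + l + C))" by (rule mult.left_commute)
   finally show "\<kappa> * (4 + log 2 B + C) <= y0 * \<Theta> / 2" unfolding l_def by linarith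
  qed
  have \<epsilon>: "0 < \<epsilon>" "\<epsilon> <= \<kappa> / 1000" "\<epsilon> <= y0 * \<Theta> / 8" using \<kappa> yT by (auto simp: \<epsilon>_def)
  have j: "real j >= 1000 / \<kappa>" unfolding j_def by linarith
  have j0: "real j > 0" using j divide_pos_pos[of 1000 \<kappa>] \<kappa> by linarith
  have \<beta>0: "\<beta> > 0" using j0 by (simp add: \<beta>_def)
  have "0 < 1 - \<kappa> / 100" "1 - \<kappa> / 100 < 1" using \<kappa> y0 by auto
  from cf_dim_near_1[OF this] obtain A1 where A1: "!!A. A >= A1 ==> 1 - \<kappa> / 100 <= cf_dim A"
   unfolding eventually_sequentially by blast
  \<comment> \<open>A is chosen after \<kappa>, because 1 - \<open>cf_dim A\<close> has to be small
    against the saving \<kappa>/4.\<close>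
  define A where "A = max (max A0 A1) 1"
  have A: "A >= A0" "A >= 1" "1 - \<kappa> / 100 <= cf_dim A" using A1[of A] by (auto simp: A_def)
  define x1 where "x1 = 1 - 2 * y0"
  have x1: "x1 > 0" using y0 by (simp add: x1_def)
  have lX: "filterlim (%N::real. N powr x1) at_top at_top" "filterlim (%N::real. N powr y0) at_top at_top"
   using x1 y0(1) by real_asymp+
  have prod: "N powr x1 * N powr y0 * N powr y0 = N" if "N > 0" for N
   using that by (simp add: x1_def flip: powr_add)
  have ev: "\<forall>\<^sub>F N in at_top. \<forall>\<Omega>X S \<Omega>Z. Omega_set A c (N powr x1) \<Omega>X --> equidistributed_set C \<Theta> K (N powr y0) S -->
      Omega_set A c (N powr y0) \<Omega>Z --> real (card (almost_primes N (Pi_set \<Omega>X S \<Omega>Z))) > N powr (2 * cf_dim A - \<eta>)"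
   if c: "c > 0" for c :: real
  proof -
   have zt: "filterlim (%N::real. N powr (1/350)) at_top at_top" by real_asymp
   note Esieve = eventually_compose_filterlim[OF sieve[OF \<epsilon>(1)] zt]
   have "32 * B^2 >= 0" by simp
   from eventually_compose_filterlim[OF eventually_prod_prime[OF \<epsilon>(1) this] zt]
   have EU2: "\<forall>\<^sub>F N in at_top. (PROD p:primes_upto (N powr (1/350)). 1 + 32 * B^2 / real p) <= (N powr (1/350)) powr \<epsilon>" .
   have q1: "1 <= 8 * (real A ^ 2 + 1)" by simp
   have Ediv: "\<forall>\<^sub>F N in at_top. \<forall>M::int. M ~= 0 -->
    real_of_int \<bar>M\<bar> <= 7 * (8 * (real A ^ 2 + 1)) ^ (4 * (4 + 16 * j)) * N powr (4 * real (4 + 16 * j) * \<beta>) --> real (card {d. d dvd M}) <= N powr \<epsilon>"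
    by (rule eventually_divisors_le[OF \<epsilon>(1)], use \<beta>0 in simp, use one_le_power[OF q1, of "4 * (4 + 16 * j)"] in linarith)
   have "0 < log 2 (1 + 32 * B^2)"
   proof -
    have "0 < B\<^sup>2" using B by simp
    then show ?thesis by (intro zero_less_log_cancel_iff[THEN iffD2]) linarith+
   qed
   then have "0 < \<epsilon> / log 2 (1 + 32 * B^2)" using \<epsilon>(1) by simp
   then have Ediv': "\<forall>\<^sub>F N in at_top. \<forall>M::int. M ~= 0 --> real_of_int \<bar>M\<bar> <= 256 * N powr (8 * y0) -->
     real (card {d. d dvd M}) <= N powr (\<epsilon> / log 2 (1 + 32 * B^2))"
    by (rule eventually_divisors_le) (use y0 in auto)
   have big: "\<forall>\<^sub>F N in at_top. r <= N powr \<epsilon>" for r :: real using \<epsilon>(1) by real_asymp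
   have "\<forall>\<^sub>F N::real in at_top. ln N <= N powr \<epsilon>" using \<epsilon>(1) by real_asymp
   moreover have "\<forall>\<^sub>F N::real in at_top. 2 <= N powr \<beta>" using \<beta>0 by real_asymp
   ultimately show ?thesis
    using Esieve EU2 Ediv Ediv' big[of "10000 * (8 * 812^2 * (4 * (real A ^ 2 + 1)) ^ (2 * (4 + 16 * j)) * (8 * (real A ^ 2 + 1)) ^ 6)"]
     big[of "2 * (8 * (real A ^ 2 + 1)) ^ (2 * (4 + 16 * j))"] big[of "4 / c"] big[of 5] big[of "100 * \<bar>K\<bar>"]
     eventually_gt_at_top[of "1::real"]
   proof eventually_elim
    case (elim N)
    show ?case
    proof (intro allI impI)
     fix \<Omega>X S \<Omega>Z
     assume O: "Omega_set A c (N powr x1) \<Omega>X" "equidistributed_set C \<Theta> K (N powr y0) S" "Omega_set A c (N powr y0) \<Omega>Z"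
     show "N powr (2 * cf_dim A - \<eta>) < real (card (almost_primes N (Pi_set \<Omega>X S \<Omega>Z)))"
      by (rule count_at[OF elim(12) assms(1,2) c B y0 \<kappa> \<epsilon> j \<beta>_def A(3) elim(1) elim(7-11) elim(2)
         elim(5)[rule_format] elim(6)[rule_format] elim(4) elim(3) O(1)[unfolded x1_def] O(2,3)])
    qed
   qed
  qed
  show ?case
   by (intro exI[of _ A] conjI A(1,2) exI[of _ "%N. N powr x1"] exI[of _ "%N. N powr y0"] lX allI impI)
    (use prod ev in auto)
 qed simp
qed

end
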